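(* In the $m$-sample semiparametric density model ($m\ge1$) described in the context, suppose Assumptions 1 to 8 (written out in the context) hold, and let $\hat\tau=(\hat\theta,\hat h)$ be the penalized likelihood estimator. Then, as $n=\min_{1\le l\le m}n_l\to\infty$, $\lambda\to0$ and $n\lambda^{1/r}\to\infty$, $$\mathrm{SKL}(\tau_0,\hat\tau)=\sum_{l=1}^m\Big\{\mu_{l,\tau_0}[\eta_l(\theta_0,h_0)-\eta_l(\hat\theta,\hat h)]+\mu_{l,\hat\tau}[\eta_l(\hat\theta,\hat h)-\eta_l(\theta_0,h_0)]\Big\}=O_p\big(n^{-1}\lambda^{-1/r}+\lambda\big).$$
   Context: Setting. $p,m\ge1$; for $l=1,\dots,m$, $\mathcal X_l$ is a sample space (integrals are with respect to a reference measure $dx$); $\mathcal H$ is a real Hilbert space of functions with norm $\|\cdot\|$; $\mathcal Q=\mathbb R^p\times\mathcal H$. Write $\tau=(\theta,h)\in\mathcal Q$. For each $l$, $\eta_l:\mathcal Q\to L^2_0(\mathcal X_l)$ is a known map, with values written $\eta_l(x;\tau)$, and $f_l(x;\tau)=e^{\eta_l(x;\tau)}/\int_{\mathcal X_l}e^{\eta_l(t;\tau)}dt$. The true parameter is $\tau_0=(\theta_0,h_0)$; $L^2_{\tau_0}(\mathcal X_l)$ is the space of functions with finite second moment under $f_l(\cdot;\tau_0)$ and $L^2_0(\mathcal X_l)=L^2_{\tau_0}(\mathcal X_l)\ominus\{1\}$. The samples are independent, $X_{l1},\dots,X_{ln_l}$ iid from $f_l(\cdot;\tau_0)$; $n=\min_ln_l$;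 $\lambda>0$ is a smoothing parameter. $D_\theta,D_h$ are Fréchet partial derivatives. Put $\mu_{l,\tau}(\varphi)=\int\varphi f_l(\cdot;\tau)$, $V_{l,\tau}(\varphi_1,\varphi_2)=\mu_{l,\tau}(\varphi_1\varphi_2)-\mu_{l,\tau}(\varphi_1)\mu_{l,\tau}(\varphi_2)$, $V_{l,\tau}(\varphi)=V_{l,\tau}(\varphi,\varphi)$. $O_p$ statements are along arbitrary deterministic sequences of $(n_1,\dots,n_m,\lambda)$ with the stated limits. Criteria. $\mathfrak L_{n_l}(\theta,h)=-\frac1{n_l}\sum_{i=1}^{n_l}\eta_l(X_{li};\theta,h)+\log\int_{\mathcal X_l}e^{\eta_l(x;\theta,h)}dx$. It is assumed that $\sum_l\mathfrak L_{n_l}$ is convex and that the penalized criterion $\sum_l\mathfrak L_{n_l}(\theta,h)+\frac\lambda2J(h)$ has a unique local minimum $\hat\tau=(\hat\theta,\hat h)$ in $\mathcal N_{\theta_0}\times\mathcal N_{h_0}$, which is its unique critical point there (both $D_\theta$ and $D_h$ derivatives zero). It is also assumed that the minimizer $\tilde\tau$ of the quadratic criterion $\sum_l\tilde{\mathfrak L}_{n_l}(\theta,h)+\frac\lambda2J(h)$, where $$\tilde{\mathfrak L}_{n_l}(\theta,h)=-\tfrac1{n_l}\sum_{i}[D_\theta\eta_l(X_{li};\tau_0)\theta+D_h\eta_l(X_{li};\tau_0)h]+\mu_{l,\tau_0}[D_\theta\eta_l(\tau_0)\theta+D_h\eta_l(\tau_0)h]+\tfrac12V_{l,\tau_0}[D_\theta\eta_l(\tau_0)(\theta-\theta_0)+D_h\eta_l(\tau_0)(h-h_0)],$$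 lies in $\mathcal N_{\theta_0}\times\mathcal N_{h_0}$. Assumption 1. $J$ is a square seminorm on $\mathcal H$ with finite-dimensional null space and semi-inner product $J(\cdot,\cdot)$; $J(h_0)<\infty$. Assumption 2. For each $l$ there are bounded linear operators $L_{l,\theta}:\mathbb R^p\to L^2_0(\mathcal X_l)$, $L_{l,h}:\mathcal H\to L^2_0(\mathcal X_l)$ with zero null spaces such that (i) there are positive constants $M_1,M_2$ (possibly depending on $\lambda$) with $M_1\|g\|^2\le\sum_lV_{l,\tau_0}(L_{l,h}g)+\lambda J(g)\le M_2\|g\|^2$ for all $g\in\mathcal H$; (ii) there is $c_\delta>0$ with $\sum_lV_{l,\tau_0}(L_{l,\theta}\zeta-L_{l,h}g)>c_\delta$ for all $\zeta\in\mathbb R^p$ with $\|\zeta\|_{l^2}=1$ and all $g\in\mathcal H$. The norm on $\mathcal Q$ is $\|(\zeta,g)\|_{\mathcal Q}^2=\sum_lV_{l,\tau_0}(L_{l,\theta}\zeta+L_{l,h}g)+\lambda J(g)$. There are neighborhoods $\mathcal N_{\theta_0}\subset\mathbb R^p$ of $\theta_0$ and $\mathcal N_{h_0}\subset\mathcal H$ of $h_0$ for which Assumptions 3–6 hold. Assumption 3. Each $\eta_l$ is one-to-one and three times continuously Fréchet differentiable on $\mathcal N_{\theta_0}\times\mathcal N_{h_0}$, and $\tau_0$ is the unique root there of $E[D_\theta\sum_l\mathfrak L_{n_l}(\theta,h)]=0$, $E[D_h\sum_l\mathfrak L_{n_l}(\theta,h)]=0$. Assumption 4. For all $(\theta_*,h_*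 )\in\mathcal N_{\theta_0}\times\mathcal N_{h_0}$ and all $l$, $D_\theta\eta_l(\theta_*,h_* ):\mathbb R^p\to L_0^2(\mathcal X_l)$ and $D_h\eta_l(\theta_*,h_* ):\mathcal H\to L_0^2(\mathcal X_l)$ are bounded linear, and there are constants $C_1,C_2>0$ with $C_1\sum_lV_{l,\tau_0}(L_{l,\theta}\zeta+L_{l,h}g)\le\sum_lV_{l,\tau_0}(D_\theta\eta_l(\theta_*,h_* )\zeta+D_h\eta_l(\theta_*,h_* )g)\le C_2\sum_lV_{l,\tau_0}(L_{l,\theta}\zeta+L_{l,h}g)$ for all $(\zeta,g)\in\mathcal Q$. Assumption 5. There is a positive constant $C_d<2C_1$ such that for all $(\theta_1,h_1),(\theta_2,h_2)$ and $(\zeta,g)$ in $\mathcal N_{\theta_0}\times\mathcal N_{h_0}$, $\sum_lV_{l,\tau_0}[(D_\theta\eta_l(\theta_1,h_1)-D_\theta\eta_l(\theta_2,h_2))\zeta+(D_h\eta_l(\theta_1,h_1)-D_h\eta_l(\theta_2,h_2))g]\le C_d\sum_lV_{l,\tau_0}(L_{l,\theta}\zeta+L_{l,h}g)$. Assumption 6. $\mathcal N_{\theta_0}\times\mathcal N_{h_0}$ is convex and contains $\hat\tau$, and there are $C_3,C_4>0$ with $C_3\sum_lV_{l,\tau_0}(f_l)\le\sum_lV_{l,\tau}(f_l)\le C_4\sum_lV_{l,\tau_0}(f_l)$ for all $\tau\in\mathcal N_{\theta_0}\times\mathcal N_{h_0}$ and all $f_l\in L_0^2(\mathcal X_l)$,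 $l=1,\dots,m$. Assumption 7. The quadratic functional $g\mapsto\sum_lV_{l,\tau_0}(L_{l,h}g)$ is completely continuous with respect to $J$ (for every $\epsilon>0$ there are finitely many continuous linear functionals $\ell_1,\dots,\ell_k$ such that $\ell_1(g)=\dots=\ell_k(g)=0$ implies $\sum_lV_{l,\tau_0}(L_{l,h}g)\le\epsilon J(g)$). This yields eigenfunctions $\phi_\nu$ and eigenvalues $0\le\rho_\nu\to\infty$, $\nu=1,2,\dots$, with $\sum_lV_{l,\tau_0}(L_{l,h}\phi_\nu,L_{l,h}\phi_\mu)=\delta_{\nu\mu}$, $J(\phi_\nu,\phi_\mu)=\rho_\nu\delta_{\nu\mu}$. Assumption 8. $\rho_\nu=\kappa_\nu\nu^r$ with $r>1$ and $\kappa_\nu\in(\beta_1,\beta_2)\subset(0,\infty)$. *)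

theory Defs
  imports "HOL-Probability.Probability"
begin

definition gibbs :: "'x measure \<Rightarrow> ('x \<Rightarrow> real) \<Rightarrow> 'x measure" where
  "gibbs R e = density R (\<lambda>x. ennreal (exp (e x) / (\<integral>t. exp (e t) \<partial>R)))"

definition L2_0 :: "'x measure \<Rightarrow> ('x \<Rightarrow> real) set" where
  "L2_0 P = {\<phi> \<in> borel_measurable P. integrable P (\<lambda>x. (\<phi> x)\<^sup>2) \<and> (\<integral>x. \<phi> x \<partial>P) = 0}"

definition L2_norm :: "'x measure \<Rightarrow> ('x \<Rightarrow> real) \<Rightarrow> real" where
  "L2_norm P \<phi> = sqrt (\<integral>x. (\<phi> x)\<^sup>2 \<partial>P)"

text \<open>
  Elements of the Hilbert space \<open>L2_0 P\<close> are represented by functions, equality being equality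
  almost everywhere. Linearity, Frechet derivatives and smoothness of maps into this space
  are therefore formulated with almost-everywhere identities and with the seminorm \<open>L2_norm P\<close>.
\<close>

definition L2_bounded_linear :: "'x measure \<Rightarrow> ('a::real_normed_vector \<Rightarrow> 'x \<Rightarrow> real) \<Rightarrow> bool" where
  "L2_bounded_linear P A \<longleftrightarrow>
     (\<forall>u. A u \<in> L2_0 P) \<and>
     (\<forall>u v. AE x in P. A (u + v) x = A u x + A v x) \<and>
     (\<forall>c u. AE x in P. A (c *\<^sub>R u) x = c * A u x) \<and>
     (\<exists>B. \<forall>u. L2_norm P (A u) \<le> B * norm u)"

definition L2_has_derivative ::
  "'x measure \<Rightarrow> ('a::real_normed_vector \<Rightarrow> 'x \<Rightarrow> real) \<Rightarrow> ('a \<Rightarrow> 'x \<Rightarrow> real) \<Rightarrow> 'a \<Rightarrow> bool" where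
  "L2_has_derivative P F A t \<longleftrightarrow>
     L2_bounded_linear P A \<and>
     (\<forall>\<epsilon>>0. \<exists>\<delta>>0. \<forall>u. norm u < \<delta> \<longrightarrow>
        L2_norm P (\<lambda>x. F (t + u) x - F t x - A u x) \<le> \<epsilon> * norm u)"

text \<open>Bounded \<open>k\<close>-linear maps; the \<open>k\<close> arguments are passed as a list of length \<open>k\<close>.\<close>

definition L2_bounded_multilinear ::
  "'x measure \<Rightarrow> nat \<Rightarrow> ('a::real_normed_vector list \<Rightarrow> 'x \<Rightarrow> real) \<Rightarrow> bool" where
  "L2_bounded_multilinear P k A \<longleftrightarrow>
     (\<forall>us. length us = k \<longrightarrow> A us \<in> L2_0 P) \<and>
     (\<forall>us i a b v w. length us = k \<and> i < k \<longrightarrow>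
        (AE x in P. A (us[i := a *\<^sub>R v + b *\<^sub>R w]) x = a * A (us[i := v]) x + b * A (us[i := w]) x)) \<and>
     (\<exists>B. \<forall>us. length us = k \<longrightarrow> L2_norm P (A us) \<le> B * prod_list (map norm us))"

text \<open>
  \<open>F\<close> is \<open>k\<close> times continuously Frechet differentiable on the (open) set \<open>S\<close>: \<open>D j t\<close> is the
  \<open>j\<close>-th derivative at \<open>t\<close>, the differentiability of \<open>D j\<close> and the continuity of \<open>D k\<close> being
  with respect to the operator norm of multilinear maps.
\<close>

definition L2_C_on ::
  "'x measure \<Rightarrow> nat \<Rightarrow> 'a::real_normed_vector set \<Rightarrow> ('a \<Rightarrow> 'x \<Rightarrow> real) \<Rightarrow> bool" where
  "L2_C_on P k S F \<longleftrightarrow> (\<exists>D.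
     (\<forall>t\<in>S. AE x in P. D 0 t [] x = F t x) \<and>
     (\<forall>j\<le>k. \<forall>t\<in>S. L2_bounded_multilinear P j (D j t)) \<and>
     (\<forall>j<k. \<forall>t\<in>S. \<forall>\<epsilon>>0. \<exists>\<delta>>0. \<forall>u. norm u < \<delta> \<and> t + u \<in> S \<longrightarrow>
        (\<forall>vs. length vs = j \<longrightarrow>
           L2_norm P (\<lambda>x. D j (t + u) vs x - D j t vs x - D (Suc j) t (u # vs) x)
             \<le> \<epsilon> * norm u * prod_list (map norm vs))) \<and>
     (\<forall>t\<in>S. \<forall>\<epsilon>>0. \<exists>\<delta>>0. \<forall>s\<in>S. dist s t < \<delta> \<longrightarrow>
        (\<forall>vs. length vs = k \<longrightarrow>
           L2_norm P (\<lambda>x. D k s vs x - D k t vs x) \<le> \<epsilon> * prod_list (map norm vs))))"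


text \<open>
  Samples are indexed by a finite type \<open>'m\<close>; \<open>M l\<close> is the sample space together with its
  reference measure; \<open>eta l \<tau> x\<close> is the log-density, up to normalization, at \<open>x\<close>.
\<close>

definition mu ::
  "('m \<Rightarrow> 'x measure) \<Rightarrow> ('m \<Rightarrow> 'q \<Rightarrow> 'x \<Rightarrow> real) \<Rightarrow> 'm \<Rightarrow> 'q \<Rightarrow> ('x \<Rightarrow> real) \<Rightarrow> real" where
  "mu M eta l \<tau> \<phi> = (\<integral>x. \<phi> x \<partial>gibbs (M l) (eta l \<tau>))"

definition V2 ::
  "('m \<Rightarrow> 'x measure) \<Rightarrow> ('m \<Rightarrow> 'q \<Rightarrow> 'x \<Rightarrow> real) \<Rightarrow> 'm \<Rightarrow> 'q
     \<Rightarrow> ('x \<Rightarrow> real) \<Rightarrow> ('x \<Rightarrow> real) \<Rightarrow> real" where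
  "V2 M eta l \<tau> \<phi> \<psi> = mu M eta l \<tau> (\<lambda>x. \<phi> x * \<psi> x) - mu M eta l \<tau> \<phi> * mu M eta l \<tau> \<psi>"

definition V ::
  "('m \<Rightarrow> 'x measure) \<Rightarrow> ('m \<Rightarrow> 'q \<Rightarrow> 'x \<Rightarrow> real) \<Rightarrow> 'm \<Rightarrow> 'q \<Rightarrow> ('x \<Rightarrow> real) \<Rightarrow> real" where
  "V M eta l \<tau> \<phi> = V2 M eta l \<tau> \<phi> \<phi>"

definition SKL ::
  "('m::finite \<Rightarrow> 'x measure) \<Rightarrow> ('m \<Rightarrow> 'q \<Rightarrow> 'x \<Rightarrow> real) \<Rightarrow> 'q \<Rightarrow> 'q \<Rightarrow> real" where
  "SKL M eta \<tau>0 \<tau> = (\<Sum>l\<in>UNIV.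
      mu M eta l \<tau>0 (\<lambda>x. eta l \<tau>0 x - eta l \<tau> x) + mu M eta l \<tau> (\<lambda>x. eta l \<tau> x - eta l \<tau>0 x))"

text \<open>Criteria, for sample sizes \<open>n l\<close> and observations \<open>x l i\<close> with \<open>i < n l\<close>.\<close>

definition nll ::
  "('m \<Rightarrow> 'x measure) \<Rightarrow> ('m \<Rightarrow> 'q \<Rightarrow> 'x \<Rightarrow> real)
     \<Rightarrow> ('m \<Rightarrow> nat) \<Rightarrow> ('m \<Rightarrow> nat \<Rightarrow> 'x) \<Rightarrow> 'm \<Rightarrow> 'q \<Rightarrow> real" where
  "nll M eta n x l \<tau> =
     - (1 / real (n l)) * (\<Sum>i<n l. eta l \<tau> (x l i)) + ln (\<integral>t. exp (eta l \<tau> t) \<partial>M l)"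

definition total_nll ::
  "('m::finite \<Rightarrow> 'x measure) \<Rightarrow> ('m \<Rightarrow> 'q \<Rightarrow> 'x \<Rightarrow> real)
     \<Rightarrow> ('m \<Rightarrow> nat) \<Rightarrow> ('m \<Rightarrow> nat \<Rightarrow> 'x) \<Rightarrow> 'q \<Rightarrow> real" where
  "total_nll M eta n x \<tau> = (\<Sum>l\<in>UNIV. nll M eta n x l \<tau>)"

definition pen_nll ::
  "('m::finite \<Rightarrow> 'x measure) \<Rightarrow> ('m \<Rightarrow> 'b \<times> 'h \<Rightarrow> 'x \<Rightarrow> real) \<Rightarrow> ('h \<Rightarrow> 'h \<Rightarrow> real)
     \<Rightarrow> ('m \<Rightarrow> nat) \<Rightarrow> real \<Rightarrow> ('m \<Rightarrow> nat \<Rightarrow> 'x) \<Rightarrow> 'b \<times> 'h \<Rightarrow> real" where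
  "pen_nll M eta J n lam x \<tau> = total_nll M eta n x \<tau> + lam / 2 * J (snd \<tau>) (snd \<tau>)"

definition quad_nll ::
  "('m \<Rightarrow> 'x measure) \<Rightarrow> ('m \<Rightarrow> 'b \<times> 'h \<Rightarrow> 'x \<Rightarrow> real)
     \<Rightarrow> ('m \<Rightarrow> 'b \<times> 'h \<Rightarrow> 'b::minus \<Rightarrow> 'x \<Rightarrow> real) \<Rightarrow> ('m \<Rightarrow> 'b \<times> 'h \<Rightarrow> 'h::minus \<Rightarrow> 'x \<Rightarrow> real)
     \<Rightarrow> 'b \<times> 'h \<Rightarrow> ('m \<Rightarrow> nat) \<Rightarrow> ('m \<Rightarrow> nat \<Rightarrow> 'x) \<Rightarrow> 'm \<Rightarrow> 'b \<times> 'h \<Rightarrow> real" where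
  "quad_nll M eta D\<theta> Dh \<tau>0 n x l \<tau> =
     - (1 / real (n l)) * (\<Sum>i<n l. D\<theta> l \<tau>0 (fst \<tau>) (x l i) + Dh l \<tau>0 (snd \<tau>) (x l i))
     + mu M eta l \<tau>0 (\<lambda>y. D\<theta> l \<tau>0 (fst \<tau>) y + Dh l \<tau>0 (snd \<tau>) y)
     + 1 / 2 * V M eta l \<tau>0 (\<lambda>y. D\<theta> l \<tau>0 (fst \<tau> - fst \<tau>0) y + Dh l \<tau>0 (snd \<tau> - snd \<tau>0) y)"

definition pen_quad_nll ::
  "('m::finite \<Rightarrow> 'x measure) \<Rightarrow> ('m \<Rightarrow> 'b \<times> 'h \<Rightarrow> 'x \<Rightarrow> real)
     \<Rightarrow> ('m \<Rightarrow> 'b \<times> 'h \<Rightarrow> 'b::minus \<Rightarrow> 'x \<Rightarrow> real) \<Rightarrow> ('m \<Rightarrow> 'b \<times> 'h \<Rightarrow> 'h::minus \<Rightarrow> 'x \<Rightarrow> real)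
     \<Rightarrow> ('h \<Rightarrow> 'h \<Rightarrow> real) \<Rightarrow> 'b \<times> 'h \<Rightarrow> ('m \<Rightarrow> nat) \<Rightarrow> real \<Rightarrow> ('m \<Rightarrow> nat \<Rightarrow> 'x)
     \<Rightarrow> 'b \<times> 'h \<Rightarrow> real" where
  "pen_quad_nll M eta D\<theta> Dh J \<tau>0 n lam x \<tau> =
     (\<Sum>l\<in>UNIV. quad_nll M eta D\<theta> Dh \<tau>0 n x l \<tau>) + lam / 2 * J (snd \<tau>) (snd \<tau>)"

definition local_min_in :: "('a::metric_space \<Rightarrow> real) \<Rightarrow> 'a set \<Rightarrow> 'a \<Rightarrow> bool" where
  "local_min_in f S t \<longleftrightarrow> t \<in> S \<and> (\<exists>e>0. \<forall>s\<in>S. dist s t < e \<longrightarrow> f t \<le> f s)"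

definition critical_point ::
  "('b::real_normed_vector \<times> 'h::real_normed_vector \<Rightarrow> real) \<Rightarrow> 'b \<times> 'h \<Rightarrow> bool" where
  "critical_point f t \<longleftrightarrow>
     ((\<lambda>\<theta>. f (\<theta>, snd t)) has_derivative (\<lambda>_. 0)) (at (fst t)) \<and>
     ((\<lambda>h. f (fst t, h)) has_derivative (\<lambda>_. 0)) (at (snd t))"

text \<open>
  The next two notions are phrased with outer probability, so that no measurability of the
  estimator is needed; in the measurable case they are the usual ones: \<open>Z k = O\<^sub>p(a k)\<close>, and
  \<open>Q k\<close> holds with probability tending to one.
\<close>

definition big_Op :: "'w measure \<Rightarrow> (nat \<Rightarrow> 'w \<Rightarrow> real) \<Rightarrow> (nat \<Rightarrow> real) \<Rightarrow> bool" where
  "big_Op \<Omega> Z a \<longleftrightarrow> (\<forall>\<epsilon>>0. \<exists>C>0. \<forall>\<^sub>F k in sequentially.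
     \<exists>E\<in>sets \<Omega>. {\<omega>\<in>space \<Omega>. \<bar>Z k \<omega>\<bar> > C * a k} \<subseteq> E \<and> measure \<Omega> E < \<epsilon>)"

definition prob_to_one :: "'w measure \<Rightarrow> (nat \<Rightarrow> 'w \<Rightarrow> bool) \<Rightarrow> bool" where
  "prob_to_one \<Omega> Q \<longleftrightarrow> (\<forall>\<epsilon>>0. \<forall>\<^sub>F k in sequentially.
     \<exists>E\<in>sets \<Omega>. {\<omega>\<in>space \<Omega>. \<not> Q k \<omega>} \<subseteq> E \<and> measure \<Omega> E < \<epsilon>)"


text \<open>
  The real-valued form \<open>J\<close> is finite on all of \<open>'h\<close>, as the upper bound in \<open>norm_equiv\<close> requires.
  \<open>D\<theta> l \<tau>\<close> and \<open>Dh l \<tau>\<close> are the Frechet partial derivatives of \<open>eta l\<close> as a map into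
  \<open>L2_0 (gibbs (M l) (eta l \<tau>0))\<close>. The criteria evaluate \<open>eta l\<close> and its derivatives at data
  points, so \<open>eval_derivative\<close> selects the representatives for which \<open>D\<theta> l \<tau> \<zeta> x\<close> and
  \<open>Dh l \<tau> g x\<close> are the partial derivatives of \<open>\<tau> \<mapsto> eta l \<tau> x\<close>.
  In \<open>derivative_diff\<close> the direction \<open>(\<zeta>, g)\<close> is deliberately restricted to the neighborhoods.
  The index \<open>\<nu>\<close> of the eigensystem starts at 1; \<open>eigen_complete\<close> says that \<open>\<phi>\<close> is a full
  eigensystem rather than a subfamily, without which the growth of \<open>\<rho>\<close> carries no information.
\<close>

locale semiparametric_density_model = prob_space \<Omega>
  for \<Omega> :: "'w measure" +
  fixes M :: "'m::finite \<Rightarrow> 'x measure"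
    and eta :: "'m \<Rightarrow> (real^'p) \<times> 'h::{real_inner, complete_space} \<Rightarrow> 'x \<Rightarrow> real"
    and \<tau>0 :: "(real^'p) \<times> 'h"
    and X :: "'m \<Rightarrow> nat \<Rightarrow> 'w \<Rightarrow> 'x"
    and J :: "'h \<Rightarrow> 'h \<Rightarrow> real"
    and L\<theta> :: "'m \<Rightarrow> real^'p \<Rightarrow> 'x \<Rightarrow> real"
    and Lh :: "'m \<Rightarrow> 'h \<Rightarrow> 'x \<Rightarrow> real"
    and D\<theta> :: "'m \<Rightarrow> (real^'p) \<times> 'h \<Rightarrow> real^'p \<Rightarrow> 'x \<Rightarrow> real"
    and Dh :: "'m \<Rightarrow> (real^'p) \<times> 'h \<Rightarrow> 'h \<Rightarrow> 'x \<Rightarrow> real"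
    and N\<theta> :: "(real^'p) set"
    and Nh :: "'h set"
    and C1 C2 Cd :: real
    and \<phi> :: "nat \<Rightarrow> 'h"
    and \<rho> :: "nat \<Rightarrow> real"
    and r :: real
  assumes exp_integrable: "\<And>l \<tau>. integrable (M l) (\<lambda>x. exp (eta l \<tau> x))"
    and norm_const_pos: "\<And>l \<tau>. 0 < (\<integral>x. exp (eta l \<tau> x) \<partial>M l)"
    and eta_L2_0: "\<And>l \<tau>. eta l \<tau> \<in> L2_0 (gibbs (M l) (eta l \<tau>0))"
    and X_measurable: "\<And>l i. X l i \<in> measurable \<Omega> (M l)"
    and X_law: "\<And>l i. distr \<Omega> (M l) (X l i) = gibbs (M l) (eta l \<tau>0)"
    and X_indep: "indep_vars (\<lambda>(l, i). M l) (\<lambda>(l, i). X l i) UNIV"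
    and open_N\<theta>: "open N\<theta>" and \<theta>0_in: "fst \<tau>0 \<in> N\<theta>"
    and open_Nh: "open Nh" and h0_in: "snd \<tau>0 \<in> Nh"
    and L2_derivative: "\<And>l \<theta> h. \<theta> \<in> N\<theta> \<Longrightarrow> h \<in> Nh \<Longrightarrow>
          L2_has_derivative (gibbs (M l) (eta l \<tau>0)) (\<lambda>\<theta>'. eta l (\<theta>', h)) (D\<theta> l (\<theta>, h)) \<theta> \<and>
          L2_has_derivative (gibbs (M l) (eta l \<tau>0)) (\<lambda>h'. eta l (\<theta>, h')) (Dh l (\<theta>, h)) h"
    and eval_derivative: "\<And>l \<theta> h x. \<theta> \<in> N\<theta> \<Longrightarrow> h \<in> Nh \<Longrightarrow> x \<in> space (M l) \<Longrightarrow>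
          ((\<lambda>\<theta>'. eta l (\<theta>', h) x) has_derivative (\<lambda>\<zeta>. D\<theta> l (\<theta>, h) \<zeta> x)) (at \<theta>) \<and>
          ((\<lambda>h'. eta l (\<theta>, h') x) has_derivative (\<lambda>g. Dh l (\<theta>, h) g x)) (at h)"
    and J_sym: "\<And>g h. J g h = J h g"
    and J_linear: "\<And>g. linear (J g)"
    and J_nonneg: "\<And>g. 0 \<le> J g g"
    and J_null: "\<exists>B. finite B \<and> {g. J g g = 0} \<subseteq> span B"
    and L\<theta>_bounded_linear: "\<And>l. L2_bounded_linear (gibbs (M l) (eta l \<tau>0)) (L\<theta> l)"
    and Lh_bounded_linear: "\<And>l. L2_bounded_linear (gibbs (M l) (eta l \<tau>0)) (Lh l)"
    and L\<theta>_null: "\<And>l \<zeta>. (AE x in gibbs (M l) (eta l \<tau>0). L\<theta> l \<zeta> x = 0) \<Longrightarrow> \<zeta> = 0"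
    and Lh_null: "\<And>l g. (AE x in gibbs (M l) (eta l \<tau>0). Lh l g x = 0) \<Longrightarrow> g = 0"
    and norm_equiv: "\<And>lam. lam > 0 \<Longrightarrow> \<exists>M1>0. \<exists>M2>0. \<forall>g.
          M1 * (norm g)\<^sup>2 \<le> (\<Sum>l\<in>UNIV. V M eta l \<tau>0 (Lh l g)) + lam * J g g \<and>
          (\<Sum>l\<in>UNIV. V M eta l \<tau>0 (Lh l g)) + lam * J g g \<le> M2 * (norm g)\<^sup>2"
    and separation: "\<exists>c>0. \<forall>\<zeta> g. norm \<zeta> = 1 \<longrightarrow>
          (\<Sum>l\<in>UNIV. V M eta l \<tau>0 (\<lambda>x. L\<theta> l \<zeta> x - Lh l g x)) > c"
    and eta_inj: "\<And>l \<tau> \<tau>'. \<tau> \<in> N\<theta> \<times> Nh \<Longrightarrow> \<tau>' \<in> N\<theta> \<times> Nh \<Longrightarrow>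
          (AE x in gibbs (M l) (eta l \<tau>0). eta l \<tau> x = eta l \<tau>' x) \<Longrightarrow> \<tau> = \<tau>'"
    and eta_C3: "\<And>l. L2_C_on (gibbs (M l) (eta l \<tau>0)) 3 (N\<theta> \<times> Nh) (eta l)"
    and unique_root: "\<And>n \<theta> h. (\<forall>l. 0 < n l) \<Longrightarrow> \<theta> \<in> N\<theta> \<Longrightarrow> h \<in> Nh \<Longrightarrow>
          ((\<forall>\<zeta>. expectation (\<lambda>\<omega>.
                  frechet_derivative (\<lambda>\<theta>'. total_nll M eta n (\<lambda>l i. X l i \<omega>) (\<theta>', h)) (at \<theta>) \<zeta>) = 0) \<and>
           (\<forall>g. expectation (\<lambda>\<omega>.
                  frechet_derivative (\<lambda>h'. total_nll M eta n (\<lambda>l i. X l i \<omega>) (\<theta>, h')) (at h) g) = 0))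
          \<longleftrightarrow> (\<theta>, h) = \<tau>0"
    and D\<theta>_bounded_linear: "\<And>l \<tau>. \<tau> \<in> N\<theta> \<times> Nh \<Longrightarrow>
          L2_bounded_linear (gibbs (M l) (eta l \<tau>0)) (D\<theta> l \<tau>)"
    and Dh_bounded_linear: "\<And>l \<tau>. \<tau> \<in> N\<theta> \<times> Nh \<Longrightarrow>
          L2_bounded_linear (gibbs (M l) (eta l \<tau>0)) (Dh l \<tau>)"
    and C1_pos: "0 < C1" and C2_pos: "0 < C2"
    and derivative_equiv: "\<And>\<tau> \<zeta> g. \<tau> \<in> N\<theta> \<times> Nh \<Longrightarrow>
          C1 * (\<Sum>l\<in>UNIV. V M eta l \<tau>0 (\<lambda>x. L\<theta> l \<zeta> x + Lh l g x))
            \<le> (\<Sum>l\<in>UNIV. V M eta l \<tau>0 (\<lambda>x. D\<theta> l \<tau> \<zeta> x + Dh l \<tau> g x)) \<and>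
          (\<Sum>l\<in>UNIV. V M eta l \<tau>0 (\<lambda>x. D\<theta> l \<tau> \<zeta> x + Dh l \<tau> g x))
            \<le> C2 * (\<Sum>l\<in>UNIV. V M eta l \<tau>0 (\<lambda>x. L\<theta> l \<zeta> x + Lh l g x))"
    and Cd_pos: "0 < Cd" and Cd_less: "Cd < 2 * C1"
    and derivative_diff: "\<And>\<tau>1 \<tau>2 \<zeta> g. \<tau>1 \<in> N\<theta> \<times> Nh \<Longrightarrow> \<tau>2 \<in> N\<theta> \<times> Nh \<Longrightarrow>
          \<zeta> \<in> N\<theta> \<Longrightarrow> g \<in> Nh \<Longrightarrow>
          (\<Sum>l\<in>UNIV. V M eta l \<tau>0
             (\<lambda>x. (D\<theta> l \<tau>1 \<zeta> x - D\<theta> l \<tau>2 \<zeta> x) + (Dh l \<tau>1 g x - Dh l \<tau>2 g x)))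
            \<le> Cd * (\<Sum>l\<in>UNIV. V M eta l \<tau>0 (\<lambda>x. L\<theta> l \<zeta> x + Lh l g x))"
    and convex_N: "convex (N\<theta> \<times> Nh)"
    and variance_equiv: "\<exists>C3>0. \<exists>C4>0. \<forall>\<tau>\<in>N\<theta> \<times> Nh. \<forall>f.
          (\<forall>l. f l \<in> L2_0 (gibbs (M l) (eta l \<tau>0))) \<longrightarrow>
          C3 * (\<Sum>l\<in>UNIV. V M eta l \<tau>0 (f l)) \<le> (\<Sum>l\<in>UNIV. V M eta l \<tau> (f l)) \<and>
          (\<Sum>l\<in>UNIV. V M eta l \<tau> (f l)) \<le> C4 * (\<Sum>l\<in>UNIV. V M eta l \<tau>0 (f l))"
    and completely_continuous: "\<And>\<epsilon>. \<epsilon> > 0 \<Longrightarrow> \<exists>F :: ('h \<Rightarrow> real) set.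
          finite F \<and> (\<forall>ell\<in>F. bounded_linear ell) \<and>
          (\<forall>g. (\<forall>ell\<in>F. ell g = 0) \<longrightarrow> (\<Sum>l\<in>UNIV. V M eta l \<tau>0 (Lh l g)) \<le> \<epsilon> * J g g)"
    and eigen_V: "\<And>\<nu> \<mu>. 1 \<le> \<nu> \<Longrightarrow> 1 \<le> \<mu> \<Longrightarrow>
          (\<Sum>l\<in>UNIV. V2 M eta l \<tau>0 (Lh l (\<phi> \<nu>)) (Lh l (\<phi> \<mu>))) = (if \<nu> = \<mu> then 1 else 0)"
    and eigen_J: "\<And>\<nu> \<mu>. 1 \<le> \<nu> \<Longrightarrow> 1 \<le> \<mu> \<Longrightarrow> J (\<phi> \<nu>) (\<phi> \<mu>) = (if \<nu> = \<mu> then \<rho> \<nu> else 0)"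
    and eigen_complete: "closure (span (\<phi> ` {1..})) = UNIV"
    and eigenvalue_nonneg: "\<And>\<nu>. 1 \<le> \<nu> \<Longrightarrow> 0 \<le> \<rho> \<nu>"
    and eigenvalue_limit: "filterlim \<rho> at_top sequentially"
    and r_gt_1: "1 < r"
    and eigenvalue_growth: "\<exists>\<beta>1 \<beta>2 \<kappa>. 0 < \<beta>1 \<and> (\<forall>\<nu>\<ge>1. \<kappa> \<nu> \<in> {\<beta>1<..<\<beta>2} \<and> \<rho> \<nu> = \<kappa> \<nu> * real \<nu> powr r)"

end

theory Submission
  imports Defs
begin

text \<open>
  Applied to centred indicators, the equivalence of the variances bounds all likelihood ratios on the
  neighborhood, so that the Kullback-Leibler divergences of two parameters are comparable to the squared
  \<open>L2\<close> distance of their log densities, and at most a multiple of \<open>nrm2\<close> of their difference.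

  Almost sure convexity of the empirical criterion descends to the single observation: by independence,
  the log likelihood ratio \<open>u l d\<close> lies above its tangent at any \<open>w\<close> up to the divergence
  between \<open>d\<close> and \<open>w\<close>. In the mean this makes the criterion grow quadratically around the truth.
  The tangents are linear in \<open>d - w\<close>, which permits a PAC-Bayes bound that is uniform in \<open>d\<close>: the prior
  is Gaussian in the coordinates of the eigensystem with variances of order \<open>1 / (n * (1 + lam * \<rho> \<nu>))\<close>,
  and \<open>w\<close> runs through representatives of the cells of a grid of mesh \<open>1 / sqrt n\<close>. Eigenvalue growth
  turns the sum of the variances and the number of relevant coordinates into the rate
  \<open>lam powr (- 1 / r) / n\<close>. The resulting lower bound of the criterion, compared with its value at the
  truth, confines the minimizer.
\<close>

subsection \<open>Real inequalities\<close>

text \<open>Mean-square smoothness does not bound Taylor remainders at the observations uniformly in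
  an infinite-dimensional parameter. Convexity supplies one-sided pointwise remainders instead, and
  a lower bound of the criterion needs only one side. The remainder of the tangent at
  \<open>w\<close> is a multiple of \<open>nrm2 (d - w)\<close> and enters the exponent multiplied
  by the sample size: with the given mesh every discretized coordinate costs a constant, as it does
  in the weight of its cell. Grid and Gaussian share the work: the grid handles the nonlinear
  dependence on \<open>w\<close>, the Gaussian the linear dependence on \<open>d - w\<close>. About
  \<open>lam powr (- 1 / r)\<close> coordinates have \<open>lam * rho k\<close> below a fixed
  constant; in the others the penalty bounds \<open>d - w\<close>. Tangents are not known to be
  bounded functions of the observation, hence \<open>tilt\<close> in place of the exponential. The
  bounds are proved for finite sets of parameters with constants independent of the set, so they
  pass to a countable dense set, and convexity carries them to the minimizer.\<close>

lemma cosh_type_bounds: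
  fixes y B :: real
  assumes "\<bar>y\<bar> \<le> B"
  shows "exp (- B) / 2 * y\<^sup>2 \<le> exp (- y) - 1 + y" "exp (- y) - 1 + y \<le> exp B / 2 * y\<^sup>2"
proof -
  obtain t where t: "\<bar>t\<bar> \<le> \<bar>- y\<bar>" "exp (- y) = (\<Sum>m<2. (- y) ^ m / fact m) + exp t / fact 2 * (- y) ^ 2"
    using Maclaurin_exp_le[of "- y" 2] by blast
  have eq: "exp (- y) - 1 + y = exp t / 2 * y\<^sup>2"
    using t(2) by (simp add: numeral_2_eq_2)
  have "- B \<le> t" "t \<le> B" using t(1) assms by auto
  then show "exp (- B) / 2 * y\<^sup>2 \<le> exp (- y) - 1 + y" "exp (- y) - 1 + y \<le> exp B / 2 * y\<^sup>2"
    unfolding eq by (auto intro!: mult_right_mono divide_right_mono)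
qed

text \<open>A substitute for \<open>exp (- y)\<close> under which unbounded \<open>y\<close> do no harm: its expectation needs only
  second moments of \<open>y\<close>, and averaging \<open>- ln (tilt y)\<close> over a symmetric perturbation of \<open>y\<close> of any
  size yields at most \<open>max y (- 1 / 4)\<close>.\<close>

definition tilt :: "real \<Rightarrow> real" where
  "tilt y = 1 - y + y\<^sup>2"

lemma tilt_ge: "3 / 4 \<le> tilt y"
proof -
  have "tilt y = 3 / 4 + (y - 1 / 2)\<^sup>2" by (simp add: tilt_def power2_eq_square algebra_simps)
  then show ?thesis by simp
qed

lemma tilt_pos: "0 < tilt y"
  using tilt_ge[of y] by linarith

lemma exp_minus_le_tilt:
  assumes "- 1 \<le> m"
  shows "exp (- m) \<le> tilt m"
proof (cases "0 \<le> m")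
  case True
  \<comment> \<open>The cubic remainder has a negative sign, so the expansion up to the square is an
    upper bound.\<close>
  obtain t where t: "\<bar>t\<bar> \<le> \<bar>- m\<bar>" "exp (- m) = (\<Sum>k<3. (- m) ^ k / fact k) + exp t / fact 3 * (- m) ^ 3"
    using Maclaurin_exp_le[of "- m" 3] by blast
  have "exp (- m) = 1 - m + m\<^sup>2 / 2 - exp t / 6 * m ^ 3"
    using t(2) by (simp add: numeral_3_eq_3 numeral_2_eq_2 fact_numeral power2_eq_square)
  moreover have "0 \<le> exp t / 6 * m ^ 3" using True by simp
  moreover have "0 \<le> m\<^sup>2" by simp
  ultimately show ?thesis unfolding tilt_def by linarith
next
  case False
  then show ?thesis using exp_bound[of "- m"] assms by (simp add: tilt_def)
qed

text \<open>With \<open>A = tilt m\<close> and \<open>S = s\<^sup>2\<close> the product of the two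
  values is \<open>(A - S)\<^sup>2 + 3 * S\<close>. Over \<open>S \<ge> 0\<close> its minimum is
  \<open>A\<^sup>2\<close>, at \<open>S = 0\<close>, if \<open>A \<le> 3 / 2\<close>, and
  \<open>3 * A - 9 / 4\<close> otherwise. In the first case \<open>m \<ge> - 1\<close> and the
  minimum is at least \<open>exp (- 2 * m)\<close>, in the second it exceeds \<open>9 / 4\<close>
  and hence \<open>exp (1 / 2)\<close>. The size of \<open>s\<close> never enters.\<close>

lemma neg_ln_tilt_average:
  "- (ln (tilt (m + s)) + ln (tilt (m - s))) / 2 \<le> max m (- 1 / 4)"
proof -
  define A S where "A = tilt m" and "S = s\<^sup>2"
  have S: "0 \<le> S" by (simp add: S_def)
  have prod: "tilt (m + s) * tilt (m - s) = (A - S)\<^sup>2 + 3 * S"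
    by (simp add: tilt_def A_def S_def power2_eq_square algebra_simps)
  have "exp (- 2 * max m (- 1 / 4)) \<le> tilt (m + s) * tilt (m - s)"
  proof (cases "A \<le> 3 / 2")
    case True
    have "m * m - m \<le> 1 / 2" using True by (simp add: A_def tilt_def power2_eq_square)
    have m1: "- 1 \<le> m"
    proof (rule ccontr)
      assume "\<not> - 1 \<le> m"
      then have "1 * 1 \<le> (- m) * (- m)" by (intro mult_mono) auto
      then show False using \<open>m * m - m \<le> 1 / 2\<close> \<open>\<not> - 1 \<le> m\<close> by simp
    qed
    have "exp (- 2 * max m (- 1 / 4)) \<le> exp (- 2 * m)" by simp
    also have "\<dots> = (exp (- m))\<^sup>2" by (simp add: power2_eq_square flip: exp_add)
    also have "\<dots> \<le> A\<^sup>2"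
      unfolding A_def by (intro power_mono exp_minus_le_tilt[OF m1]) auto
    also have "\<dots> \<le> (A - S)\<^sup>2 + 3 * S"
    proof -
      have "(A - S)\<^sup>2 + 3 * S - A\<^sup>2 = S\<^sup>2 + 2 * S * (3 / 2 - A)"
        by (simp add: power2_eq_square algebra_simps)
      also have "\<dots> \<ge> 0" using True S by simp
      finally show ?thesis by simp
    qed
    finally show ?thesis by (simp add: prod)
  next
    case False
    have "exp (- 2 * max m (- 1 / 4)) \<le> exp (1 / 2)" by simp
    also have "\<dots> \<le> 1 + 1 / 2 + (1 / 2)\<^sup>2" using exp_bound[of "1 / 2"] by simp
    also have "\<dots> \<le> 3 * A - 9 / 4" using False by (simp add: power2_eq_square)
    also have "\<dots> \<le> (A - S)\<^sup>2 + 3 * S"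
    proof -
      have "(A - S)\<^sup>2 + 3 * S - (3 * A - 9 / 4) = (A - S - 3 / 2)\<^sup>2"
        by (simp add: power2_eq_square algebra_simps)
      then show ?thesis by (metis diff_ge_0_iff_ge zero_le_power2)
    qed
    finally show ?thesis by (simp add: prod)
  qed
  then have "ln (exp (- 2 * max m (- 1 / 4))) \<le> ln (tilt (m + s) * tilt (m - s))"
    using tilt_pos[of "m + s"] tilt_pos[of "m - s"] by (subst ln_le_cancel_iff) auto
  also have "\<dots> = ln (tilt (m + s)) + ln (tilt (m - s))"
    using tilt_pos[of "m + s"] tilt_pos[of "m - s"] by (intro ln_mult_pos)
  finally show ?thesis by simp
qed

text \<open>Pointwise form of the bound on the moment generating function. Only the factor
  \<open>u\<close> has to be bounded: the tangent value \<open>l\<close> enters through the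
  polynomial \<open>tilt\<close>, so its second moment will be enough.\<close>

lemma exp_tilt_le:
  fixes a u l :: real
  assumes a: "0 \<le> a" "a * \<bar>u\<bar> \<le> 1"
  shows "exp (- (a * u)) * tilt (a * l) \<le> 1 - a * (u + l) + a\<^sup>2 * (2 * u\<^sup>2 + 4 * l\<^sup>2)"
proof -
  define v y where "v = a * u" and "y = a * l"
  have v: "\<bar>v\<bar> \<le> 1" using a by (simp add: v_def abs_mult)
  have "exp (- v) * tilt y \<le> tilt v * tilt y"
    using v tilt_pos[of y] exp_minus_le_tilt[of v] by (intro mult_right_mono) auto
  also have "\<dots> \<le> 1 - (v + y) + (2 * v\<^sup>2 + 4 * y\<^sup>2)"
  proof -
    have v2: "v\<^sup>2 \<le> 1" using v by (simp add: abs_square_le_1)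
    have 1: "v * y \<le> (v\<^sup>2 + y\<^sup>2) / 2" using sum_squares_bound[of v y] by simp
    have 2: "- (v\<^sup>2 * y) \<le> (v\<^sup>2 + y\<^sup>2) / 2"
    proof -
      have "- (v\<^sup>2 * y) \<le> \<bar>v\<bar> * (\<bar>v\<bar> * \<bar>y\<bar>)"
        by (metis abs_ge_minus_self abs_mult mult.assoc power2_eq_square)
      also have "\<dots> \<le> 1 * (\<bar>v\<bar> * \<bar>y\<bar>)" using v by (intro mult_right_mono) auto
      also have "\<dots> \<le> (v\<^sup>2 + y\<^sup>2) / 2" using sum_squares_bound[of "\<bar>v\<bar>" "\<bar>y\<bar>"] by simp
      finally show ?thesis .
    qed
    have 3: "- (v * y\<^sup>2) \<le> y\<^sup>2"
      using v mult_right_mono[of "- v" 1 "y\<^sup>2"] by auto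
    have 4: "v\<^sup>2 * y\<^sup>2 \<le> y\<^sup>2"
      using v2 mult_right_mono[of "v\<^sup>2" 1 "y\<^sup>2"] by auto
    have "tilt v * tilt y = 1 - (v + y) + v\<^sup>2 + y\<^sup>2 + v * y + (- (v\<^sup>2 * y)) + (- (v * y\<^sup>2)) + v\<^sup>2 * y\<^sup>2"
      by (simp add: tilt_def power2_eq_square algebra_simps)
    then show ?thesis using 1 2 3 4 by argo
  qed
  also have "\<dots> = 1 - a * (u + l) + a\<^sup>2 * (2 * u\<^sup>2 + 4 * l\<^sup>2)"
    by (simp add: v_def y_def power_mult_distrib algebra_simps)
  finally show ?thesis by (simp add: v_def y_def)
qed

section \<open>Midpoint convexity from support lines, sums over eigenvalues, Cauchy-Schwarz\<close>

lemma midpoint_le_of_local_support: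
  fixes k :: "real \<Rightarrow> real"
  assumes cont: "continuous_on {0..1} k"
    and sup: "\<And>s. 0 < s \<Longrightarrow> s < 1 \<Longrightarrow>
      \<exists>p. \<exists>d>0. \<forall>t. 0 < t \<and> t < 1 \<and> t \<noteq> s \<and> \<bar>t - s\<bar> < d \<longrightarrow> k s + p * (t - s) < k t"
  shows "k (1/2) \<le> (k 0 + k 1) / 2"
proof (rule ccontr)
  \<comment> \<open>Maximum principle: an interior maximum of \<open>k\<close> minus its chord contradicts the local support line there.\<close>
  assume neg: "\<not> ?thesis"
  define h where "h s = k s - (k 0 + (k 1 - k 0) * s)" for s
  have hc: "continuous_on {0..1} h"
    unfolding h_def by (intro continuous_intros cont)
  obtain s where s: "s \<in> {0..1}" "\<And>t. t \<in> {0..1} \<Longrightarrow> h t \<le> h s"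
    using continuous_attains_sup[of "{0..1::real}" h] hc by auto
  have h01: "h 0 = 0" "h 1 = 0" by (auto simp: h_def)
  have "0 < h (1/2)" using neg by (simp add: h_def field_simps)
  then have hs: "0 < h s" using s(2)[of "1/2"] by auto
  have si: "0 < s" "s < 1" using s(1) hs h01 by (auto simp: less_le)
  obtain p d where d: "0 < d" and
    sup': "\<And>t. 0 < t \<Longrightarrow> t < 1 \<Longrightarrow> t \<noteq> s \<Longrightarrow> \<bar>t - s\<bar> < d \<Longrightarrow> k s + p * (t - s) < k t"
    using sup[OF si] by blast
  define q where "q = p - (k 1 - k 0)"
  define e where "e = min d (min s (1 - s)) / 2"
  have e: "0 < e" "e < d" "e < s" "e < 1 - s" using d si by (auto simp: e_def min_def)
  \<comment> \<open>Step to the side on which the support line does not fall below the chord; its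
    strictness lifts \<open>h\<close> above the supposed maximum.\<close>
  define t where "t = (if 0 \<le> q then s + e else s - e)"
  have t: "0 < t" "t < 1" "t \<noteq> s" "\<bar>t - s\<bar> < d" "0 \<le> q * (t - s)"
    using e by (auto simp: t_def mult_nonpos_nonneg mult_nonneg_nonpos)
  have "k s + p * (t - s) < k t" using sup' t by blast
  then have "h s + q * (t - s) < h t" by (simp add: h_def q_def algebra_simps)
  then show False using s(2)[of t] t by auto
qed

text \<open>Comparison with the integral of \<open>x powr (- r)\<close> over one unit interval, in
  telescoping form for the induction that follows.\<close>

lemma powr_minus_telescope:
  fixes r :: real and n :: nat
  assumes r: "1 < r" and n: "1 \<le> n"
  shows "real (Suc n) powr (- r) \<le> (real n powr (1 - r) - real (Suc n) powr (1 - r)) / (r - 1)"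
proof -
  have "\<exists>z. real n < z \<and> z < real (Suc n) \<and>
    real (Suc n) powr (1 - r) - real n powr (1 - r) = (real (Suc n) - real n) * ((1 - r) * z powr (- r))"
  proof (rule MVT2)
    fix x assume "real n \<le> x" "x \<le> real (Suc n)"
    then have "0 < x" using n by linarith
    then show "((\<lambda>x. x powr (1 - r)) has_real_derivative (1 - r) * x powr (- r)) (at x)"
      using DERIV_powr[OF DERIV_ident _ DERIV_const, of x "1 - r"] by (simp add: powr_diff powr_minus divide_simps)
  qed auto
  then obtain z where z: "real n < z" "z < real (Suc n)"
    "real (Suc n) powr (1 - r) - real n powr (1 - r) = (1 - r) * z powr (- r)" by auto
  have "real (Suc n) powr (- r) \<le> z powr (- r)"
    using z n r by (intro powr_mono2') auto
  also have "\<dots> = (real n powr (1 - r) - real (Suc n) powr (1 - r)) / (r - 1)"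
    using z(3) r by (simp add: field_simps)
  finally show ?thesis .
qed

lemma sum_powr_tail_le:
  fixes r :: real and n K :: nat
  assumes r: "1 < r" and n: "1 \<le> n"
  shows "(\<Sum>i\<in>{n<..n + K}. real i powr (- r)) \<le> (real n powr (1 - r) - real (n + K) powr (1 - r)) / (r - 1)"
proof (induction K)
  case (Suc K)
  have "{n<..n + Suc K} = insert (Suc (n + K)) {n<..n + K}" by auto
  then have "(\<Sum>i\<in>{n<..n + Suc K}. real i powr (- r))
    = real (Suc (n + K)) powr (- r) + (\<Sum>i\<in>{n<..n + K}. real i powr (- r))" by simp
  also have "\<dots> \<le> (real (n + K) powr (1 - r) - real (Suc (n + K)) powr (1 - r)) / (r - 1)
    + (real n powr (1 - r) - real (n + K) powr (1 - r)) / (r - 1)"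
    using Suc powr_minus_telescope[of r "n + K"] r n by (intro add_mono) auto
  also have "\<dots> = (real n powr (1 - r) - real (n + Suc K) powr (1 - r)) / (r - 1)"
    by (simp add: diff_divide_distrib)
  finally show ?case .
qed simp

text \<open>The sum is the effective dimension of the penalized problem for eigenvalues of order
  \<open>i powr r\<close>. It is split near \<open>x = L powr (- 1 / r)\<close>, where
  \<open>L * i powr r = 1\<close>: each term before is at most \<open>1\<close>, and the terms after
  are dominated by \<open>1 / (L * b)\<close> times the tail of \<open>i powr (- r)\<close>.\<close>

lemma sum_inverse_eigenvalue_le:
  fixes r b L :: real and K :: nat
  assumes r: "1 < r" and b: "0 < b" and L: "0 < L" "L \<le> 1"
  shows "(\<Sum>i\<in>{1..K}. 1 / (1 + L * (b * real i powr r))) \<le> (2 + 1 / (b * (r - 1))) * L powr (- 1 / r)"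
proof -
  define x where "x = L powr (- 1 / r)"
  define n where "n = nat \<lceil>x\<rceil>"
  have x1: "1 \<le> x"
    using L r powr_mono2'[of "- 1 / r" L 1] by (simp add: x_def)
  have n: "1 \<le> n" "x \<le> real n" "real n \<le> 2 * x" using x1 unfolding n_def by linarith+
  have pos: "0 < 1 + L * (b * real i powr r)" for i
    using b L by (intro add_pos_nonneg) auto
  have "(\<Sum>i\<in>{1..K}. 1 / (1 + L * (b * real i powr r)))
     \<le> (\<Sum>i\<in>{1..n} \<union> {n<..n + K}. 1 / (1 + L * (b * real i powr r)))"
    using pos by (intro sum_mono2) (auto simp: less_imp_le)
  also have "\<dots> = (\<Sum>i\<in>{1..n}. 1 / (1 + L * (b * real i powr r))) + (\<Sum>i\<in>{n<..n + K}. 1 / (1 + L * (b * real i powr r)))"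
    by (intro sum.union_disjoint) auto
  also have "\<dots> \<le> (\<Sum>i\<in>{1..n}. 1) + (\<Sum>i\<in>{n<..n + K}. 1 / (L * b) * real i powr (- r))"
  proof (intro add_mono sum_mono)
    fix i show "1 / (1 + L * (b * real i powr r)) \<le> 1"
      using b L by (intro divide_le_eq_1_pos[THEN iffD2]) (auto intro!: add_pos_nonneg)
  next
    fix i assume "i \<in> {n<..n + K}"
    then have "0 < real i" using n by auto
    have "1 / (1 + L * (b * real i powr r)) \<le> 1 / (L * (b * real i powr r))"
      using b L \<open>0 < real i\<close> by (intro divide_left_mono) (auto intro!: mult_pos_pos add_pos_nonneg)
    also have "\<dots> = 1 / (L * b) * real i powr (- r)"
      by (simp add: powr_minus divide_simps)
    finally show "1 / (1 + L * (b * real i powr r)) \<le> 1 / (L * b) * real i powr (- r)" .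
  qed
  also have "\<dots> = real n + 1 / (L * b) * (\<Sum>i\<in>{n<..n + K}. real i powr (- r))"
    by (simp add: sum_distrib_left)
  also have "\<dots> \<le> 2 * x + 1 / (L * b) * (x powr (1 - r) / (r - 1))"
  proof (intro add_mono mult_left_mono)
    have "(\<Sum>i\<in>{n<..n + K}. real i powr (- r)) \<le> (real n powr (1 - r) - real (n + K) powr (1 - r)) / (r - 1)"
      by (rule sum_powr_tail_le[OF r n(1)])
    also have "\<dots> \<le> real n powr (1 - r) / (r - 1)"
      using r by (intro divide_right_mono) auto
    also have "\<dots> \<le> x powr (1 - r) / (r - 1)"
      using r n x1 by (intro divide_right_mono powr_mono2') auto
    finally show "(\<Sum>i\<in>{n<..n + K}. real i powr (- r)) \<le> x powr (1 - r) / (r - 1)" .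
  qed (use n b L in auto)
  \<comment> \<open>\<open>x powr (- r) = L\<close> by the choice of \<open>x\<close>, so the tail
    is of the same order \<open>x\<close> as the number of leading terms.\<close>
  also have "x powr (1 - r) = L * x"
  proof -
    have "x powr (1 - r) = L powr (- 1 / r * (1 - r))" by (simp add: x_def powr_powr)
    also have "- 1 / r * (1 - r) = 1 + (- 1 / r)" using r by (simp add: field_simps)
    also have "L powr \<dots> = L * x" using L by (simp only: powr_add x_def) simp
    finally show ?thesis .
  qed
  also have "2 * x + 1 / (L * b) * (L * x / (r - 1)) = (2 + 1 / (b * (r - 1))) * x"
    using L b r by (simp add: field_simps)
  finally show ?thesis by (simp add: x_def)
qed

text \<open>The discriminant argument. In the degenerate case \<open>c = 0\<close> a linear function
  of \<open>t\<close> is nonnegative everywhere, which forces \<open>b = 0\<close>.\<close>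

lemma integral_product_sq_le:
  fixes f g :: "'x \<Rightarrow> real"
  assumes [measurable]: "f \<in> borel_measurable N" "g \<in> borel_measurable N"
    and f: "integrable N (\<lambda>x. (f x)\<^sup>2)" and g: "integrable N (\<lambda>x. (g x)\<^sup>2)"
  shows "integrable N (\<lambda>x. f x * g x)"
    "(\<integral>x. f x * g x \<partial>N)\<^sup>2 \<le> (\<integral>x. (f x)\<^sup>2 \<partial>N) * (\<integral>x. (g x)\<^sup>2 \<partial>N)"
proof -
  show fg: "integrable N (\<lambda>x. f x * g x)"
  proof (rule Bochner_Integration.integrable_bound)
    show "integrable N (\<lambda>x. (f x)\<^sup>2 + (g x)\<^sup>2)" using f g by simp
    have "\<bar>f x * g x\<bar> \<le> (f x)\<^sup>2 + (g x)\<^sup>2" for x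
      using sum_squares_bound[of "\<bar>f x\<bar>" "\<bar>g x\<bar>"] abs_ge_zero[of "f x * g x"]
      unfolding abs_mult power2_abs by linarith
    then show "AE x in N. norm (f x * g x) \<le> norm ((f x)\<^sup>2 + (g x)\<^sup>2)" by simp
  qed simp
  define a b c where "a = (\<integral>x. (f x)\<^sup>2 \<partial>N)" and "b = (\<integral>x. f x * g x \<partial>N)" and "c = (\<integral>x. (g x)\<^sup>2 \<partial>N)"
  have q: "0 \<le> a + 2 * t * b + t\<^sup>2 * c" for t
  proof -
    have "0 \<le> (\<integral>x. (f x + t * g x)\<^sup>2 \<partial>N)" by simp
    also have "\<dots> = (\<integral>x. (f x)\<^sup>2 + 2 * t * (f x * g x) + t\<^sup>2 * (g x)\<^sup>2 \<partial>N)"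
      by (intro Bochner_Integration.integral_cong) (auto simp: power2_eq_square algebra_simps)
    also have "\<dots> = a + 2 * t * b + t\<^sup>2 * c"
      using f g fg by (simp add: a_def b_def c_def)
    finally show ?thesis .
  qed
  have c0: "0 \<le> c" by (simp add: c_def)
  have "b\<^sup>2 \<le> a * c"
  proof (cases "c = 0")
    case True
    show ?thesis
    proof (cases "b = 0")
      case False
      have "0 \<le> a + 2 * (- (a + 1) / (2 * b)) * b" using q[of "- (a + 1) / (2 * b)"] True by simp
      then show ?thesis using False by (simp add: field_simps)
    qed (use True in simp)
  next
    case False
    then have "0 < c" using c0 by simp
    then have "0 \<le> a - b\<^sup>2 / c" using q[of "- b / c"] by (simp add: power2_eq_square field_simps)
    then show ?thesis using \<open>0 < c\<close> by (simp add: field_simps)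
  qed
  then show "(\<integral>x. f x * g x \<partial>N)\<^sup>2 \<le> (\<integral>x. (f x)\<^sup>2 \<partial>N) * (\<integral>x. (g x)\<^sup>2 \<partial>N)"
    by (simp add: a_def b_def c_def)
qed

subsection \<open>Gaussian measures and the PAC-Bayes bound\<close>

definition std_gauss :: "real measure" where
  "std_gauss = density lborel (\<lambda>x. ennreal (std_normal_density x))"

definition gauss :: "'i set \<Rightarrow> ('i \<Rightarrow> real) measure" where
  "gauss I = PiM I (\<lambda>_. std_gauss)"

lemma sets_std_gauss: "sets std_gauss = sets borel"
  by (simp add: std_gauss_def)

lemma space_std_gauss [simp]: "space std_gauss = UNIV"
  by (simp add: std_gauss_def)

lemma prob_space_std_gauss: "prob_space std_gauss"
  unfolding std_gauss_def by (rule prob_space_normal_density) simp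

interpretation std_gauss: prob_space std_gauss
  by (rule prob_space_std_gauss)

lemma prob_space_gauss: "prob_space (gauss I)"
  unfolding gauss_def by (intro prob_space_PiM prob_space_std_gauss)

lemma measurable_std_gauss [simp]:
  "measurable std_gauss N = measurable borel N" "measurable N std_gauss = measurable N borel"
  by (rule measurable_cong_sets[OF sets_std_gauss refl], rule measurable_cong_sets[OF refl sets_std_gauss])

lemma sets_PiM_std_gauss: "sets (PiM I (\<lambda>_. std_gauss)) = sets (PiM I (\<lambda>_. borel))"
  by (intro sets_PiM_cong sets_std_gauss) simp

lemma sets_gauss [measurable_cong]: "sets (gauss I) = sets (PiM I (\<lambda>_. borel))"
  unfolding gauss_def by (rule sets_PiM_std_gauss)

lemma std_gauss_moments:
  "integrable std_gauss (\<lambda>x. x)" "(\<integral>x. x \<partial>std_gauss) = 0"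
  "integrable std_gauss (\<lambda>x. x\<^sup>2)" "(\<integral>x. x\<^sup>2 \<partial>std_gauss) = 1"
proof -
  have 1: "has_bochner_integral lborel (\<lambda>x. std_normal_density x * x) 0"
    using std_normal_moment_odd[of 0] by simp
  have 2: "has_bochner_integral lborel (\<lambda>x. std_normal_density x * x\<^sup>2) 1"
    using std_normal_moment_even[of 1] by (simp add: fact_numeral)
  show "integrable std_gauss (\<lambda>x. x)" "(\<integral>x. x \<partial>std_gauss) = 0"
    using 1 by (auto simp: std_gauss_def integrable_density integral_density has_bochner_integral_iff)
  show "integrable std_gauss (\<lambda>x. x\<^sup>2)" "(\<integral>x. x\<^sup>2 \<partial>std_gauss) = 1"
    using 2 by (auto simp: std_gauss_def integrable_density integral_density has_bochner_integral_iff)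
qed

lemma distr_gauss_component: "i \<in> I \<Longrightarrow> distr (gauss I) std_gauss (\<lambda>z. z i) = std_gauss"
  unfolding gauss_def by (rule distr_PiM_component[of I "\<lambda>_. std_gauss"]) (auto intro: prob_space_std_gauss)

lemma gauss_component_measurable':
  "i \<in> I \<Longrightarrow> (\<lambda>z. z i) \<in> measurable (gauss I) std_gauss"
  by simp

lemma gauss_moments:
  assumes i: "i \<in> I"
  shows "integrable (gauss I) (\<lambda>z. z i)" "(\<integral>z. z i \<partial>gauss I) = 0"
    "integrable (gauss I) (\<lambda>z. (z i)\<^sup>2)" "(\<integral>z. (z i)\<^sup>2 \<partial>gauss I) = 1"
proof -
  note m = gauss_component_measurable'[OF i] and d = distr_gauss_component[OF i]
  have b: "(\<lambda>x::real. x) \<in> borel_measurable std_gauss" "(\<lambda>x::real. x\<^sup>2) \<in> borel_measurable std_gauss"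
    by simp_all
  show "integrable (gauss I) (\<lambda>z. z i)"
    using integrable_distr_eq[OF m b(1)] std_gauss_moments(1) d by simp
  show "(\<integral>z. z i \<partial>gauss I) = 0"
    using integral_distr[OF m b(1)] std_gauss_moments(2) d by simp
  show "integrable (gauss I) (\<lambda>z. (z i)\<^sup>2)"
    using integrable_distr_eq[OF m b(2)] std_gauss_moments(3) d by simp
  show "(\<integral>z. (z i)\<^sup>2 \<partial>gauss I) = 1"
    using integral_distr[OF m b(2)] std_gauss_moments(4) d by simp
qed

text \<open>Change of variables one coordinate at a time: \<open>w i\<close> is the density of the
  image of the standard Gaussian under \<open>T i\<close> with respect to the Gaussian itself. It
  covers translations, with a nontrivial weight, and the reflection, with weight
  \<open>1\<close>.\<close>

lemma nn_integral_gauss_transform: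
  fixes T :: "'i \<Rightarrow> real \<Rightarrow> real" and w :: "'i \<Rightarrow> real \<Rightarrow> ennreal"
  assumes I: "finite I"
    and T [measurable]: "\<And>i. T i \<in> borel_measurable borel"
    and w [measurable]: "\<And>i. w i \<in> borel_measurable borel"
    and one: "\<And>i f. f \<in> borel_measurable borel \<Longrightarrow>
      (\<integral>\<^sup>+y. f (T i y) \<partial>std_gauss) = (\<integral>\<^sup>+y. f y * w i y \<partial>std_gauss)"
    and f: "f \<in> borel_measurable (gauss I)"
  shows "(\<integral>\<^sup>+z. f (\<lambda>i\<in>I. T i (z i)) \<partial>gauss I) = (\<integral>\<^sup>+z. f z * (\<Prod>i\<in>I. w i (z i)) \<partial>gauss I)"
  using I f
proof (induction I arbitrary: f rule: finite_induct)
  case empty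
  show ?case by (simp add: gauss_def PiM_empty nn_integral_count_space_finite)
next
  case (insert i I)
  interpret P: product_sigma_finite "\<lambda>_. std_gauss" by standard
  have mG: "borel_measurable (PiM A (\<lambda>_. std_gauss)) = borel_measurable (PiM A (\<lambda>_. borel))" for A :: "'i set"
    by (rule measurable_cong_sets[OF sets_PiM_std_gauss refl])
  have f' [measurable]: "f \<in> borel_measurable (PiM (insert i I) (\<lambda>_. borel))"
    using insert.prems by (simp add: gauss_def mG)
  have fp [measurable]: "(\<lambda>(x, y). f (x(i := y))) \<in> borel_measurable (PiM I (\<lambda>_. borel) \<Otimes>\<^sub>M borel)"
    by measurable
  have fp': "(\<lambda>(x, y). f (x(i := y)) * w i y) \<in> borel_measurable (PiM I (\<lambda>_. borel) \<Otimes>\<^sub>M std_gauss)"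
    unfolding measurable_cong_sets[OF sets_pair_measure_cong[OF refl sets_std_gauss] refl] by measurable
  have rT [measurable]: "(\<lambda>z. \<lambda>k\<in>insert i I. T k (z k)) \<in> measurable (PiM (insert i I) (\<lambda>_. borel)) (PiM (insert i I) (\<lambda>_. borel))"
    by measurable
  have "(\<integral>\<^sup>+z. f (\<lambda>k\<in>insert i I. T k (z k)) \<partial>gauss (insert i I))
    = (\<integral>\<^sup>+x. \<integral>\<^sup>+y. f (\<lambda>k\<in>insert i I. T k ((x(i := y)) k)) \<partial>std_gauss \<partial>PiM I (\<lambda>_. std_gauss))"
    unfolding gauss_def
    using measurable_compose[OF rT f'] by (subst P.product_nn_integral_insert[OF insert.hyps(1,2)]) (auto simp: mG)
  also have "\<dots> = (\<integral>\<^sup>+x. \<integral>\<^sup>+y. f ((\<lambda>k\<in>I. T k (x k))(i := T i y)) \<partial>std_gauss \<partial>PiM I (\<lambda>_. std_gauss))"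
    using insert.hyps(2) by (intro nn_integral_cong arg_cong[of _ _ f]) (auto simp: fun_eq_iff)
  also have "\<dots> = (\<integral>\<^sup>+x. \<integral>\<^sup>+y. f ((\<lambda>k\<in>I. T k (x k))(i := y)) * w i y \<partial>std_gauss \<partial>PiM I (\<lambda>_. std_gauss))"
  proof (rule nn_integral_cong)
    fix x assume "x \<in> space (PiM I (\<lambda>_. std_gauss))"
    then have "(\<lambda>k\<in>I. T k (x k)) \<in> space (PiM I (\<lambda>_. borel))" by (auto simp: space_PiM)
    from measurable_Pair2[OF fp this]
    have "(\<lambda>y. f ((\<lambda>k\<in>I. T k (x k))(i := y))) \<in> borel_measurable borel" by simp
    from one[OF this]
    show "(\<integral>\<^sup>+y. f ((\<lambda>k\<in>I. T k (x k))(i := T i y)) \<partial>std_gauss)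
      = (\<integral>\<^sup>+y. f ((\<lambda>k\<in>I. T k (x k))(i := y)) * w i y \<partial>std_gauss)" .
  qed
  also have "\<dots> = (\<integral>\<^sup>+x. (\<integral>\<^sup>+y. f (x(i := y)) * w i y \<partial>std_gauss) * (\<Prod>k\<in>I. w k (x k)) \<partial>PiM I (\<lambda>_. std_gauss))"
  proof -
    have "(\<lambda>x. \<integral>\<^sup>+y. f (x(i := y)) * w i y \<partial>std_gauss) \<in> borel_measurable (gauss I)"
      using std_gauss.borel_measurable_nn_integral[OF fp'] unfolding gauss_def mG .
    from insert.IH[OF this] show ?thesis unfolding gauss_def .
  qed
  also have "\<dots> = (\<integral>\<^sup>+x. \<integral>\<^sup>+y. f (x(i := y)) * w i y * (\<Prod>k\<in>I. w k (x k)) \<partial>std_gauss \<partial>PiM I (\<lambda>_. std_gauss))"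
  proof (intro nn_integral_cong nn_integral_multc[symmetric])
    fix x assume "x \<in> space (PiM I (\<lambda>_. std_gauss))"
    then have "x \<in> space (PiM I (\<lambda>_. borel))" by (auto simp: space_PiM)
    from measurable_Pair2[OF fp' this]
    show "(\<lambda>y. f (x(i := y)) * w i y) \<in> borel_measurable std_gauss" by simp
  qed
  also have "\<dots> = (\<integral>\<^sup>+x. \<integral>\<^sup>+y. f (x(i := y)) * (\<Prod>k\<in>insert i I. w k ((x(i := y)) k)) \<partial>std_gauss \<partial>PiM I (\<lambda>_. std_gauss))"
  proof (intro nn_integral_cong)
    fix x y
    have "(\<Prod>k\<in>I. w k (x k)) = (\<Prod>k\<in>I. w k ((x(i := y)) k))"
      using insert.hyps(2) by (intro prod.cong) auto
    then show "f (x(i := y)) * w i y * (\<Prod>k\<in>I. w k (x k)) = f (x(i := y)) * (\<Prod>k\<in>insert i I. w k ((x(i := y)) k))"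
      using insert.hyps by (simp add: mult.assoc)
  qed
  also have "\<dots> = (\<integral>\<^sup>+z. f z * (\<Prod>k\<in>insert i I. w k (z k)) \<partial>gauss (insert i I))"
    unfolding gauss_def by (subst P.product_nn_integral_insert[OF insert.hyps(1,2)]) (auto simp: mG)
  finally show ?case .
qed

text \<open>The weight is the Cameron-Martin density of the translate by \<open>v\<close>; in one
  coordinate it comes from completing the square.\<close>

lemma nn_integral_gauss_shift:
  fixes v :: "'i \<Rightarrow> real"
  assumes "finite I" and "f \<in> borel_measurable (gauss I)"
  shows "(\<integral>\<^sup>+z. f (\<lambda>i\<in>I. v i + z i) \<partial>gauss I)
    = (\<integral>\<^sup>+z. f z * (\<Prod>i\<in>I. ennreal (exp (z i * v i - (v i)\<^sup>2 / 2))) \<partial>gauss I)"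
proof (rule nn_integral_gauss_transform[OF assms(1) _ _ _ assms(2)])
  fix i and f :: "real \<Rightarrow> ennreal" assume f [measurable]: "f \<in> borel_measurable borel"
  have "(\<integral>\<^sup>+y. f y * ennreal (exp (y * v i - (v i)\<^sup>2 / 2)) \<partial>std_gauss)
    = (\<integral>\<^sup>+y. ennreal (std_normal_density y) * (f y * ennreal (exp (y * v i - (v i)\<^sup>2 / 2))) \<partial>lborel)"
    unfolding std_gauss_def by (subst nn_integral_density) auto
  also have "\<dots> = (\<integral>\<^sup>+y. ennreal (std_normal_density (v i + 1 * y)) * (f (v i + 1 * y) * ennreal (exp ((v i + 1 * y) * v i - (v i)\<^sup>2 / 2))) \<partial>lborel)"
    by (subst nn_integral_real_affine[where c = 1 and t = "v i"]) auto
  also have "\<dots> = (\<integral>\<^sup>+y. ennreal (std_normal_density y) * f (v i + y) \<partial>lborel)"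
  proof (intro nn_integral_cong)
    fix y
    have "std_normal_density (v i + y) * exp ((v i + y) * v i - (v i)\<^sup>2 / 2) = std_normal_density y"
      by (simp add: normal_density_def power2_eq_square field_simps flip: exp_add)
    then have "ennreal (std_normal_density (v i + y)) * ennreal (exp ((v i + y) * v i - (v i)\<^sup>2 / 2)) = ennreal (std_normal_density y)"
      by (simp flip: ennreal_mult)
    moreover have "a * (F * c) = (a * c) * F" for a F c :: ennreal by (simp only: mult_ac)
    ultimately show "ennreal (std_normal_density (v i + 1 * y)) * (f (v i + 1 * y) * ennreal (exp ((v i + 1 * y) * v i - (v i)\<^sup>2 / 2)))
      = ennreal (std_normal_density y) * f (v i + y)"
      by (simp only: mult_1)
  qed
  also have "\<dots> = (\<integral>\<^sup>+y. f (v i + y) \<partial>std_gauss)"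
    unfolding std_gauss_def by (subst nn_integral_density) auto
  finally show "(\<integral>\<^sup>+y. f (v i + y) \<partial>std_gauss) = (\<integral>\<^sup>+y. f y * ennreal (exp (y * v i - (v i)\<^sup>2 / 2)) \<partial>std_gauss)"
    by simp
qed auto

lemma nn_integral_gauss_reflect:
  assumes "finite I" and "f \<in> borel_measurable (gauss I)"
  shows "(\<integral>\<^sup>+z. f (\<lambda>i\<in>I. - z i) \<partial>gauss I) = (\<integral>\<^sup>+z. f z \<partial>gauss I)"
proof -
  have "(\<integral>\<^sup>+z. f (\<lambda>i\<in>I. - z i) \<partial>gauss I) = (\<integral>\<^sup>+z. f z * (\<Prod>i\<in>I. 1) \<partial>gauss I)"
  proof (rule nn_integral_gauss_transform[where T = "\<lambda>_. uminus" and w = "\<lambda>_ _. 1", OF assms(1) _ _ _ assms(2)])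
    fix i and f :: "real \<Rightarrow> ennreal" assume f [measurable]: "f \<in> borel_measurable borel"
    have "(\<integral>\<^sup>+y. f y * 1 \<partial>std_gauss) = (\<integral>\<^sup>+y. ennreal (std_normal_density y) * f y \<partial>lborel)"
      unfolding std_gauss_def by (subst nn_integral_density) auto
    also have "\<dots> = (\<integral>\<^sup>+y. ennreal (std_normal_density (0 + (-1) * y)) * f (0 + (-1) * y) \<partial>lborel)"
      by (subst nn_integral_real_affine[where c = "-1" and t = 0]) auto
    also have "\<dots> = (\<integral>\<^sup>+y. f (- y) \<partial>std_gauss)"
      unfolding std_gauss_def by (subst nn_integral_density) (auto simp: normal_density_def)
    finally show "(\<integral>\<^sup>+y. f (- y) \<partial>std_gauss) = (\<integral>\<^sup>+y. f y * 1 \<partial>std_gauss)" by (rule sym)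
  qed measurable
  then show ?thesis by (simp only: prod.neutral_const mult_1_right)
qed

lemma distr_gauss_reflect:
  assumes "finite I"
  shows "distr (gauss I) (gauss I) (\<lambda>z. \<lambda>i\<in>I. - z i) = gauss I"
proof (rule measure_eqI)
  have m: "(\<lambda>z. \<lambda>i\<in>I. - z i) \<in> measurable (gauss I) (gauss I)"
    by measurable
  fix A assume "A \<in> sets (distr (gauss I) (gauss I) (\<lambda>z. \<lambda>i\<in>I. - z i))"
  then have A [measurable]: "A \<in> sets (gauss I)" by simp
  have "emeasure (distr (gauss I) (gauss I) (\<lambda>z. \<lambda>i\<in>I. - z i)) A
    = (\<integral>\<^sup>+z. indicator A z \<partial>distr (gauss I) (gauss I) (\<lambda>z. \<lambda>i\<in>I. - z i))" by simp
  also have "\<dots> = (\<integral>\<^sup>+z. indicator A (\<lambda>i\<in>I. - z i) \<partial>gauss I)"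
    by (rule nn_integral_distr[OF m]) simp
  also have "\<dots> = (\<integral>\<^sup>+z. indicator A z \<partial>gauss I)"
    by (rule nn_integral_gauss_reflect[OF assms]) simp
  finally show "emeasure (distr (gauss I) (gauss I) (\<lambda>z. \<lambda>i\<in>I. - z i)) A = emeasure (gauss I) A" by simp
qed simp

section \<open>Jensen, Donsker-Varadhan and the uniform PAC-Bayes inequality\<close>

lemma (in prob_space) exp_integral_le_nn_integral_exp:
  assumes "integrable M g"
  shows "ennreal (exp (\<integral>x. g x \<partial>M)) \<le> (\<integral>\<^sup>+x. ennreal (exp (g x)) \<partial>M)"
proof (cases "(\<integral>\<^sup>+x. ennreal (exp (g x)) \<partial>M) = \<infinity>")
  case False
  have [measurable]: "g \<in> borel_measurable M" using assms by auto
  have int: "integrable M (\<lambda>x. exp (g x))"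
    using False by (intro integrableI_nonneg) (auto simp: less_top)
  \<comment> \<open>The right side may be infinite; in the remaining integrable case Jensen's
    inequality comes from the tangent line of the exponential at the mean \<open>a\<close>.\<close>
  define a where "a = (\<integral>x. g x \<partial>M)"
  have "exp a = (\<integral>x. exp a * (1 + (g x - a)) \<partial>M)"
    using assms by (simp add: a_def prob_space)
  also have "\<dots> \<le> (\<integral>x. exp (g x) \<partial>M)"
  proof (intro integral_mono int)
    show "integrable M (\<lambda>x. exp a * (1 + (g x - a)))" using assms by simp
    fix x
    have "exp a * (1 + (g x - a)) \<le> exp a * exp (g x - a)"
      by (intro mult_left_mono exp_ge_add_one_self) auto
    then show "exp a * (1 + (g x - a)) \<le> exp (g x)" by (simp flip: exp_add)
  qed
  finally show ?thesis using nn_integral_eq_integral[OF int] by (simp add: a_def)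
qed simp

text \<open>The Donsker-Varadhan inequality with the translate by \<open>v\<close> as posterior: its divergence from the
  Gaussian prior is half the squared length of \<open>v\<close>.\<close>

lemma gauss_shift_jensen:
  fixes v :: "'i \<Rightarrow> real"
  assumes I: "finite I" and g [measurable]: "g \<in> borel_measurable (gauss I)"
    and int: "integrable (gauss I) (\<lambda>z. g (\<lambda>i\<in>I. v i + z i))"
  shows "ennreal (exp ((\<integral>z. g (\<lambda>i\<in>I. v i + z i) \<partial>gauss I) - (\<Sum>i\<in>I. (v i)\<^sup>2) / 2))
    \<le> (\<integral>\<^sup>+z. ennreal (exp (g z)) \<partial>gauss I)"
proof -
  interpret G: prob_space "gauss I" by (rule prob_space_gauss)
  \<comment> \<open>\<open>h\<close> is \<open>exp (g z)\<close> divided by the density of the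
    translate, so that \<open>nn_integral_gauss_shift\<close> turns the prior integral of
    \<open>exp (g z)\<close> into an integral under the translate.\<close>
  define h where "h z = exp (g z) * (\<Prod>i\<in>I. exp ((v i)\<^sup>2 / 2 - z i * v i))" for z
  have [measurable]: "(\<lambda>z. h z) \<in> borel_measurable (gauss I)"
    unfolding h_def by measurable
  have "(\<integral>\<^sup>+z. ennreal (exp (g z)) \<partial>gauss I)
    = (\<integral>\<^sup>+z. ennreal (h z) * (\<Prod>i\<in>I. ennreal (exp (z i * v i - (v i)\<^sup>2 / 2))) \<partial>gauss I)"
  proof (intro nn_integral_cong)
    fix z
    have "h z * (\<Prod>i\<in>I. exp (z i * v i - (v i)\<^sup>2 / 2)) = exp (g z)"
      by (simp add: h_def mult.assoc flip: prod.distrib exp_add)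
    then show "ennreal (exp (g z)) = ennreal (h z) * (\<Prod>i\<in>I. ennreal (exp (z i * v i - (v i)\<^sup>2 / 2)))"
      by (subst prod_ennreal) (auto simp: h_def prod_nonneg simp flip: ennreal_mult)
  qed
  also have "\<dots> = (\<integral>\<^sup>+z. ennreal (h (\<lambda>i\<in>I. v i + z i)) \<partial>gauss I)"
    by (rule nn_integral_gauss_shift[OF I, symmetric]) measurable
  also have "\<dots> = (\<integral>\<^sup>+z. ennreal (exp (g (\<lambda>i\<in>I. v i + z i) - (\<Sum>i\<in>I. z i * v i) - (\<Sum>i\<in>I. (v i)\<^sup>2) / 2)) \<partial>gauss I)"
  proof (intro nn_integral_cong arg_cong[of _ _ ennreal])
    fix z
    have "(\<Sum>i\<in>I. (v i)\<^sup>2 / 2 - (v i + z i) * v i) = (\<Sum>i\<in>I. - (z i * v i) - (v i)\<^sup>2 / 2)"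
      by (intro sum.cong) (auto simp: power2_eq_square field_simps)
    also have "\<dots> = - (\<Sum>i\<in>I. z i * v i) - (\<Sum>i\<in>I. (v i)\<^sup>2) / 2"
      by (simp only: sum_subtractf sum_negf sum_divide_distrib)
    finally have "(\<Prod>i\<in>I. exp ((v i)\<^sup>2 / 2 - (v i + z i) * v i)) = exp (- (\<Sum>i\<in>I. z i * v i) - (\<Sum>i\<in>I. (v i)\<^sup>2) / 2)"
      by (simp only: exp_sum[OF I, symmetric])
    then show "h (\<lambda>i\<in>I. v i + z i) = exp (g (\<lambda>i\<in>I. v i + z i) - (\<Sum>i\<in>I. z i * v i) - (\<Sum>i\<in>I. (v i)\<^sup>2) / 2)"
      unfolding h_def by (simp add: restrict_def I algebra_simps flip: exp_add cong: prod.cong)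
  qed
  finally have eq: "(\<integral>\<^sup>+z. ennreal (exp (g z)) \<partial>gauss I) = \<dots>" .
  \<comment> \<open>Under the centred Gaussian the linear term integrates to zero, and half the
    squared length of \<open>v\<close> remains.\<close>
  have "(\<integral>z. g (\<lambda>i\<in>I. v i + z i) - (\<Sum>i\<in>I. z i * v i) - (\<Sum>i\<in>I. (v i)\<^sup>2) / 2 \<partial>gauss I)
    = (\<integral>z. g (\<lambda>i\<in>I. v i + z i) \<partial>gauss I) - (\<Sum>i\<in>I. (v i)\<^sup>2) / 2"
    using int by (simp add: G.prob_space gauss_moments integrable_sum Bochner_Integration.integral_sum)
  moreover have "integrable (gauss I) (\<lambda>z. g (\<lambda>i\<in>I. v i + z i) - (\<Sum>i\<in>I. z i * v i) - (\<Sum>i\<in>I. (v i)\<^sup>2) / 2)"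
    using int by (simp add: gauss_moments)
  ultimately show ?thesis
    using G.exp_integral_le_nn_integral_exp unfolding eq by fastforce
qed

text \<open>Quadratic growth is all that integrability against a Gaussian requires; the positive
  lower bound of \<open>tilt\<close> controls the logarithm from below.\<close>

lemma abs_ln_tilt_le: "\<bar>ln (tilt y)\<bar> \<le> 2 + 2 * y\<^sup>2"
proof -
  have "ln (tilt y) \<le> tilt y - 1" using tilt_pos[of y] by (rule ln_le_minus_one)
  moreover have "1 - 1 / tilt y \<le> ln (tilt y)"
    using ln_le_minus_one[of "1 / tilt y"] tilt_pos[of y] by (simp add: ln_div)
  moreover have "1 / tilt y \<le> 2" using tilt_ge[of y] by (simp add: field_simps)
  moreover have "- y \<le> 1 + y\<^sup>2"
    using zero_le_power2[of "y + 1 / 2"] by (simp add: power2_eq_square algebra_simps)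
  moreover have "0 \<le> y\<^sup>2" by simp
  ultimately show ?thesis unfolding tilt_def by linarith
qed

lemma tilt_measurable [measurable (raw)]:
  assumes [measurable]: "f \<in> borel_measurable N"
  shows "(\<lambda>x. tilt (f x)) \<in> borel_measurable N"
  unfolding tilt_def by measurable

text \<open>Reflecting the Gaussian noise leaves its law unchanged, so the integrand may be averaged
  with its mirror image, and \<open>neg_ln_tilt_average\<close> applies at each point whatever the
  variance of the noise.\<close>

lemma gauss_ln_tilt:
  fixes c v :: "'i \<Rightarrow> real"
  assumes I: "finite I"
  shows "integrable (gauss I) (\<lambda>z. ln (tilt (\<Sum>i\<in>I. c i * (v i + z i))))"
    "- (\<integral>z. ln (tilt (\<Sum>i\<in>I. c i * (v i + z i))) \<partial>gauss I) \<le> max (\<Sum>i\<in>I. c i * v i) (- 1 / 4)"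
proof -
  interpret G: prob_space "gauss I" by (rule prob_space_gauss)
  define m where "m = (\<Sum>i\<in>I. c i * v i)"
  have lin: "(\<Sum>i\<in>I. c i * (v i + z i)) = m + (\<Sum>i\<in>I. c i * z i)" for z
    by (simp add: m_def distrib_left sum.distrib)
  \<comment> \<open>The factor \<open>s\<close> lets the values \<open>1\<close> and
    \<open>- 1\<close> serve both members of the symmetrized pair.\<close>
  have int: "integrable (gauss I) (\<lambda>z. ln (tilt (m + s * (\<Sum>i\<in>I. c i * z i))))" for s
  proof (rule Bochner_Integration.integrable_bound)
    show "integrable (gauss I) (\<lambda>z. 2 + (4 * m\<^sup>2 + 4 * (s\<^sup>2 * (real (card I) * (\<Sum>i\<in>I. (c i)\<^sup>2 * (z i)\<^sup>2)))))"
      by (simp add: gauss_moments G.integrable_const)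
    show "(\<lambda>z. ln (tilt (m + s * (\<Sum>i\<in>I. c i * z i)))) \<in> borel_measurable (gauss I)"
      by measurable
    show "AE z in gauss I. norm (ln (tilt (m + s * (\<Sum>i\<in>I. c i * z i)))) \<le> norm (2 + (4 * m\<^sup>2 + 4 * (s\<^sup>2 * (real (card I) * (\<Sum>i\<in>I. (c i)\<^sup>2 * (z i)\<^sup>2)))))"
    proof (rule AE_I2)
      fix z
      define y where "y = (\<Sum>i\<in>I. c i * z i)"
      have y: "y\<^sup>2 \<le> real (card I) * (\<Sum>i\<in>I. (c i)\<^sup>2 * (z i)\<^sup>2)"
        using sum_squared_le_sum_of_squares[of "\<lambda>i. c i * z i" I] I
        by (simp add: y_def power_mult_distrib mult.commute)
      have "(m + s * y)\<^sup>2 \<le> 2 * m\<^sup>2 + 2 * (s * y)\<^sup>2"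
        using sum_squares_bound[of m "s * y"] by (simp add: power2_sum)
      then have "(m + s * y)\<^sup>2 \<le> 2 * m\<^sup>2 + 2 * (s\<^sup>2 * y\<^sup>2)" by (simp add: power_mult_distrib)
      moreover have "s\<^sup>2 * y\<^sup>2 \<le> s\<^sup>2 * (real (card I) * (\<Sum>i\<in>I. (c i)\<^sup>2 * (z i)\<^sup>2))"
        using y by (intro mult_left_mono) auto
      ultimately have "2 + 2 * (m + s * y)\<^sup>2 \<le> 2 + (4 * m\<^sup>2 + 4 * (s\<^sup>2 * (real (card I) * (\<Sum>i\<in>I. (c i)\<^sup>2 * (z i)\<^sup>2))))"
        by linarith
      then show "norm (ln (tilt (m + s * (\<Sum>i\<in>I. c i * z i)))) \<le> norm (2 + (4 * m\<^sup>2 + 4 * (s\<^sup>2 * (real (card I) * (\<Sum>i\<in>I. (c i)\<^sup>2 * (z i)\<^sup>2)))))"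
        using abs_ln_tilt_le[of "m + s * y"] unfolding y_def real_norm_def by linarith
    qed
  qed
  show "integrable (gauss I) (\<lambda>z. ln (tilt (\<Sum>i\<in>I. c i * (v i + z i))))"
    using int[of 1] by (simp add: lin)
  have R: "(\<lambda>z. \<lambda>i\<in>I. - z i) \<in> measurable (gauss I) (gauss I)" by measurable
  have "(\<integral>z. ln (tilt (m + (\<Sum>i\<in>I. c i * z i))) \<partial>gauss I)
    = (\<integral>z. ln (tilt (m + (\<Sum>i\<in>I. c i * z i))) \<partial>distr (gauss I) (gauss I) (\<lambda>z. \<lambda>i\<in>I. - z i))"
    by (simp only: distr_gauss_reflect[OF I])
  also have "\<dots> = (\<integral>z. ln (tilt (m + (\<Sum>i\<in>I. c i * (\<lambda>i\<in>I. - z i) i))) \<partial>gauss I)"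
    by (rule integral_distr[OF R]) measurable
  also have "\<dots> = (\<integral>z. ln (tilt (m - (\<Sum>i\<in>I. c i * z i))) \<partial>gauss I)"
    by (simp add: sum_negf cong: sum.cong)
  finally have eq: "(\<integral>z. ln (tilt (m + (\<Sum>i\<in>I. c i * z i))) \<partial>gauss I) = \<dots>" .
  have i2: "integrable (gauss I) (\<lambda>z. ln (tilt (m + (\<Sum>i\<in>I. c i * z i))))"
    "integrable (gauss I) (\<lambda>z. ln (tilt (m - (\<Sum>i\<in>I. c i * z i))))"
    using int[of 1] int[of "- 1"] by simp_all
  have "- (\<integral>z. ln (tilt (m + (\<Sum>i\<in>I. c i * z i))) \<partial>gauss I)
    = (\<integral>z. - (ln (tilt (m + (\<Sum>i\<in>I. c i * z i))) + ln (tilt (m - (\<Sum>i\<in>I. c i * z i)))) / 2 \<partial>gauss I)"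
    using i2 eq by simp
  also have "\<dots> \<le> (\<integral>z. max m (- 1 / 4) \<partial>gauss I)"
    using i2 by (intro integral_mono neg_ln_tilt_average) auto
  also have "\<dots> = max m (- 1 / 4)" by (simp add: G.prob_space)
  finally show "- (\<integral>z. ln (tilt (\<Sum>i\<in>I. c i * (v i + z i))) \<partial>gauss I) \<le> max (\<Sum>i\<in>I. c i * v i) (- 1 / 4)"
    by (simp add: lin m_def)
qed

text \<open>For fixed \<open>w\<close> and \<open>z\<close> the product of the factors of the
  observations, divided by the bound on its mean, has expectation at most \<open>1\<close>; so has
  its mixture \<open>Y\<close> over the Gaussian prior and the weights \<open>wt\<close>. One
  application of Markov's inequality to \<open>Y\<close> gives an event outside which the bound
  holds for every \<open>w\<close> and all \<open>v\<close> at once: each \<open>v\<close> is only a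
  choice of posterior in \<open>gauss_shift_jensen\<close>, so no supremum over directions is ever
  taken. The terms \<open>(v i)\<^sup>2 + 1\<close> are second moments under that posterior.\<close>

lemma (in prob_space) pac_bayes_gauss:
  fixes X :: "'j \<Rightarrow> 'a \<Rightarrow> 'x" and N :: "'j \<Rightarrow> 'x measure"
    and a :: "'v \<Rightarrow> 'j \<Rightarrow> 'x \<Rightarrow> real" and c :: "'v \<Rightarrow> 'j \<Rightarrow> 'i \<Rightarrow> 'x \<Rightarrow> real"
    and A :: "'v \<Rightarrow> real" and B Q :: "'v \<Rightarrow> 'i \<Rightarrow> real"
  assumes S: "finite S" and I: "finite I" and W: "finite W"
    and indep: "indep_vars N X S"
    and am [measurable]: "\<And>w j. w \<in> W \<Longrightarrow> j \<in> S \<Longrightarrow> a w j \<in> borel_measurable (N j)"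
    and cm [measurable]: "\<And>w j i. w \<in> W \<Longrightarrow> j \<in> S \<Longrightarrow> i \<in> I \<Longrightarrow> c w j i \<in> borel_measurable (N j)"
    and wt: "\<And>w. w \<in> W \<Longrightarrow> 0 < wt w" "sum wt W \<le> 1"
    and mgf: "\<And>w z. w \<in> W \<Longrightarrow>
      (\<Prod>j\<in>S. \<integral>\<^sup>+\<omega>. ennreal (exp (- a w j (X j \<omega>)) * tilt (\<Sum>i\<in>I. c w j i (X j \<omega>) * z i)) \<partial>M)
        \<le> ennreal (exp (A w + (\<Sum>i\<in>I. B w i * z i + Q w i * (z i)\<^sup>2)))"
    and eps: "0 < \<epsilon>"
  shows "\<exists>E\<in>events. prob E \<le> \<epsilon> \<and> (\<forall>\<omega>\<in>space M - E. \<forall>w\<in>W. \<forall>v.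
    - A w - (\<Sum>i\<in>I. B w i * v i + Q w i * ((v i)\<^sup>2 + 1)) - (\<Sum>i\<in>I. (v i)\<^sup>2) / 2 + ln (\<epsilon> * wt w)
      \<le> (\<Sum>j\<in>S. a w j (X j \<omega>) + max (\<Sum>i\<in>I. c w j i (X j \<omega>) * v i) (- 1 / 4)))"
proof -
  interpret G: prob_space "gauss I" by (rule prob_space_gauss)
  interpret MG: pair_sigma_finite M "gauss I" by standard
  have X [measurable]: "\<And>j. j \<in> S \<Longrightarrow> X j \<in> measurable M (N j)"
    using indep by (auto simp: indep_vars_def)
  have acX [measurable]: "\<And>w j. w \<in> W \<Longrightarrow> j \<in> S \<Longrightarrow> (\<lambda>\<omega>. a w j (X j \<omega>)) \<in> borel_measurable M"
    "\<And>w j i. w \<in> W \<Longrightarrow> j \<in> S \<Longrightarrow> i \<in> I \<Longrightarrow> (\<lambda>\<omega>. c w j i (X j \<omega>)) \<in> borel_measurable M"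
    using am cm X by (auto intro: measurable_compose)
  define m where "m w z = A w + (\<Sum>i\<in>I. B w i * z i + Q w i * (z i)\<^sup>2)" for w and z :: "'i \<Rightarrow> real"
  define f where "f w j z x = exp (- a w j x) * tilt (\<Sum>i\<in>I. c w j i x * z i)" for w j and z :: "'i \<Rightarrow> real" and x
  have f_pos: "0 < f w j z x" for w j z x
    unfolding f_def by (intro mult_pos_pos tilt_pos) simp
  have fm [measurable]: "\<And>w j z. w \<in> W \<Longrightarrow> j \<in> S \<Longrightarrow> f w j z \<in> borel_measurable (N j)"
    unfolding f_def by measurable
  \<comment> \<open>Normalized by the bound \<open>exp (m w z)\<close> on the mean of the
    product.\<close>
  define F where "F w \<omega> z = ennreal (exp (- m w z) * (\<Prod>j\<in>S. f w j z (X j \<omega>)))" for w \<omega> z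
  have Fm: "(\<lambda>(\<omega>, z). F w \<omega> z) \<in> borel_measurable (M \<Otimes>\<^sub>M gauss I)" if [measurable]: "w \<in> W" for w
    unfolding F_def m_def f_def by measurable
  have F1: "(\<integral>\<^sup>+\<omega>. F w \<omega> z \<partial>M) \<le> 1" if w: "w \<in> W" for w z
  proof -
    have ind: "indep_vars (\<lambda>_. borel) (\<lambda>j \<omega>. ennreal (f w j z (X j \<omega>))) S"
      using indep_vars_compose2[OF indep, of "\<lambda>j x. ennreal (f w j z x)" "\<lambda>_. borel"] w by auto
    have "(\<integral>\<^sup>+\<omega>. F w \<omega> z \<partial>M) = (\<integral>\<^sup>+\<omega>. ennreal (exp (- m w z)) * (\<Prod>j\<in>S. ennreal (f w j z (X j \<omega>))) \<partial>M)"
      unfolding F_def using f_pos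
      by (intro nn_integral_cong) (simp add: prod_ennreal less_imp_le ennreal_mult prod_nonneg)
    also have "\<dots> = ennreal (exp (- m w z)) * (\<integral>\<^sup>+\<omega>. (\<Prod>j\<in>S. ennreal (f w j z (X j \<omega>))) \<partial>M)"
      using w by (intro nn_integral_cmult) measurable
    also have "\<dots> = ennreal (exp (- m w z)) * (\<Prod>j\<in>S. \<integral>\<^sup>+\<omega>. ennreal (f w j z (X j \<omega>)) \<partial>M)"
      by (subst indep_vars_nn_integral[OF S ind]) auto
    also have "\<dots> \<le> ennreal (exp (- m w z)) * ennreal (exp (m w z))"
      unfolding f_def m_def by (intro mult_left_mono mgf w) auto
    also have "\<dots> = 1" by (simp flip: ennreal_mult exp_add)
    finally show ?thesis .
  qed
  define Y where "Y \<omega> = (\<Sum>w\<in>W. ennreal (wt w) * (\<integral>\<^sup>+z. F w \<omega> z \<partial>gauss I))" for \<omega>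
  have Im [measurable]: "\<And>w. w \<in> W \<Longrightarrow> (\<lambda>\<omega>. \<integral>\<^sup>+z. F w \<omega> z \<partial>gauss I) \<in> borel_measurable M"
    using G.borel_measurable_nn_integral[OF Fm] by simp
  have Ym [measurable]: "Y \<in> borel_measurable M"
    unfolding Y_def by measurable
  have "(\<integral>\<^sup>+\<omega>. Y \<omega> \<partial>M) = (\<Sum>w\<in>W. ennreal (wt w) * (\<integral>\<^sup>+\<omega>. \<integral>\<^sup>+z. F w \<omega> z \<partial>gauss I \<partial>M))"
    unfolding Y_def by (simp add: nn_integral_sum nn_integral_cmult)
  also have "\<dots> = (\<Sum>w\<in>W. ennreal (wt w) * (\<integral>\<^sup>+z. \<integral>\<^sup>+\<omega>. F w \<omega> z \<partial>M \<partial>gauss I))"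
    using MG.Fubini'[OF Fm] by (intro sum.cong) auto
  also have "\<dots> \<le> (\<Sum>w\<in>W. ennreal (wt w) * 1)"
  proof (intro sum_mono mult_left_mono)
    fix w assume "w \<in> W"
    then have "(\<integral>\<^sup>+z. \<integral>\<^sup>+\<omega>. F w \<omega> z \<partial>M \<partial>gauss I) \<le> (\<integral>\<^sup>+z. 1 \<partial>gauss I)"
      by (intro nn_integral_mono F1)
    then show "(\<integral>\<^sup>+z. \<integral>\<^sup>+\<omega>. F w \<omega> z \<partial>M \<partial>gauss I) \<le> 1" by (simp add: G.emeasure_space_1)
  qed auto
  also have "\<dots> = ennreal (sum wt W)" using wt(1) by (simp add: sum_ennreal less_imp_le)
  also have "\<dots> \<le> 1" using wt(2) by simp
  finally have Y1: "(\<integral>\<^sup>+\<omega>. Y \<omega> \<partial>M) \<le> 1" .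
  define E where "E = {\<omega>\<in>space M. 1 \<le> ennreal \<epsilon> * Y \<omega>}"
  have E [measurable]: "E \<in> events" unfolding E_def by measurable
  have "emeasure M E \<le> ennreal \<epsilon> * (\<integral>\<^sup>+\<omega>. Y \<omega> * indicator (space M) \<omega> \<partial>M)"
    unfolding E_def by (rule nn_integral_Markov_inequality) auto
  also have "\<dots> = ennreal \<epsilon> * (\<integral>\<^sup>+\<omega>. Y \<omega> \<partial>M)"
    by (intro arg_cong[of _ _ "(*) (ennreal \<epsilon>)"] nn_integral_cong) auto
  also have "\<dots> \<le> ennreal \<epsilon> * 1" using Y1 by (intro mult_left_mono) auto
  finally have PE: "prob E \<le> \<epsilon>" using eps by (simp add: emeasure_eq_measure)
  show ?thesis
  proof (intro bexI[OF _ E] conjI PE ballI allI)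
    fix \<omega> w and v :: "'i \<Rightarrow> real" assume \<omega>: "\<omega> \<in> space M - E" and w: "w \<in> W"
    define g where "g z = - m w z + (\<Sum>j\<in>S. - a w j (X j \<omega>) + ln (tilt (\<Sum>i\<in>I. c w j i (X j \<omega>) * z i)))" for z
    have gm: "g \<in> borel_measurable (gauss I)" unfolding g_def m_def by measurable
    have "f w j z (X j \<omega>) = exp (- a w j (X j \<omega>) + ln (tilt (\<Sum>i\<in>I. c w j i (X j \<omega>) * z i)))" for j z
      unfolding f_def exp_add by (simp add: tilt_pos)
    then have Fg: "F w \<omega> z = ennreal (exp (g z))" for z
      unfolding F_def g_def by (simp only: exp_add exp_sum[OF S])
    have gv: "g (\<lambda>i\<in>I. v i + z i) = - A w
        - (\<Sum>i\<in>I. B w i * (v i + z i) + Q w i * ((v i)\<^sup>2 + 2 * v i * z i + (z i)\<^sup>2))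
        + (\<Sum>j\<in>S. - a w j (X j \<omega>) + ln (tilt (\<Sum>i\<in>I. c w j i (X j \<omega>) * (v i + z i))))" for z
    proof -
      have "(\<Sum>i\<in>I. B w i * (\<lambda>i\<in>I. v i + z i) i + Q w i * ((\<lambda>i\<in>I. v i + z i) i)\<^sup>2)
        = (\<Sum>i\<in>I. B w i * (v i + z i) + Q w i * ((v i)\<^sup>2 + 2 * v i * z i + (z i)\<^sup>2))"
        by (intro sum.cong) (auto simp: power2_sum algebra_simps)
      moreover have "(\<Sum>i\<in>I. c w j i (X j \<omega>) * (\<lambda>i\<in>I. v i + z i) i) = (\<Sum>i\<in>I. c w j i (X j \<omega>) * (v i + z i))" for j
        by (intro sum.cong) auto
      ultimately show ?thesis unfolding g_def m_def by simp
    qed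
    have int: "integrable (gauss I) (\<lambda>z. g (\<lambda>i\<in>I. v i + z i))"
      unfolding gv using gauss_ln_tilt(1)[OF I] by (simp add: gauss_moments)
    have eq: "(\<integral>z. g (\<lambda>i\<in>I. v i + z i) \<partial>gauss I) = - A w - (\<Sum>i\<in>I. B w i * v i + Q w i * ((v i)\<^sup>2 + 1))
        + (\<Sum>j\<in>S. - a w j (X j \<omega>) + (\<integral>z. ln (tilt (\<Sum>i\<in>I. c w j i (X j \<omega>) * (v i + z i))) \<partial>gauss I))"
      unfolding gv using gauss_ln_tilt(1)[OF I] by (simp add: G.prob_space gauss_moments)
    \<comment> \<open>A single component is bounded by the whole mixture; this costs
      \<open>ln (wt w)\<close>.\<close>
    have "ennreal \<epsilon> * (ennreal (wt w) * (\<integral>\<^sup>+z. F w \<omega> z \<partial>gauss I)) \<le> ennreal \<epsilon> * Y \<omega>"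
      unfolding Y_def using w W by (intro mult_left_mono member_le_sum) auto
    also have "\<dots> < 1" using \<omega> by (auto simp: E_def)
    finally have less: "ennreal \<epsilon> * (ennreal (wt w) * (\<integral>\<^sup>+z. F w \<omega> z \<partial>gauss I)) < 1" .
    define r where "r = (\<integral>z. g (\<lambda>i\<in>I. v i + z i) \<partial>gauss I) - (\<Sum>i\<in>I. (v i)\<^sup>2) / 2"
    have "ennreal (exp r) \<le> (\<integral>\<^sup>+z. F w \<omega> z \<partial>gauss I)"
      unfolding r_def Fg by (rule gauss_shift_jensen[OF I gm int])
    then have "ennreal \<epsilon> * (ennreal (wt w) * ennreal (exp r)) \<le> ennreal \<epsilon> * (ennreal (wt w) * (\<integral>\<^sup>+z. F w \<omega> z \<partial>gauss I))"
      by (intro mult_left_mono) auto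
    also note less
    finally have "ennreal (\<epsilon> * wt w * exp r) < 1"
      using eps wt(1)[OF w] by (simp add: ennreal_mult mult.assoc less_imp_le)
    then have lt1: "\<epsilon> * wt w * exp r < 1" by simp
    have pos: "0 < \<epsilon> * wt w" using eps wt(1)[OF w] by simp
    have "ln (\<epsilon> * wt w) + r = ln (\<epsilon> * wt w * exp r)"
      using pos by (simp add: ln_mult_pos)
    also have "\<dots> < 0" using lt1 pos by (subst ln_less_zero_iff) auto
    finally have r0: "ln (\<epsilon> * wt w) + r < 0" .
    \<comment> \<open>Posterior averaging bounds each \<open>- ln (tilt y)\<close> by the larger of
      \<open>- 1 / 4\<close> and the value of \<open>y\<close> at the centre.\<close>
    have "(\<Sum>j\<in>S. a w j (X j \<omega>) - (\<integral>z. ln (tilt (\<Sum>i\<in>I. c w j i (X j \<omega>) * (v i + z i))) \<partial>gauss I))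
      \<le> (\<Sum>j\<in>S. a w j (X j \<omega>) + max (\<Sum>i\<in>I. c w j i (X j \<omega>) * v i) (- 1 / 4))"
      using gauss_ln_tilt(2)[OF I] by (intro sum_mono) (simp add: diff_conv_add_uminus del: add_uminus_conv_diff)
    moreover have "(\<Sum>j\<in>S. a w j (X j \<omega>) - (\<integral>z. ln (tilt (\<Sum>i\<in>I. c w j i (X j \<omega>) * (v i + z i))) \<partial>gauss I))
      = - (\<Sum>j\<in>S. - a w j (X j \<omega>) + (\<integral>z. ln (tilt (\<Sum>i\<in>I. c w j i (X j \<omega>) * (v i + z i))) \<partial>gauss I))"
      unfolding sum_negf[symmetric] by (intro sum.cong) auto
    ultimately show "- A w - (\<Sum>i\<in>I. B w i * v i + Q w i * ((v i)\<^sup>2 + 1)) - (\<Sum>i\<in>I. (v i)\<^sup>2) / 2 + ln (\<epsilon> * wt w)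
      \<le> (\<Sum>j\<in>S. a w j (X j \<omega>) + max (\<Sum>i\<in>I. c w j i (X j \<omega>) * v i) (- 1 / 4))"
      using r0 unfolding r_def eq by linarith
  qed
qed

subsection \<open>Bounded likelihood ratios\<close>

lemma sets_gibbs [simp, measurable_cong]: "sets (gibbs R e) = sets R"
  by (simp add: gibbs_def)

lemma space_gibbs [simp]: "space (gibbs R e) = space R"
  by (simp add: gibbs_def)

lemma borel_measurable_gibbs [simp]: "borel_measurable (gibbs R e) = borel_measurable R"
  by (rule measurable_cong_sets) auto

lemma L2_0_D:
  assumes "\<phi> \<in> L2_0 N"
  shows "\<phi> \<in> borel_measurable N" "integrable N (\<lambda>x. (\<phi> x)\<^sup>2)" "(\<integral>x. \<phi> x \<partial>N) = 0"
  using assms by (auto simp: L2_0_def)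

lemma (in prob_space) integrable_of_square:
  fixes f :: "'a \<Rightarrow> real"
  assumes "f \<in> borel_measurable M" "integrable M (\<lambda>x. (f x)\<^sup>2)"
  shows "integrable M f"
  using integral_product_sq_le(1)[of f M "\<lambda>_. 1"] assms by simp

lemma integrable_square_add:
  fixes f g :: "'x \<Rightarrow> real"
  assumes f: "f \<in> borel_measurable N" "integrable N (\<lambda>x. (f x)\<^sup>2)"
    and g: "g \<in> borel_measurable N" "integrable N (\<lambda>x. (g x)\<^sup>2)"
  shows "integrable N (\<lambda>x. (f x + g x)\<^sup>2)"
  using integral_product_sq_le(1)[OF f(1) g(1) f(2) g(2)] f g by (simp add: power2_sum mult.assoc)

lemma L2_0_add:
  assumes "prob_space N" "\<phi> \<in> L2_0 N" "\<psi> \<in> L2_0 N"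
  shows "(\<lambda>x. \<phi> x + \<psi> x) \<in> L2_0 N"
proof -
  interpret prob_space N by fact
  note f = L2_0_D[OF assms(2)] and g = L2_0_D[OF assms(3)]
  note fi = integrable_of_square[OF f(1,2)] and gi = integrable_of_square[OF g(1,2)]
  show ?thesis
    using f g fi gi integrable_square_add[OF f(1,2) g(1,2)] by (auto simp: L2_0_def)
qed

lemma L2_0_scale: "\<phi> \<in> L2_0 N \<Longrightarrow> (\<lambda>x. c * \<phi> x) \<in> L2_0 N"
  by (auto simp: L2_0_def power_mult_distrib)

lemma L2_0_diff:
  assumes "prob_space N" "\<phi> \<in> L2_0 N" "\<psi> \<in> L2_0 N"
  shows "(\<lambda>x. \<phi> x - \<psi> x) \<in> L2_0 N"
  using L2_0_add[OF assms(1,2) L2_0_scale[OF assms(3), of "-1"]] by simp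

lemma L2_0_zero: "(\<lambda>x. 0) \<in> L2_0 N"
  by (auto simp: L2_0_def)

lemma L2_norm_sq: "(L2_norm N f)\<^sup>2 = (\<integral>x. (f x)\<^sup>2 \<partial>N)"
  by (simp add: L2_norm_def)

lemma L2_norm_nonneg: "0 \<le> L2_norm N f"
  by (simp add: L2_norm_def)

lemma L2_norm_cong_AE:
  assumes "f \<in> borel_measurable N" "g \<in> borel_measurable N" "AE x in N. f x = g x"
  shows "L2_norm N f = L2_norm N g"
  unfolding L2_norm_def using assms by (intro arg_cong[of _ _ sqrt] integral_cong_AE) auto

lemma L2_bounded_linear_D:
  assumes "L2_bounded_linear N A"
  shows "A u \<in> L2_0 N" "AE x in N. A (u + v) x = A u x + A v x" "AE x in N. A (c *\<^sub>R u) x = c * A u x"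
    "\<exists>B. \<forall>u. L2_norm N (A u) \<le> B * norm u"
  using assms by (auto simp: L2_bounded_linear_def)

lemma L2_bounded_linear_zero:
  assumes "L2_bounded_linear N A"
  shows "AE x in N. A 0 x = 0"
  using L2_bounded_linear_D(3)[OF assms, of 0 0] by simp

lemma L2_bounded_linear_sum:
  assumes A: "L2_bounded_linear N A" and I: "finite I"
  shows "AE x in N. A (\<Sum>i\<in>I. c i *\<^sub>R e i) x = (\<Sum>i\<in>I. c i * A (e i) x)"
  using I
proof (induction I rule: finite_induct)
  case empty
  show ?case using L2_bounded_linear_zero[OF A] by simp
next
  case (insert i I)
  have "AE x in N. A (c i *\<^sub>R e i + (\<Sum>i\<in>I. c i *\<^sub>R e i)) x = A (c i *\<^sub>R e i) x + A (\<Sum>i\<in>I. c i *\<^sub>R e i) x"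
    by (rule L2_bounded_linear_D[OF A])
  moreover have "AE x in N. A (c i *\<^sub>R e i) x = c i * A (e i) x"
    by (rule L2_bounded_linear_D[OF A])
  ultimately show ?case using insert.IH by eventually_elim (use insert.hyps in simp)
qed

lemma L2_bounded_linear_sq_bound:
  assumes A: "L2_bounded_linear N A"
  obtains B where "0 \<le> B" "\<And>u. (\<integral>x. (A u x)\<^sup>2 \<partial>N) \<le> B * (norm u)\<^sup>2"
proof -
  obtain B where B: "\<And>u. L2_norm N (A u) \<le> B * norm u" using L2_bounded_linear_D(4)[OF A] by blast
  have "(\<integral>x. (A u x)\<^sup>2 \<partial>N) \<le> B\<^sup>2 * (norm u)\<^sup>2" for u
    using power_mono[OF B L2_norm_nonneg, of u 2] by (simp add: L2_norm_sq power_mult_distrib)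
  then show ?thesis using that[of "B\<^sup>2"] by simp
qed

context semiparametric_density_model
begin

abbreviation N :: "((real^'p) \<times> 'h) set" where "N \<equiv> N\<theta> \<times> Nh"

abbreviation P :: "'m \<Rightarrow> 'x measure" where "P l \<equiv> gibbs (M l) (eta l \<tau>0)"

definition F :: "'m \<Rightarrow> (real^'p) \<times> 'h \<Rightarrow> real" where
  "F l t = ln (\<integral>x. exp (eta l t x) \<partial>M l)"

text \<open>Minus the log likelihood ratio of the law at \<open>t\<close> against the law at
  \<open>\<tau>0\<close>, see \<open>gibbs_density\<close>. Differences of the criterion are
  empirical means of differences of \<open>u\<close>.\<close>

definition u :: "'m \<Rightarrow> (real^'p) \<times> 'h \<Rightarrow> 'x \<Rightarrow> real" where
  "u l t x = (F l t - eta l t x) - (F l \<tau>0 - eta l \<tau>0 x)"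

lemma \<tau>0_in: "\<tau>0 \<in> N"
  using \<theta>0_in h0_in by (cases \<tau>0) auto

lemma open_N: "open N"
  by (intro open_Times open_N\<theta> open_Nh)

lemma eta_measurable [measurable]: "eta l t \<in> borel_measurable (M l)"
  using L2_0_D(1)[OF eta_L2_0[of l t]] by simp

lemma u_measurable [measurable]: "u l t \<in> borel_measurable (M l)"
  unfolding u_def by measurable

lemma prob_gibbs: "prob_space (gibbs (M l) (eta l t))"
proof
  have "emeasure (gibbs (M l) (eta l t)) (space (gibbs (M l) (eta l t)))
    = (\<integral>\<^sup>+x. ennreal (exp (eta l t x) / (\<integral>x. exp (eta l t x) \<partial>M l)) \<partial>M l)"
    by (simp add: gibbs_def emeasure_density)
  also have "\<dots> = ennreal (\<integral>x. exp (eta l t x) / (\<integral>x. exp (eta l t x) \<partial>M l) \<partial>M l)"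
    using exp_integrable norm_const_pos[of l t] by (intro nn_integral_eq_integral) auto
  also have "\<dots> = 1" using norm_const_pos[of l t] by simp
  finally show "emeasure (gibbs (M l) (eta l t)) (space (gibbs (M l) (eta l t))) = 1" .
qed

lemma prob_P: "prob_space (P l)"
  by (rule prob_gibbs)

lemma gibbs_density: "gibbs (M l) (eta l t) = density (P l) (\<lambda>x. ennreal (exp (- u l t x)))"
proof -
  have e: "exp (F l t) = (\<integral>x. exp (eta l t x) \<partial>M l)" for t
    using norm_const_pos[of l t] by (simp add: F_def)
  have "density (P l) (\<lambda>x. ennreal (exp (- u l t x)))
    = density (M l) (\<lambda>x. ennreal (exp (eta l \<tau>0 x) / (\<integral>x. exp (eta l \<tau>0 x) \<partial>M l)) * ennreal (exp (- u l t x)))"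
    unfolding gibbs_def by (rule density_density_eq) auto
  also have "\<dots> = gibbs (M l) (eta l t)"
    unfolding gibbs_def e[symmetric]
    by (intro arg_cong[of _ _ "density (M l)"] ext)
       (simp add: u_def flip: ennreal_mult exp_diff exp_add)
  finally show ?thesis ..
qed

lemma AE_gibbs: "(AE x in gibbs (M l) (eta l t). Q x) \<longleftrightarrow> (AE x in P l. Q x)"
  unfolding gibbs_density[of l t] by (subst AE_density) auto

lemma integral_gibbs:
  assumes "f \<in> borel_measurable (M l)"
  shows "(\<integral>x. f x \<partial>gibbs (M l) (eta l t)) = (\<integral>x. exp (- u l t x) * f x \<partial>P l)"
  unfolding gibbs_density[of l t] using assms by (subst integral_density) auto

lemma integrable_gibbs:
  assumes "f \<in> borel_measurable (M l)"
  shows "integrable (gibbs (M l) (eta l t)) f \<longleftrightarrow> integrable (P l) (\<lambda>x. exp (- u l t x) * f x)"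
  unfolding gibbs_density[of l t] using assms by (subst integrable_density) auto

lemma V_eq: "V M eta l t f = (\<integral>x. (f x)\<^sup>2 \<partial>gibbs (M l) (eta l t)) - (\<integral>x. f x \<partial>gibbs (M l) (eta l t))\<^sup>2"
  by (simp add: V_def V2_def mu_def power2_eq_square)

lemma V_L2_0: "f \<in> L2_0 (P l) \<Longrightarrow> V M eta l \<tau>0 f = (\<integral>x. (f x)\<^sup>2 \<partial>P l)"
  using L2_0_D(3)[of f "P l"] by (simp add: V_eq)

text \<open>The assumption compares sums over all samples. A family of functions that vanishes
  outside sample \<open>l\<close> isolates one summand.\<close>

lemma sample_variance_equiv:
  obtains C3 C4 where "0 < C3" "0 < C4"
    "\<And>l t f. t \<in> N \<Longrightarrow> f \<in> L2_0 (P l) \<Longrightarrow> C3 * V M eta l \<tau>0 f \<le> V M eta l t f \<and> V M eta l t f \<le> C4 * V M eta l \<tau>0 f"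
proof -
  obtain C3 C4 where C: "0 < C3" "0 < C4" and
    eq: "\<And>t f. t \<in> N \<Longrightarrow> (\<forall>l. f l \<in> L2_0 (P l)) \<Longrightarrow>
          C3 * (\<Sum>l\<in>UNIV. V M eta l \<tau>0 (f l)) \<le> (\<Sum>l\<in>UNIV. V M eta l t (f l)) \<and>
          (\<Sum>l\<in>UNIV. V M eta l t (f l)) \<le> C4 * (\<Sum>l\<in>UNIV. V M eta l \<tau>0 (f l))"
    using variance_equiv by blast
  show ?thesis
  proof (rule that[OF C])
    fix l t f assume t: "t \<in> N" and f: "f \<in> L2_0 (P l)"
    define g where "g k = (if k = l then f else (\<lambda>_. 0))" for k
    have V0: "V M eta k s (\<lambda>_. 0) = 0" for k s by (simp add: V_eq)
    have "(\<Sum>k\<in>UNIV. V M eta k s (g k)) = V M eta l s f" for s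
    proof -
      have "(\<Sum>k\<in>UNIV. V M eta k s (g k)) = (\<Sum>k\<in>UNIV. if k = l then V M eta l s f else 0)"
        by (intro sum.cong) (auto simp: g_def V0)
      then show ?thesis by simp
    qed
    moreover have "\<forall>k. g k \<in> L2_0 (P k)" using f L2_0_zero by (auto simp: g_def)
    ultimately show "C3 * V M eta l \<tau>0 f \<le> V M eta l t f \<and> V M eta l t f \<le> C4 * V M eta l \<tau>0 f"
      using eq[OF t, of g] by simp
  qed
qed

text \<open>A variance ignores the centring constant, so the indicator centred under
  \<open>\<tau>0\<close> has a Bernoulli variance under every parameter.\<close>

lemma set_variance:
  assumes A: "A \<in> sets (M l)"
  defines "f \<equiv> \<lambda>x. indicator A x - measure (P l) A"
  shows "f \<in> L2_0 (P l)"
    "V M eta l t f = measure (gibbs (M l) (eta l t)) A * (1 - measure (gibbs (M l) (eta l t)) A)"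
proof -
  have main: "integrable (gibbs (M l) (eta l t)) (\<lambda>x. (f x)\<^sup>2) \<and>
    (\<integral>x. f x \<partial>gibbs (M l) (eta l t)) = measure (gibbs (M l) (eta l t)) A - measure (P l) A \<and>
    V M eta l t f = measure (gibbs (M l) (eta l t)) A * (1 - measure (gibbs (M l) (eta l t)) A)" for t
  proof -
    interpret Q: prob_space "gibbs (M l) (eta l t)" by (rule prob_gibbs)
    define p q where "p = measure (P l) A" and "q = measure (gibbs (M l) (eta l t)) A"
    have ii: "integrable (gibbs (M l) (eta l t)) (indicator A :: 'x \<Rightarrow> real)"
      using A by (simp add: Q.emeasure_eq_measure)
    have sq: "(f x)\<^sup>2 = (1 - 2 * p) * indicator A x + p\<^sup>2" for x
      by (auto simp: f_def p_def indicator_def power2_eq_square algebra_simps)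
    have 1: "(\<integral>x. f x \<partial>gibbs (M l) (eta l t)) = q - p"
      using ii A Q.prob_space by (simp add: f_def p_def q_def sets.Int_space_eq1)
    have 2: "(\<integral>x. (f x)\<^sup>2 \<partial>gibbs (M l) (eta l t)) = (1 - 2 * p) * q + p\<^sup>2"
      unfolding sq using ii A Q.prob_space by (simp add: q_def sets.Int_space_eq1)
    show ?thesis
    proof (intro conjI)
      show "integrable (gibbs (M l) (eta l t)) (\<lambda>x. (f x)\<^sup>2)" unfolding sq using ii by simp
      show "V M eta l t f = Q.prob A * (1 - Q.prob A)"
        unfolding V_eq 1 2 q_def[symmetric] by (simp add: power2_eq_square algebra_simps)
    qed (use 1 in \<open>simp add: p_def q_def\<close>)
  qed
  show "f \<in> L2_0 (P l)"
    using main[of \<tau>0] A by (auto simp: L2_0_def f_def)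
  show "V M eta l t f = measure (gibbs (M l) (eta l t)) A * (1 - measure (gibbs (M l) (eta l t)) A)"
    using main by blast
qed

text \<open>If every event had probability \<open>0\<close> or \<open>1\<close>, a centred function
  would vanish almost everywhere, in particular the image of a nonzero vector under
  \<open>L\<theta> l\<close>, whose null space is trivial.\<close>

lemma P_nontrivial: "\<exists>B\<in>sets (M l). 0 < measure (P l) B \<and> measure (P l) B < 1"
proof (rule ccontr)
  assume neg: "\<not> ?thesis"
  interpret R: prob_space "P l" by (rule prob_P)
  define \<phi>' where "\<phi>' = L\<theta> l (axis undefined 1)"
  have L: "\<phi>' \<in> L2_0 (P l)" unfolding \<phi>'_def by (rule L2_bounded_linear_D[OF L\<theta>_bounded_linear])
  note D = L2_0_D[OF L]
  have [measurable]: "\<phi>' \<in> borel_measurable (M l)" using D by simp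
  have int: "integrable (P l) \<phi>'" by (rule R.integrable_of_square[OF D(1,2)])
  define B where "B = {x\<in>space (M l). 0 < \<phi>' x}"
  have B: "B \<in> sets (P l)" unfolding B_def by simp
  have "R.prob B = 0 \<or> R.prob B = 1"
    using neg B by (metis antisym_conv2 measure_nonneg order_less_le R.prob_le_1 sets_gibbs)
  then have "AE x in P l. \<phi>' x = 0"
  proof
    assume "R.prob B = 0"
    then have "AE x in P l. x \<notin> B" using R.prob_eq_0[OF B] by simp
    then have "AE x in P l. 0 \<le> - \<phi>' x"
      using AE_space by eventually_elim (auto simp: B_def)
    then show ?thesis
      using integral_nonneg_eq_0_iff_AE[of "P l" "\<lambda>x. - \<phi>' x"] int D(3) by simp
  next
    assume "R.prob B = 1"
    then have "AE x in P l. x \<in> B" using B R.prob_eq_1 by simp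
    then have "AE x in P l. 0 \<le> \<phi>' x" by eventually_elim (auto simp: B_def)
    then show ?thesis
      using integral_nonneg_eq_0_iff_AE[of "P l" \<phi>'] int D(3) by simp
  qed
  then have "axis undefined 1 = (0 :: real^'p)" unfolding \<phi>'_def by (rule L\<theta>_null)
  then show False by (simp add: axis_eq_0_iff)
qed

lemma gibbs_measure_ge:
  assumes A: "A \<in> sets (M l)" and K: "0 \<le> K" "\<And>x. x \<in> A \<Longrightarrow> K \<le> exp (- u l t x)"
  shows "K * measure (P l) A \<le> measure (gibbs (M l) (eta l t)) A"
proof -
  interpret R: prob_space "P l" by (rule prob_P)
  interpret Q: prob_space "gibbs (M l) (eta l t)" by (rule prob_gibbs)
  have "ennreal K * emeasure (P l) A = (\<integral>\<^sup>+x. ennreal K * indicator A x \<partial>P l)"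
    using A by (simp add: nn_integral_cmult)
  also have "\<dots> \<le> (\<integral>\<^sup>+x. ennreal (exp (- u l t x)) * indicator A x \<partial>P l)"
    using K by (intro nn_integral_mono) (auto simp: indicator_def intro!: ennreal_leI)
  also have "\<dots> = emeasure (gibbs (M l) (eta l t)) A"
    unfolding gibbs_density[of l t] using A by (subst emeasure_density) auto
  finally show ?thesis
    using K by (simp add: R.emeasure_eq_measure Q.emeasure_eq_measure flip: ennreal_mult)
qed

lemma gibbs_measure_le:
  assumes A: "A \<in> sets (M l)" and K: "0 \<le> K" "\<And>x. x \<in> A \<Longrightarrow> exp (- u l t x) \<le> K"
  shows "measure (gibbs (M l) (eta l t)) A \<le> K * measure (P l) A"
proof -
  interpret R: prob_space "P l" by (rule prob_P)
  interpret Q: prob_space "gibbs (M l) (eta l t)" by (rule prob_gibbs)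
  have "emeasure (gibbs (M l) (eta l t)) A = (\<integral>\<^sup>+x. ennreal (exp (- u l t x)) * indicator A x \<partial>P l)"
    unfolding gibbs_density[of l t] using A by (subst emeasure_density) auto
  also have "\<dots> \<le> (\<integral>\<^sup>+x. ennreal K * indicator A x \<partial>P l)"
    using K by (intro nn_integral_mono) (auto simp: indicator_def intro!: ennreal_leI)
  also have "\<dots> = ennreal K * emeasure (P l) A"
    using A by (simp add: nn_integral_cmult)
  finally show ?thesis
    using K by (simp add: R.emeasure_eq_measure Q.emeasure_eq_measure flip: ennreal_mult)
qed

text \<open>Variances of indicators under \<open>\<tau>\<close> and \<open>\<tau>0\<close> are comparable, which bounds the likelihood
  ratio on both sides of any set \<open>B\<close> of nontrivial probability.\<close>

lemma u_bounded_sample: "\<exists>b>0. \<forall>t\<in>N. AE x in P l. \<bar>u l t x\<bar> \<le> b"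
proof -
  interpret R: prob_space "P l" by (rule prob_P)
  obtain C3 C4 where C: "0 < C3" "0 < C4" and
    eq: "\<And>l t f. t \<in> N \<Longrightarrow> f \<in> L2_0 (P l) \<Longrightarrow> C3 * V M eta l \<tau>0 f \<le> V M eta l t f \<and> V M eta l t f \<le> C4 * V M eta l \<tau>0 f"
    using sample_variance_equiv by blast
  obtain B where B: "B \<in> sets (M l)" "0 < R.prob B" "R.prob B < 1" using P_nontrivial by blast
  define c where "c = R.prob B * (1 - R.prob B)"
  have c: "0 < c" using B by (simp add: c_def)
  \<comment> \<open>\<open>K\<close> exceeds both \<open>C4 / (C3 * c)\<close> and
    \<open>1 / (C3 * c)\<close>, the thresholds in the two contradictions that follow.\<close>
  define K where "K = 1 + (C4 + 1) / (C3 * c)"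
  have K: "1 < K" "C4 < K * (C3 * c)" "1 < K * (C3 * c)"
    using C c by (auto simp: K_def field_simps intro!: add_pos_pos mult_pos_pos)
  \<comment> \<open>If the likelihood ratio is at least \<open>K\<close> on \<open>A\<close>, then
    \<open>q\<close> is at least \<open>K\<close> times the probability of \<open>A\<close> under
    \<open>\<tau>0\<close>, while the variance comparison bounds \<open>q * (1 - q)\<close> by
    \<open>C4\<close> times that probability; the set \<open>D\<close> keeps \<open>1 - q\<close>
    above \<open>C3 * c\<close>. Small ratios are excluded in the same way with the roles of the two
    laws exchanged.\<close>
  have null: "measure (P l) A = 0"
    if t: "t \<in> N" and A: "A \<in> sets (M l)" and D: "D \<in> sets (M l)" "A \<subseteq> D" "R.prob D * (1 - R.prob D) = c"
      and AK: "(\<forall>x\<in>A. K \<le> exp (- u l t x)) \<or> (\<forall>x\<in>A. exp (- u l t x) \<le> 1 / K)" for t A D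
  proof (rule ccontr)
    assume "measure (P l) A \<noteq> 0"
    then have p: "0 < R.prob A" by (simp add: zero_less_measure_iff)
    interpret Q: prob_space "gibbs (M l) (eta l t)" by (rule prob_gibbs)
    define q where "q = measure (gibbs (M l) (eta l t)) A"
    define q' where "q' = measure (gibbs (M l) (eta l t)) D"
    have v: "C3 * (R.prob E * (1 - R.prob E)) \<le> Q.prob E * (1 - Q.prob E)"
      "Q.prob E * (1 - Q.prob E) \<le> C4 * (R.prob E * (1 - R.prob E))" if "E \<in> sets (M l)" for E
      using eq[OF t set_variance(1)[OF that]] set_variance(2)[OF that] by auto
    have AD: "R.prob A \<le> R.prob D" using A D by (intro R.finite_measure_mono) auto
    have qq: "q \<le> q'" unfolding q_def q'_def using A D by (intro Q.finite_measure_mono) auto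
    have q1: "0 \<le> q" "q' \<le> 1" "0 \<le> q'" "q \<le> 1" by (auto simp: q_def q'_def)
    from AK show False
    proof
      assume "\<forall>x\<in>A. K \<le> exp (- u l t x)"
      then have "K * R.prob A \<le> q" unfolding q_def using K by (intro gibbs_measure_ge[OF A]) auto
      then have "K * R.prob A * (1 - q) \<le> q * (1 - q)" using q1 by (intro mult_right_mono) auto
      also have "\<dots> \<le> C4 * (R.prob A * (1 - R.prob A))" unfolding q_def by (rule v(2)[OF A])
      also have "\<dots> \<le> C4 * (R.prob A * 1)" using C p by (intro mult_left_mono) auto
      finally have "K * (1 - q) \<le> C4" using p by (simp add: mult.assoc mult.left_commute)
      moreover have "C3 * c \<le> 1 - q"
      proof -
        have "C3 * c \<le> q' * (1 - q')" using v(1)[OF D(1)] D(3) by (simp add: q'_def)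
        also have "\<dots> \<le> 1 * (1 - q)" using q1 qq by (intro mult_mono) auto
        finally show ?thesis by simp
      qed
      ultimately have "K * (C3 * c) \<le> C4" using K by (smt (verit) mult_left_mono)
      then show False using K by simp
    next
      assume "\<forall>x\<in>A. exp (- u l t x) \<le> 1 / K"
      then have qK: "q \<le> 1 / K * R.prob A" unfolding q_def using K by (intro gibbs_measure_le[OF A]) auto
      have "C3 * (R.prob A * (1 - R.prob A)) \<le> q * (1 - q)" unfolding q_def by (rule v(1)[OF A])
      also have "\<dots> \<le> q * 1" using q1 by (intro mult_left_mono) auto
      also have "\<dots> \<le> 1 / K * R.prob A" using qK by simp
      finally have "C3 * (1 - R.prob A) * R.prob A \<le> 1 / K * R.prob A" by (simp add: mult_ac)
      then have "C3 * (1 - R.prob A) \<le> 1 / K" using p by (rule mult_right_le_imp_le)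
      moreover have "c \<le> 1 - R.prob A"
      proof -
        have "c \<le> 1 * (1 - R.prob D)" unfolding D(3)[symmetric] by (intro mult_right_mono) auto
        then show ?thesis using AD by simp
      qed
      ultimately have "C3 * c \<le> 1 / K" using C by (smt (verit) mult_left_mono)
      then show False using K by (simp add: field_simps)
    qed
  qed
  have bound: "AE x in P l. \<not> (K \<le> exp (- u l t x) \<or> exp (- u l t x) \<le> 1 / K)" if t: "t \<in> N" for t
  proof -
    \<comment> \<open>\<open>B\<close> and its complement have the same Bernoulli variance and
      together cover the space.\<close>
    define Bc where "Bc = space (M l) - B"
    have Bc: "Bc \<in> sets (M l)" "R.prob Bc * (1 - R.prob Bc) = c"
      using B R.prob_compl[of B] by (auto simp: Bc_def c_def)
    have "AE x in P l. x \<notin> {x\<in>D. Q (exp (- u l t x))}"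
      if D: "D \<in> sets (M l)" "R.prob D * (1 - R.prob D) = c" and
        Q: "Q = (\<lambda>y. K \<le> y) \<or> Q = (\<lambda>y. y \<le> 1 / K)" for D Q
    proof -
      have "D \<subseteq> space (M l)" using D(1) by (rule sets.sets_into_space)
      then have "{x\<in>D. Q (exp (- u l t x))} = D \<inter> {x\<in>space (M l). Q (exp (- u l t x))}" by auto
      also have "\<dots> \<in> sets (M l)" using Q D(1) by (auto intro!: sets.Int)
      finally have S: "{x\<in>D. Q (exp (- u l t x))} \<in> sets (M l)" .
      have "R.prob {x\<in>D. Q (exp (- u l t x))} = 0"
        using null[OF t S D(1) _ D(2)] Q by auto
      then show ?thesis using R.prob_eq_0[of "{x\<in>D. Q (exp (- u l t x))}"] S by simp
    qed
    note this[OF B(1) c_def[symmetric], of "\<lambda>y. K \<le> y"] this[OF B(1) c_def[symmetric], of "\<lambda>y. y \<le> 1 / K"]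
      this[OF Bc, of "\<lambda>y. K \<le> y"] this[OF Bc, of "\<lambda>y. y \<le> 1 / K"]
    then have "AE x in P l. x \<notin> {x\<in>B. K \<le> exp (- u l t x)}" "AE x in P l. x \<notin> {x\<in>B. exp (- u l t x) \<le> 1 / K}"
      "AE x in P l. x \<notin> {x\<in>Bc. K \<le> exp (- u l t x)}" "AE x in P l. x \<notin> {x\<in>Bc. exp (- u l t x) \<le> 1 / K}" by auto
    then show ?thesis using AE_space by eventually_elim (auto simp: Bc_def)
  qed
  have lnK: "0 < ln K" using K by simp
  have "\<bar>u l t x\<bar> \<le> ln K" if "\<not> (K \<le> exp (- u l t x) \<or> exp (- u l t x) \<le> 1 / K)" for t x
  proof -
    have "exp (- u l t x) < exp (ln K)" "exp (- ln K) < exp (- u l t x)"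
      using that K by (auto simp: exp_minus inverse_eq_divide)
    then show ?thesis by simp
  qed
  then have "AE x in P l. \<bar>u l t x\<bar> \<le> ln K" if "t \<in> N" for t
    using bound[OF that] by (rule eventually_mono[rotated])
  then show ?thesis using lnK by blast
qed

lemma u_bounded: "\<exists>b>0. \<forall>l. \<forall>t\<in>N. AE x in P l. \<bar>u l t x\<bar> \<le> b"
proof -
  obtain b where b: "\<And>l. 0 < b l" "\<And>l t. t \<in> N \<Longrightarrow> AE x in P l. \<bar>u l t x\<bar> \<le> b l"
    using u_bounded_sample by metis
  have le: "b l \<le> (\<Sum>k\<in>UNIV. b k)" for l
    using b(1) by (intro member_le_sum) (auto simp: less_imp_le)
  show ?thesis
  proof (intro exI[of _ "\<Sum>k\<in>UNIV. b k"] conjI allI ballI)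
    show "0 < (\<Sum>k\<in>UNIV. b k)" using b(1) by (intro sum_pos) auto
    fix l t assume "t \<in> N"
    from b(2)[OF this, of l] show "AE x in P l. \<bar>u l t x\<bar> \<le> (\<Sum>k\<in>UNIV. b k)"
      by eventually_elim (use le[of l] in linarith)
  qed
qed

end

subsection \<open>Differentiation in mean square\<close>

lemma integral_square_add_le:
  fixes f g :: "'x \<Rightarrow> real"
  assumes f: "f \<in> borel_measurable N" "integrable N (\<lambda>x. (f x)\<^sup>2)"
    and g: "g \<in> borel_measurable N" "integrable N (\<lambda>x. (g x)\<^sup>2)"
  shows "(\<integral>x. (f x + g x)\<^sup>2 \<partial>N) \<le> 2 * (\<integral>x. (f x)\<^sup>2 \<partial>N) + 2 * (\<integral>x. (g x)\<^sup>2 \<partial>N)"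
proof -
  have "(\<integral>x. (f x + g x)\<^sup>2 \<partial>N) \<le> (\<integral>x. 2 * (f x)\<^sup>2 + 2 * (g x)\<^sup>2 \<partial>N)"
  proof (rule integral_mono)
    show "integrable N (\<lambda>x. (f x + g x)\<^sup>2)" by (rule integrable_square_add[OF f g])
    show "(f x + g x)\<^sup>2 \<le> 2 * (f x)\<^sup>2 + 2 * (g x)\<^sup>2" for x
      using sum_squares_bound[of "f x" "g x"] by (simp add: power2_sum)
  qed (use f g in simp)
  then show ?thesis using f g by simp
qed

lemma abs_integral_product_le:
  fixes f g :: "'x \<Rightarrow> real"
  assumes f: "f \<in> borel_measurable N" "integrable N (\<lambda>x. (f x)\<^sup>2)"
    and g: "g \<in> borel_measurable N" "integrable N (\<lambda>x. (g x)\<^sup>2)"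
  shows "\<bar>\<integral>x. f x * g x \<partial>N\<bar> \<le> L2_norm N f * L2_norm N g"
proof -
  have "\<bar>\<integral>x. f x * g x \<partial>N\<bar> = sqrt ((\<integral>x. f x * g x \<partial>N)\<^sup>2)" by simp
  also have "\<dots> \<le> sqrt ((\<integral>x. (f x)\<^sup>2 \<partial>N) * (\<integral>x. (g x)\<^sup>2 \<partial>N))"
    by (intro real_sqrt_le_mono integral_product_sq_le assms)
  finally show ?thesis by (simp add: L2_norm_def real_sqrt_mult)
qed

text \<open>Pairing with a fixed function reduces mean-square differentiability to a scalar
  derivative, to which the mean value theorem applies.\<close>

lemma L2_has_derivative_pairing:
  fixes F :: "'a::real_normed_vector \<Rightarrow> 'x \<Rightarrow> real"
  assumes N: "prob_space N" and F: "\<And>t. F t \<in> L2_0 N" and \<psi>: "\<psi> \<in> L2_0 N"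
    and D: "L2_has_derivative N F A (t0 + s *\<^sub>R v)"
  shows "((\<lambda>s. \<integral>x. F (t0 + s *\<^sub>R v) x * \<psi> x \<partial>N) has_real_derivative (\<integral>x. A v x * \<psi> x \<partial>N)) (at s)"
proof -
  interpret prob_space N by fact
  have lin: "L2_bounded_linear N A" using D by (simp add: L2_has_derivative_def)
  note A = L2_bounded_linear_D[OF lin]
  have int: "integrable N (\<lambda>x. f x * \<psi> x)" if "f \<in> L2_0 N" for f
    using integral_product_sq_le(1) L2_0_D[OF that] L2_0_D[OF \<psi>] by blast
  define K where "K = L2_norm N \<psi> * norm v + 1"
  have K: "0 < K" using L2_norm_nonneg[of N \<psi>] by (simp add: K_def add_nonneg_pos)
  show ?thesis
    unfolding has_field_derivative_iff
    proof (rule tendstoI)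
      fix e :: real assume e: "0 < e"
      define e' where "e' = e / (2 * K)"
      have e': "0 < e'" using e K by (simp add: e'_def)
      obtain d where d: "0 < d" and small: "\<And>w. norm w < d \<Longrightarrow>
        L2_norm N (\<lambda>x. F (t0 + s *\<^sub>R v + w) x - F (t0 + s *\<^sub>R v) x - A w x) \<le> e' * norm w"
        using D e' unfolding L2_has_derivative_def by blast
      have "\<forall>\<^sub>F y in at s. dist y s < d / (norm v + 1)"
        using d by (auto simp: eventually_at add_nonneg_pos intro!: exI[of _ "d / (norm v + 1)"] divide_pos_pos)
      moreover have "\<forall>\<^sub>F y in at s. y \<noteq> s" by (simp add: eventually_at_filter)
      ultimately show "\<forall>\<^sub>F y in at s. dist (((\<integral>x. F (t0 + y *\<^sub>R v) x * \<psi> x \<partial>N)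
       - (\<integral>x. F (t0 + s *\<^sub>R v) x * \<psi> x \<partial>N)) / (y - s)) (\<integral>x. A v x * \<psi> x \<partial>N) < e"
      proof eventually_elim
        case (elim y)
        define w where "w = (y - s) *\<^sub>R v"
        define g where "g x = F (t0 + s *\<^sub>R v + w) x - F (t0 + s *\<^sub>R v) x - A w x" for x
        have ys: "t0 + s *\<^sub>R v + w = t0 + y *\<^sub>R v" by (simp add: w_def algebra_simps)
        have "norm w \<le> \<bar>y - s\<bar> * (norm v + 1)" unfolding w_def norm_scaleR by (simp add: distrib_left)
        also have "\<dots> < d" using elim(1) by (simp add: dist_real_def pos_less_divide_eq add_nonneg_pos)
        finally have "norm w < d" .
        from small[OF this] have sm: "L2_norm N g \<le> e' * norm w" by (simp add: g_def[abs_def])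
        have gL: "g \<in> L2_0 N" unfolding g_def by (intro L2_0_diff[OF N] F A(1))
        have "(\<integral>x. g x * \<psi> x \<partial>N) = (\<integral>x. F (t0 + y *\<^sub>R v) x * \<psi> x - F (t0 + s *\<^sub>R v) x * \<psi> x - (y - s) * (A v x * \<psi> x) \<partial>N)"
        proof (rule integral_cong_AE)
          show "AE x in N. g x * \<psi> x = F (t0 + y *\<^sub>R v) x * \<psi> x - F (t0 + s *\<^sub>R v) x * \<psi> x - (y - s) * (A v x * \<psi> x)"
            using A(3)[of "y - s" v, folded w_def] by eventually_elim (simp add: g_def ys left_diff_distrib mult.assoc)
        qed (use int[OF gL] int[OF F] int[OF A(1)] in \<open>auto intro!: borel_measurable_integrable\<close>)
        also have "\<dots> = (\<integral>x. F (t0 + y *\<^sub>R v) x * \<psi> x \<partial>N)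
          - ((\<integral>x. F (t0 + s *\<^sub>R v) x * \<psi> x \<partial>N) + (\<integral>x. A v x * \<psi> x \<partial>N) * (y - s))"
          using int[OF F] int[OF A(1)] by (simp add: algebra_simps)
        finally have eq: "(\<integral>x. g x * \<psi> x \<partial>N) = \<dots>" .
        have "\<bar>\<integral>x. g x * \<psi> x \<partial>N\<bar> \<le> L2_norm N g * L2_norm N \<psi>"
          using L2_0_D[OF gL] L2_0_D[OF \<psi>] by (intro abs_integral_product_le) auto
        also have "\<dots> \<le> e' * norm w * L2_norm N \<psi>" using sm L2_norm_nonneg by (intro mult_right_mono)
        also have "\<dots> = \<bar>y - s\<bar> * (e' * (L2_norm N \<psi> * norm v))" by (simp add: w_def)
        also have "\<dots> \<le> \<bar>y - s\<bar> * (e' * K)" using e' by (intro mult_left_mono) (auto simp: K_def)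
        also have "e' * K = e / 2" using K by (simp add: e'_def)
        finally have "\<bar>\<integral>x. g x * \<psi> x \<partial>N\<bar> / \<bar>y - s\<bar> \<le> e / 2"
          using elim(2) by (simp add: pos_divide_le_eq mult.commute)
        then have "\<bar>\<integral>x. g x * \<psi> x \<partial>N\<bar> / \<bar>y - s\<bar> < e" using e by linarith
        moreover have "((\<integral>x. F (t0 + y *\<^sub>R v) x * \<psi> x \<partial>N) - (\<integral>x. F (t0 + s *\<^sub>R v) x * \<psi> x \<partial>N)) / (y - s)
            - (\<integral>x. A v x * \<psi> x \<partial>N) = (\<integral>x. g x * \<psi> x \<partial>N) / (y - s)"
          unfolding eq using elim(2) by (simp add: field_simps)
        ultimately show ?case by (simp add: dist_real_def)
      qed
    qed
qed

text \<open>The mean value inequality for paths in a product of \<open>L2\<close> spaces. The path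
  is paired with its own increment; with \<open>T\<close> the squared length of the increment, the
  mean value theorem and the inequality of the two means give \<open>T \<le> (K + T) / 2\<close>.
  The samples are treated jointly because only the sum over them is bounded.\<close>

lemma L2_path_bound:
  fixes f f' :: "'m::finite \<Rightarrow> real \<Rightarrow> 'x \<Rightarrow> real"
  assumes P: "\<And>l. prob_space (P l)" and f: "\<And>l s. f l s \<in> L2_0 (P l)"
    and f': "\<And>l s. 0 \<le> s \<Longrightarrow> s \<le> 1 \<Longrightarrow> f' l s \<in> L2_0 (P l)"
    and der: "\<And>l s \<psi>. 0 \<le> s \<Longrightarrow> s \<le> 1 \<Longrightarrow> \<psi> \<in> L2_0 (P l) \<Longrightarrow>
      ((\<lambda>s. \<integral>x. f l s x * \<psi> x \<partial>P l) has_real_derivative (\<integral>x. f' l s x * \<psi> x \<partial>P l)) (at s)"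
    and K: "\<And>s. 0 \<le> s \<Longrightarrow> s \<le> 1 \<Longrightarrow> (\<Sum>l\<in>UNIV. \<integral>x. (f' l s x)\<^sup>2 \<partial>P l) \<le> K"
  shows "(\<Sum>l\<in>UNIV. \<integral>x. (f l 1 x - f l 0 x)\<^sup>2 \<partial>P l) \<le> K"
proof -
  define \<psi> where "\<psi> l x = f l 1 x - f l 0 x" for l x
  have \<psi>: "\<psi> l \<in> L2_0 (P l)" for l unfolding \<psi>_def by (intro L2_0_diff P f)
  define g where "g s = (\<Sum>l\<in>UNIV. \<integral>x. f l s x * \<psi> l x \<partial>P l)" for s
  define T where "T = (\<Sum>l\<in>UNIV. \<integral>x. (\<psi> l x)\<^sup>2 \<partial>P l)"
  have int: "integrable (P l) (\<lambda>x. h x * \<psi> l x)" if "h \<in> L2_0 (P l)" for h l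
    using integral_product_sq_le(1) L2_0_D[OF that] L2_0_D[OF \<psi>] by blast
  have "\<exists>z. 0 < z \<and> z < 1 \<and> g 1 - g 0 = (1 - 0) * (\<Sum>l\<in>UNIV. \<integral>x. f' l z x * \<psi> l x \<partial>P l)"
    unfolding g_def by (intro MVT2 DERIV_sum der \<psi>) auto
  then obtain z where z: "0 < z" "z < 1" "g 1 - g 0 = (\<Sum>l\<in>UNIV. \<integral>x. f' l z x * \<psi> l x \<partial>P l)" by auto
  have "g 1 - g 0 = T"
    unfolding g_def T_def sum_subtractf[symmetric]
  proof (intro sum.cong refl)
    fix l
    have "(\<integral>x. (\<psi> l x)\<^sup>2 \<partial>P l) = (\<integral>x. f l 1 x * \<psi> l x - f l 0 x * \<psi> l x \<partial>P l)"
      by (intro Bochner_Integration.integral_cong) (auto simp: \<psi>_def power2_eq_square algebra_simps)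
    then show "(\<integral>x. f l 1 x * \<psi> l x \<partial>P l) - (\<integral>x. f l 0 x * \<psi> l x \<partial>P l) = (\<integral>x. (\<psi> l x)\<^sup>2 \<partial>P l)"
      using int[OF f] by simp
  qed
  moreover have "(\<Sum>l\<in>UNIV. \<integral>x. f' l z x * \<psi> l x \<partial>P l) \<le> (\<Sum>l\<in>UNIV. ((\<integral>x. (f' l z x)\<^sup>2 \<partial>P l) + (\<integral>x. (\<psi> l x)\<^sup>2 \<partial>P l)) / 2)"
  proof (rule sum_mono)
    fix l
    have f'z: "f' l z \<in> L2_0 (P l)" using f' z by simp
    have "(\<integral>x. f' l z x * \<psi> l x \<partial>P l) \<le> (\<integral>x. ((f' l z x)\<^sup>2 + (\<psi> l x)\<^sup>2) / 2 \<partial>P l)"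
    proof (rule integral_mono)
      show "f' l z x * \<psi> l x \<le> ((f' l z x)\<^sup>2 + (\<psi> l x)\<^sup>2) / 2" for x
        using sum_squares_bound[of "f' l z x" "\<psi> l x"] by simp
    qed (use int[OF f'z] L2_0_D[OF f'z] L2_0_D[OF \<psi>] in auto)
    then show "(\<integral>x. f' l z x * \<psi> l x \<partial>P l) \<le> ((\<integral>x. (f' l z x)\<^sup>2 \<partial>P l) + (\<integral>x. (\<psi> l x)\<^sup>2 \<partial>P l)) / 2"
      using L2_0_D[OF f'z] L2_0_D[OF \<psi>] by simp
  qed
  moreover have "\<dots> = ((\<Sum>l\<in>UNIV. \<integral>x. (f' l z x)\<^sup>2 \<partial>P l) + T) / 2"
    by (simp add: T_def sum.distrib sum_divide_distrib add_divide_distrib)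
  moreover have "(\<Sum>l\<in>UNIV. \<integral>x. (f' l z x)\<^sup>2 \<partial>P l) \<le> K" using K z by simp
  ultimately have "T \<le> K" using z(3) by simp
  then show ?thesis by (simp add: T_def \<psi>_def)
qed

section \<open>Comparison of norms on the parameter space and Lipschitz continuity of the log
  densities\<close>

context semiparametric_density_model
begin

text \<open>Stands in for \<open>S\<close>, the penalty-free part of the norm on the parameter
  space, to which \<open>S_equiv\<close> shows it equivalent. Without cross terms between
  \<open>\<theta>\<close> and \<open>h\<close> it is a plain sum of squares in the coordinates of
  the eigensystem, see \<open>nrm2_comb\<close>.\<close>

definition nrm2 :: "(real^'p) \<times> 'h \<Rightarrow> real" where
  "nrm2 v = (norm (fst v))\<^sup>2 + (\<Sum>l\<in>UNIV. \<integral>x. (Lh l (snd v) x)\<^sup>2 \<partial>P l)"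

definition S :: "(real^'p) \<times> 'h \<Rightarrow> real" where
  "S v = (\<Sum>l\<in>UNIV. \<integral>x. (L\<theta> l (fst v) x + Lh l (snd v) x)\<^sup>2 \<partial>P l)"

definition Deta :: "'m \<Rightarrow> (real^'p) \<times> 'h \<Rightarrow> (real^'p) \<times> 'h \<Rightarrow> 'x \<Rightarrow> real" where
  "Deta l t v x = D\<theta> l t (fst v) x + Dh l t (snd v) x"

lemma L_L2_0: "L\<theta> l \<zeta> \<in> L2_0 (P l)" "Lh l g \<in> L2_0 (P l)"
  by (rule L2_bounded_linear_D[OF L\<theta>_bounded_linear] L2_bounded_linear_D[OF Lh_bounded_linear])+

lemma D_L2_0: "t \<in> N \<Longrightarrow> D\<theta> l t \<zeta> \<in> L2_0 (P l)" "t \<in> N \<Longrightarrow> Dh l t g \<in> L2_0 (P l)"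
  by (rule L2_bounded_linear_D[OF D\<theta>_bounded_linear] L2_bounded_linear_D[OF Dh_bounded_linear]; assumption)+

lemma Deta_L2_0: "t \<in> N \<Longrightarrow> Deta l t v \<in> L2_0 (P l)"
  unfolding Deta_def using L2_0_add[OF prob_P D_L2_0] by simp

lemma Deta_measurable: "t \<in> N \<Longrightarrow> Deta l t v \<in> borel_measurable (M l)"
  using L2_0_D(1)[OF Deta_L2_0[of t l v]] by simp

text \<open>Linearity of the derivatives holds almost everywhere only, so the derivative in the
  other argument vanishes at \<open>0\<close> merely outside a null set.\<close>

lemma Deta_partial:
  assumes t: "t \<in> N"
  shows "(\<integral>x. (Deta l t (\<zeta>, 0) x)\<^sup>2 \<partial>P l) = (\<integral>x. (D\<theta> l t \<zeta> x)\<^sup>2 \<partial>P l)"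
    "(\<integral>x. (Deta l t (0, g) x)\<^sup>2 \<partial>P l) = (\<integral>x. (Dh l t g x)\<^sup>2 \<partial>P l)"
proof -
  have m: "Deta l t v \<in> borel_measurable (P l)" "D\<theta> l t \<zeta> \<in> borel_measurable (P l)" "Dh l t g \<in> borel_measurable (P l)" for v \<zeta> g
    by (rule L2_0_D(1)[OF Deta_L2_0[OF t]] L2_0_D(1)[OF D_L2_0(1)[OF t]] L2_0_D(1)[OF D_L2_0(2)[OF t]])+
  have "AE x in P l. (Deta l t (\<zeta>, 0) x)\<^sup>2 = (D\<theta> l t \<zeta> x)\<^sup>2"
    using L2_bounded_linear_zero[OF Dh_bounded_linear[OF t, of l]] by eventually_elim (simp add: Deta_def)
  then show "(\<integral>x. (Deta l t (\<zeta>, 0) x)\<^sup>2 \<partial>P l) = (\<integral>x. (D\<theta> l t \<zeta> x)\<^sup>2 \<partial>P l)"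
    using m by (intro integral_cong_AE borel_measurable_power)
  have "AE x in P l. (Deta l t (0, g) x)\<^sup>2 = (Dh l t g x)\<^sup>2"
    using L2_bounded_linear_zero[OF D\<theta>_bounded_linear[OF t, of l]] by eventually_elim (simp add: Deta_def)
  then show "(\<integral>x. (Deta l t (0, g) x)\<^sup>2 \<partial>P l) = (\<integral>x. (Dh l t g x)\<^sup>2 \<partial>P l)"
    using m by (intro integral_cong_AE borel_measurable_power)
qed

lemma Deta_bounds:
  assumes t: "t \<in> N"
  shows "C1 * S v \<le> (\<Sum>l\<in>UNIV. \<integral>x. (Deta l t v x)\<^sup>2 \<partial>P l)"
    "(\<Sum>l\<in>UNIV. \<integral>x. (Deta l t v x)\<^sup>2 \<partial>P l) \<le> C2 * S v"
proof -
  have "V M eta l \<tau>0 (\<lambda>x. D\<theta> l t (fst v) x + Dh l t (snd v) x) = (\<integral>x. (Deta l t v x)\<^sup>2 \<partial>P l)" for l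
    using V_L2_0[OF Deta_L2_0[OF t, of l v]] by (simp add: Deta_def[abs_def])
  moreover have "V M eta l \<tau>0 (\<lambda>x. L\<theta> l (fst v) x + Lh l (snd v) x) = (\<integral>x. (L\<theta> l (fst v) x + Lh l (snd v) x)\<^sup>2 \<partial>P l)" for l
    using V_L2_0[OF L2_0_add[OF prob_P L_L2_0(1) L_L2_0(2)]] by simp
  ultimately show "C1 * S v \<le> (\<Sum>l\<in>UNIV. \<integral>x. (Deta l t v x)\<^sup>2 \<partial>P l)"
    "(\<Sum>l\<in>UNIV. \<integral>x. (Deta l t v x)\<^sup>2 \<partial>P l) \<le> C2 * S v"
    using derivative_equiv[OF t, of "fst v" "snd v"] by (simp_all add: S_def)
qed

lemma nrm2_nonneg: "0 \<le> nrm2 v"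
  unfolding nrm2_def by (intro add_nonneg_nonneg sum_nonneg) auto

lemma S_nonneg: "0 \<le> S v"
  unfolding S_def by (intro sum_nonneg) auto

lemma L\<theta>_sq_bound:
  obtains B where "0 \<le> B" "\<And>\<zeta>. (\<Sum>l\<in>UNIV. \<integral>x. (L\<theta> l \<zeta> x)\<^sup>2 \<partial>P l) \<le> B * (norm \<zeta>)\<^sup>2"
proof -
  have "\<exists>B\<ge>0. \<forall>\<zeta>. (\<integral>x. (L\<theta> l \<zeta> x)\<^sup>2 \<partial>P l) \<le> B * (norm \<zeta>)\<^sup>2" for l
    by (rule L2_bounded_linear_sq_bound[OF L\<theta>_bounded_linear[of l]]) blast
  then obtain B where B: "\<And>l. 0 \<le> B l" "\<And>l \<zeta>. (\<integral>x. (L\<theta> l \<zeta> x)\<^sup>2 \<partial>P l) \<le> B l * (norm \<zeta>)\<^sup>2" by metis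
  show ?thesis
  proof (rule that[of "\<Sum>l\<in>UNIV. B l"])
    show "0 \<le> (\<Sum>l\<in>UNIV. B l)" using B by (intro sum_nonneg) auto
    show "(\<Sum>l\<in>UNIV. \<integral>x. (L\<theta> l \<zeta> x)\<^sup>2 \<partial>P l) \<le> (\<Sum>l\<in>UNIV. B l) * (norm \<zeta>)\<^sup>2" for \<zeta>
      unfolding sum_distrib_right by (intro sum_mono B)
  qed
qed

text \<open>The separation assumption, rescaled from unit vectors, bounds the parametric part of
  \<open>v\<close> by \<open>S v\<close>; the nonparametric part is then the whole minus a term
  already controlled.\<close>

lemma S_equiv: "\<exists>c>0. \<exists>C>0. \<forall>v. c * nrm2 v \<le> S v \<and> S v \<le> C * nrm2 v"
proof -
  obtain B where B: "0 \<le> B" "\<And>\<zeta>. (\<Sum>l\<in>UNIV. \<integral>x. (L\<theta> l \<zeta> x)\<^sup>2 \<partial>P l) \<le> B * (norm \<zeta>)\<^sup>2"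
    using L\<theta>_sq_bound by blast
  obtain c where c: "0 < c" and sep: "\<And>\<zeta> g. norm \<zeta> = 1 \<Longrightarrow>
          (\<Sum>l\<in>UNIV. V M eta l \<tau>0 (\<lambda>x. L\<theta> l \<zeta> x - Lh l g x)) > c"
    using separation by blast
  define H where "H g = (\<Sum>l\<in>UNIV. \<integral>x. (Lh l g x)\<^sup>2 \<partial>P l)" for g
  have upper: "S (\<zeta>, g) \<le> 2 * (B * (norm \<zeta>)\<^sup>2) + 2 * H g" for \<zeta> g
  proof -
    have "S (\<zeta>, g) \<le> (\<Sum>l\<in>UNIV. 2 * (\<integral>x. (L\<theta> l \<zeta> x)\<^sup>2 \<partial>P l) + 2 * (\<integral>x. (Lh l g x)\<^sup>2 \<partial>P l))"
      unfolding S_def fst_conv snd_conv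
      by (intro sum_mono integral_square_add_le L2_0_D L_L2_0)
    also have "\<dots> = 2 * (\<Sum>l\<in>UNIV. \<integral>x. (L\<theta> l \<zeta> x)\<^sup>2 \<partial>P l) + 2 * H g"
      by (simp add: sum.distrib sum_distrib_left H_def)
    also have "\<dots> \<le> 2 * (B * (norm \<zeta>)\<^sup>2) + 2 * H g" using B(2)[of \<zeta>] by simp
    finally show ?thesis .
  qed
  have low\<theta>: "c * (norm \<zeta>)\<^sup>2 \<le> S (\<zeta>, g)" for \<zeta> g
  proof (cases "\<zeta> = 0")
    case True
    then show ?thesis using S_nonneg by simp
  next
    case False
    define k where "k = norm \<zeta>"
    have k: "0 < k" using False by (simp add: k_def)
    \<comment> \<open>Sign and scale of \<open>g'\<close> make
      \<open>L\<theta> l \<zeta>' x - Lh l g' x\<close> equal to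
      \<open>(L\<theta> l \<zeta> x + Lh l g x) / k\<close> almost everywhere.\<close>
    define \<zeta>' g' where "\<zeta>' = (1 / k) *\<^sub>R \<zeta>" and "g' = (- 1 / k) *\<^sub>R g"
    have "c < (\<Sum>l\<in>UNIV. V M eta l \<tau>0 (\<lambda>x. L\<theta> l \<zeta>' x - Lh l g' x))"
      using k by (intro sep) (simp add: \<zeta>'_def k_def)
    also have "\<dots> = (\<Sum>l\<in>UNIV. 1 / k\<^sup>2 * (\<integral>x. (L\<theta> l \<zeta> x + Lh l g x)\<^sup>2 \<partial>P l))"
    proof (intro sum.cong refl)
      fix l
      have m: "L\<theta> l \<zeta> \<in> borel_measurable (P l)" "Lh l g \<in> borel_measurable (P l)"
        "L\<theta> l \<zeta>' \<in> borel_measurable (P l)" "Lh l g' \<in> borel_measurable (P l)" for \<zeta> g \<zeta>' g'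
        by (rule L2_0_D(1)[OF L_L2_0(1)] L2_0_D(1)[OF L_L2_0(2)])+
      have "AE x in P l. L\<theta> l \<zeta>' x = 1 / k * L\<theta> l \<zeta> x"
        unfolding \<zeta>'_def by (rule L2_bounded_linear_D[OF L\<theta>_bounded_linear])
      moreover have "AE x in P l. Lh l g' x = - 1 / k * Lh l g x"
        unfolding g'_def by (rule L2_bounded_linear_D[OF Lh_bounded_linear])
      ultimately have "AE x in P l. (L\<theta> l \<zeta>' x - Lh l g' x)\<^sup>2 = 1 / k\<^sup>2 * (L\<theta> l \<zeta> x + Lh l g x)\<^sup>2"
        by eventually_elim (simp add: power_divide flip: add_divide_distrib)
      then have "(\<integral>x. (L\<theta> l \<zeta>' x - Lh l g' x)\<^sup>2 \<partial>P l) = (\<integral>x. 1 / k\<^sup>2 * (L\<theta> l \<zeta> x + Lh l g x)\<^sup>2 \<partial>P l)"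
        using m by (intro integral_cong_AE) auto
      then show "V M eta l \<tau>0 (\<lambda>x. L\<theta> l \<zeta>' x - Lh l g' x) = 1 / k\<^sup>2 * (\<integral>x. (L\<theta> l \<zeta> x + Lh l g x)\<^sup>2 \<partial>P l)"
        using V_L2_0[OF L2_0_diff[OF prob_P L_L2_0(1) L_L2_0(2)]] by simp
    qed
    also have "\<dots> = 1 / k\<^sup>2 * S (\<zeta>, g)" by (simp add: S_def sum_divide_distrib)
    finally show ?thesis using k by (simp add: field_simps k_def)
  qed
  have lowh: "H g \<le> 2 * S (\<zeta>, g) + 2 * (B * (norm \<zeta>)\<^sup>2)" for \<zeta> g
  proof -
    have "H g \<le> (\<Sum>l\<in>UNIV. 2 * (\<integral>x. (L\<theta> l \<zeta> x + Lh l g x)\<^sup>2 \<partial>P l) + 2 * (\<integral>x. (L\<theta> l \<zeta> x)\<^sup>2 \<partial>P l))"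
      unfolding H_def
    proof (rule sum_mono)
      fix l
      have sum: "(\<lambda>x. L\<theta> l \<zeta> x + Lh l g x) \<in> L2_0 (P l)" by (intro L2_0_add prob_P L_L2_0)
      have neg: "(\<lambda>x. - 1 * L\<theta> l \<zeta> x) \<in> L2_0 (P l)" by (intro L2_0_scale L_L2_0)
      show "(\<integral>x. (Lh l g x)\<^sup>2 \<partial>P l) \<le> 2 * (\<integral>x. (L\<theta> l \<zeta> x + Lh l g x)\<^sup>2 \<partial>P l) + 2 * (\<integral>x. (L\<theta> l \<zeta> x)\<^sup>2 \<partial>P l)"
        using integral_square_add_le[OF L2_0_D(1,2)[OF sum] L2_0_D(1,2)[OF neg]] by simp
    qed
    also have "\<dots> = 2 * S (\<zeta>, g) + 2 * (\<Sum>l\<in>UNIV. \<integral>x. (L\<theta> l \<zeta> x)\<^sup>2 \<partial>P l)"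
      by (simp add: sum.distrib sum_distrib_left S_def)
    also have "\<dots> \<le> 2 * S (\<zeta>, g) + 2 * (B * (norm \<zeta>)\<^sup>2)" using B(2)[of \<zeta>] by simp
    finally show ?thesis .
  qed
  define k where "k = 1 / c + 2 + 2 * B / c"
  have k: "0 < k" using c B by (simp add: k_def add_pos_nonneg)
  have nr: "nrm2 (\<zeta>, g) = (norm \<zeta>)\<^sup>2 + H g" for \<zeta> g by (simp add: nrm2_def H_def)
  have "nrm2 (\<zeta>, g) \<le> k * S (\<zeta>, g)" for \<zeta> g
  proof -
    have 1: "(norm \<zeta>)\<^sup>2 \<le> S (\<zeta>, g) / c" using low\<theta>[of \<zeta> g] c by (simp add: field_simps)
    have "B * (norm \<zeta>)\<^sup>2 \<le> B * (S (\<zeta>, g) / c)" using 1 B by (intro mult_left_mono)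
    then have "nrm2 (\<zeta>, g) \<le> S (\<zeta>, g) / c + (2 * S (\<zeta>, g) + 2 * (B * (S (\<zeta>, g) / c)))"
      using 1 lowh[of g \<zeta>] unfolding nr by linarith
    also have "\<dots> = k * S (\<zeta>, g)" using c by (simp add: k_def field_simps)
    finally show ?thesis .
  qed
  then have "1 / k * nrm2 v \<le> S v" for v using k by (cases v) (simp add: field_simps)
  moreover have "S v \<le> (2 * B + 2) * nrm2 v" for v
  proof (cases v)
    case (Pair \<zeta> g)
    have "0 \<le> H g" unfolding H_def by (intro sum_nonneg) auto
    then have "0 \<le> B * H g" using B by simp
    moreover have "0 \<le> (norm \<zeta>)\<^sup>2" by simp
    moreover have "(2 * B + 2) * ((norm \<zeta>)\<^sup>2 + H g) = 2 * (B * (norm \<zeta>)\<^sup>2) + 2 * (B * H g) + 2 * (norm \<zeta>)\<^sup>2 + 2 * H g"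
      by (simp add: algebra_simps)
    ultimately show ?thesis using upper[of \<zeta> g] unfolding Pair nr by linarith
  qed
  ultimately show ?thesis using k B by (intro exI[of _ "1 / k"] conjI exI[of _ "2 * B + 2"]) auto
qed

lemma nrm2_split: "nrm2 (\<zeta>, 0) + nrm2 (0, g) = nrm2 (\<zeta>, g)"
proof -
  have "(\<integral>x. (Lh l 0 x)\<^sup>2 \<partial>P l) = (\<integral>x. 0 \<partial>P l)" for l
    using L2_bounded_linear_zero[OF Lh_bounded_linear[of l]] L2_0_D(1)[OF L_L2_0(2), of l 0]
    by (intro integral_cong_AE) (auto elim: eventually_mono)
  then show ?thesis by (simp add: nrm2_def)
qed

text \<open>The derivatives used are partial, so \<open>w\<close> is joined to \<open>d\<close> by
  one segment in \<open>\<theta>\<close> and one in \<open>h\<close>, both inside the product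
  neighborhood. The path bound applies to each, and \<open>nrm2\<close> splits additively over the
  two.\<close>

lemma eta_lipschitz:
  "\<exists>C>0. \<forall>d\<in>N. \<forall>w\<in>N. (\<Sum>l\<in>UNIV. \<integral>x. (eta l d x - eta l w x)\<^sup>2 \<partial>P l) \<le> C * nrm2 (d - w)"
proof -
  obtain c C where C: "0 < C" "\<And>v. S v \<le> C * nrm2 v" using S_equiv by blast
  \<comment> \<open>The factors are the linear projections of a nonempty convex product.\<close>
  have convex: "convex N\<theta>" "convex Nh"
    using convex_linear_image[OF bounded_linear.linear[OF bounded_linear_fst] convex_N]
      convex_linear_image[OF bounded_linear.linear[OF bounded_linear_snd] convex_N] \<theta>0_in h0_in
    by (auto simp: fst_image_times snd_image_times split: if_splits)
  have step1: "(\<Sum>l\<in>UNIV. \<integral>x. (eta l (\<theta>1, h) x - eta l (\<theta>0, h) x)\<^sup>2 \<partial>P l) \<le> C2 * (C * nrm2 (\<theta>1 - \<theta>0, 0))"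
    if "\<theta>0 \<in> N\<theta>" "\<theta>1 \<in> N\<theta>" "h \<in> Nh" for \<theta>0 \<theta>1 h
  proof -
    define t where "t s = \<theta>0 + s *\<^sub>R (\<theta>1 - \<theta>0)" for s
    have t: "t s \<in> N\<theta>" if "0 \<le> s" "s \<le> 1" for s
      using convexD_alt[OF convex(1) \<open>\<theta>0 \<in> N\<theta>\<close> \<open>\<theta>1 \<in> N\<theta>\<close>] that by (simp add: t_def algebra_simps)
    have "(\<Sum>l\<in>UNIV. \<integral>x. (eta l (t 1, h) x - eta l (t 0, h) x)\<^sup>2 \<partial>P l) \<le> C2 * (C * nrm2 (\<theta>1 - \<theta>0, 0))"
    proof (rule L2_path_bound[where f' = "\<lambda>l s. D\<theta> l (t s, h) (\<theta>1 - \<theta>0)"])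
      fix l s \<psi> assume s: "0 \<le> s" "s \<le> (1::real)"
      show "D\<theta> l (t s, h) (\<theta>1 - \<theta>0) \<in> L2_0 (P l)" using t[OF s] that by (intro D_L2_0) auto
      assume \<psi>: "\<psi> \<in> L2_0 (P l)"
      show "((\<lambda>s. \<integral>x. eta l (t s, h) x * \<psi> x \<partial>P l) has_real_derivative (\<integral>x. D\<theta> l (t s, h) (\<theta>1 - \<theta>0) x * \<psi> x \<partial>P l)) (at s)"
        unfolding t_def using t[OF s] that
        by (intro L2_has_derivative_pairing[where F = "\<lambda>\<theta>'. eta l (\<theta>', h)"] prob_P eta_L2_0 \<psi> L2_derivative[THEN conjunct1]) (auto simp: t_def)
    next
      fix s assume s: "0 \<le> s" "s \<le> (1::real)"
      have ts: "(t s, h) \<in> N" using t[OF s] that by auto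
      have "(\<Sum>l\<in>UNIV. \<integral>x. (D\<theta> l (t s, h) (\<theta>1 - \<theta>0) x)\<^sup>2 \<partial>P l) = (\<Sum>l\<in>UNIV. \<integral>x. (Deta l (t s, h) (\<theta>1 - \<theta>0, 0) x)\<^sup>2 \<partial>P l)"
        by (simp only: Deta_partial[OF ts])
      also have "\<dots> \<le> C2 * S (\<theta>1 - \<theta>0, 0)" by (rule Deta_bounds(2)[OF ts])
      also have "\<dots> \<le> C2 * (C * nrm2 (\<theta>1 - \<theta>0, 0))" using C2_pos C(2) by (intro mult_left_mono) auto
      finally show "(\<Sum>l\<in>UNIV. \<integral>x. (D\<theta> l (t s, h) (\<theta>1 - \<theta>0) x)\<^sup>2 \<partial>P l) \<le> C2 * (C * nrm2 (\<theta>1 - \<theta>0, 0))" .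
    qed (intro prob_P eta_L2_0)+
    then show ?thesis by (simp add: t_def)
  qed
  have step2: "(\<Sum>l\<in>UNIV. \<integral>x. (eta l (\<theta>, h1) x - eta l (\<theta>, h0) x)\<^sup>2 \<partial>P l) \<le> C2 * (C * nrm2 (0, h1 - h0))"
    if "\<theta> \<in> N\<theta>" "h0 \<in> Nh" "h1 \<in> Nh" for \<theta> h0 h1
  proof -
    define t where "t s = h0 + s *\<^sub>R (h1 - h0)" for s
    have t: "t s \<in> Nh" if "0 \<le> s" "s \<le> 1" for s
      using convexD_alt[OF convex(2) \<open>h0 \<in> Nh\<close> \<open>h1 \<in> Nh\<close>] that by (simp add: t_def algebra_simps)
    have "(\<Sum>l\<in>UNIV. \<integral>x. (eta l (\<theta>, t 1) x - eta l (\<theta>, t 0) x)\<^sup>2 \<partial>P l) \<le> C2 * (C * nrm2 (0, h1 - h0))"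
    proof (rule L2_path_bound[where f' = "\<lambda>l s. Dh l (\<theta>, t s) (h1 - h0)"])
      fix l s \<psi> assume s: "0 \<le> s" "s \<le> (1::real)"
      show "Dh l (\<theta>, t s) (h1 - h0) \<in> L2_0 (P l)" using t[OF s] that by (intro D_L2_0) auto
      assume \<psi>: "\<psi> \<in> L2_0 (P l)"
      show "((\<lambda>s. \<integral>x. eta l (\<theta>, t s) x * \<psi> x \<partial>P l) has_real_derivative (\<integral>x. Dh l (\<theta>, t s) (h1 - h0) x * \<psi> x \<partial>P l)) (at s)"
        unfolding t_def using t[OF s] that
        by (intro L2_has_derivative_pairing[where F = "\<lambda>h'. eta l (\<theta>, h')"] prob_P eta_L2_0 \<psi> L2_derivative[THEN conjunct2]) (auto simp: t_def)
    next
      fix s assume s: "0 \<le> s" "s \<le> (1::real)"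
      have ts: "(\<theta>, t s) \<in> N" using t[OF s] that by auto
      have "(\<Sum>l\<in>UNIV. \<integral>x. (Dh l (\<theta>, t s) (h1 - h0) x)\<^sup>2 \<partial>P l) = (\<Sum>l\<in>UNIV. \<integral>x. (Deta l (\<theta>, t s) (0, h1 - h0) x)\<^sup>2 \<partial>P l)"
        by (simp only: Deta_partial[OF ts])
      also have "\<dots> \<le> C2 * S (0, h1 - h0)" by (rule Deta_bounds(2)[OF ts])
      also have "\<dots> \<le> C2 * (C * nrm2 (0, h1 - h0))" using C2_pos C(2) by (intro mult_left_mono) auto
      finally show "(\<Sum>l\<in>UNIV. \<integral>x. (Dh l (\<theta>, t s) (h1 - h0) x)\<^sup>2 \<partial>P l) \<le> C2 * (C * nrm2 (0, h1 - h0))" .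
    qed (intro prob_P eta_L2_0)+
    then show ?thesis by (simp add: t_def)
  qed
  have "(\<Sum>l\<in>UNIV. \<integral>x. (eta l d x - eta l w x)\<^sup>2 \<partial>P l) \<le> 2 * C2 * C * nrm2 (d - w)"
    if "d \<in> N" "w \<in> N" for d w
  proof -
    obtain \<theta>1 h1 \<theta>0 h0 where d: "d = (\<theta>1, h1)" and w: "w = (\<theta>0, h0)" by (meson prod.exhaust)
    have "(\<Sum>l\<in>UNIV. \<integral>x. (eta l d x - eta l w x)\<^sup>2 \<partial>P l) \<le>
      (\<Sum>l\<in>UNIV. 2 * (\<integral>x. (eta l (\<theta>1, h1) x - eta l (\<theta>1, h0) x)\<^sup>2 \<partial>P l) + 2 * (\<integral>x. (eta l (\<theta>1, h0) x - eta l (\<theta>0, h0) x)\<^sup>2 \<partial>P l))"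
    proof (rule sum_mono)
      fix l
      have "(\<lambda>x. eta l (\<theta>1, h1) x - eta l (\<theta>1, h0) x) \<in> L2_0 (P l)" "(\<lambda>x. eta l (\<theta>1, h0) x - eta l (\<theta>0, h0) x) \<in> L2_0 (P l)"
        by (intro L2_0_diff prob_P eta_L2_0)+
      from integral_square_add_le[OF L2_0_D(1,2)[OF this(1)] L2_0_D(1,2)[OF this(2)]]
      show "(\<integral>x. (eta l d x - eta l w x)\<^sup>2 \<partial>P l) \<le> 2 * (\<integral>x. (eta l (\<theta>1, h1) x - eta l (\<theta>1, h0) x)\<^sup>2 \<partial>P l) + 2 * (\<integral>x. (eta l (\<theta>1, h0) x - eta l (\<theta>0, h0) x)\<^sup>2 \<partial>P l)"
        by (simp add: d w)
    qed
    also have "\<dots> = 2 * (\<Sum>l\<in>UNIV. \<integral>x. (eta l (\<theta>1, h1) x - eta l (\<theta>1, h0) x)\<^sup>2 \<partial>P l)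
      + 2 * (\<Sum>l\<in>UNIV. \<integral>x. (eta l (\<theta>1, h0) x - eta l (\<theta>0, h0) x)\<^sup>2 \<partial>P l)"
      by (simp add: sum.distrib sum_distrib_left)
    also have "\<dots> \<le> 2 * (C2 * (C * nrm2 (0, h1 - h0))) + 2 * (C2 * (C * nrm2 (\<theta>1 - \<theta>0, 0)))"
      using that d w by (intro add_mono mult_left_mono step1 step2) auto
    also have "\<dots> = 2 * C2 * C * (nrm2 (\<theta>1 - \<theta>0, 0) + nrm2 (0, h1 - h0))" by (simp add: algebra_simps)
    also have "nrm2 (\<theta>1 - \<theta>0, 0) + nrm2 (0, h1 - h0) = nrm2 (d - w)"
      using nrm2_split[of "\<theta>1 - \<theta>0" "h1 - h0"] by (simp add: d w)
    finally show ?thesis .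
  qed
  then show ?thesis using C C2_pos by (intro exI[of _ "2 * C2 * C"]) auto
qed

end

section \<open>Directional derivatives in mean square\<close>

lemma L2_norm_triangle:
  assumes f: "f \<in> borel_measurable N" "integrable N (\<lambda>x. (f x)\<^sup>2)"
    and g: "g \<in> borel_measurable N" "integrable N (\<lambda>x. (g x)\<^sup>2)"
  shows "L2_norm N (\<lambda>x. f x + g x) \<le> L2_norm N f + L2_norm N g"
proof (rule power2_le_imp_le)
  have "(L2_norm N (\<lambda>x. f x + g x))\<^sup>2 = (\<integral>x. (f x)\<^sup>2 + (g x)\<^sup>2 + 2 * (f x * g x) \<partial>N)"
    unfolding L2_norm_sq by (simp add: power2_sum mult.assoc)
  also have "\<dots> = (L2_norm N f)\<^sup>2 + (L2_norm N g)\<^sup>2 + 2 * (\<integral>x. f x * g x \<partial>N)"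
    using f g integral_product_sq_le(1)[OF f(1) g(1) f(2) g(2)] by (simp add: L2_norm_sq)
  also have "\<dots> \<le> (L2_norm N f)\<^sup>2 + (L2_norm N g)\<^sup>2 + 2 * (L2_norm N f * L2_norm N g)"
    using abs_integral_product_le[OF f g] by simp
  finally show "(L2_norm N (\<lambda>x. f x + g x))\<^sup>2 \<le> (L2_norm N f + L2_norm N g)\<^sup>2"
    by (simp add: power2_sum mult.assoc)
qed (simp add: L2_norm_nonneg)

lemma L2_norm_scale: "L2_norm N (\<lambda>x. c * f x) = \<bar>c\<bar> * L2_norm N f"
  by (simp add: L2_norm_def power_mult_distrib real_sqrt_mult)

lemma L2_norm_minus: "L2_norm N (\<lambda>x. f x - g x) = L2_norm N (\<lambda>x. g x - f x)"
  by (simp add: L2_norm_def power2_commute)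

text \<open>The derivative of a single curve at \<open>s = 0\<close>, with no uniformity in a
  direction. It is weak enough to be shared by partial and total derivatives, and still determines
  \<open>f\<close> almost everywhere.\<close>

definition L2_ray_derivative :: "'x measure \<Rightarrow> (real \<Rightarrow> 'x \<Rightarrow> real) \<Rightarrow> ('x \<Rightarrow> real) \<Rightarrow> bool" where
  "L2_ray_derivative N G f \<longleftrightarrow>
    (\<forall>\<epsilon>>0. \<exists>\<delta>>0. \<forall>s. \<bar>s\<bar> < \<delta> \<longrightarrow> L2_norm N (\<lambda>x. G s x - G 0 x - s * f x) \<le> \<epsilon> * \<bar>s\<bar>)"

lemma L2_ray_derivative_cong:
  assumes "prob_space N" "\<And>s. G s \<in> L2_0 N" "f \<in> L2_0 N" "g \<in> L2_0 N" "AE x in N. f x = g x"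
    and "L2_ray_derivative N G f"
  shows "L2_ray_derivative N G g"
proof -
  have eq: "L2_norm N (\<lambda>x. G s x - G 0 x - s * f x) = L2_norm N (\<lambda>x. G s x - G 0 x - s * g x)" for s
  proof (rule L2_norm_cong_AE)
    show "(\<lambda>x. G s x - G 0 x - s * f x) \<in> borel_measurable N" "(\<lambda>x. G s x - G 0 x - s * g x) \<in> borel_measurable N"
      by (intro L2_0_D(1) L2_0_diff L2_0_scale assms)+
    show "AE x in N. G s x - G 0 x - s * f x = G s x - G 0 x - s * g x"
      using assms(5) by eventually_elim simp
  qed
  show ?thesis using assms(6) unfolding L2_ray_derivative_def eq .
qed

lemma L2_ray_derivative_unique:
  assumes N: "prob_space N" and G: "\<And>s. G s \<in> L2_0 N" and f: "f \<in> L2_0 N" and g: "g \<in> L2_0 N"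
    and Df: "L2_ray_derivative N G f" and Dg: "L2_ray_derivative N G g"
  shows "AE x in N. f x = g x"
proof -
  have "L2_norm N (\<lambda>x. f x - g x) \<le> \<epsilon>" if \<epsilon>: "0 < \<epsilon>" for \<epsilon>
  proof -
    obtain d1 where d1: "0 < d1" "\<And>s. \<bar>s\<bar> < d1 \<Longrightarrow> L2_norm N (\<lambda>x. G s x - G 0 x - s * f x) \<le> \<epsilon> / 2 * \<bar>s\<bar>"
      using Df \<epsilon> unfolding L2_ray_derivative_def by (metis half_gt_zero)
    obtain d2 where d2: "0 < d2" "\<And>s. \<bar>s\<bar> < d2 \<Longrightarrow> L2_norm N (\<lambda>x. G s x - G 0 x - s * g x) \<le> \<epsilon> / 2 * \<bar>s\<bar>"
      using Dg \<epsilon> unfolding L2_ray_derivative_def by (metis half_gt_zero)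
    define s where "s = min d1 d2 / 2"
    have s: "0 < s" "\<bar>s\<bar> < d1" "\<bar>s\<bar> < d2" using d1(1) d2(1) by (auto simp: s_def)
    have L: "(\<lambda>x. G s x - G 0 x - s * g x) \<in> L2_0 N" "(\<lambda>x. s * f x - (G s x - G 0 x)) \<in> L2_0 N"
      by (intro L2_0_diff L2_0_scale N G f g)+
    have "s * L2_norm N (\<lambda>x. f x - g x) = L2_norm N (\<lambda>x. (G s x - G 0 x - s * g x) + (s * f x - (G s x - G 0 x)))"
      using s(1) L2_norm_scale[of N s "\<lambda>x. f x - g x"] by (simp add: right_diff_distrib)
    also have "\<dots> \<le> L2_norm N (\<lambda>x. G s x - G 0 x - s * g x) + L2_norm N (\<lambda>x. s * f x - (G s x - G 0 x))"
      by (intro L2_norm_triangle L2_0_D L)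
    also have "L2_norm N (\<lambda>x. s * f x - (G s x - G 0 x)) = L2_norm N (\<lambda>x. G s x - G 0 x - s * f x)"
      by (rule L2_norm_minus)
    also have "L2_norm N (\<lambda>x. G s x - G 0 x - s * g x) + L2_norm N (\<lambda>x. G s x - G 0 x - s * f x) \<le> \<epsilon> / 2 * \<bar>s\<bar> + \<epsilon> / 2 * \<bar>s\<bar>"
      using d1(2)[OF s(2)] d2(2)[OF s(3)] by (rule add_mono[rotated])
    also have "\<dots> = s * \<epsilon>" using s(1) by simp
    finally show ?thesis using s(1) by simp
  qed
  then have "L2_norm N (\<lambda>x. f x - g x) \<le> 0" by (rule field_le_epsilon) simp
  then have "(\<integral>x. (f x - g x)\<^sup>2 \<partial>N) \<le> 0" by (simp add: L2_norm_def)
  then have "(\<integral>x. (f x - g x)\<^sup>2 \<partial>N) = 0" by (simp add: order_antisym)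
  then have "AE x in N. (f x - g x)\<^sup>2 = 0"
    using integral_nonneg_eq_0_iff_AE[of N "\<lambda>x. (f x - g x)\<^sup>2"] L2_0_D(2)[OF L2_0_diff[OF N f g]] by simp
  then show ?thesis by eventually_elim simp
qed

lemma L2_ray_derivative_of_derivative:
  assumes N: "prob_space N" and F: "\<And>t. F t \<in> L2_0 N" and D: "L2_has_derivative N F A t"
  shows "L2_ray_derivative N (\<lambda>s. F (t + s *\<^sub>R v)) (A v)"
  unfolding L2_ray_derivative_def
proof (intro allI impI)
  fix \<epsilon> :: real assume e: "0 < \<epsilon>"
  have lin: "L2_bounded_linear N A" using D by (simp add: L2_has_derivative_def)
  note A = L2_bounded_linear_D[OF lin]
  define k where "k = norm v + 1"
  have k: "0 < k" "norm v \<le> k" by (auto simp: k_def add_nonneg_pos)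
  have ek: "0 < \<epsilon> / k" using e k by simp
  then obtain d where d: "0 < d" "\<And>w. norm w < d \<Longrightarrow> L2_norm N (\<lambda>x. F (t + w) x - F t x - A w x) \<le> \<epsilon> / k * norm w"
    using D unfolding L2_has_derivative_def by blast
  show "\<exists>\<delta>>0. \<forall>s. \<bar>s\<bar> < \<delta> \<longrightarrow> L2_norm N (\<lambda>x. F (t + s *\<^sub>R v) x - F (t + 0 *\<^sub>R v) x - s * A v x) \<le> \<epsilon> * \<bar>s\<bar>"
  proof (intro exI[of _ "d / k"] conjI allI impI)
    show "0 < d / k" using d k by simp
    fix s assume s: "\<bar>s\<bar> < d / k"
    have "norm (s *\<^sub>R v) \<le> \<bar>s\<bar> * k" using k by (simp add: mult_left_mono)
    also have "\<dots> < d" using s k by (simp add: pos_less_divide_eq)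
    finally have "L2_norm N (\<lambda>x. F (t + s *\<^sub>R v) x - F t x - A (s *\<^sub>R v) x) \<le> \<epsilon> / k * norm (s *\<^sub>R v)" by (rule d(2))
    also have "\<dots> = \<bar>s\<bar> * (\<epsilon> / k * norm v)" by simp
    also have "\<dots> \<le> \<bar>s\<bar> * (\<epsilon> / k * k)" using k ek by (intro mult_left_mono) auto
    also have "\<dots> = \<epsilon> * \<bar>s\<bar>" using k by simp
    finally have *: "L2_norm N (\<lambda>x. F (t + s *\<^sub>R v) x - F t x - A (s *\<^sub>R v) x) \<le> \<epsilon> * \<bar>s\<bar>" .
    have "L2_norm N (\<lambda>x. F (t + s *\<^sub>R v) x - F t x - A (s *\<^sub>R v) x) = L2_norm N (\<lambda>x. F (t + s *\<^sub>R v) x - F t x - s * A v x)"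
    proof (rule L2_norm_cong_AE)
      show "(\<lambda>x. F (t + s *\<^sub>R v) x - F t x - A (s *\<^sub>R v) x) \<in> borel_measurable N" "(\<lambda>x. F (t + s *\<^sub>R v) x - F t x - s * A v x) \<in> borel_measurable N"
        by (intro L2_0_D(1) L2_0_diff L2_0_scale N F A)+
      show "AE x in N. F (t + s *\<^sub>R v) x - F t x - A (s *\<^sub>R v) x = F (t + s *\<^sub>R v) x - F t x - s * A v x"
        using A(3)[of s v] by eventually_elim simp
    qed
    then show "L2_norm N (\<lambda>x. F (t + s *\<^sub>R v) x - F (t + 0 *\<^sub>R v) x - s * A v x) \<le> \<epsilon> * \<bar>s\<bar>"
      using * by simp
  qed
qed

text \<open>The first link of the chain of derivatives is a total Frechet derivative;
  \<open>T\<close> being open removes the restriction to increments that stay inside it.\<close>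

lemma L2_C_on_derivative:
  fixes F :: "'a::real_normed_vector \<Rightarrow> 'x \<Rightarrow> real"
  assumes N: "prob_space N" and F: "\<And>t. F t \<in> L2_0 N" and C: "L2_C_on N k T F" and k: "0 < k"
    and T: "open T" "t \<in> T"
  shows "\<exists>A. L2_has_derivative N F A t"
proof -
  define step where "step D j t \<longleftrightarrow> (\<forall>\<epsilon>>0. \<exists>\<delta>>0. \<forall>u. norm u < \<delta> \<and> t + u \<in> T \<longrightarrow>
        (\<forall>vs. length vs = j \<longrightarrow>
           L2_norm N (\<lambda>x. D j (t + u) vs x - D j t vs x - D (Suc j) t (u # vs) x)
             \<le> \<epsilon> * norm u * prod_list (map norm vs)))" for D and j :: nat and t
  define chain where "chain D \<longleftrightarrow> (\<forall>t\<in>T. AE x in N. D 0 t [] x = F t x) \<and>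
     (\<forall>j\<le>k. \<forall>t\<in>T. L2_bounded_multilinear N j (D j t)) \<and>
     (\<forall>j<k. \<forall>t\<in>T. step D j t) \<and>
     (\<forall>t\<in>T. \<forall>\<epsilon>>0. \<exists>\<delta>>0. \<forall>s\<in>T. dist s t < \<delta> \<longrightarrow>
        (\<forall>vs. length vs = k \<longrightarrow>
           L2_norm N (\<lambda>x. D k s vs x - D k t vs x) \<le> \<epsilon> * prod_list (map norm vs)))" for D
  have "\<exists>D. chain D" using C unfolding L2_C_on_def chain_def step_def .
  then obtain D where D: "chain D" by (rule exE)
  have D0: "\<And>t. t \<in> T \<Longrightarrow> AE x in N. D 0 t [] x = F t x"
    and Dm: "\<And>j t. j \<le> k \<Longrightarrow> t \<in> T \<Longrightarrow> L2_bounded_multilinear N j (D j t)"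
    using D by (simp_all add: chain_def)
  have Dd: "step D 0 t" using D k T(2) by (simp add: chain_def)
  have m1: "L2_bounded_multilinear N 1 (D 1 t)" using Dm[of 1 t] k T by simp
  have m0: "D 0 s [] \<in> L2_0 N" if "s \<in> T" for s
    using Dm[of 0 s] that unfolding L2_bounded_multilinear_def by simp
  define A where "A w = D 1 t [w]" for w
  have A0: "A w \<in> L2_0 N" for w using m1 unfolding L2_bounded_multilinear_def A_def by auto
  have AE: "AE x in N. A (a *\<^sub>R v + b *\<^sub>R w) x = a * A v x + b * A w x" for a b v w
  proof -
    have "length [v] = 1 \<and> 0 < (1::nat)" by simp
    then have "AE x in N. D 1 t ([v][0 := a *\<^sub>R v + b *\<^sub>R w]) x = a * D 1 t ([v][0 := v]) x + b * D 1 t ([v][0 := w]) x"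
      using m1 unfolding L2_bounded_multilinear_def by blast
    then show ?thesis by (simp add: A_def)
  qed
  have "\<exists>B. \<forall>w. L2_norm N (A w) \<le> B * norm w"
  proof -
    obtain B where B: "\<And>us. length us = 1 \<Longrightarrow> L2_norm N (D 1 t us) \<le> B * prod_list (map norm us)"
      using m1 unfolding L2_bounded_multilinear_def by blast
    have "L2_norm N (A w) \<le> B * norm w" for w using B[of "[w]"] by (simp add: A_def)
    then show ?thesis by blast
  qed
  moreover have "AE x in N. A (v + w) x = A v x + A w x" for v w using AE[of 1 v 1 w] by simp
  moreover have "AE x in N. A (c *\<^sub>R v) x = c * A v x" for c v using AE[of c v 0 0] by simp
  ultimately have lin: "L2_bounded_linear N A" using A0 by (simp add: L2_bounded_linear_def)
  have "\<exists>\<delta>>0. \<forall>w. norm w < \<delta> \<longrightarrow> L2_norm N (\<lambda>x. F (t + w) x - F t x - A w x) \<le> \<epsilon> * norm w" if e: "0 < \<epsilon>" for \<epsilon>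
  proof -
    obtain d1 where d1: "0 < d1" and b1: "\<And>u. norm u < d1 \<Longrightarrow> t + u \<in> T \<Longrightarrow>
      L2_norm N (\<lambda>x. D 0 (t + u) [] x - D 0 t [] x - D (Suc 0) t [u] x) \<le> \<epsilon> * norm u"
    proof -
      from Dd[unfolded step_def, THEN spec, THEN mp, OF e] obtain d where "0 < d"
        and d: "\<forall>u. norm u < d \<and> t + u \<in> T \<longrightarrow> (\<forall>vs. length vs = 0 \<longrightarrow>
           L2_norm N (\<lambda>x. D 0 (t + u) vs x - D 0 t vs x - D (Suc 0) t (u # vs) x)
             \<le> \<epsilon> * norm u * prod_list (map norm vs))" by (elim exE conjE)
      have "L2_norm N (\<lambda>x. D 0 (t + u) [] x - D 0 t [] x - D (Suc 0) t [u] x) \<le> \<epsilon> * norm u"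
        if "norm u < d" "t + u \<in> T" for u
        using d[THEN spec[of _ u], THEN mp, OF conjI[OF that], THEN spec[of _ "[]"]] by simp
      then show thesis by (rule that[OF \<open>0 < d\<close>])
    qed
    obtain d2 where d2: "0 < d2" "\<And>y. dist y t < d2 \<Longrightarrow> y \<in> T" using T by (auto simp: open_dist)
    show ?thesis
    proof (intro exI[of _ "min d1 d2"] conjI allI impI)
      show "0 < min d1 d2" using d1 d2 by simp
      fix w :: 'a assume w: "norm w < min d1 d2"
      then have tw: "t + w \<in> T" by (intro d2(2)) (simp add: dist_norm)
      have "L2_norm N (\<lambda>x. F (t + w) x - F t x - A w x) = L2_norm N (\<lambda>x. D 0 (t + w) [] x - D 0 t [] x - A w x)"
      proof (rule L2_norm_cong_AE)
        show "(\<lambda>x. F (t + w) x - F t x - A w x) \<in> borel_measurable N" "(\<lambda>x. D 0 (t + w) [] x - D 0 t [] x - A w x) \<in> borel_measurable N"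
          by (intro L2_0_D(1) L2_0_diff N F A0 m0 tw T(2))+
        have "AE x in N. D 0 (t + w) [] x = F (t + w) x" "AE x in N. D 0 t [] x = F t x" using D0 tw T(2) by auto
        then show "AE x in N. F (t + w) x - F t x - A w x = D 0 (t + w) [] x - D 0 t [] x - A w x"
          by eventually_elim simp
      qed
      also have "\<dots> \<le> \<epsilon> * norm w" using b1[of w] w tw by (simp add: A_def)
      finally show "L2_norm N (\<lambda>x. F (t + w) x - F t x - A w x) \<le> \<epsilon> * norm w" .
    qed
  qed
  then show ?thesis using lin unfolding L2_has_derivative_def by blast
qed

context semiparametric_density_model
begin

text \<open>\<open>eta_C3\<close> yields some total derivative \<open>A\<close>. On the coordinate
  axes \<open>A\<close> and the given partial derivatives are ray derivatives of the same curve,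
  hence agree almost everywhere, and linearity of \<open>A\<close> extends this to all
  directions.\<close>

lemma eta_ray_derivative:
  assumes t: "t \<in> N"
  shows "L2_ray_derivative (P l) (\<lambda>s. eta l (t + s *\<^sub>R v)) (Deta l t v)"
proof -
  obtain \<theta> h where th: "t = (\<theta>, h)" "\<theta> \<in> N\<theta>" "h \<in> Nh" using t by auto
  obtain A where A: "L2_has_derivative (P l) (eta l) A t"
    using L2_C_on_derivative[OF prob_P eta_L2_0 eta_C3 _ open_N t] by auto
  have lin: "L2_bounded_linear (P l) A" using A by (simp add: L2_has_derivative_def)
  note ray = L2_ray_derivative_of_derivative[OF prob_P, of _ l]
  have 1: "AE x in P l. A (\<zeta>, 0) x = D\<theta> l t \<zeta> x" for \<zeta>
  proof (rule L2_ray_derivative_unique[OF prob_P])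
    show "L2_ray_derivative (P l) (\<lambda>s. eta l (t + s *\<^sub>R (\<zeta>, 0))) (A (\<zeta>, 0))"
      by (rule ray[OF eta_L2_0 A])
    show "L2_ray_derivative (P l) (\<lambda>s. eta l (t + s *\<^sub>R (\<zeta>, 0))) (D\<theta> l t \<zeta>)"
      using ray[OF eta_L2_0 L2_derivative[THEN conjunct1, OF th(2,3)], of \<zeta>] by (simp add: th(1))
  qed (intro eta_L2_0 L2_bounded_linear_D[OF lin] D_L2_0[OF t])+
  have 2: "AE x in P l. A (0, g) x = Dh l t g x" for g
  proof (rule L2_ray_derivative_unique[OF prob_P])
    show "L2_ray_derivative (P l) (\<lambda>s. eta l (t + s *\<^sub>R (0, g))) (A (0, g))"
      by (rule ray[OF eta_L2_0 A])
    show "L2_ray_derivative (P l) (\<lambda>s. eta l (t + s *\<^sub>R (0, g))) (Dh l t g)"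
      using ray[OF eta_L2_0 L2_derivative[THEN conjunct2, OF th(2,3)], of g] by (simp add: th(1))
  qed (intro eta_L2_0 L2_bounded_linear_D[OF lin] D_L2_0[OF t])+
  have "AE x in P l. A ((fst v, 0) + (0, snd v)) x = A (fst v, 0) x + A (0, snd v) x"
    by (rule L2_bounded_linear_D[OF lin])
  then have "AE x in P l. A v x = Deta l t v x"
    using 1[of "fst v"] 2[of "snd v"] by eventually_elim (simp add: Deta_def)
  then show ?thesis
    by (rule L2_ray_derivative_cong[OF prob_P eta_L2_0 L2_bounded_linear_D(1)[OF lin] Deta_L2_0[OF t]])
       (rule ray[OF eta_L2_0 A])
qed

section \<open>Changes of measure, Kullback-Leibler divergences and tangents\<close>

definition ubound :: real where
  "ubound = (SOME b. 0 < b \<and> (\<forall>l. \<forall>t\<in>N. AE x in P l. \<bar>u l t x\<bar> \<le> b))"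

lemma ubound: "0 < ubound" "t \<in> N \<Longrightarrow> AE x in P l. \<bar>u l t x\<bar> \<le> ubound"
  using someI_ex[OF u_bounded] unfolding ubound_def[symmetric] by auto

lemma gibbs_integrable:
  fixes f :: "'x \<Rightarrow> real"
  assumes t: "t \<in> N" and f: "integrable (P l) f"
  shows "integrable (gibbs (M l) (eta l t)) f"
proof -
  have [measurable]: "f \<in> borel_measurable (M l)" using borel_measurable_integrable[OF f] by simp
  have "integrable (P l) (\<lambda>x. exp (- u l t x) * f x)"
  proof (rule Bochner_Integration.integrable_bound)
    show "integrable (P l) (\<lambda>x. exp ubound * f x)" using f by simp
    show "AE x in P l. norm (exp (- u l t x) * f x) \<le> norm (exp ubound * f x)"
      using ubound(2)[OF t, of l] by eventually_elim (auto simp: abs_mult intro!: mult_right_mono)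
  qed simp
  then show ?thesis by (rule integrable_gibbs[THEN iffD2, rotated]) simp
qed

lemma gibbs_integral_bounds:
  fixes f :: "'x \<Rightarrow> real"
  assumes t: "t \<in> N" and f: "integrable (P l) f" and nn: "AE x in P l. 0 \<le> f x"
  shows "exp (- ubound) * (\<integral>x. f x \<partial>P l) \<le> (\<integral>x. f x \<partial>gibbs (M l) (eta l t))"
    "(\<integral>x. f x \<partial>gibbs (M l) (eta l t)) \<le> exp ubound * (\<integral>x. f x \<partial>P l)"
proof -
  have m [measurable]: "f \<in> borel_measurable (M l)" using borel_measurable_integrable[OF f] by simp
  have i: "integrable (P l) (\<lambda>x. exp (- u l t x) * f x)"
    using gibbs_integrable[OF t f] by (rule integrable_gibbs[OF m, THEN iffD1])
  have "(\<integral>x. exp (- ubound) * f x \<partial>P l) \<le> (\<integral>x. exp (- u l t x) * f x \<partial>P l)"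
  proof (rule integral_mono_AE)
    show "AE x in P l. exp (- ubound) * f x \<le> exp (- u l t x) * f x"
      using ubound(2)[OF t, of l] nn by eventually_elim (auto intro!: mult_right_mono)
  qed (use f i in auto)
  then show "exp (- ubound) * (\<integral>x. f x \<partial>P l) \<le> (\<integral>x. f x \<partial>gibbs (M l) (eta l t))"
    unfolding integral_gibbs[OF m, of t] integral_mult_right_zero .
  have "(\<integral>x. exp (- u l t x) * f x \<partial>P l) \<le> (\<integral>x. exp ubound * f x \<partial>P l)"
  proof (rule integral_mono_AE)
    show "AE x in P l. exp (- u l t x) * f x \<le> exp ubound * f x"
      using ubound(2)[OF t, of l] nn by eventually_elim (auto intro!: mult_right_mono)
  qed (use f i in auto)
  then show "(\<integral>x. f x \<partial>gibbs (M l) (eta l t)) \<le> exp ubound * (\<integral>x. f x \<partial>P l)"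
    unfolding integral_gibbs[OF m, of t] integral_mult_right_zero .
qed

lemma gibbs_integral_sq_le:
  assumes t: "t \<in> N" and f: "f \<in> borel_measurable (M l)" "integrable (P l) (\<lambda>x. (f x)\<^sup>2)"
  shows "(\<integral>x. f x \<partial>gibbs (M l) (eta l t))\<^sup>2 \<le> exp ubound * (\<integral>x. (f x)\<^sup>2 \<partial>P l)"
proof -
  interpret Q: prob_space "gibbs (M l) (eta l t)" by (rule prob_gibbs)
  have i: "integrable (gibbs (M l) (eta l t)) (\<lambda>x. (f x)\<^sup>2)" by (rule gibbs_integrable[OF t f(2)])
  have "(\<integral>x. f x \<partial>gibbs (M l) (eta l t))\<^sup>2 \<le> (\<integral>x. (f x)\<^sup>2 \<partial>gibbs (M l) (eta l t)) * (\<integral>x. 1\<^sup>2 \<partial>gibbs (M l) (eta l t))"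
    using integral_product_sq_le(2)[of f "gibbs (M l) (eta l t)" "\<lambda>_. 1"] f(1) i by simp
  also have "\<dots> \<le> exp ubound * (\<integral>x. (f x)\<^sup>2 \<partial>P l)"
    using gibbs_integral_bounds(2)[OF t f(2)] Q.prob_space by simp
  finally show ?thesis .
qed

lemma gibbs_exp_u:
  "(\<integral>x. exp (- (u l d x - u l w x)) \<partial>gibbs (M l) (eta l w)) = 1"
proof -
  interpret Q: prob_space "gibbs (M l) (eta l d)" by (rule prob_gibbs)
  have "(\<integral>x. exp (- (u l d x - u l w x)) \<partial>gibbs (M l) (eta l w)) = (\<integral>x. exp (- u l w x) * exp (- (u l d x - u l w x)) \<partial>P l)"
    by (rule integral_gibbs) measurable
  also have "\<dots> = (\<integral>x. exp (- u l d x) * 1 \<partial>P l)" by (simp flip: exp_add)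
  also have "\<dots> = (\<integral>x. 1 \<partial>gibbs (M l) (eta l d))" by (rule integral_gibbs[symmetric]) simp
  finally show ?thesis using Q.prob_space by simp
qed

lemma eta_diff_L2_0: "(\<lambda>x. eta l d x - eta l w x) \<in> L2_0 (P l)"
  by (intro L2_0_diff prob_P eta_L2_0)

lemma u_diff: "u l d x - u l w x = (F l d - F l w) - (eta l d x - eta l w x)"
  by (simp add: u_def)

lemma u_diff_sq_integrable: "integrable (P l) (\<lambda>x. (u l d x - u l w x)\<^sup>2)"
proof -
  interpret R: prob_space "P l" by (rule prob_P)
  note L2_0_D(1,2)[OF eta_diff_L2_0[of l w d]]
  then have "integrable (P l) (\<lambda>x. ((F l d - F l w) + (eta l w x - eta l d x))\<^sup>2)"
    by (intro integrable_square_add) auto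
  then show ?thesis by (simp add: u_diff algebra_simps)
qed

text \<open>Under \<open>w\<close> the likelihood ratio \<open>exp (- y x)\<close> has mean
  \<open>1\<close>, so the divergence is the mean of \<open>exp (- y x) - 1 + y x\<close>, which
  lies between multiples of the square of \<open>y x\<close>. Of the exponent
  \<open>3 * ubound\<close>, two parts bound \<open>\<bar>y x\<bar>\<close> and one pays for the
  change of measure between \<open>w\<close> and \<open>\<tau>0\<close>.\<close>

lemma KL_sample:
  fixes l :: 'm
  assumes d: "d \<in> N" and w: "w \<in> N"
  defines "kl \<equiv> F l d - F l w - (\<integral>x. eta l d x - eta l w x \<partial>gibbs (M l) (eta l w))"
    and "Y \<equiv> (\<integral>x. (u l d x - u l w x)\<^sup>2 \<partial>P l)"
  shows "kl = (\<integral>x. u l d x - u l w x \<partial>gibbs (M l) (eta l w))"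
    "exp (- 3 * ubound) / 2 * Y \<le> kl" "kl \<le> exp (3 * ubound) / 2 * Y"
proof -
  interpret R: prob_space "P l" by (rule prob_P)
  interpret Q: prob_space "gibbs (M l) (eta l w)" by (rule prob_gibbs)
  define y where "y x = u l d x - u l w x" for x
  have [measurable]: "y \<in> borel_measurable (M l)" unfolding y_def by measurable
  note L = L2_0_D[OF eta_diff_L2_0[of l d w]]
  have qi: "integrable (gibbs (M l) (eta l w)) (\<lambda>x. eta l d x - eta l w x)"
    using R.integrable_of_square[OF L(1,2)] by (rule gibbs_integrable[OF w])
  have yi: "integrable (gibbs (M l) (eta l w)) y"
    unfolding y_def u_diff using qi by simp
  have y2: "integrable (P l) (\<lambda>x. (y x)\<^sup>2)" unfolding y_def by (rule u_diff_sq_integrable)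
  have y2': "integrable (gibbs (M l) (eta l w)) (\<lambda>x. (y x)\<^sup>2)" by (rule gibbs_integrable[OF w y2])
  show kl: "kl = (\<integral>x. u l d x - u l w x \<partial>gibbs (M l) (eta l w))"
    unfolding u_diff kl_def using qi Q.prob_space by simp
  have b: "AE x in P l. \<bar>y x\<bar> \<le> 2 * ubound"
    using ubound(2)[OF d, of l] ubound(2)[OF w, of l] by eventually_elim (simp add: y_def)
  have ei: "integrable (gibbs (M l) (eta l w)) (\<lambda>x. exp (- y x))"
  proof (rule gibbs_integrable[OF w], rule R.integrable_const_bound)
    show "AE x in P l. norm (exp (- y x)) \<le> exp (2 * ubound)" using b by eventually_elim auto
  qed simp
  have e1: "(\<integral>x. exp (- y x) \<partial>gibbs (M l) (eta l w)) = 1" unfolding y_def by (rule gibbs_exp_u)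
  have eq: "(\<integral>x. exp (- y x) - 1 + y x \<partial>gibbs (M l) (eta l w)) = kl"
    using ei yi e1 Q.prob_space unfolding kl y_def[symmetric] by simp
  have AEb: "AE x in gibbs (M l) (eta l w). \<bar>y x\<bar> \<le> 2 * ubound" using b by (rule AE_gibbs[THEN iffD2])
  have "exp (- 3 * ubound) / 2 * Y = exp (- (2 * ubound)) / 2 * (exp (- ubound) * (\<integral>x. (y x)\<^sup>2 \<partial>P l))"
    unfolding Y_def y_def by (simp flip: exp_add)
  also have "\<dots> \<le> exp (- (2 * ubound)) / 2 * (\<integral>x. (y x)\<^sup>2 \<partial>gibbs (M l) (eta l w))"
    by (intro mult_left_mono gibbs_integral_bounds[OF w y2]) auto
  also have "\<dots> = (\<integral>x. exp (- (2 * ubound)) / 2 * (y x)\<^sup>2 \<partial>gibbs (M l) (eta l w))" by simp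
  also have "\<dots> \<le> (\<integral>x. exp (- y x) - 1 + y x \<partial>gibbs (M l) (eta l w))"
  proof (rule integral_mono_AE)
    show "AE x in gibbs (M l) (eta l w). exp (- (2 * ubound)) / 2 * (y x)\<^sup>2 \<le> exp (- y x) - 1 + y x"
      using AEb by eventually_elim (rule cosh_type_bounds)
  qed (use y2' ei yi in simp_all)
  finally show "exp (- 3 * ubound) / 2 * Y \<le> kl" unfolding eq .
  have "(\<integral>x. exp (- y x) - 1 + y x \<partial>gibbs (M l) (eta l w)) \<le> (\<integral>x. exp (2 * ubound) / 2 * (y x)\<^sup>2 \<partial>gibbs (M l) (eta l w))"
  proof (rule integral_mono_AE)
    show "AE x in gibbs (M l) (eta l w). exp (- y x) - 1 + y x \<le> exp (2 * ubound) / 2 * (y x)\<^sup>2"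
      using AEb by eventually_elim (rule cosh_type_bounds)
  qed (use y2' ei yi in simp_all)
  also have "\<dots> = exp (2 * ubound) / 2 * (\<integral>x. (y x)\<^sup>2 \<partial>gibbs (M l) (eta l w))" by simp
  also have "\<dots> \<le> exp (2 * ubound) / 2 * (exp ubound * (\<integral>x. (y x)\<^sup>2 \<partial>P l))"
    by (intro mult_left_mono gibbs_integral_bounds[OF w y2]) auto
  also have "\<dots> = exp (3 * ubound) / 2 * Y"
    unfolding Y_def y_def by (simp flip: exp_add)
  finally show "kl \<le> exp (3 * ubound) / 2 * Y" unfolding eq .
qed

text \<open>\<open>F l d - F l w\<close> lies between the means of \<open>eta l d - eta l w\<close> under \<open>w\<close> and under \<open>d\<close>.\<close>

lemma u_diff_sq:
  fixes l :: 'm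
  assumes d: "d \<in> N" and w: "w \<in> N"
  defines "Q \<equiv> (\<integral>x. (eta l d x - eta l w x)\<^sup>2 \<partial>P l)"
  shows "Q \<le> (\<integral>x. (u l d x - u l w x)\<^sup>2 \<partial>P l)" "(\<integral>x. (u l d x - u l w x)\<^sup>2 \<partial>P l) \<le> (1 + exp ubound) * Q"
    "(F l d - F l w)\<^sup>2 \<le> exp ubound * Q"
proof -
  interpret R: prob_space "P l" by (rule prob_P)
  note L = L2_0_D[OF eta_diff_L2_0[of l d w]] and L' = L2_0_D[OF eta_diff_L2_0[of l w d]]
  note qi = R.integrable_of_square[OF L(1,2)]
  define c where "c = F l d - F l w"
  define q where "q x = eta l d x - eta l w x" for x
  have q: "integrable (P l) q" "integrable (P l) (\<lambda>x. (q x)\<^sup>2)" "(\<integral>x. q x \<partial>P l) = 0"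
    using qi L by (simp_all add: q_def[abs_def])
  \<comment> \<open>Under \<open>\<tau>0\<close> all \<open>eta\<close> are centred, so the cross
    term vanishes and only \<open>F l d - F l w\<close> remains to be bounded.\<close>
  have "(\<integral>x. (u l d x - u l w x)\<^sup>2 \<partial>P l) = (\<integral>x. c\<^sup>2 - 2 * c * q x + (q x)\<^sup>2 \<partial>P l)"
    unfolding u_diff c_def[symmetric] q_def[symmetric] by (simp add: power2_diff algebra_simps)
  also have "\<dots> = c\<^sup>2 + Q"
    using q R.prob_space unfolding Q_def q_def[symmetric] by simp
  also have "\<dots> = (F l d - F l w)\<^sup>2 + Q" by (simp add: c_def)
  finally have eq: "(\<integral>x. (u l d x - u l w x)\<^sup>2 \<partial>P l) = (F l d - F l w)\<^sup>2 + Q" .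
  then show "Q \<le> (\<integral>x. (u l d x - u l w x)\<^sup>2 \<partial>P l)" by simp
  have nn: "0 \<le> F l d' - F l w' - (\<integral>x. eta l d' x - eta l w' x \<partial>gibbs (M l) (eta l w'))" if "d' \<in> N" "w' \<in> N" for d' w'
    using KL_sample(2)[OF that, of l] by (rule order_trans[rotated]) simp
  have "(\<integral>x. eta l d x - eta l w x \<partial>gibbs (M l) (eta l w)) \<le> F l d - F l w" using nn[OF d w] by simp
  moreover have "F l d - F l w \<le> - (\<integral>x. eta l w x - eta l d x \<partial>gibbs (M l) (eta l d))" using nn[OF w d] by simp
  \<comment> \<open>A number between two others is at most as large in modulus as one of
    them.\<close>
  ultimately have "\<bar>F l d - F l w\<bar> \<le> \<bar>\<integral>x. eta l d x - eta l w x \<partial>gibbs (M l) (eta l w)\<bar> \<or>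
    \<bar>F l d - F l w\<bar> \<le> \<bar>\<integral>x. eta l w x - eta l d x \<partial>gibbs (M l) (eta l d)\<bar>" by linarith
  then have "(F l d - F l w)\<^sup>2 \<le> (\<integral>x. eta l d x - eta l w x \<partial>gibbs (M l) (eta l w))\<^sup>2 \<or>
    (F l d - F l w)\<^sup>2 \<le> (\<integral>x. eta l w x - eta l d x \<partial>gibbs (M l) (eta l d))\<^sup>2"
    by (simp add: abs_le_square_iff)
  moreover have "(\<integral>x. eta l d x - eta l w x \<partial>gibbs (M l) (eta l w))\<^sup>2 \<le> exp ubound * Q"
    unfolding Q_def using L by (intro gibbs_integral_sq_le[OF w]) auto
  moreover have "(\<integral>x. eta l w x - eta l d x \<partial>gibbs (M l) (eta l d))\<^sup>2 \<le> exp ubound * Q"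
    using gibbs_integral_sq_le[OF d, of "\<lambda>x. eta l w x - eta l d x" l] L' unfolding Q_def by (simp add: power2_commute)
  ultimately show F2: "(F l d - F l w)\<^sup>2 \<le> exp ubound * Q" by linarith
  show "(\<integral>x. (u l d x - u l w x)\<^sup>2 \<partial>P l) \<le> (1 + exp ubound) * Q"
    using F2 unfolding eq by (simp add: algebra_simps)
qed

lemma Deta_bounded_linear:
  assumes t: "t \<in> N"
  shows "L2_bounded_linear (P l) (Deta l t)"
proof -
  note A = L2_bounded_linear_D[OF D\<theta>_bounded_linear[OF t, of l]] and B = L2_bounded_linear_D[OF Dh_bounded_linear[OF t, of l]]
  obtain B1 where B1: "\<And>\<zeta>. L2_norm (P l) (D\<theta> l t \<zeta>) \<le> B1 * norm \<zeta>" using A(4) by blast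
  obtain B2 where B2: "\<And>g. L2_norm (P l) (Dh l t g) \<le> B2 * norm g" using B(4) by blast
  have "L2_norm (P l) (Deta l t v) \<le> (\<bar>B1\<bar> + \<bar>B2\<bar>) * norm v" for v
  proof -
    have "L2_norm (P l) (Deta l t v) \<le> L2_norm (P l) (D\<theta> l t (fst v)) + L2_norm (P l) (Dh l t (snd v))"
      unfolding Deta_def[abs_def] by (intro L2_norm_triangle L2_0_D D_L2_0 t)
    also have "\<dots> \<le> B1 * norm (fst v) + B2 * norm (snd v)" by (intro add_mono B1 B2)
    also have "\<dots> \<le> \<bar>B1\<bar> * norm v + \<bar>B2\<bar> * norm v"
    proof (rule add_mono)
      show "B1 * norm (fst v) \<le> \<bar>B1\<bar> * norm v"
        using mult_mono[of B1 "\<bar>B1\<bar>" "norm (fst v)" "norm v"] norm_fst_le[of "fst v" "snd v"] by simp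
      show "B2 * norm (snd v) \<le> \<bar>B2\<bar> * norm v"
        using mult_mono[of B2 "\<bar>B2\<bar>" "norm (snd v)" "norm v"] norm_snd_le[of "snd v" "fst v"] by simp
    qed
    finally show ?thesis by (simp add: distrib_right)
  qed
  moreover have "AE x in P l. Deta l t (v + w) x = Deta l t v x + Deta l t w x" for v w
    using A(2)[of "fst v" "fst w"] B(2)[of "snd v" "snd w"] by eventually_elim (simp add: Deta_def)
  moreover have "AE x in P l. Deta l t (c *\<^sub>R v) x = c * Deta l t v x" for c v
    using A(3)[of c "fst v"] B(3)[of c "snd v"] by eventually_elim (simp add: Deta_def distrib_left)
  ultimately show ?thesis using Deta_L2_0[OF t] unfolding L2_bounded_linear_def by blast
qed

lemma gibbs_integrable_L2_0:
  assumes "w \<in> N" "f \<in> L2_0 (P l)"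
  shows "integrable (gibbs (M l) (eta l w)) f"
proof -
  interpret R: prob_space "P l" by (rule prob_P)
  have "integrable (P l) f" by (rule R.integrable_of_square[OF L2_0_D(1,2)[OF assms(2)]])
  then show ?thesis by (rule gibbs_integrable[OF assms(1)])
qed

text \<open>The derivative of \<open>F l\<close> at \<open>w\<close> in the direction
  \<open>v\<close>, written as the mean under \<open>w\<close> of the derivative of
  \<open>eta l\<close>.\<close>

definition mw :: "'m \<Rightarrow> (real^'p) \<times> 'h \<Rightarrow> (real^'p) \<times> 'h \<Rightarrow> real" where
  "mw l w v = (\<integral>x. Deta l w v x \<partial>gibbs (M l) (eta l w))"

text \<open>\<open>tang l w v\<close> is the derivative of \<open>u l\<close> at \<open>w\<close> in the direction \<open>v\<close>.\<close>

definition tang :: "'m \<Rightarrow> (real^'p) \<times> 'h \<Rightarrow> (real^'p) \<times> 'h \<Rightarrow> 'x \<Rightarrow> real" where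
  "tang l w v x = mw l w v - Deta l w v x"

lemma tang_measurable: "w \<in> N \<Longrightarrow> tang l w v \<in> borel_measurable (M l)"
  unfolding tang_def using Deta_measurable[of w l v] by measurable

lemma mw_sq: "w \<in> N \<Longrightarrow> (mw l w v)\<^sup>2 \<le> exp ubound * (\<integral>x. (Deta l w v x)\<^sup>2 \<partial>P l)"
  unfolding mw_def using L2_0_D[OF Deta_L2_0] by (intro gibbs_integral_sq_le Deta_measurable)

lemma tang_sq:
  assumes w: "w \<in> N"
  shows "integrable (P l) (tang l w v)" "integrable (P l) (\<lambda>x. (tang l w v x)\<^sup>2)" "(\<integral>x. tang l w v x \<partial>P l) = mw l w v"
    "(\<integral>x. (tang l w v x)\<^sup>2 \<partial>P l) \<le> (1 + exp ubound) * (\<integral>x. (Deta l w v x)\<^sup>2 \<partial>P l)"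
proof -
  interpret R: prob_space "P l" by (rule prob_P)
  note L = L2_0_D[OF Deta_L2_0[OF w, of l v]]
  note i = R.integrable_of_square[OF L(1,2)]
  show 1: "integrable (P l) (tang l w v)" unfolding tang_def[abs_def] using i by simp
  have sq: "(tang l w v x)\<^sup>2 = (mw l w v)\<^sup>2 - 2 * mw l w v * Deta l w v x + (Deta l w v x)\<^sup>2" for x
    by (simp add: tang_def power2_diff)
  show "integrable (P l) (\<lambda>x. (tang l w v x)\<^sup>2)" unfolding sq using i L(2) by simp
  show "(\<integral>x. tang l w v x \<partial>P l) = mw l w v"
    unfolding tang_def using i L(3) R.prob_space by simp
  have "(\<integral>x. (tang l w v x)\<^sup>2 \<partial>P l) = (mw l w v)\<^sup>2 + (\<integral>x. (Deta l w v x)\<^sup>2 \<partial>P l)"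
    unfolding sq using i L R.prob_space by simp
  then show "(\<integral>x. (tang l w v x)\<^sup>2 \<partial>P l) \<le> (1 + exp ubound) * (\<integral>x. (Deta l w v x)\<^sup>2 \<partial>P l)"
    using mw_sq[OF w, of l v] by (simp add: algebra_simps)
qed

lemma gibbs_integral_tang:
  assumes w: "w \<in> N"
  shows "(\<integral>x. tang l w v x \<partial>gibbs (M l) (eta l w)) = 0"
proof -
  interpret R: prob_space "P l" by (rule prob_P)
  interpret Q: prob_space "gibbs (M l) (eta l w)" by (rule prob_gibbs)
  note L = L2_0_D[OF Deta_L2_0[OF w, of l v]]
  have "integrable (gibbs (M l) (eta l w)) (Deta l w v)"
    by (rule gibbs_integrable[OF w R.integrable_of_square[OF L(1,2)]])
  then show ?thesis unfolding tang_def using Q.prob_space by (simp add: mw_def)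
qed

lemma mw_scale:
  assumes w: "w \<in> N"
  shows "mw l w (c *\<^sub>R v) = c * mw l w v"
proof -
  have "AE x in P l. Deta l w (c *\<^sub>R v) x = c * Deta l w v x"
    by (rule L2_bounded_linear_D(3)[OF Deta_bounded_linear[OF w]])
  then have "AE x in gibbs (M l) (eta l w). Deta l w (c *\<^sub>R v) x = c * Deta l w v x"
    by (rule AE_gibbs[THEN iffD2])
  then have "mw l w (c *\<^sub>R v) = (\<integral>x. c * Deta l w v x \<partial>gibbs (M l) (eta l w))"
    unfolding mw_def using Deta_measurable[OF w] by (intro integral_cong_AE) auto
  then show ?thesis by (simp add: mw_def)
qed

text \<open>By \<open>KL_sample\<close> the Kullback-Leibler divergence between the laws at
  \<open>w\<close> and \<open>d\<close>, with the expectation taken under \<open>w\<close>. The two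
  orders add up to a summand of \<open>SKL\<close>.\<close>

definition kl :: "'m \<Rightarrow> (real^'p) \<times> 'h \<Rightarrow> (real^'p) \<times> 'h \<Rightarrow> real" where
  "kl l d w = F l d - F l w - (\<integral>x. eta l d x - eta l w x \<partial>gibbs (M l) (eta l w))"

lemma kl_bounds:
  assumes d: "d \<in> N" and w: "w \<in> N"
  defines "Q \<equiv> \<lambda>l. (\<integral>x. (eta l d x - eta l w x)\<^sup>2 \<partial>P l)"
  shows "0 \<le> kl l d w" "exp (- 3 * ubound) / 2 * Q l \<le> kl l d w"
    "kl l d w \<le> exp (3 * ubound) / 2 * (1 + exp ubound) * Q l"
proof -
  note k = KL_sample[OF d w, of l, folded kl_def] and q = u_diff_sq[OF d w, of l]
  have Q0: "0 \<le> Q l" by (simp add: Q_def)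
  have "exp (- 3 * ubound) / 2 * Q l \<le> exp (- 3 * ubound) / 2 * (\<integral>x. (u l d x - u l w x)\<^sup>2 \<partial>P l)"
    using q(1) unfolding Q_def by (intro mult_left_mono) auto
  also note k(2)
  finally show 1: "exp (- 3 * ubound) / 2 * Q l \<le> kl l d w" .
  have "0 \<le> exp (- 3 * ubound) / 2 * Q l" using Q0 by simp
  with 1 show "0 \<le> kl l d w" by linarith
  note k(3)
  also have "exp (3 * ubound) / 2 * (\<integral>x. (u l d x - u l w x)\<^sup>2 \<partial>P l) \<le> exp (3 * ubound) / 2 * ((1 + exp ubound) * Q l)"
    using q(2) unfolding Q_def by (intro mult_left_mono) auto
  finally show "kl l d w \<le> exp (3 * ubound) / 2 * (1 + exp ubound) * Q l" by (simp only: mult.assoc)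
qed

lemma L2_norm_const: "L2_norm (P l) (\<lambda>x. c) = \<bar>c\<bar>"
proof -
  interpret R: prob_space "P l" by (rule prob_P)
  show ?thesis using R.prob_space by (simp add: L2_norm_def)
qed

text \<open>The increment of \<open>F l\<close> is the mean under \<open>w\<close> of the increment
  of \<open>eta l\<close>, plus a divergence that is quadratic in \<open>s\<close>. Hence
  \<open>F l\<close> inherits its derivative from \<open>eta l\<close>, without differentiation
  under the integral of the exponential.\<close>

lemma u_ray_derivative:
  assumes w: "w \<in> N"
  shows "L2_ray_derivative (P l) (\<lambda>s. u l (w + s *\<^sub>R v)) (tang l w v)"
  unfolding L2_ray_derivative_def
proof (intro allI impI)
  fix \<epsilon> :: real assume e: "0 < \<epsilon>"
  interpret R: prob_space "P l" by (rule prob_P)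
  interpret Q: prob_space "gibbs (M l) (eta l w)" by (rule prob_gibbs)
  define A where "A = L2_norm (P l) (Deta l w v) + 1"
  define K where "K = exp (3 * ubound) / 2 * (1 + exp ubound)"
  have A: "0 < A" using L2_norm_nonneg[of "P l" "Deta l w v"] by (simp add: A_def)
  have K: "0 < K" by (simp add: K_def add_pos_pos)
  define e' where "e' = min 1 (\<epsilon> / (2 * (exp ubound + 1)))"
  have e': "0 < e'" "e' \<le> 1" "(exp ubound + 1) * e' \<le> \<epsilon> / 2"
  proof -
    have "0 < exp ubound + 1" by (simp add: add_pos_pos)
    then show "0 < e'" using e by (simp add: e'_def)
    show "e' \<le> 1" by (simp add: e'_def)
    have "e' \<le> \<epsilon> / (2 * (exp ubound + 1))" by (simp add: e'_def)
    then have "e' * (2 * (exp ubound + 1)) \<le> \<epsilon>"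
      using \<open>0 < exp ubound + 1\<close> by (subst (asm) pos_le_divide_eq) auto
    then show "(exp ubound + 1) * e' \<le> \<epsilon> / 2" by (simp add: algebra_simps)
  qed
  obtain d1 where d1: "0 < d1" "\<And>s. \<bar>s\<bar> < d1 \<Longrightarrow>
    L2_norm (P l) (\<lambda>x. eta l (w + s *\<^sub>R v) x - eta l (w + 0 *\<^sub>R v) x - s * Deta l w v x) \<le> e' * \<bar>s\<bar>"
    using eta_ray_derivative[OF w, of l v] e'(1) unfolding L2_ray_derivative_def by meson
  obtain d2 where d2: "0 < d2" "\<And>y. dist y w < d2 \<Longrightarrow> y \<in> N" using open_N w unfolding open_dist by meson
  \<comment> \<open>The three bounds make the expansion of \<open>eta\<close> valid, keep
    \<open>y\<close> in the neighborhood and push the quadratic divergence below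
    \<open>\<epsilon> / 2 * \<bar>s\<bar>\<close>.\<close>
  define d where "d = min d1 (min (d2 / (norm v + 1)) (\<epsilon> / (2 * (K * A\<^sup>2))))"
  have nv: "0 < norm v + 1" by (simp add: add_nonneg_pos)
  have KA: "0 < K * A\<^sup>2" using K A by simp
  have d0: "0 < d" using d1(1) d2(1) nv KA e by (simp add: d_def)
  show "\<exists>\<delta>>0. \<forall>s. \<bar>s\<bar> < \<delta> \<longrightarrow> L2_norm (P l) (\<lambda>x. u l (w + s *\<^sub>R v) x - u l (w + 0 *\<^sub>R v) x - s * tang l w v x) \<le> \<epsilon> * \<bar>s\<bar>"
  proof (intro exI[of _ d] conjI d0 allI impI)
    fix s :: real assume s: "\<bar>s\<bar> < d"
    define y where "y = w + s *\<^sub>R v"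
    have "\<bar>s\<bar> * norm v \<le> \<bar>s\<bar> * (norm v + 1)" by (intro mult_left_mono) auto
    also have "\<dots> < d2" using s nv by (simp add: d_def pos_less_divide_eq)
    finally have y: "y \<in> N" by (intro d2(2)) (simp add: y_def dist_norm)
    define q where "q x = eta l y x - eta l w x" for x
    define h where "h x = q x - s * Deta l w v x" for x
    have qL: "q \<in> L2_0 (P l)" unfolding q_def by (rule eta_diff_L2_0)
    have hL: "h \<in> L2_0 (P l)" unfolding h_def by (intro L2_0_diff L2_0_scale prob_P qL Deta_L2_0 w)
    have hn: "L2_norm (P l) h \<le> e' * \<bar>s\<bar>"
      using d1(2)[of s] s by (simp add: d_def h_def[abs_def] q_def y_def)
    have hn2: "e' * \<bar>s\<bar> \<le> \<bar>s\<bar>" using e'(1,2) by (intro mult_left_le_one_le) auto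
    have "L2_norm (P l) q = L2_norm (P l) (\<lambda>x. h x + s * Deta l w v x)" by (simp add: h_def)
    also have "\<dots> \<le> L2_norm (P l) h + L2_norm (P l) (\<lambda>x. s * Deta l w v x)"
      by (intro L2_norm_triangle L2_0_D hL L2_0_scale Deta_L2_0 w)
    also have "\<dots> \<le> \<bar>s\<bar> + \<bar>s\<bar> * L2_norm (P l) (Deta l w v)"
      using hn hn2 by (simp add: L2_norm_scale)
    also have "\<dots> = \<bar>s\<bar> * A" by (simp add: A_def algebra_simps)
    finally have qn: "L2_norm (P l) q \<le> \<bar>s\<bar> * A" .
    have "(L2_norm (P l) q)\<^sup>2 \<le> (\<bar>s\<bar> * A)\<^sup>2" using qn L2_norm_nonneg by (intro power_mono)
    then have q2: "(\<integral>x. (q x)\<^sup>2 \<partial>P l) \<le> s\<^sup>2 * A\<^sup>2" by (simp add: L2_norm_sq power_mult_distrib)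
    have "kl l y w \<le> K * (\<integral>x. (q x)\<^sup>2 \<partial>P l)" unfolding K_def q_def by (rule kl_bounds(3)[OF y w])
    also have "\<dots> \<le> K * (s\<^sup>2 * A\<^sup>2)" using q2 K by (intro mult_left_mono) auto
    also have "\<dots> = (K * A\<^sup>2 * \<bar>s\<bar>) * \<bar>s\<bar>" by (simp add: power2_eq_square abs_mult_self_eq mult_ac)
    also have "\<dots> \<le> (\<epsilon> / 2) * \<bar>s\<bar>"
    proof (rule mult_right_mono)
      have "\<bar>s\<bar> \<le> \<epsilon> / (2 * (K * A\<^sup>2))" using s by (simp add: d_def)
      then show "K * A\<^sup>2 * \<bar>s\<bar> \<le> \<epsilon> / 2" using KA by (simp add: pos_le_divide_eq mult_ac)
    qed simp
    finally have kle: "kl l y w \<le> \<epsilon> / 2 * \<bar>s\<bar>" .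
    have kl0: "0 \<le> kl l y w" by (rule kl_bounds(1)[OF y w])
    have ih: "integrable (gibbs (M l) (eta l w)) h" "integrable (gibbs (M l) (eta l w)) q"
      "integrable (gibbs (M l) (eta l w)) (Deta l w v)"
      by (rule gibbs_integrable_L2_0[OF w hL] gibbs_integrable_L2_0[OF w qL] gibbs_integrable_L2_0[OF w Deta_L2_0[OF w]])+
    have Eh: "(\<integral>x. h x \<partial>gibbs (M l) (eta l w)) = (\<integral>x. q x \<partial>gibbs (M l) (eta l w)) - s * mw l w v"
      unfolding h_def mw_def using ih by simp
    have "(\<integral>x. h x \<partial>gibbs (M l) (eta l w))\<^sup>2 \<le> exp ubound * (\<integral>x. (h x)\<^sup>2 \<partial>P l)"
      using L2_0_D[OF hL] by (intro gibbs_integral_sq_le[OF w]) auto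
    also have "\<dots> \<le> (exp ubound)\<^sup>2 * (L2_norm (P l) h)\<^sup>2"
      unfolding L2_norm_sq power2_eq_square[of "exp ubound"] using ubound(1) by (intro mult_right_mono) auto
    also have "\<dots> = (exp ubound * L2_norm (P l) h)\<^sup>2" by (simp add: power_mult_distrib)
    finally have "\<bar>\<integral>x. h x \<partial>gibbs (M l) (eta l w)\<bar> \<le> exp ubound * L2_norm (P l) h"
      by (rule abs_le_square_iff[THEN iffD2, THEN order_trans]) (simp add: L2_norm_nonneg)
    also have "\<dots> \<le> exp ubound * (e' * \<bar>s\<bar>)" using hn by (intro mult_left_mono) auto
    finally have Eh2: "\<bar>\<integral>x. h x \<partial>gibbs (M l) (eta l w)\<bar> \<le> exp ubound * (e' * \<bar>s\<bar>)" .
    define c where "c = F l y - F l w - s * mw l w v"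
    have c: "c = kl l y w + (\<integral>x. h x \<partial>gibbs (M l) (eta l w))"
      unfolding c_def kl_def q_def[symmetric] Eh by simp
    have cb: "\<bar>c\<bar> \<le> \<epsilon> / 2 * \<bar>s\<bar> + exp ubound * (e' * \<bar>s\<bar>)"
      using kle kl0 Eh2 unfolding c by linarith
    have "L2_norm (P l) (\<lambda>x. u l y x - u l w x - s * tang l w v x) = L2_norm (P l) (\<lambda>x. c + - 1 * h x)"
      unfolding u_diff c_def h_def q_def tang_def by (simp add: algebra_simps)
    also have "\<dots> \<le> L2_norm (P l) (\<lambda>x. c) + L2_norm (P l) (\<lambda>x. - 1 * h x)"
      by (intro L2_norm_triangle L2_0_D(1,2)[OF L2_0_scale[OF hL, of "- 1"]]) auto
    also have "\<dots> = \<bar>c\<bar> + L2_norm (P l) h" unfolding L2_norm_const L2_norm_scale by simp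
    also have "\<dots> \<le> \<epsilon> / 2 * \<bar>s\<bar> + exp ubound * (e' * \<bar>s\<bar>) + e' * \<bar>s\<bar>" using cb hn by simp
    also have "\<dots> = \<epsilon> / 2 * \<bar>s\<bar> + ((exp ubound + 1) * e') * \<bar>s\<bar>" by (simp add: algebra_simps)
    also have "\<dots> \<le> \<epsilon> / 2 * \<bar>s\<bar> + \<epsilon> / 2 * \<bar>s\<bar>" using e'(3) by (intro add_left_mono mult_right_mono) auto
    finally show "L2_norm (P l) (\<lambda>x. u l (w + s *\<^sub>R v) x - u l (w + 0 *\<^sub>R v) x - s * tang l w v x) \<le> \<epsilon> * \<bar>s\<bar>"
      by (simp add: y_def)
  qed
qed

subsection \<open>Consequences of convexity\<close>

definition emp :: "('m \<Rightarrow> nat) \<Rightarrow> ('m \<Rightarrow> 'x \<Rightarrow> real) \<Rightarrow> 'w \<Rightarrow> real" where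
  "emp n f \<omega> = (\<Sum>l\<in>UNIV. 1 / real (n l) * (\<Sum>i<n l. f l (X l i \<omega>)))"

lemma total_nll_diff:
  assumes n: "\<And>l. 0 < n l"
  shows "total_nll M eta n (\<lambda>l i. X l i \<omega>) d - total_nll M eta n (\<lambda>l i. X l i \<omega>) w = emp n (\<lambda>l x. u l d x - u l w x) \<omega>"
  unfolding total_nll_def nll_def emp_def sum_subtractf[symmetric] F_def[symmetric]
proof (intro sum.cong refl)
  fix l
  have n': "real (n l) \<noteq> 0" using n[of l] by simp
  have "(\<Sum>i<n l. u l d (X l i \<omega>) - u l w (X l i \<omega>)) = real (n l) * (F l d - F l w) - ((\<Sum>i<n l. eta l d (X l i \<omega>)) - (\<Sum>i<n l. eta l w (X l i \<omega>)))"
    by (simp add: u_diff sum_subtractf)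
  then show "- (1 / real (n l)) * (\<Sum>i<n l. eta l d (X l i \<omega>)) + F l d - (- (1 / real (n l)) * (\<Sum>i<n l. eta l w (X l i \<omega>)) + F l w)
    = 1 / real (n l) * (\<Sum>i<n l. u l d (X l i \<omega>) - u l w (X l i \<omega>))"
    using n' by (simp add: right_diff_distrib diff_divide_distrib)
qed

lemma X_measurable' [measurable]: "X l i \<in> measurable \<Omega> (M l)"
  by (rule X_measurable)

lemma X_integral:
  fixes f :: "'x \<Rightarrow> real"
  assumes f: "integrable (P l) f"
  shows "integrable \<Omega> (\<lambda>\<omega>. f (X l i \<omega>))" "expectation (\<lambda>\<omega>. f (X l i \<omega>)) = (\<integral>x. f x \<partial>P l)"
proof -
  have m: "f \<in> borel_measurable (M l)" using borel_measurable_integrable[OF f] by simp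
  show "integrable \<Omega> (\<lambda>\<omega>. f (X l i \<omega>))"
    using integrable_distr_eq[OF X_measurable m, of i] f by (simp add: X_law)
  show "expectation (\<lambda>\<omega>. f (X l i \<omega>)) = (\<integral>x. f x \<partial>P l)"
    using integral_distr[OF X_measurable m, of i] by (simp add: X_law)
qed

lemma AE_X:
  assumes "AE x in P l. Q x"
  shows "AE \<omega> in \<Omega>. Q (X l i \<omega>)"
proof -
  have "AE x in distr \<Omega> (M l) (X l i). Q x" unfolding X_law by (rule assms)
  then show ?thesis by (rule AE_distrD[OF X_measurable])
qed

lemma emp_integrable:
  assumes "\<And>l. integrable (P l) (f l)"
  shows "integrable \<Omega> (emp n f)"
  unfolding emp_def[abs_def] using X_integral(1)[OF assms] by simp

lemma emp_abs_le:
  assumes f: "\<And>l. integrable (P l) (f l)" and n: "\<And>l. 0 < n l"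
  shows "expectation (\<lambda>\<omega>. \<bar>emp n f \<omega>\<bar>) \<le> (\<Sum>l\<in>UNIV. \<integral>x. \<bar>f l x\<bar> \<partial>P l)"
proof -
  have fa: "integrable (P l) (\<lambda>x. \<bar>f l x\<bar>)" for l using f by simp
  have "expectation (\<lambda>\<omega>. \<bar>emp n f \<omega>\<bar>) \<le> expectation (emp n (\<lambda>l x. \<bar>f l x\<bar>))"
  proof (rule integral_mono)
    fix \<omega>
    have "\<bar>emp n f \<omega>\<bar> \<le> (\<Sum>l\<in>UNIV. \<bar>1 / real (n l) * (\<Sum>i<n l. f l (X l i \<omega>))\<bar>)"
      unfolding emp_def by (rule sum_abs)
    also have "\<dots> \<le> emp n (\<lambda>l x. \<bar>f l x\<bar>) \<omega>"
      unfolding emp_def abs_mult by (intro sum_mono mult_mono) (auto intro: sum_abs)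
    finally show "\<bar>emp n f \<omega>\<bar> \<le> emp n (\<lambda>l x. \<bar>f l x\<bar>) \<omega>" .
  qed (use emp_integrable[OF f] emp_integrable[OF fa] in auto)
  also have "\<dots> = (\<Sum>l\<in>UNIV. 1 / real (n l) * (\<Sum>i<n l. \<integral>x. \<bar>f l x\<bar> \<partial>P l))"
    unfolding emp_def using X_integral[OF fa] by simp
  also have "\<dots> = (\<Sum>l\<in>UNIV. \<integral>x. \<bar>f l x\<bar> \<partial>P l)"
    using n by (intro sum.cong) (auto simp: less_imp_neq[symmetric])
  finally show ?thesis .
qed

text \<open>The essential infimum of \<open>emp n B\<close> is the sum of those of the \<open>B l\<close>, since independent observations
  come close to their infima simultaneously.\<close>

lemma ess_inf_exists:
  fixes B :: "'m \<Rightarrow> 'x \<Rightarrow> real"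
  assumes B: "\<And>l. B l \<in> borel_measurable (M l)" and n: "\<And>l. 0 < n l"
    and pos: "AE \<omega> in \<Omega>. 0 \<le> emp n B \<omega>"
  shows "\<exists>a. 0 \<le> (\<Sum>l\<in>UNIV. a l) \<and> (\<forall>l. AE x in P l. a l \<le> B l x)"
proof -
  \<comment> \<open>The essential infimum of \<open>B l\<close> is \<open>Inf (T l)\<close>:
    \<open>B l\<close> falls below each level in \<open>T l\<close> with positive probability, and
    almost never below their infimum.\<close>
  define T where "T l = {c. 0 < measure (P l) {x\<in>space (M l). B l x < c}}" for l
  have Bs: "{x\<in>space (M l). B l x < c} \<in> sets (M l)" for l c using B[of l] by measurable
  have key: "0 \<le> (\<Sum>l\<in>UNIV. c l)" if c: "\<And>l. c l \<in> T l" for c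
  proof (rule ccontr)
    assume neg: "\<not> 0 \<le> (\<Sum>l\<in>UNIV. c l)"
    define I where "I = Sigma UNIV (\<lambda>l. {..<n l})"
    define A where "A = (\<lambda>(l, i :: nat). {x\<in>space (M l). B l x < c l})"
    define E where "E = (\<Inter>j\<in>I. (\<lambda>(l, i). X l i) j -` A j \<inter> space \<Omega>)"
    have I: "finite I" "I \<noteq> {}" using n by (auto simp: I_def)
    have prA: "prob ((\<lambda>(l, i). X l i) j -` A j \<inter> space \<Omega>) > 0" for j
    proof (cases j)
      case (Pair l i)
      have "prob (X l i -` {x\<in>space (M l). B l x < c l} \<inter> space \<Omega>) = measure (distr \<Omega> (M l) (X l i)) {x\<in>space (M l). B l x < c l}"
        using Bs X_measurable by (intro measure_distr[symmetric]) auto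
      also have "\<dots> > 0" using c[of l] by (simp add: X_law T_def)
      finally show ?thesis by (simp add: Pair A_def)
    qed
    have "prob E = (\<Prod>j\<in>I. prob ((\<lambda>(l, i). X l i) j -` A j \<inter> space \<Omega>))"
      unfolding E_def using I Bs by (intro indep_varsD[OF X_indep]) (auto simp: A_def)
    also have "\<dots> > 0" using prA by (intro prod_pos) auto
    finally have pE: "0 < prob E" .
    have Em: "E \<in> events"
      unfolding E_def using I Bs X_measurable by (intro sets.finite_INT) (auto simp: A_def intro!: measurable_sets)
    have "AE \<omega> in \<Omega>. \<omega> \<notin> E"
      using pos
    proof eventually_elim
      case (elim \<omega>)
      show ?case
      proof
        assume \<omega>: "\<omega> \<in> E"
        have "B l (X l i \<omega>) \<le> c l" if "i < n l" for l i
        proof -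
          have "(l, i) \<in> I" using that by (simp add: I_def)
          then have "\<omega> \<in> (\<lambda>(l, i). X l i) (l, i) -` A (l, i) \<inter> space \<Omega>" using \<omega> unfolding E_def by blast
          then show ?thesis by (simp add: A_def)
        qed
        then have "(\<Sum>i<n l. B l (X l i \<omega>)) \<le> real (n l) * c l" for l
          using sum_bounded_above[of "{..<n l}" "\<lambda>i. B l (X l i \<omega>)" "c l"] by simp
        then have "emp n B \<omega> \<le> (\<Sum>l\<in>UNIV. 1 / real (n l) * (real (n l) * c l))"
          unfolding emp_def by (intro sum_mono mult_left_mono) auto
        also have "\<dots> = (\<Sum>l\<in>UNIV. c l)" using n by (intro sum.cong) (auto simp: less_imp_neq[symmetric])
        finally show False using elim neg by simp
      qed
    qed
    then have "prob E = 0" using prob_eq_0[OF Em] by simp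
    then show False using pE by simp
  qed
  have ne: "T l \<noteq> {}" for l
  proof
    interpret R: prob_space "P l" by (rule prob_P)
    assume "T l = {}"
    then have "R.prob {x\<in>space (M l). B l x < real k} = 0" for k :: nat
      by (auto simp: T_def zero_less_measure_iff)
    then have "AE x in P l. x \<notin> {x\<in>space (M l). B l x < real k}" for k :: nat
      using R.prob_eq_0[of "{x\<in>space (M l). B l x < real k}"] Bs by simp
    then have "AE x in P l. \<forall>k::nat. x \<notin> {x\<in>space (M l). B l x < real k}"
      by (rule AE_all_countable[THEN iffD2, OF allI])
    then have "AE x in P l. False"
      using AE_space by eventually_elim (use reals_Archimedean2 in auto)
    then show False by simp
  qed
  define c0 where "c0 l = (SOME c. c \<in> T l)" for l
  have c0: "c0 l \<in> T l" for l unfolding c0_def using ne[of l] by (simp add: some_in_eq)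
  \<comment> \<open>Fixed levels \<open>c0\<close> for the other samples bound \<open>T l\<close>
    from below, so the infima are finite.\<close>
  have below: "- (\<Sum>k\<in>UNIV - {l}. c0 k) \<le> c" if "c \<in> T l" for c l
  proof -
    have "0 \<le> (\<Sum>k\<in>UNIV. (c0(l := c)) k)" using that c0 by (intro key) auto
    also have "\<dots> = c + (\<Sum>k\<in>UNIV - {l}. c0 k)" by (subst sum.remove[of _ l]) auto
    finally show ?thesis by simp
  qed
  define a where "a l = Inf (T l)" for l
  have bdd: "bdd_below (T l)" for l using below by (intro bdd_belowI) auto
  have near: "\<exists>c\<in>T l. c < a l + e" if "0 < e" for l e
    using cInf_lessD[OF ne, of l "a l + e"] that by (auto simp: a_def)
  have "0 \<le> (\<Sum>l\<in>UNIV. a l)"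
  proof (rule field_le_epsilon)
    fix e :: real assume e: "0 < e"
    define e' where "e' = e / real CARD('m)"
    have e': "0 < e'" using e by (simp add: e'_def)
    then have "\<forall>l. \<exists>c. c \<in> T l \<and> c < a l + e'" using near by blast
    from choice[OF this] obtain c where c: "\<And>l. c l \<in> T l" "\<And>l. c l < a l + e'" by blast
    have "0 \<le> (\<Sum>l\<in>UNIV. c l)" using c(1) by (rule key)
    also have "\<dots> \<le> (\<Sum>l\<in>UNIV. a l + e')" using c(2) by (intro sum_mono less_imp_le)
    also have "\<dots> = (\<Sum>l\<in>UNIV. a l) + e" by (simp add: sum.distrib e'_def)
    finally show "0 \<le> (\<Sum>l\<in>UNIV. a l) + e" .
  qed
  moreover have "AE x in P l. a l \<le> B l x" for l
  proof -
    interpret R: prob_space "P l" by (rule prob_P)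
    have "AE x in P l. x \<notin> {x\<in>space (M l). B l x < a l - 1 / real (Suc k)}" for k
    proof -
      have "a l - 1 / real (Suc k) \<notin> T l"
      proof
        assume "a l - 1 / real (Suc k) \<in> T l"
        then have "a l \<le> a l - 1 / real (Suc k)" unfolding a_def using bdd by (rule cInf_lower)
        then show False by simp
      qed
      then have "R.prob {x\<in>space (M l). B l x < a l - 1 / real (Suc k)} = 0" by (auto simp: T_def zero_less_measure_iff)
      then show ?thesis using R.prob_eq_0[of "{x\<in>space (M l). B l x < a l - 1 / real (Suc k)}"] Bs by simp
    qed
    then have "AE x in P l. \<forall>k. x \<notin> {x\<in>space (M l). B l x < a l - 1 / real (Suc k)}"
      by (rule AE_all_countable[THEN iffD2, OF allI])
    then show ?thesis
      using AE_space
    proof eventually_elim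
      case (elim x)
      then have *: "a l - 1 / real (Suc k) \<le> B l x" for k by (auto simp: not_less)
      show ?case
      proof (rule ccontr)
        assume "\<not> a l \<le> B l x"
        then obtain k where "1 / real (Suc k) < a l - B l x" using reals_Archimedean[of "a l - B l x"] by (auto simp: inverse_eq_divide)
        then show False using *[of k] by simp
      qed
    qed
  qed
  ultimately show ?thesis by blast
qed

lemma emp_diff: "emp n (\<lambda>l x. f l x - g l x) \<omega> = emp n f \<omega> - emp n g \<omega>"
  by (simp add: emp_def sum_subtractf right_diff_distrib)

lemma emp_scale: "emp n (\<lambda>l x. c * f l x) \<omega> = c * emp n f \<omega>"
  by (simp add: emp_def sum_distrib_left mult.left_commute)

lemma u_diff_integrable: "integrable (P l) (\<lambda>x. u l a x - u l b x)"
proof -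
  interpret R: prob_space "P l" by (rule prob_P)
  show ?thesis by (rule R.integrable_of_square[OF _ u_diff_sq_integrable]) simp
qed

lemma integral_abs_le_L2_norm:
  assumes "f \<in> borel_measurable (P l)" "integrable (P l) (\<lambda>x. (f x)\<^sup>2)"
  shows "(\<integral>x. \<bar>f x\<bar> \<partial>P l) \<le> L2_norm (P l) f"
proof -
  interpret R: prob_space "P l" by (rule prob_P)
  have "\<bar>\<integral>x. \<bar>f x\<bar> * 1 \<partial>P l\<bar> \<le> L2_norm (P l) (\<lambda>x. \<bar>f x\<bar>) * L2_norm (P l) (\<lambda>x. 1)"
    using assms by (intro abs_integral_product_le) auto
  then show ?thesis unfolding L2_norm_const by (simp add: L2_norm_def)
qed

text \<open>One admissible vector of sample sizes suffices, because the consequences drawn from convexity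
  do not involve \<open>n\<close>.\<close>

definition nll_convexity :: bool where
  "nll_convexity \<longleftrightarrow> (\<exists>n. (\<forall>l. 0 < n l) \<and> (AE \<omega> in \<Omega>. convex_on UNIV (total_nll M eta n (\<lambda>l i. X l i \<omega>))))"

text \<open>Convexity on the segment from \<open>w\<close> to \<open>d\<close> bounds the difference
  quotient at \<open>w\<close> by the full increment. The quotient is known to approach the tangent
  in mean square, so the conclusion is reached through expectations: the negative part of the
  remainder has mean zero.\<close>

lemma tangent_remainder_nonneg:
  assumes n: "\<And>l. 0 < n l" and conv: "AE \<omega> in \<Omega>. convex_on UNIV (total_nll M eta n (\<lambda>l i. X l i \<omega>))"
    and w: "w \<in> N" and d: "d \<in> N"
  shows "AE \<omega> in \<Omega>. 0 \<le> emp n (\<lambda>l x. u l d x - u l w x - tang l w (d - w) x) \<omega>"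
proof -
  define v where "v = d - w"
  define B where "B l x = u l d x - u l w x - tang l w v x" for l x
  define Y where "Y s l x = u l (w + s *\<^sub>R v) x - u l w x" for s l x
  define Z where "Z s l x = 1 / s * Y s l x - tang l w v x" for s l x
  have ui: "integrable (P l) (\<lambda>x. u l a x - u l b x)" for l a b
    by (rule u_diff_integrable)
  have Bi: "integrable (P l) (B l)" for l
    unfolding B_def[abs_def] by (rule Bochner_Integration.integrable_diff[OF ui tang_sq(1)[OF w]])
  have Zi: "integrable (P l) (Z s l)" for s l
    unfolding Z_def[abs_def] Y_def by (rule Bochner_Integration.integrable_diff[OF integrable_mult_right[OF ui] tang_sq(1)[OF w]])
  have Zsq: "(Z s l) \<in> borel_measurable (P l)" "integrable (P l) (\<lambda>x. (Z s l x)\<^sup>2)" for s l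
  proof -
    show "(Z s l) \<in> borel_measurable (P l)" using Zi[of l s] by (rule borel_measurable_integrable)
    have "integrable (P l) (\<lambda>x. (1 / s * Y s l x + - 1 * tang l w v x)\<^sup>2)"
    proof (rule integrable_square_add)
      show "integrable (P l) (\<lambda>x. (1 / s * Y s l x)\<^sup>2)"
        unfolding Y_def power_mult_distrib by (rule integrable_mult_right[OF u_diff_sq_integrable])
      show "integrable (P l) (\<lambda>x. (- 1 * tang l w v x)\<^sup>2)" using tang_sq(2)[OF w] by simp
    qed (use tang_measurable[OF w] in \<open>simp_all add: Y_def\<close>)
    then show "integrable (P l) (\<lambda>x. (Z s l x)\<^sup>2)" by (simp add: Z_def)
  qed
  have ge: "AE \<omega> in \<Omega>. - emp n B \<omega> \<le> \<bar>emp n (Z s) \<omega>\<bar>" if s: "0 < s" "s < 1" for s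
    using conv
  proof eventually_elim
    case (elim \<omega>)
    let ?T = "total_nll M eta n (\<lambda>l i. X l i \<omega>)"
    have "?T (w + s *\<^sub>R v) = ?T ((1 - s) *\<^sub>R w + s *\<^sub>R d)" by (simp add: v_def algebra_simps)
    also have "\<dots> \<le> (1 - s) * ?T w + s * ?T d"
      using elim s by (intro convex_onD) auto
    finally have "?T (w + s *\<^sub>R v) - ?T w \<le> s * (?T d - ?T w)" by (simp add: algebra_simps)
    then have "emp n (Y s) \<omega> \<le> s * emp n (\<lambda>l x. u l d x - u l w x) \<omega>"
      unfolding total_nll_diff[OF n] Y_def .
    then have "1 / s * emp n (Y s) \<omega> \<le> emp n (\<lambda>l x. u l d x - u l w x) \<omega>"
      using s by (simp add: pos_divide_le_eq mult.commute)
    moreover have "emp n B \<omega> = emp n (\<lambda>l x. u l d x - u l w x) \<omega> - emp n (\<lambda>l. tang l w v) \<omega>"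
      unfolding B_def by (rule emp_diff)
    moreover have "emp n (Z s) \<omega> = 1 / s * emp n (Y s) \<omega> - emp n (\<lambda>l. tang l w v) \<omega>"
      unfolding Z_def[abs_def] emp_diff emp_scale ..
    ultimately show ?case by linarith
  qed
  \<comment> \<open>The negative part is independent of \<open>s\<close> and at most the error of
    the difference quotient, whose mean vanishes as \<open>s\<close> does.\<close>
  have small: "expectation (\<lambda>\<omega>. max 0 (- emp n B \<omega>)) \<le> e" if e: "0 < e" for e
  proof -
    define e' where "e' = e / real CARD('m)"
    have e': "0 < e'" using e by (simp add: e'_def)
    have "\<forall>l. \<exists>\<delta>>0. \<forall>s. \<bar>s\<bar> < \<delta> \<longrightarrow> L2_norm (P l) (\<lambda>x. u l (w + s *\<^sub>R v) x - u l (w + 0 *\<^sub>R v) x - s * tang l w v x) \<le> e' * \<bar>s\<bar>"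
      using u_ray_derivative[OF w, of _ v] e' unfolding L2_ray_derivative_def by meson
    from choice[OF this] obtain \<delta> where \<delta>: "\<And>l. 0 < \<delta> l"
      "\<And>l s. \<bar>s\<bar> < \<delta> l \<Longrightarrow> L2_norm (P l) (\<lambda>x. u l (w + s *\<^sub>R v) x - u l (w + 0 *\<^sub>R v) x - s * tang l w v x) \<le> e' * \<bar>s\<bar>" by blast
    define m where "m = Min (range \<delta>)"
    have m0: "0 < m" unfolding m_def using \<delta>(1) by (subst Min_gr_iff) auto
    have m\<delta>: "m \<le> \<delta> l" for l unfolding m_def by (intro Min_le) auto
    define s where "s = min 1 m / 2"
    have s: "0 < s" "s < 1" and sm: "s < m" using m0 by (auto simp: s_def min_def)
    have s\<delta>: "\<bar>s\<bar> < \<delta> l" for l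
      using s(1) sm m\<delta>[of l] by linarith
    have "expectation (\<lambda>\<omega>. max 0 (- emp n B \<omega>)) \<le> expectation (\<lambda>\<omega>. \<bar>emp n (Z s) \<omega>\<bar>)"
    proof (rule integral_mono_AE)
      show "integrable \<Omega> (\<lambda>\<omega>. max 0 (- emp n B \<omega>))" using emp_integrable[OF Bi] by simp
      show "integrable \<Omega> (\<lambda>\<omega>. \<bar>emp n (Z s) \<omega>\<bar>)" using emp_integrable[OF Zi] by simp
      show "AE \<omega> in \<Omega>. max 0 (- emp n B \<omega>) \<le> \<bar>emp n (Z s) \<omega>\<bar>" using ge[OF s] by eventually_elim simp
    qed
    also have "\<dots> \<le> (\<Sum>l\<in>UNIV. \<integral>x. \<bar>Z s l x\<bar> \<partial>P l)" by (rule emp_abs_le[OF Zi n])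
    also have "\<dots> \<le> (\<Sum>l\<in>(UNIV :: 'm set). e')"
    proof (rule sum_mono)
      fix l
      have "(\<integral>x. \<bar>Z s l x\<bar> \<partial>P l) \<le> L2_norm (P l) (Z s l)" by (rule integral_abs_le_L2_norm[OF Zsq])
      also have "L2_norm (P l) (Z s l) = L2_norm (P l) (\<lambda>x. 1 / s * (u l (w + s *\<^sub>R v) x - u l (w + 0 *\<^sub>R v) x - s * tang l w v x))"
        using s(1) by (simp add: Z_def[abs_def] Y_def right_diff_distrib)
      also have "\<dots> = \<bar>1 / s\<bar> * L2_norm (P l) (\<lambda>x. u l (w + s *\<^sub>R v) x - u l (w + 0 *\<^sub>R v) x - s * tang l w v x)"
        by (rule L2_norm_scale)
      also have "\<dots> \<le> \<bar>1 / s\<bar> * (e' * \<bar>s\<bar>)" by (intro mult_left_mono \<delta>(2) s\<delta>) simp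
      also have "\<dots> = e'" using s(1) by simp
      finally show "(\<integral>x. \<bar>Z s l x\<bar> \<partial>P l) \<le> e'" .
    qed
    also have "\<dots> = e" by (simp add: e'_def)
    finally show ?thesis .
  qed
  have "expectation (\<lambda>\<omega>. max 0 (- emp n B \<omega>)) \<le> 0" by (rule field_le_epsilon) (use small in simp)
  moreover have "0 \<le> expectation (\<lambda>\<omega>. max 0 (- emp n B \<omega>))" by simp
  ultimately have "expectation (\<lambda>\<omega>. max 0 (- emp n B \<omega>)) = 0" by simp
  then have "AE \<omega> in \<Omega>. max 0 (- emp n B \<omega>) = 0"
    using integral_nonneg_eq_0_iff_AE[of \<Omega> "\<lambda>\<omega>. max 0 (- emp n B \<omega>)"] emp_integrable[OF Bi] by simp
  then have "AE \<omega> in \<Omega>. 0 \<le> emp n B \<omega>" by eventually_elim (simp add: max_def split: if_splits)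
  then show ?thesis by (simp add: B_def[abs_def] v_def)
qed

text \<open>\<open>ess_inf_exists\<close> splits the nonnegative empirical remainder into bounds
  \<open>a l\<close> for single observations with nonnegative sum \<open>A\<close>. The remainder
  \<open>B l\<close> has mean \<open>F l d - F l w - mw l w (d - w)\<close> under
  \<open>\<tau>0\<close> and mean \<open>kl l d w\<close> under \<open>w\<close>; comparing the
  integrals of the nonnegative functions \<open>B l x - a l\<close> under both laws gives the first
  two claims, \<open>A\<close> entering with a favourable sign. The third holds since no
  \<open>a k\<close> exceeds \<open>kl k d w\<close>, so that \<open>a l\<close> is at least
  \<open>- K\<close>.\<close>

lemma tangent_bounds:
  assumes conv: nll_convexity and w: "w \<in> N" and d: "d \<in> N"
  defines "K \<equiv> (\<Sum>l\<in>UNIV. kl l d w)"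
  shows "exp (- ubound) * K \<le> (\<Sum>l\<in>UNIV. F l d - F l w - mw l w (d - w))"
    "(\<Sum>l\<in>UNIV. F l d - F l w - mw l w (d - w)) \<le> exp ubound * K"
    "AE x in P l. tang l w (d - w) x - K \<le> u l d x - u l w x"
proof -
  define B where "B l x = u l d x - u l w x - tang l w (d - w) x" for l x
  obtain n where n: "\<And>l. 0 < n l" "AE \<omega> in \<Omega>. convex_on UNIV (total_nll M eta n (\<lambda>l i. X l i \<omega>))"
    using conv unfolding nll_convexity_def by blast
  have Bm: "B l \<in> borel_measurable (M l)" for l
    unfolding B_def[abs_def] using tang_measurable[OF w] by simp
  have "AE \<omega> in \<Omega>. 0 \<le> emp n B \<omega>"
    using tangent_remainder_nonneg[OF n w d] by (simp add: B_def[abs_def])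
  from ess_inf_exists[OF Bm n(1) this] obtain a where a: "0 \<le> (\<Sum>l\<in>UNIV. a l)" "\<And>l. AE x in P l. a l \<le> B l x" by blast
  have ui: "integrable (P l) (\<lambda>x. u l d x - u l w x)" for l
    by (rule u_diff_integrable)
  have Bi: "integrable (P l) (B l)" for l
    unfolding B_def[abs_def] by (rule Bochner_Integration.integrable_diff[OF ui tang_sq(1)[OF w]])
  have E0: "(\<integral>x. B l x \<partial>P l) = F l d - F l w - mw l w (d - w)" for l
  proof -
    interpret R: prob_space "P l" by (rule prob_P)
    have "integrable (P l) (\<lambda>x. eta l d x - eta l w x)" by (rule gibbs_integrable_L2_0[OF \<tau>0_in eta_diff_L2_0])
    then have "(\<integral>x. u l d x - u l w x \<partial>P l) = F l d - F l w"
      unfolding u_diff using L2_0_D(3)[OF eta_diff_L2_0[of l d w]] R.prob_space by simp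
    then show ?thesis unfolding B_def using ui tang_sq[OF w] by simp
  qed
  have Ew: "(\<integral>x. B l x \<partial>gibbs (M l) (eta l w)) = kl l d w" for l
    unfolding B_def using gibbs_integrable[OF w ui] gibbs_integrable[OF w tang_sq(1)[OF w]] gibbs_integral_tang[OF w]
      KL_sample(1)[OF d w, of l, folded kl_def] by simp
  have cmp: "exp (- ubound) * ((\<integral>x. B l x \<partial>P l) - a l) \<le> kl l d w - a l"
    "kl l d w - a l \<le> exp ubound * ((\<integral>x. B l x \<partial>P l) - a l)" for l
  proof -
    interpret R: prob_space "P l" by (rule prob_P)
    interpret Q: prob_space "gibbs (M l) (eta l w)" by (rule prob_gibbs)
    have i: "integrable (P l) (\<lambda>x. B l x - a l)" using Bi by simp
    have nn: "AE x in P l. 0 \<le> B l x - a l" using a(2)[of l] by eventually_elim simp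
    have e1: "(\<integral>x. B l x - a l \<partial>P l) = (\<integral>x. B l x \<partial>P l) - a l" using Bi R.prob_space by simp
    have e2: "(\<integral>x. B l x - a l \<partial>gibbs (M l) (eta l w)) = kl l d w - a l"
      using gibbs_integrable[OF w Bi] Q.prob_space by (simp add: Ew)
    show "exp (- ubound) * ((\<integral>x. B l x \<partial>P l) - a l) \<le> kl l d w - a l"
      "kl l d w - a l \<le> exp ubound * ((\<integral>x. B l x \<partial>P l) - a l)"
      using gibbs_integral_bounds[OF w i nn] unfolding e1 e2 by auto
  qed
  define E where "E = (\<Sum>l\<in>UNIV. \<integral>x. B l x \<partial>P l)"
  define A where "A = (\<Sum>l\<in>UNIV. a l)"
  have E: "E = (\<Sum>l\<in>UNIV. F l d - F l w - mw l w (d - w))" by (simp add: E_def E0)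
  have s1: "exp (- ubound) * (E - A) \<le> K - A"
    using sum_mono[of UNIV "\<lambda>l. exp (- ubound) * ((\<integral>x. B l x \<partial>P l) - a l)" "\<lambda>l. kl l d w - a l"] cmp(1)
    by (simp add: E_def A_def K_def sum_subtractf sum_distrib_left[symmetric])
  have s2: "K - A \<le> exp ubound * (E - A)"
    using sum_mono[of UNIV "\<lambda>l. kl l d w - a l" "\<lambda>l. exp ubound * ((\<integral>x. B l x \<partial>P l) - a l)"] cmp(2)
    by (simp add: E_def A_def K_def sum_subtractf sum_distrib_left[symmetric])
  have A0: "0 \<le> A" using a(1) by (simp add: A_def)
  have eb: "exp (- ubound) \<le> 1" "1 \<le> exp ubound" "exp ubound * exp (- ubound) = 1" "exp (- ubound) * exp ubound = 1"
    using ubound(1) by (simp_all flip: exp_add)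
  show "exp (- ubound) * K \<le> (\<Sum>l\<in>UNIV. F l d - F l w - mw l w (d - w))"
  proof -
    have "exp (- ubound) * (K - A) \<le> exp (- ubound) * (exp ubound * (E - A))" using s2 by (intro mult_left_mono) auto
    also have "\<dots> = E - A" using eb by (simp flip: mult.assoc)
    finally have "exp (- ubound) * K + (1 - exp (- ubound)) * A \<le> E" by (simp add: algebra_simps)
    moreover have "0 \<le> (1 - exp (- ubound)) * A" using eb A0 by simp
    ultimately show ?thesis unfolding E[symmetric] by linarith
  qed
  show "(\<Sum>l\<in>UNIV. F l d - F l w - mw l w (d - w)) \<le> exp ubound * K"
  proof -
    have "exp ubound * (exp (- ubound) * (E - A)) \<le> exp ubound * (K - A)" using s1 by (intro mult_left_mono) auto
    also have "exp ubound * (exp (- ubound) * (E - A)) = E - A" using eb by (simp flip: mult.assoc)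
    finally have "E + (exp ubound - 1) * A \<le> exp ubound * K" by (simp add: algebra_simps)
    moreover have "0 \<le> (exp ubound - 1) * A" using eb A0 by simp
    ultimately show ?thesis unfolding E[symmetric] by linarith
  qed
  have ak: "a k \<le> kl k d w" for k
  proof -
    interpret R: prob_space "P k" by (rule prob_P)
    have "a k = (\<integral>x. a k \<partial>P k)" using R.prob_space by simp
    also have "\<dots> \<le> (\<integral>x. B k x \<partial>P k)" using a(2)[of k] Bi by (intro integral_mono_AE) auto
    finally have "0 \<le> exp (- ubound) * ((\<integral>x. B k x \<partial>P k) - a k)" by simp
    with cmp(1)[of k] show ?thesis by linarith
  qed
  have al: "- K \<le> a l"
  proof -
    have "A = a l + (\<Sum>k\<in>UNIV - {l}. a k)" unfolding A_def by (subst sum.remove[of _ l]) auto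
    also have "\<dots> \<le> a l + (\<Sum>k\<in>UNIV - {l}. kl k d w)" by (intro add_left_mono sum_mono ak)
    also have "\<dots> \<le> a l + K"
      unfolding K_def using kl_bounds(1)[OF d w] by (intro add_left_mono sum_mono2) auto
    finally show ?thesis using A0 by simp
  qed
  show "AE x in P l. tang l w (d - w) x - K \<le> u l d x - u l w x"
    using a(2)[of l] by eventually_elim (use al in \<open>simp add: B_def\<close>)
qed

lemma nrm2_scale: "nrm2 (c *\<^sub>R v) = c\<^sup>2 * nrm2 v"
proof -
  have "(\<integral>x. (Lh l (c *\<^sub>R snd v) x)\<^sup>2 \<partial>P l) = (\<integral>x. c\<^sup>2 * (Lh l (snd v) x)\<^sup>2 \<partial>P l)" for l
  proof (rule integral_cong_AE)
    show "AE x in P l. (Lh l (c *\<^sub>R snd v) x)\<^sup>2 = c\<^sup>2 * (Lh l (snd v) x)\<^sup>2"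
      using L2_bounded_linear_D(3)[OF Lh_bounded_linear, of l c "snd v"] by eventually_elim (simp add: power_mult_distrib)
  qed (use L2_0_D(1)[OF L_L2_0(2)] in auto)
  then show ?thesis
    by (simp add: nrm2_def power_mult_distrib distrib_left sum_distrib_left)
qed

lemma kl_sum_le: "\<exists>C>0. \<forall>d\<in>N. \<forall>w\<in>N. (\<Sum>l\<in>UNIV. kl l d w) \<le> C * nrm2 (d - w)"
proof -
  obtain C where C: "0 < C" "\<And>d w. d \<in> N \<Longrightarrow> w \<in> N \<Longrightarrow> (\<Sum>l\<in>UNIV. \<integral>x. (eta l d x - eta l w x)\<^sup>2 \<partial>P l) \<le> C * nrm2 (d - w)"
    using eta_lipschitz by blast
  define K where "K = exp (3 * ubound) / 2 * (1 + exp ubound)"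
  have K: "0 < K" by (simp add: K_def add_pos_pos)
  have "(\<Sum>l\<in>UNIV. kl l d w) \<le> (K * C) * nrm2 (d - w)" if "d \<in> N" "w \<in> N" for d w
  proof -
    have "(\<Sum>l\<in>UNIV. kl l d w) \<le> (\<Sum>l\<in>UNIV. K * (\<integral>x. (eta l d x - eta l w x)\<^sup>2 \<partial>P l))"
      unfolding K_def by (intro sum_mono kl_bounds that)
    also have "\<dots> = K * (\<Sum>l\<in>UNIV. \<integral>x. (eta l d x - eta l w x)\<^sup>2 \<partial>P l)" by (simp add: sum_distrib_left)
    also have "\<dots> \<le> K * (C * nrm2 (d - w))" using C(2)[OF that] K by (intro mult_left_mono) auto
    finally show ?thesis by simp
  qed
  then show ?thesis using K C by (intro exI[of _ "K * C"]) auto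
qed

text \<open>The lower bound on the derivative is infinitesimal and does not by itself separate
  \<open>eta l d\<close> from \<open>eta l \<tau>0\<close> in the large. Along the segment it makes
  \<open>g\<close> exceed its tangents locally by a quadratic, so that \<open>g\<close> minus a
  parabola is midpoint convex. As \<open>g\<close> is smallest at the truth, the midpoint inequality
  forces \<open>g 1 - g 0\<close> to be at least a quarter of \<open>q\<close>.\<close>

lemma F_quadratic_growth:
  assumes conv: nll_convexity
  shows "\<exists>\<kappa>>0. \<forall>d\<in>N. \<kappa> * nrm2 (d - \<tau>0) \<le> (\<Sum>l\<in>UNIV. F l d - F l \<tau>0)"
proof -
  obtain cS where cS: "0 < cS" "\<And>v. cS * nrm2 v \<le> S v" using S_equiv by blast
  obtain Ce where Ce: "0 < Ce" "\<And>d w. d \<in> N \<Longrightarrow> w \<in> N \<Longrightarrow> (\<Sum>l\<in>UNIV. \<integral>x. (eta l d x - eta l w x)\<^sup>2 \<partial>P l) \<le> Ce * nrm2 (d - w)"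
    using eta_lipschitz by blast
  define k0 where "k0 = exp (- ubound) * (exp (- 3 * ubound) / 2)"
  have k0: "0 < k0" by (simp add: k0_def)
  define \<kappa> where "\<kappa> = k0 * (C1 * cS / 4) / 4"
  have \<kappa>: "0 < \<kappa>" using k0 C1_pos cS by (simp add: \<kappa>_def)
  have "\<kappa> * nrm2 (d - \<tau>0) \<le> (\<Sum>l\<in>UNIV. F l d - F l \<tau>0)" if d: "d \<in> N" for d
  proof -
    define v where "v = d - \<tau>0"
    define t where "t s = \<tau>0 + s *\<^sub>R v" for s
    have tN: "t s \<in> N" if "0 \<le> s" "s \<le> 1" for s
      using convexD_alt[OF convex_N \<tau>0_in d] that by (simp add: t_def v_def algebra_simps)
    have tt: "t b - t a = (b - a) *\<^sub>R v" for a b by (simp add: t_def algebra_simps)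
    define g where "g s = (\<Sum>l\<in>UNIV. F l (t s))" for s
    have g0: "g 0 = (\<Sum>l\<in>UNIV. F l \<tau>0)" and g1: "g 1 = (\<Sum>l\<in>UNIV. F l d)" by (auto simp: g_def t_def v_def)
    have low: "g 0 \<le> g s" if "0 \<le> s" "s \<le> 1" for s
    proof -
      \<comment> \<open>\<open>eta\<close> is centred under \<open>\<tau>0\<close>, so this
        difference is itself a divergence.\<close>
      have "F l \<tau>0 \<le> F l (t s)" for l
        using kl_bounds(1)[OF tN[OF that] \<tau>0_in, of l] L2_0_D(3)[OF eta_diff_L2_0[of l "t s" \<tau>0]] by (simp add: kl_def)
      then show ?thesis unfolding g0 unfolding g_def by (intro sum_mono)
    qed
    show ?thesis
    proof (cases "nrm2 v = 0")
      case True
      then show ?thesis using low[of 1] by (simp add: g0 g1 v_def sum_subtractf)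
    next
      case False
      then have nv: "0 < nrm2 v" using nrm2_nonneg[of v] by simp
      have Sv: "0 < S v" using cS(2)[of v] cS(1) nv by (smt (verit) mult_pos_pos)
      define q where "q = k0 * (C1 * S v / 4)"
      have q: "0 < q" using k0 C1_pos Sv by (simp add: q_def)
      \<comment> \<open>Local growth has the coefficient \<open>q\<close>; subtracting only half of
        it leaves the strictness that local support lines require.\<close>
      define k where "k s = g s - q / 2 * s\<^sup>2" for s
      have lip: "\<bar>F l (t a) - F l (t b)\<bar> \<le> sqrt (exp ubound * Ce * nrm2 v) * \<bar>a - b\<bar>" if "0 \<le> a" "a \<le> 1" "0 \<le> b" "b \<le> 1" for l a b
      proof -
        have "(\<integral>x. (eta l (t a) x - eta l (t b) x)\<^sup>2 \<partial>P l) \<le> (\<Sum>l\<in>UNIV. \<integral>x. (eta l (t a) x - eta l (t b) x)\<^sup>2 \<partial>P l)"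
          by (intro member_le_sum) auto
        also have "\<dots> \<le> Ce * nrm2 (t a - t b)" using that tN by (intro Ce) auto
        also have "\<dots> = Ce * ((a - b)\<^sup>2 * nrm2 v)" unfolding tt nrm2_scale ..
        finally have Q: "(\<integral>x. (eta l (t a) x - eta l (t b) x)\<^sup>2 \<partial>P l) \<le> Ce * ((a - b)\<^sup>2 * nrm2 v)" .
        have "(F l (t a) - F l (t b))\<^sup>2 \<le> exp ubound * (\<integral>x. (eta l (t a) x - eta l (t b) x)\<^sup>2 \<partial>P l)"
          using that tN by (intro u_diff_sq(3)) auto
        also have "\<dots> \<le> exp ubound * (Ce * ((a - b)\<^sup>2 * nrm2 v))" using Q by (intro mult_left_mono) auto
        also have "\<dots> = exp ubound * Ce * nrm2 v * (a - b)\<^sup>2" by (simp add: mult_ac)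
        finally have "sqrt ((F l (t a) - F l (t b))\<^sup>2) \<le> sqrt (exp ubound * Ce * nrm2 v * (a - b)\<^sup>2)" by (rule real_sqrt_le_mono)
        then show ?thesis by (simp add: real_sqrt_mult)
      qed
      have contF: "continuous_on {0..1} (\<lambda>s. F l (t s))" for l
      proof (rule lipschitz_on_continuous_on[OF lipschitz_onI[of "{0..1}" "\<lambda>s. F l (t s)" "sqrt (exp ubound * Ce * nrm2 v)"]])
        show "dist (F l (t a)) (F l (t b)) \<le> sqrt (exp ubound * Ce * nrm2 v) * dist a b" if "a \<in> {0..1}" "b \<in> {0..1}" for a b
          using lip[of a b l] that by (simp add: dist_real_def)
      qed (use Ce nv in auto)
      have cont: "continuous_on {0..1} k" unfolding k_def g_def by (intro continuous_intros contF)
      have "k (1/2) \<le> (k 0 + k 1) / 2"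
      proof (rule midpoint_le_of_local_support[OF cont])
        fix s :: real assume s: "0 < s" "s < 1"
        have ts: "t s \<in> N" using s tN by simp
        \<comment> \<open>With this error per sample the mean-square remainders add up to a quarter
          of \<open>C1 * S v\<close>; after the factor \<open>2\<close> of the squared triangle
          inequality another quarter is left for the increments of \<open>eta\<close>.\<close>
        define e where "e = sqrt (C1 * S v / 4 / real CARD('m))"
        have e: "0 < e" using C1_pos Sv by (simp add: e_def)
        have e2: "real CARD('m) * e\<^sup>2 = C1 * S v / 4" using C1_pos Sv by (simp add: e_def)
        have "\<forall>l. \<exists>\<delta>>0. \<forall>r. \<bar>r\<bar> < \<delta> \<longrightarrow> L2_norm (P l) (\<lambda>x. eta l (t s + r *\<^sub>R v) x - eta l (t s + 0 *\<^sub>R v) x - r * Deta l (t s) v x) \<le> e * \<bar>r\<bar>"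
          using eta_ray_derivative[OF ts, of _ v] e unfolding L2_ray_derivative_def by meson
        from choice[OF this] obtain \<delta> where \<delta>: "\<And>l. 0 < \<delta> l"
          "\<And>l r. \<bar>r\<bar> < \<delta> l \<Longrightarrow> L2_norm (P l) (\<lambda>x. eta l (t s + r *\<^sub>R v) x - eta l (t s + 0 *\<^sub>R v) x - r * Deta l (t s) v x) \<le> e * \<bar>r\<bar>" by blast
        \<comment> \<open>The slope of the tangent of \<open>g\<close> at \<open>s\<close>,
          corrected by the derivative of the parabola.\<close>
        define p where "p = (\<Sum>l\<in>UNIV. mw l (t s) v) - q * s"
        have "k s + p * (r - s) < k r" if r: "0 < r" "r < 1" "r \<noteq> s" "\<bar>r - s\<bar> < Min (range \<delta>)" for r
        proof -
          have tr: "t r \<in> N" using r tN by simp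
          have low_l: "(r - s)\<^sup>2 * (\<integral>x. (Deta l (t s) v x)\<^sup>2 \<partial>P l) \<le> 2 * (\<integral>x. (eta l (t r) x - eta l (t s) x)\<^sup>2 \<partial>P l) + 2 * (e\<^sup>2 * (r - s)\<^sup>2)" for l
          proof -
            define a where "a x = eta l (t r) x - eta l (t s) x" for x
            define b where "b x = a x - (r - s) * Deta l (t s) v x" for x
            have aL: "a \<in> L2_0 (P l)" unfolding a_def by (rule eta_diff_L2_0)
            have bL: "(\<lambda>x. - 1 * b x) \<in> L2_0 (P l)" unfolding b_def by (intro L2_0_diff L2_0_scale prob_P aL Deta_L2_0 ts)
            have "\<bar>r - s\<bar> < \<delta> l" using r(4) Min_le[of "range \<delta>" "\<delta> l"] by simp
            from \<delta>(2)[OF this] have "L2_norm (P l) b \<le> e * \<bar>r - s\<bar>"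
              by (simp add: b_def[abs_def] a_def t_def algebra_simps)
            then have "(L2_norm (P l) b)\<^sup>2 \<le> (e * \<bar>r - s\<bar>)\<^sup>2" using L2_norm_nonneg by (intro power_mono)
            then have b2: "(\<integral>x. (- 1 * b x)\<^sup>2 \<partial>P l) \<le> e\<^sup>2 * (r - s)\<^sup>2" by (simp add: L2_norm_sq power_mult_distrib)
            have "(r - s)\<^sup>2 * (\<integral>x. (Deta l (t s) v x)\<^sup>2 \<partial>P l) = (\<integral>x. (a x + - 1 * b x)\<^sup>2 \<partial>P l)"
              by (simp add: b_def power_mult_distrib)
            also have "\<dots> \<le> 2 * (\<integral>x. (a x)\<^sup>2 \<partial>P l) + 2 * (\<integral>x. (- 1 * b x)\<^sup>2 \<partial>P l)"
              by (intro integral_square_add_le L2_0_D aL bL)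
            finally show ?thesis using b2 by (simp add: a_def)
          qed
          have "(r - s)\<^sup>2 * (C1 * S v) \<le> (r - s)\<^sup>2 * (\<Sum>l\<in>UNIV. \<integral>x. (Deta l (t s) v x)\<^sup>2 \<partial>P l)"
            by (intro mult_left_mono Deta_bounds ts) auto
          also have "\<dots> \<le> (\<Sum>l\<in>UNIV. 2 * (\<integral>x. (eta l (t r) x - eta l (t s) x)\<^sup>2 \<partial>P l) + 2 * (e\<^sup>2 * (r - s)\<^sup>2))"
            unfolding sum_distrib_left by (intro sum_mono low_l)
          also have "\<dots> = 2 * (\<Sum>l\<in>UNIV. \<integral>x. (eta l (t r) x - eta l (t s) x)\<^sup>2 \<partial>P l) + 2 * (real CARD('m) * e\<^sup>2) * (r - s)\<^sup>2"
            by (simp add: sum.distrib sum_distrib_left)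
          finally have Q: "(r - s)\<^sup>2 * (C1 * S v / 4) \<le> (\<Sum>l\<in>UNIV. \<integral>x. (eta l (t r) x - eta l (t s) x)\<^sup>2 \<partial>P l)"
            unfolding e2 by (simp add: field_simps)
          have "q * (r - s)\<^sup>2 = k0 * ((r - s)\<^sup>2 * (C1 * S v / 4))" by (simp add: q_def)
          also have "\<dots> \<le> k0 * (\<Sum>l\<in>UNIV. \<integral>x. (eta l (t r) x - eta l (t s) x)\<^sup>2 \<partial>P l)" using Q k0 by (intro mult_left_mono) auto
          also have "\<dots> = exp (- ubound) * (\<Sum>l\<in>UNIV. exp (- 3 * ubound) / 2 * (\<integral>x. (eta l (t r) x - eta l (t s) x)\<^sup>2 \<partial>P l))"
            by (simp add: k0_def sum_distrib_left mult.assoc)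
          also have "\<dots> \<le> exp (- ubound) * (\<Sum>l\<in>UNIV. kl l (t r) (t s))"
            by (intro mult_left_mono sum_mono kl_bounds tr ts) auto
          also have "\<dots> \<le> (\<Sum>l\<in>UNIV. F l (t r) - F l (t s) - mw l (t s) (t r - t s))"
            by (rule tangent_bounds(1)[OF conv ts tr])
          also have "\<dots> = g r - g s - (r - s) * (\<Sum>l\<in>UNIV. mw l (t s) v)"
            unfolding tt mw_scale[OF ts] by (simp add: g_def sum_subtractf sum_distrib_left)
          finally have main: "q * (r - s)\<^sup>2 \<le> g r - g s - (r - s) * (\<Sum>l\<in>UNIV. mw l (t s) v)" .
          have "0 < q / 2 * (r - s)\<^sup>2" using q r(3) by simp
          moreover have "k r - (k s + p * (r - s)) = (g r - g s - (r - s) * (\<Sum>l\<in>UNIV. mw l (t s) v)) - q / 2 * (r - s)\<^sup>2"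
            by (simp add: k_def p_def power2_eq_square field_simps)
          moreover have "q * (r - s)\<^sup>2 = q / 2 * (r - s)\<^sup>2 + q / 2 * (r - s)\<^sup>2" by simp
          ultimately show ?thesis using main by linarith
        qed
        moreover have "0 < Min (range \<delta>)" using \<delta>(1) by (subst Min_gr_iff) auto
        ultimately show "\<exists>p. \<exists>d>0. \<forall>r. 0 < r \<and> r < 1 \<and> r \<noteq> s \<and> \<bar>r - s\<bar> < d \<longrightarrow> k s + p * (r - s) < k r" by blast
      qed
      then have "2 * g (1/2) - q / 4 \<le> g 0 + g 1 - q / 2" by (simp add: k_def power2_eq_square field_simps)
      then have "q / 4 \<le> g 1 - g 0" using low[of "1/2"] by simp
      moreover have "\<kappa> * nrm2 v \<le> q / 4"
      proof -
        have "k0 * C1 / 16 * (cS * nrm2 v) \<le> k0 * C1 / 16 * S v" using cS(2)[of v] k0 C1_pos by (intro mult_left_mono) auto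
        then show ?thesis by (simp add: \<kappa>_def q_def mult_ac)
      qed
      ultimately show ?thesis by (simp add: g0 g1 v_def sum_subtractf)
    qed
  qed
  then show ?thesis using \<kappa> by blast
qed

end

subsection \<open>Coordinates in the eigensystem\<close>

lemma sum_half_power_abs_le:
  fixes A :: "int set"
  assumes "finite A"
  shows "(\<Sum>j\<in>A. (1 / 2 :: real) ^ nat \<bar>j\<bar>) \<le> 4"
proof -
  obtain n where n: "A \<subseteq> int ` {..n} \<union> (\<lambda>k. - int k) ` {..n}"
  proof -
    define n where "n = nat (Max (abs ` insert 0 A))"
    have "\<bar>j\<bar> \<le> Max (abs ` insert 0 A)" if "j \<in> A" for j using assms that by (intro Max_ge) auto
    then have "nat \<bar>j\<bar> \<le> n" if "j \<in> A" for j using that unfolding n_def by (intro nat_mono) auto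
    then have "j \<in> int ` {..n} \<union> (\<lambda>k. - int k) ` {..n}" if "j \<in> A" for j
      using that[THEN \<open>\<And>j. j \<in> A \<Longrightarrow> nat \<bar>j\<bar> \<le> n\<close>]
      by (cases "0 \<le> j") (auto intro!: image_eqI[of _ _ "nat \<bar>j\<bar>"])
    then show thesis using that by blast
  qed
  have half: "(\<Sum>k\<le>n. (1 / 2 :: real) ^ k) \<le> 2"
  proof -
    have "(\<Sum>k\<le>n. (1 / 2 :: real) ^ k) \<le> (\<Sum>k. (1 / 2 :: real) ^ k)"
      by (intro sum_le_suminf summable_geometric) auto
    also have "\<dots> = 2" by (subst suminf_geometric) auto
    finally show ?thesis .
  qed
  have "(\<Sum>j\<in>A. (1 / 2 :: real) ^ nat \<bar>j\<bar>) \<le> (\<Sum>j\<in>int ` {..n} \<union> (\<lambda>k. - int k) ` {..n}. (1 / 2 :: real) ^ nat \<bar>j\<bar>)"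
    using n by (intro sum_mono2) auto
  also have "\<dots> \<le> (\<Sum>j\<in>int ` {..n}. (1 / 2 :: real) ^ nat \<bar>j\<bar>) + (\<Sum>j\<in>(\<lambda>k. - int k) ` {..n}. (1 / 2 :: real) ^ nat \<bar>j\<bar>)"
    by (subst sum_Un) (auto intro!: sum_nonneg)
  also have "\<dots> = (\<Sum>k\<le>n. (1 / 2 :: real) ^ k) + (\<Sum>k\<le>n. (1 / 2 :: real) ^ k)"
    by (simp add: sum.reindex inj_on_def)
  finally show ?thesis using half by simp
qed

text \<open>The cells are the unit cubes in the coordinates \<open>x d\<close>; the weight of a cell decays geometrically
  in its integer corner.\<close>

lemma cell_representatives:
  fixes x :: "'d \<Rightarrow> 'i \<Rightarrow> real" and f :: "'d \<Rightarrow> real"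
  assumes D: "finite D" and L: "finite L"
  obtains rep wt where "\<And>d. d \<in> D \<Longrightarrow> rep d \<in> D" "\<And>d. d \<in> D \<Longrightarrow> f (rep d) \<le> f d"
    "\<And>d i. d \<in> D \<Longrightarrow> i \<in> L \<Longrightarrow> \<bar>x d i - x (rep d) i\<bar> \<le> 1"
    "\<And>w. 0 < wt w" "sum wt (rep ` D) \<le> (1 :: real)"
    "\<And>w. - ln (wt w) \<le> (\<Sum>i\<in>L. (x w i)\<^sup>2 + 4)"
proof -
  define key where "key d = (\<lambda>i\<in>L. \<lfloor>x d i\<rfloor>)" for d
  \<comment> \<open>Within its cell the representative minimizes \<open>f\<close>; with the penalty
    for \<open>f\<close> this later bounds the penalty of \<open>d - rep d\<close> by a multiple of
    that of \<open>d\<close>.\<close>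
  define rep where "rep d = arg_min_on f {e\<in>D. key e = key d}" for d
  have "finite {e\<in>D. key e = key d}" for d using D by simp
  then have rep: "rep d \<in> {e\<in>D. key e = key d}" "f (rep d) \<le> f d" if "d \<in> D" for d
    using arg_min_if_finite(1)[of "{e\<in>D. key e = key d}" f] arg_min_least[of "{e\<in>D. key e = key d}" d f] that
    unfolding rep_def by auto
  have rep_cong: "rep d = rep e" if "key d = key e" for d e using that by (simp add: rep_def)
  have key_inj: "inj_on key (rep ` D)"
  proof (rule inj_onI)
    fix a b assume "a \<in> rep ` D" "b \<in> rep ` D" "key a = key b"
    then obtain d e where "a = rep d" "b = rep e" "d \<in> D" "e \<in> D" by auto
    moreover have "key (rep d) = key d" "key (rep e) = key e"
      using rep(1)[OF \<open>d \<in> D\<close>] rep(1)[OF \<open>e \<in> D\<close>] by auto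
    ultimately have "key d = key e" using \<open>key a = key b\<close> by simp
    then have "rep d = rep e" by (rule rep_cong)
    then show "a = b" using \<open>a = rep d\<close> \<open>b = rep e\<close> by (simp only:)
  qed
  \<comment> \<open>Weights on the integers with total at most \<open>1\<close> and
    \<open>- ln (h j)\<close> linear in \<open>\<bar>j\<bar>\<close>; their products weight the
    cells, however many are occupied.\<close>
  define h where "h j = (1 / 2 :: real) ^ nat \<bar>j\<bar> / 4" for j :: int
  define wt where "wt w = (\<Prod>i\<in>L. h (key w i))" for w
  have h0: "0 < h j" for j by (simp add: h_def)
  have wt0: "0 < wt w" for w unfolding wt_def by (intro prod_pos) (simp add: h0)
  define R where "R i = (\<lambda>w. key w i) ` (rep ` D)" for i
  have R: "finite (R i)" for i using D by (simp add: R_def)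
  have "sum wt (rep ` D) = (\<Sum>k\<in>key ` (rep ` D). \<Prod>i\<in>L. h (k i))"
    unfolding wt_def by (subst sum.reindex[OF key_inj]) simp
  also have "\<dots> \<le> (\<Sum>k\<in>PiE L R. \<Prod>i\<in>L. h (k i))"
  proof (rule sum_mono2)
    show "finite (PiE L R)" using L R by (intro finite_PiE) auto
    show "key ` (rep ` D) \<subseteq> PiE L R" by (auto simp: R_def key_def PiE_def extensional_def)
    show "0 \<le> (\<Prod>i\<in>L. h (k i))" for k by (intro prod_nonneg) (simp add: h0 less_imp_le)
  qed
  also have "\<dots> = (\<Prod>i\<in>L. \<Sum>j\<in>R i. h j)"
    using L R by (subst prod_sum_PiE) auto
  also have "\<dots> \<le> (\<Prod>i\<in>L. 1)"
  proof (intro prod_mono conjI)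
    fix i
    show "0 \<le> (\<Sum>j\<in>R i. h j)" by (intro sum_nonneg) (simp add: h0 less_imp_le)
    show "(\<Sum>j\<in>R i. h j) \<le> 1"
      using sum_half_power_abs_le[OF R[of i]] unfolding h_def by (simp flip: sum_divide_distrib)
  qed
  finally have wt1: "sum wt (rep ` D) \<le> 1" by simp
  have wtln: "- ln (wt w) \<le> (\<Sum>i\<in>L. (x w i)\<^sup>2 + 4)" for w
  proof -
    have "ln (wt w) = (\<Sum>i\<in>L. ln (h (key w i)))"
      unfolding wt_def by (intro ln_prod L) (metis h0 less_irrefl)
    then have "- ln (wt w) = (\<Sum>i\<in>L. - ln (h (key w i)))" by (simp add: sum_negf)
    also have "\<dots> \<le> (\<Sum>i\<in>L. (x w i)\<^sup>2 + 4)"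
    proof (rule sum_mono)
      fix i assume i: "i \<in> L"
      define j where "j = key w i"
      have j: "j = \<lfloor>x w i\<rfloor>" using i by (simp add: j_def key_def)
      have "ln (h j) = - (real (nat \<bar>j\<bar>) * ln 2) - 2 * ln 2"
      proof -
        have "ln (h j) = ln ((1 / 2) ^ nat \<bar>j\<bar>) - ln (2 ^ 2)" unfolding h_def by (subst ln_div) auto
        also have "\<dots> = - (real (nat \<bar>j\<bar>) * ln 2) - 2 * ln 2" using ln_realpow[of "2::real" 2] by (simp add: ln_realpow ln_div)
        finally show ?thesis .
      qed
      moreover have "ln 2 \<le> (1 :: real)" using ln_le_minus_one[of 2] by simp
      moreover have "real (nat \<bar>j\<bar>) * ln 2 \<le> real (nat \<bar>j\<bar>) * 1"
        using \<open>ln 2 \<le> 1\<close> by (intro mult_left_mono) auto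
      moreover have "real (nat \<bar>j\<bar>) \<le> \<bar>x w i\<bar> + 1"
      proof -
        have "real (nat \<bar>j\<bar>) = \<bar>real_of_int j\<bar>" by simp
        then show ?thesis using floor_correct[of "x w i"] unfolding j by linarith
      qed
      moreover have "\<bar>x w i\<bar> \<le> (x w i)\<^sup>2 + 1"
        using zero_le_power2[of "\<bar>x w i\<bar> - 1 / 2"] by (simp add: power2_eq_square algebra_simps)
      ultimately show "- ln (h (key w i)) \<le> (x w i)\<^sup>2 + 4" unfolding j_def[symmetric] by linarith
    qed
    finally show ?thesis .
  qed
  show thesis
  proof (rule that[of rep wt, OF _ _ _ wt0 wt1 wtln])
    fix d assume d: "d \<in> D"
    show "rep d \<in> D" "f (rep d) \<le> f d" using rep[OF d] by auto
    fix i assume i: "i \<in> L"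
    have "key (rep d) i = key d i" using rep(1)[OF d] by simp
    then have "\<lfloor>x d i\<rfloor> = \<lfloor>x (rep d) i\<rfloor>" using i by (simp add: key_def)
    then show "\<bar>x d i - x (rep d) i\<bar> \<le> 1" by linarith
  qed
qed

context semiparametric_density_model
begin

text \<open>A sum of covariances under \<open>\<tau>0\<close>, since the images of \<open>Lh\<close>
  are centred. In this inner product the \<open>\<phi> \<nu>\<close> are orthonormal.\<close>

definition hip :: "'h \<Rightarrow> 'h \<Rightarrow> real" where
  "hip g h = (\<Sum>l\<in>UNIV. \<integral>x. Lh l g x * Lh l h x \<partial>P l)"

lemma Lh_product_integrable: "integrable (P l) (\<lambda>x. Lh l g x * Lh l h x)"
  by (rule integral_product_sq_le(1)[OF L2_0_D(1)[OF L_L2_0(2)] L2_0_D(1)[OF L_L2_0(2)] L2_0_D(2)[OF L_L2_0(2)] L2_0_D(2)[OF L_L2_0(2)]])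

lemma hip_commute: "hip g h = hip h g"
  by (simp add: hip_def mult.commute)

lemma hip_add: "hip (g + g') h = hip g h + hip g' h"
proof -
  have "(\<integral>x. Lh l (g + g') x * Lh l h x \<partial>P l) = (\<integral>x. Lh l g x * Lh l h x + Lh l g' x * Lh l h x \<partial>P l)" for l
  proof (rule integral_cong_AE)
    show "AE x in P l. Lh l (g + g') x * Lh l h x = Lh l g x * Lh l h x + Lh l g' x * Lh l h x"
      using L2_bounded_linear_D(2)[OF Lh_bounded_linear, of l g g'] by eventually_elim (simp add: distrib_right)
  qed (use L2_0_D(1)[OF L_L2_0(2)] in auto)
  then show ?thesis using Lh_product_integrable by (simp add: hip_def sum.distrib)
qed

lemma hip_scale: "hip (c *\<^sub>R g) h = c * hip g h"
proof -
  have "(\<integral>x. Lh l (c *\<^sub>R g) x * Lh l h x \<partial>P l) = (\<integral>x. c * (Lh l g x * Lh l h x) \<partial>P l)" for l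
  proof (rule integral_cong_AE)
    show "AE x in P l. Lh l (c *\<^sub>R g) x * Lh l h x = c * (Lh l g x * Lh l h x)"
      using L2_bounded_linear_D(3)[OF Lh_bounded_linear, of l c g] by eventually_elim simp
  qed (use L2_0_D(1)[OF L_L2_0(2)] in auto)
  then show ?thesis by (simp add: hip_def sum_distrib_left)
qed

lemma hip_linear: "linear (\<lambda>g. hip g h)"
  by (rule linearI) (simp_all add: hip_add hip_scale)

lemma hip_nonneg: "0 \<le> hip g g"
  unfolding hip_def by (intro sum_nonneg) simp

lemma nrm2_hip: "nrm2 v = (norm (fst v))\<^sup>2 + hip (snd v) (snd v)"
  by (simp add: nrm2_def hip_def power2_eq_square)

lemma hip_phi: "1 \<le> \<nu> \<Longrightarrow> 1 \<le> \<mu> \<Longrightarrow> hip (\<phi> \<nu>) (\<phi> \<mu>) = (if \<nu> = \<mu> then 1 else 0)"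
  using eigen_V[of \<nu> \<mu>] L2_0_D(3)[OF L_L2_0(2)] by (simp add: hip_def V2_def mu_def)

text \<open>The Euclidean coordinates join the eigensystem as unpenalized eigenvectors: within one
  index type they carry the eigenvalue \<open>0\<close>, see \<open>rho\<close>.\<close>

definition bas :: "'p + nat \<Rightarrow> (real^'p) \<times> 'h" where
  "bas k = (case k of Inl i \<Rightarrow> (axis i 1, 0) | Inr \<nu> \<Rightarrow> (0, \<phi> \<nu>))"

definition rho :: "'p + nat \<Rightarrow> real" where
  "rho k = (case k of Inl i \<Rightarrow> 0 | Inr \<nu> \<Rightarrow> \<rho> \<nu>)"

definition co :: "'p + nat \<Rightarrow> (real^'p) \<times> 'h \<Rightarrow> real" where
  "co k v = (case k of Inl i \<Rightarrow> fst v $ i | Inr \<nu> \<Rightarrow> hip (snd v) (\<phi> \<nu>))"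

definition idx :: "nat \<Rightarrow> ('p + nat) set" where
  "idx K = UNIV <+> {1..K}"

lemma finite_idx: "finite (idx K)"
  by (simp add: idx_def)

lemma sum_idx: "(\<Sum>k\<in>idx K. f k) = (\<Sum>i\<in>UNIV. f (Inl i)) + (\<Sum>\<nu>=1..K. f (Inr \<nu>))"
  by (simp add: idx_def sum.Plus)

lemma co_linear: "linear (co k)"
proof (cases k)
  case (Inl i)
  then show ?thesis by (intro linearI) (simp_all add: co_def)
next
  case (Inr \<nu>)
  then show ?thesis by (intro linearI) (simp_all add: co_def hip_add hip_scale)
qed

lemma comb_fst: "fst (\<Sum>k\<in>idx K. c k *\<^sub>R bas k) = (\<chi> i. c (Inl i))"
proof -
  have "fst (\<Sum>k\<in>idx K. c k *\<^sub>R bas k) = (\<Sum>i\<in>UNIV. c (Inl i) *\<^sub>R axis i 1)"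
    by (simp add: sum_idx fst_sum bas_def)
  also have "\<dots> = (\<chi> i. c (Inl i))"
    by (simp add: vec_eq_iff axis_def if_distrib[of "\<lambda>x. _ * x"] sum.delta cong: if_cong)
  finally show ?thesis .
qed

lemma comb_snd: "snd (\<Sum>k\<in>idx K. c k *\<^sub>R bas k) = (\<Sum>\<nu>=1..K. c (Inr \<nu>) *\<^sub>R \<phi> \<nu>)"
  by (simp add: sum_idx snd_sum bas_def)

lemma hip_sum: "hip (\<Sum>i\<in>I. c i *\<^sub>R g i) h = (\<Sum>i\<in>I. c i * hip (g i) h)"
  by (simp add: linear_sum[OF hip_linear] hip_scale)

lemma hip_comb_phi: "1 \<le> \<mu> \<Longrightarrow> hip (\<Sum>\<nu>=1..K. c \<nu> *\<^sub>R \<phi> \<nu>) (\<phi> \<mu>) = (if \<mu> \<le> K then c \<mu> else 0)"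
proof -
  assume \<mu>: "1 \<le> \<mu>"
  have "hip (\<Sum>\<nu>=1..K. c \<nu> *\<^sub>R \<phi> \<nu>) (\<phi> \<mu>) = (\<Sum>\<nu>=1..K. c \<nu> * hip (\<phi> \<nu>) (\<phi> \<mu>))" by (rule hip_sum)
  also have "\<dots> = (\<Sum>\<nu>=1..K. if \<nu> = \<mu> then c \<mu> else 0)" using \<mu> by (intro sum.cong) (auto simp: hip_phi)
  also have "\<dots> = (if \<mu> \<le> K then c \<mu> else 0)" using \<mu> by (simp add: sum.delta)
  finally show ?thesis .
qed

lemma co_comb: "k \<in> idx K \<Longrightarrow> co k (\<Sum>k\<in>idx K. c k *\<^sub>R bas k) = c k"
proof (cases k)
  case (Inr \<nu>)
  assume "k \<in> idx K"
  then have "1 \<le> \<nu>" "\<nu> \<le> K" by (auto simp: Inr idx_def)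
  then show ?thesis by (simp only: Inr co_def sum.case comb_snd hip_comb_phi if_True)
qed (simp add: co_def comb_fst)

lemma hip_comb: "hip (\<Sum>\<nu>=1..K. c \<nu> *\<^sub>R \<phi> \<nu>) (\<Sum>\<nu>=1..K. c \<nu> *\<^sub>R \<phi> \<nu>) = (\<Sum>\<nu>=1..K. (c \<nu>)\<^sup>2)"
proof -
  have "hip (\<Sum>\<nu>=1..K. c \<nu> *\<^sub>R \<phi> \<nu>) (\<Sum>\<nu>=1..K. c \<nu> *\<^sub>R \<phi> \<nu>) = (\<Sum>\<nu>=1..K. c \<nu> * hip (\<phi> \<nu>) (\<Sum>\<nu>=1..K. c \<nu> *\<^sub>R \<phi> \<nu>))"
    by (rule hip_sum)
  also have "\<dots> = (\<Sum>\<nu>=1..K. (c \<nu>)\<^sup>2)"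
  proof (intro sum.cong refl)
    fix \<nu> assume "\<nu> \<in> {1..K}"
    then have "1 \<le> \<nu>" "\<nu> \<le> K" by auto
    then have "hip (\<phi> \<nu>) (\<Sum>\<nu>=1..K. c \<nu> *\<^sub>R \<phi> \<nu>) = c \<nu>"
      by (simp only: hip_commute[of "\<phi> \<nu>"] hip_comb_phi if_True)
    then show "c \<nu> * hip (\<phi> \<nu>) (\<Sum>\<nu>=1..K. c \<nu> *\<^sub>R \<phi> \<nu>) = (c \<nu>)\<^sup>2" by (simp add: power2_eq_square)
  qed
  finally show ?thesis .
qed

lemma norm_vec_sq: "(norm (z :: real^'p))\<^sup>2 = (\<Sum>i\<in>UNIV. (z $ i)\<^sup>2)"
  unfolding power2_norm_eq_inner by (simp add: inner_vec_def power2_eq_square)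

lemma nrm2_comb: "nrm2 (\<Sum>k\<in>idx K. c k *\<^sub>R bas k) = (\<Sum>k\<in>idx K. (c k)\<^sup>2)"
  unfolding nrm2_hip comb_fst comb_snd hip_comb norm_vec_sq sum_idx[of "\<lambda>k. (c k)\<^sup>2"] by simp

lemma J_add_left: "J (g + g') h = J g h + J g' h"
  using J_sym J_linear by (metis linear_add)

lemma J_scale_left: "J (c *\<^sub>R g) h = c * J g h"
  using J_sym J_linear by (metis linear_scale real_scaleR_def)

lemma J_linear_left: "linear (\<lambda>g. J g h)"
  by (rule linearI) (simp_all add: J_add_left J_scale_left)

lemma J_comb: "J (snd (\<Sum>k\<in>idx K. c k *\<^sub>R bas k)) (snd (\<Sum>k\<in>idx K. c k *\<^sub>R bas k)) = (\<Sum>k\<in>idx K. rho k * (c k)\<^sup>2)"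
proof -
  define g where "g = (\<Sum>\<nu>=1..K. c (Inr \<nu>) *\<^sub>R \<phi> \<nu>)"
  have 1: "J g h = (\<Sum>\<nu>=1..K. c (Inr \<nu>) * J (\<phi> \<nu>) h)" for h
    by (simp add: g_def linear_sum[OF J_linear_left] J_scale_left)
  have 2: "J g (\<phi> \<mu>) = c (Inr \<mu>) * \<rho> \<mu>" if "\<mu> \<in> {1..K}" for \<mu>
  proof -
    have "J g (\<phi> \<mu>) = (\<Sum>\<nu>=1..K. if \<nu> = \<mu> then c (Inr \<mu>) * \<rho> \<mu> else 0)"
      unfolding 1 using that by (intro sum.cong) (auto simp: eigen_J)
    then show ?thesis using that by simp
  qed
  have "J g g = (\<Sum>\<nu>=1..K. \<rho> \<nu> * (c (Inr \<nu>))\<^sup>2)"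
    unfolding 1[of g] by (intro sum.cong) (auto simp: J_sym[of "\<phi> _" g] 2 power2_eq_square)
  then show ?thesis unfolding comb_snd g_def[symmetric] by (simp add: sum_idx rho_def)
qed

text \<open>Bessel's inequality. It bounds the cost of the cell weights, a sum over finitely many
  coordinates, by a multiple of \<open>nrm2\<close> plus the number of coordinates.\<close>

lemma bessel: "(\<Sum>k\<in>idx K. (co k v)\<^sup>2) \<le> nrm2 v"
proof -
  define g where "g = snd v"
  define c where "c \<nu> = hip g (\<phi> \<nu>)" for \<nu>
  define s where "s = (\<Sum>\<nu>=1..K. c \<nu> *\<^sub>R \<phi> \<nu>)"
  have sub: "hip (a - b) h = hip a h - hip b h" for a b h
    using linear_diff[OF hip_linear] by simp
  have sg: "hip s g = (\<Sum>\<nu>=1..K. (c \<nu>)\<^sup>2)"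
    unfolding s_def hip_sum by (intro sum.cong) (auto simp: c_def hip_commute[of "\<phi> _"] power2_eq_square)
  have ss: "hip s s = (\<Sum>\<nu>=1..K. (c \<nu>)\<^sup>2)" unfolding s_def by (rule hip_comb)
  have "0 \<le> hip (g - s) (g - s)" by (rule hip_nonneg)
  also have "\<dots> = hip g g - hip s g - (hip s g - hip s s)"
    by (simp add: sub hip_commute[of g "g - s"] hip_commute[of s "g - s"] hip_commute[of g s])
  finally have "(\<Sum>\<nu>=1..K. (c \<nu>)\<^sup>2) \<le> hip g g" using sg ss by simp
  then show ?thesis by (simp add: sum_idx co_def nrm2_hip norm_vec_sq c_def g_def)
qed

lemma quadratic_sub_le:
  fixes B :: "'h \<Rightarrow> 'h \<Rightarrow> real"
  assumes add: "\<And>g g' h. B (g + g') h = B g h + B g' h" and sc: "\<And>c g h. B (c *\<^sub>R g) h = c * B g h"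
    and sym: "\<And>g h. B g h = B h g" and pos: "\<And>g. 0 \<le> B g g"
  shows "B (g + h) (g + h) \<le> 2 * B g g + 2 * B h h" "B (g - h) (g - h) \<le> 2 * B g g + 2 * B h h"
proof -
  have neg: "B (- g) h = - B g h" for g h using sc[of "-1" g h] by simp
  have p: "B (g + h) (g + h) = B g g + 2 * B g h + B h h" for g h
    using add sym by (smt (verit))
  have m: "B (g - h) (g - h) = B g g - 2 * B g h + B h h" for g h
    using p[of g "- h"] neg sym by (smt (verit) uminus_add_conv_diff add.commute diff_conv_add_uminus)
  show "B (g + h) (g + h) \<le> 2 * B g g + 2 * B h h" using p[of g h] m[of g h] pos[of "g - h"] by simp
  show "B (g - h) (g - h) \<le> 2 * B g g + 2 * B h h" using p[of g h] m[of g h] pos[of "g + h"] by simp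
qed

lemma J_sub_le: "J (g - h) (g - h) \<le> 2 * J g g + 2 * J h h"
  by (rule quadratic_sub_le[OF J_add_left J_scale_left J_sym J_nonneg])

lemma nrm2_add_le: "nrm2 (v + w) \<le> 2 * nrm2 v + 2 * nrm2 w"
proof -
  have "hip (snd v + snd w) (snd v + snd w) \<le> 2 * hip (snd v) (snd v) + 2 * hip (snd w) (snd w)"
    by (rule quadratic_sub_le[OF hip_add hip_scale hip_commute hip_nonneg])
  moreover have "(norm (fst v + fst w))\<^sup>2 \<le> 2 * (norm (fst v))\<^sup>2 + 2 * (norm (fst w))\<^sup>2"
  proof -
    have "(norm (fst v + fst w))\<^sup>2 \<le> (norm (fst v) + norm (fst w))\<^sup>2" by (intro power_mono norm_triangle_ineq) auto
    also have "\<dots> \<le> 2 * (norm (fst v))\<^sup>2 + 2 * (norm (fst w))\<^sup>2"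
      using sum_squares_bound[of "norm (fst v)" "norm (fst w)"] by (simp add: power2_sum)
    finally show ?thesis .
  qed
  ultimately show ?thesis by (simp add: nrm2_hip)
qed

subsection \<open>Uniform lower bound of the criterion\<close>

lemma u_\<tau>0 [simp]: "u l \<tau>0 x = 0"
  by (simp add: u_def)

lemma u_sq_integrable: "integrable (P l) (u l w)" "integrable (P l) (\<lambda>x. (u l w x)\<^sup>2)" "(\<integral>x. u l w x \<partial>P l) = F l w - F l \<tau>0"
proof -
  interpret R: prob_space "P l" by (rule prob_P)
  show "integrable (P l) (u l w)" using u_diff_integrable[of l w \<tau>0] by simp
  show "integrable (P l) (\<lambda>x. (u l w x)\<^sup>2)" using u_diff_sq_integrable[of l w \<tau>0] by simp
  have "integrable (P l) (\<lambda>x. eta l w x - eta l \<tau>0 x)" by (rule gibbs_integrable_L2_0[OF \<tau>0_in eta_diff_L2_0])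
  then have "(\<integral>x. u l w x - u l \<tau>0 x \<partial>P l) = F l w - F l \<tau>0"
    unfolding u_diff using L2_0_D(3)[OF eta_diff_L2_0[of l w \<tau>0]] R.prob_space by simp
  then show "(\<integral>x. u l w x \<partial>P l) = F l w - F l \<tau>0" by simp
qed

lemma u_sq_le: "\<exists>C>0. \<forall>w\<in>N. (\<Sum>l\<in>UNIV. \<integral>x. (u l w x)\<^sup>2 \<partial>P l) \<le> C * nrm2 (w - \<tau>0)"
proof -
  obtain C where C: "0 < C" "\<And>d w. d \<in> N \<Longrightarrow> w \<in> N \<Longrightarrow> (\<Sum>l\<in>UNIV. \<integral>x. (eta l d x - eta l w x)\<^sup>2 \<partial>P l) \<le> C * nrm2 (d - w)"
    using eta_lipschitz by blast
  have "(\<Sum>l\<in>UNIV. \<integral>x. (u l w x)\<^sup>2 \<partial>P l) \<le> (1 + exp ubound) * C * nrm2 (w - \<tau>0)" if w: "w \<in> N" for w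
  proof -
    have "(\<Sum>l\<in>UNIV. \<integral>x. (u l w x)\<^sup>2 \<partial>P l) \<le> (\<Sum>l\<in>UNIV. (1 + exp ubound) * (\<integral>x. (eta l w x - eta l \<tau>0 x)\<^sup>2 \<partial>P l))"
      using u_diff_sq(2)[OF w \<tau>0_in] by (intro sum_mono) simp
    also have "\<dots> = (1 + exp ubound) * (\<Sum>l\<in>UNIV. \<integral>x. (eta l w x - eta l \<tau>0 x)\<^sup>2 \<partial>P l)" by (simp add: sum_distrib_left)
    also have "\<dots> \<le> (1 + exp ubound) * (C * nrm2 (w - \<tau>0))"
      using C(2)[OF w \<tau>0_in] by (intro mult_left_mono) (auto intro: add_nonneg_nonneg)
    finally show ?thesis by simp
  qed
  moreover have "0 < (1 + exp ubound) * C" using C by (simp add: add_pos_pos)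
  ultimately show ?thesis by blast
qed

lemma tang_sq_le: "\<exists>C>0. \<forall>w\<in>N. \<forall>v. (\<Sum>l\<in>UNIV. \<integral>x. (tang l w v x)\<^sup>2 \<partial>P l) \<le> C * nrm2 v"
proof -
  obtain C where C: "0 < C" "\<And>v. S v \<le> C * nrm2 v" using S_equiv by blast
  have "(\<Sum>l\<in>UNIV. \<integral>x. (tang l w v x)\<^sup>2 \<partial>P l) \<le> (1 + exp ubound) * (C2 * C) * nrm2 v" if w: "w \<in> N" for w v
  proof -
    have "(\<Sum>l\<in>UNIV. \<integral>x. (tang l w v x)\<^sup>2 \<partial>P l) \<le> (\<Sum>l\<in>UNIV. (1 + exp ubound) * (\<integral>x. (Deta l w v x)\<^sup>2 \<partial>P l))"
      by (intro sum_mono tang_sq w)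
    also have "\<dots> = (1 + exp ubound) * (\<Sum>l\<in>UNIV. \<integral>x. (Deta l w v x)\<^sup>2 \<partial>P l)" by (simp add: sum_distrib_left)
    also have "\<dots> \<le> (1 + exp ubound) * (C2 * (C * nrm2 v))"
    proof (intro mult_left_mono)
      have "C2 * S v \<le> C2 * (C * nrm2 v)" using C2_pos C(2) by (intro mult_left_mono) auto
      then show "(\<Sum>l\<in>UNIV. \<integral>x. (Deta l w v x)\<^sup>2 \<partial>P l) \<le> C2 * (C * nrm2 v)" using Deta_bounds(2)[OF w, of v] by linarith
    qed (auto intro: add_nonneg_nonneg)
    finally show ?thesis by simp
  qed
  moreover have "0 < (1 + exp ubound) * (C2 * C)" using C C2_pos by (simp add: add_pos_pos)
  ultimately show ?thesis by blast
qed

lemma tang_comb: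
  assumes w: "w \<in> N"
  shows "AE x in P l. tang l w (\<Sum>k\<in>idx K. c k *\<^sub>R bas k) x = (\<Sum>k\<in>idx K. c k * tang l w (bas k) x)"
    "mw l w (\<Sum>k\<in>idx K. c k *\<^sub>R bas k) = (\<Sum>k\<in>idx K. c k * mw l w (bas k))"
proof -
  have D: "AE x in P l. Deta l w (\<Sum>k\<in>idx K. c k *\<^sub>R bas k) x = (\<Sum>k\<in>idx K. c k * Deta l w (bas k) x)"
    by (rule L2_bounded_linear_sum[OF Deta_bounded_linear[OF w] finite_idx])
  have i: "integrable (gibbs (M l) (eta l w)) (Deta l w v)" for v
    by (rule gibbs_integrable_L2_0[OF w Deta_L2_0[OF w]])
  have "AE x in gibbs (M l) (eta l w). Deta l w (\<Sum>k\<in>idx K. c k *\<^sub>R bas k) x = (\<Sum>k\<in>idx K. c k * Deta l w (bas k) x)"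
    using D by (rule AE_gibbs[THEN iffD2])
  then have "mw l w (\<Sum>k\<in>idx K. c k *\<^sub>R bas k) = (\<integral>x. (\<Sum>k\<in>idx K. c k * Deta l w (bas k) x) \<partial>gibbs (M l) (eta l w))"
    unfolding mw_def using Deta_measurable[OF w] by (intro integral_cong_AE) auto
  also have "\<dots> = (\<Sum>k\<in>idx K. c k * mw l w (bas k))" using i by (simp add: mw_def)
  finally show m: "mw l w (\<Sum>k\<in>idx K. c k *\<^sub>R bas k) = (\<Sum>k\<in>idx K. c k * mw l w (bas k))" .
  show "AE x in P l. tang l w (\<Sum>k\<in>idx K. c k *\<^sub>R bas k) x = (\<Sum>k\<in>idx K. c k * tang l w (bas k) x)"
    using D by eventually_elim (simp add: tang_def m right_diff_distrib sum_subtractf)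
qed

text \<open>\<open>exp_tilt_le\<close> is integrated under \<open>\<tau>0\<close>, and
  \<open>1 + x \<le> exp x\<close> turns the result into an exponential, so that independent
  observations add up in the exponent.\<close>

lemma mgf_tilt_le:
  assumes w: "w \<in> N" and a: "0 \<le> a" "a * ubound \<le> 1"
  shows "(\<integral>\<^sup>+x. ennreal (exp (- (a * u l w x)) * tilt (a * tang l w v x)) \<partial>P l)
    \<le> ennreal (exp (- a * (F l w - F l \<tau>0 + mw l w v) + a\<^sup>2 * (2 * (\<integral>x. (u l w x)\<^sup>2 \<partial>P l) + 4 * (\<integral>x. (tang l w v x)\<^sup>2 \<partial>P l))))"
proof -
  interpret R: prob_space "P l" by (rule prob_P)
  define f where "f x = 1 - a * (u l w x + tang l w v x) + a\<^sup>2 * (2 * (u l w x)\<^sup>2 + 4 * (tang l w v x)\<^sup>2)" for x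
  note t = tang_sq[OF w, of l v] and uu = u_sq_integrable[of l w]
  have le: "AE x in P l. exp (- (a * u l w x)) * tilt (a * tang l w v x) \<le> f x"
    using ubound(2)[OF w, of l]
  proof eventually_elim
    case (elim x)
    have "a * \<bar>u l w x\<bar> \<le> a * ubound" using elim a by (intro mult_left_mono) auto
    then show ?case unfolding f_def using a by (intro exp_tilt_le) auto
  qed
  have fi: "integrable (P l) f" unfolding f_def[abs_def] using t uu by simp
  have f0: "AE x in P l. 0 \<le> f x"
    using le
  proof eventually_elim
    case (elim x)
    have "0 \<le> exp (- (a * u l w x)) * tilt (a * tang l w v x)" using tilt_pos by (simp add: less_imp_le)
    then show ?case using elim by linarith
  qed
  have "(\<integral>\<^sup>+x. ennreal (exp (- (a * u l w x)) * tilt (a * tang l w v x)) \<partial>P l) \<le> (\<integral>\<^sup>+x. ennreal (f x) \<partial>P l)"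
    using le by (intro nn_integral_mono_AE) (auto elim!: eventually_mono intro: ennreal_leI)
  also have "\<dots> = ennreal (\<integral>x. f x \<partial>P l)" by (rule nn_integral_eq_integral[OF fi f0])
  also have "(\<integral>x. f x \<partial>P l) = 1 - a * ((\<integral>x. u l w x \<partial>P l) + (\<integral>x. tang l w v x \<partial>P l))
      + a\<^sup>2 * (2 * (\<integral>x. (u l w x)\<^sup>2 \<partial>P l) + 4 * (\<integral>x. (tang l w v x)\<^sup>2 \<partial>P l))"
    unfolding f_def using t(1,2) uu(1,2) R.prob_space by simp
  also have "\<dots> = 1 + (- a * (F l w - F l \<tau>0 + mw l w v) + a\<^sup>2 * (2 * (\<integral>x. (u l w x)\<^sup>2 \<partial>P l) + 4 * (\<integral>x. (tang l w v x)\<^sup>2 \<partial>P l)))"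
    unfolding uu(3) t(3) by simp
  also have "ennreal \<dots> \<le> ennreal (exp (- a * (F l w - F l \<tau>0 + mw l w v) + a\<^sup>2 * (2 * (\<integral>x. (u l w x)\<^sup>2 \<partial>P l) + 4 * (\<integral>x. (tang l w v x)\<^sup>2 \<partial>P l))))"
    by (intro ennreal_leI exp_ge_add_one_self)
  finally show ?thesis .
qed

text \<open>The prior on directions is Gaussian with standard deviation \<open>\<sigma> k\<close>
  along \<open>bas k\<close>, placed at each base point \<open>w\<close>; \<open>v\<close> holds the
  direction in these units. Linearity of the tangent in the direction brings the observations into
  the form required by \<open>pac_bayes_gauss\<close>, and \<open>nrm2\<close> controls the
  second-order terms.\<close>

lemma pac_tangent:
  fixes n :: "'m \<Rightarrow> nat" and \<sigma> :: "'p + nat \<Rightarrow> real"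
  assumes W: "finite W" "W \<subseteq> N" and n: "\<And>l. 0 < n l" and nm: "0 < nm" "\<And>l. nm \<le> real (n l)"
    and s: "0 < s" "s * ubound \<le> 1"
    and wt: "\<And>w. w \<in> W \<Longrightarrow> 0 < wt w" "sum wt W \<le> 1" and \<epsilon>: "0 < \<epsilon>"
    and Cu: "\<And>w. w \<in> N \<Longrightarrow> (\<Sum>l\<in>UNIV. \<integral>x. (u l w x)\<^sup>2 \<partial>P l) \<le> Cu * nrm2 (w - \<tau>0)"
    and Ct: "\<And>w v. w \<in> N \<Longrightarrow> (\<Sum>l\<in>UNIV. \<integral>x. (tang l w v x)\<^sup>2 \<partial>P l) \<le> Ct * nrm2 v"
  shows "\<exists>E\<in>events. prob E \<le> \<epsilon> \<and> (\<forall>\<omega>\<in>space \<Omega> - E. \<forall>w\<in>W. \<forall>v.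
    s * nm * (\<Sum>l\<in>UNIV. F l w - F l \<tau>0 + mw l w (\<Sum>k\<in>idx K. (\<sigma> k * v k) *\<^sub>R bas k))
      - s\<^sup>2 * nm * (2 * (Cu * nrm2 (w - \<tau>0)) + 4 * (Ct * ((\<Sum>k\<in>idx K. (\<sigma> k * v k)\<^sup>2) + (\<Sum>k\<in>idx K. (\<sigma> k)\<^sup>2))))
      - (\<Sum>k\<in>idx K. (v k)\<^sup>2) / 2 + ln (\<epsilon> * wt w)
    \<le> (\<Sum>l\<in>UNIV. \<Sum>i<n l. s * nm / real (n l) * u l w (X l i \<omega>)
        + max (s * nm / real (n l) * (\<Sum>k\<in>idx K. \<sigma> k * v k * tang l w (bas k) (X l i \<omega>))) (- 1 / 4)))"
proof -
  \<comment> \<open>Each observation of sample \<open>l\<close> is weighted so that every sample has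
    the total weight \<open>s * nm\<close>, while no single weight exceeds \<open>s\<close>.\<close>
  define \<alpha> where "\<alpha> l = s * nm / real (n l)" for l
  have n0: "0 < real (n l)" for l using n[of l] by simp
  have \<alpha>: "0 \<le> \<alpha> l" "\<alpha> l \<le> s" "real (n l) * \<alpha> l = s * nm" for l
  proof -
    show "0 \<le> \<alpha> l" using s nm n0[of l] by (simp add: \<alpha>_def)
    have "s * nm \<le> s * real (n l)" using s nm(2)[of l] by (intro mult_left_mono) auto
    then show "\<alpha> l \<le> s" using n0[of l] by (simp add: \<alpha>_def pos_divide_le_eq)
    show "real (n l) * \<alpha> l = s * nm" using n0[of l] by (simp add: \<alpha>_def)
  qed
  have \<alpha>b: "\<alpha> l * ubound \<le> 1" for l
  proof -
    have "\<alpha> l * ubound \<le> s * ubound" using \<alpha>(2) ubound(1) by (intro mult_right_mono) auto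
    then show ?thesis using s by simp
  qed
  define I where "I = Sigma (UNIV :: 'm set) (\<lambda>l. {..<n l})"
  have I: "finite I" by (simp add: I_def)
  have sumI: "(\<Sum>j\<in>I. f j) = (\<Sum>l\<in>UNIV. \<Sum>i<n l. f (l, i))" for f :: "'m \<times> nat \<Rightarrow> real"
    unfolding I_def by (subst sum.Sigma) auto
  define a where "a w = (\<lambda>(l, i :: nat) x. \<alpha> l * u l w x)" for w
  define c where "c w = (\<lambda>(l, i :: nat) k x. \<alpha> l * (\<sigma> k * tang l w (bas k) x))" for w
  define A where "A w = - (s * nm * (\<Sum>l\<in>UNIV. F l w - F l \<tau>0)) + s\<^sup>2 * nm * (2 * (Cu * nrm2 (w - \<tau>0)))" for w
  define B where "B w k = - (s * nm * (\<sigma> k * (\<Sum>l\<in>UNIV. mw l w (bas k))))" for w k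
  define Q where "Q k = s\<^sup>2 * nm * (4 * (Ct * (\<sigma> k)\<^sup>2))" for k
  define vec where "vec z = (\<Sum>k\<in>idx K. (\<sigma> k * z k) *\<^sub>R bas k)" for z
  have nv: "nrm2 (vec z) = (\<Sum>k\<in>idx K. (\<sigma> k * z k)\<^sup>2)" for z unfolding vec_def by (rule nrm2_comb)
  have sumB: "(\<Sum>k\<in>idx K. B w k * z k) = - (s * nm * (\<Sum>l\<in>UNIV. mw l w (vec z)))" if "w \<in> N" for w z
  proof -
    have "(\<Sum>l\<in>UNIV. mw l w (vec z)) = (\<Sum>k\<in>idx K. \<sigma> k * z k * (\<Sum>l\<in>UNIV. mw l w (bas k)))"
      unfolding vec_def tang_comb(2)[OF that] sum_distrib_left by (rule sum.swap)
    then have "s * nm * (\<Sum>l\<in>UNIV. mw l w (vec z)) = (\<Sum>k\<in>idx K. s * nm * (\<sigma> k * z k * (\<Sum>l\<in>UNIV. mw l w (bas k))))"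
      by (simp only: sum_distrib_left)
    then show ?thesis by (simp add: B_def sum_negf mult_ac)
  qed
  have mgf: "(\<Prod>j\<in>I. \<integral>\<^sup>+\<omega>. ennreal (exp (- a w j ((\<lambda>(l, i). X l i) j \<omega>)) * tilt (\<Sum>k\<in>idx K. c w j k ((\<lambda>(l, i). X l i) j \<omega>) * z k)) \<partial>\<Omega>)
        \<le> ennreal (exp (A w + (\<Sum>k\<in>idx K. B w k * z k + Q k * (z k)\<^sup>2)))" if w: "w \<in> W" for w z
  proof -
    have wN: "w \<in> N" using w W by blast
    define e where "e l = - \<alpha> l * (F l w - F l \<tau>0 + mw l w (vec z)) + (\<alpha> l)\<^sup>2 * (2 * (\<integral>x. (u l w x)\<^sup>2 \<partial>P l) + 4 * (\<integral>x. (tang l w (vec z) x)\<^sup>2 \<partial>P l))" for l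
    have one: "(\<integral>\<^sup>+\<omega>. ennreal (exp (- a w j ((\<lambda>(l, i). X l i) j \<omega>)) * tilt (\<Sum>k\<in>idx K. c w j k ((\<lambda>(l, i). X l i) j \<omega>) * z k)) \<partial>\<Omega>)
      \<le> ennreal (exp (e (fst j)))" for j
    proof (cases j)
      case (Pair l i)
      have [measurable]: "(\<lambda>x. \<Sum>k\<in>idx K. \<alpha> l * (\<sigma> k * tang l w (bas k) x) * z k) \<in> borel_measurable (M l)"
        by (intro borel_measurable_sum borel_measurable_times borel_measurable_const tang_measurable wN)
      have "(\<integral>\<^sup>+\<omega>. ennreal (exp (- a w j ((\<lambda>(l, i). X l i) j \<omega>)) * tilt (\<Sum>k\<in>idx K. c w j k ((\<lambda>(l, i). X l i) j \<omega>) * z k)) \<partial>\<Omega>)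
        = (\<integral>\<^sup>+\<omega>. (\<lambda>x. ennreal (exp (- (\<alpha> l * u l w x)) * tilt (\<Sum>k\<in>idx K. \<alpha> l * (\<sigma> k * tang l w (bas k) x) * z k))) (X l i \<omega>) \<partial>\<Omega>)"
        by (simp add: Pair a_def c_def)
      also have "\<dots> = (\<integral>\<^sup>+x. ennreal (exp (- (\<alpha> l * u l w x)) * tilt (\<Sum>k\<in>idx K. \<alpha> l * (\<sigma> k * tang l w (bas k) x) * z k)) \<partial>distr \<Omega> (M l) (X l i))"
        by (intro nn_integral_distr[symmetric] X_measurable) simp
      also have "\<dots> = (\<integral>\<^sup>+x. ennreal (exp (- (\<alpha> l * u l w x)) * tilt (\<Sum>k\<in>idx K. \<alpha> l * (\<sigma> k * tang l w (bas k) x) * z k)) \<partial>P l)"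
        by (simp only: X_law)
      also have "\<dots> = (\<integral>\<^sup>+x. ennreal (exp (- (\<alpha> l * u l w x)) * tilt (\<alpha> l * tang l w (vec z) x)) \<partial>P l)"
      proof (rule nn_integral_cong_AE)
        show "AE x in P l. ennreal (exp (- (\<alpha> l * u l w x)) * tilt (\<Sum>k\<in>idx K. \<alpha> l * (\<sigma> k * tang l w (bas k) x) * z k))
          = ennreal (exp (- (\<alpha> l * u l w x)) * tilt (\<alpha> l * tang l w (vec z) x))"
          using tang_comb(1)[OF wN, of l "\<lambda>k. \<sigma> k * z k" K]
          by eventually_elim (simp add: vec_def sum_distrib_left mult_ac)
      qed
      also have "\<dots> \<le> ennreal (exp (e l))" unfolding e_def by (rule mgf_tilt_le[OF wN \<alpha>(1) \<alpha>b])
      finally show ?thesis by (simp add: Pair)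
    qed
    have "(\<Prod>j\<in>I. \<integral>\<^sup>+\<omega>. ennreal (exp (- a w j ((\<lambda>(l, i). X l i) j \<omega>)) * tilt (\<Sum>k\<in>idx K. c w j k ((\<lambda>(l, i). X l i) j \<omega>) * z k)) \<partial>\<Omega>)
      \<le> (\<Prod>j\<in>I. ennreal (exp (e (fst j))))"
      by (intro prod_mono_ennreal one)
    also have "\<dots> = ennreal (exp (\<Sum>j\<in>I. e (fst j)))" by (simp add: prod_ennreal exp_sum[OF I])
    also have "(\<Sum>j\<in>I. e (fst j)) = (\<Sum>l\<in>UNIV. real (n l) * e l)" unfolding sumI by simp
    also have "ennreal (exp \<dots>) \<le> ennreal (exp (A w + (\<Sum>k\<in>idx K. B w k * z k + Q k * (z k)\<^sup>2)))"
    proof (intro ennreal_leI exp_le_cancel_iff[THEN iffD2])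
      have "(\<Sum>l\<in>UNIV. real (n l) * e l) \<le> (\<Sum>l\<in>UNIV. - (s * nm) * (F l w - F l \<tau>0 + mw l w (vec z))
        + s\<^sup>2 * nm * (2 * (\<integral>x. (u l w x)\<^sup>2 \<partial>P l) + 4 * (\<integral>x. (tang l w (vec z) x)\<^sup>2 \<partial>P l)))"
      proof (rule sum_mono)
        fix l
        define T where "T = 2 * (\<integral>x. (u l w x)\<^sup>2 \<partial>P l) + 4 * (\<integral>x. (tang l w (vec z) x)\<^sup>2 \<partial>P l)"
        have T: "0 \<le> T" by (simp add: T_def)
        \<comment> \<open>One factor \<open>\<alpha> l\<close> is absorbed by the sample size and
          the other is bounded by \<open>s\<close>, so every sample contributes with at most
          \<open>s\<^sup>2 * nm\<close>.\<close>
        have "real (n l) * e l = - (real (n l) * \<alpha> l) * (F l w - F l \<tau>0 + mw l w (vec z)) + (real (n l) * \<alpha> l) * (\<alpha> l * T)"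
          by (simp add: e_def T_def power2_eq_square algebra_simps)
        also have "\<dots> \<le> - (s * nm) * (F l w - F l \<tau>0 + mw l w (vec z)) + (s * nm) * (s * T)"
          unfolding \<alpha>(3) using T s nm \<alpha>(2)[of l] by (intro add_left_mono mult_left_mono mult_right_mono) auto
        finally show "real (n l) * e l \<le> - (s * nm) * (F l w - F l \<tau>0 + mw l w (vec z)) + s\<^sup>2 * nm * (2 * (\<integral>x. (u l w x)\<^sup>2 \<partial>P l) + 4 * (\<integral>x. (tang l w (vec z) x)\<^sup>2 \<partial>P l))"
          unfolding T_def[symmetric] by (simp add: power2_eq_square mult_ac)
      qed
      also have "\<dots> = - (s * nm) * (\<Sum>l\<in>UNIV. F l w - F l \<tau>0) - s * nm * (\<Sum>l\<in>UNIV. mw l w (vec z))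
        + s\<^sup>2 * nm * (2 * (\<Sum>l\<in>UNIV. \<integral>x. (u l w x)\<^sup>2 \<partial>P l) + 4 * (\<Sum>l\<in>UNIV. \<integral>x. (tang l w (vec z) x)\<^sup>2 \<partial>P l))"
        by (simp add: sum.distrib sum_subtractf sum_distrib_left right_diff_distrib distrib_left sum_negf)
      also have "\<dots> \<le> - (s * nm) * (\<Sum>l\<in>UNIV. F l w - F l \<tau>0) - s * nm * (\<Sum>l\<in>UNIV. mw l w (vec z))
        + s\<^sup>2 * nm * (2 * (Cu * nrm2 (w - \<tau>0)) + 4 * (Ct * nrm2 (vec z)))"
        using nm Cu[OF wN] Ct[OF wN, of "vec z"] by (intro add_left_mono mult_left_mono add_mono) auto
      also have "\<dots> = A w + (\<Sum>k\<in>idx K. B w k * z k + Q k * (z k)\<^sup>2)"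
      proof -
        have "s\<^sup>2 * nm * (4 * (Ct * nrm2 (vec z))) = (\<Sum>k\<in>idx K. Q k * (z k)\<^sup>2)"
          unfolding nv sum_distrib_left by (intro sum.cong) (auto simp: Q_def power_mult_distrib)
        then show ?thesis unfolding sum.distrib sumB[OF wN] by (simp add: A_def distrib_left)
      qed
      finally show "(\<Sum>l\<in>UNIV. real (n l) * e l) \<le> A w + (\<Sum>k\<in>idx K. B w k * z k + Q k * (z k)\<^sup>2)" .
    qed
    finally show ?thesis .
  qed
  have am: "a w j \<in> borel_measurable ((\<lambda>(l, i). M l) j)" for w j by (cases j) (simp add: a_def)
  have cm: "c w j k \<in> borel_measurable ((\<lambda>(l, i). M l) j)" if "w \<in> W" for w j k
    using tang_measurable[of w _ "bas k"] that W by (cases j) (auto simp: c_def)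
  have ind: "indep_vars (\<lambda>(l, i). M l) (\<lambda>(l, i). X l i) I" by (rule indep_vars_subset[OF X_indep]) simp
  define good where "good \<omega> w v \<longleftrightarrow> - A w - (\<Sum>k\<in>idx K. B w k * v k + Q k * ((v k)\<^sup>2 + 1)) - (\<Sum>k\<in>idx K. (v k)\<^sup>2) / 2 + ln (\<epsilon> * wt w)
      \<le> (\<Sum>j\<in>I. a w j ((\<lambda>(l, i). X l i) j \<omega>) + max (\<Sum>k\<in>idx K. c w j k ((\<lambda>(l, i). X l i) j \<omega>) * v k) (- 1 / 4))"
    for \<omega> w and v :: "'p + nat \<Rightarrow> real"
  have "\<exists>E\<in>events. prob E \<le> \<epsilon> \<and> (\<forall>\<omega>\<in>space \<Omega> - E. \<forall>w\<in>W. \<forall>v. good \<omega> w v)"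
    unfolding good_def
    by (rule pac_bayes_gauss[where A = A and B = B and Q = "\<lambda>_. Q" and a = a and c = c, OF I finite_idx W(1) ind am cm wt mgf \<epsilon>])
  then obtain E where E: "E \<in> events" "prob E \<le> \<epsilon>"
    and main: "\<And>\<omega> w v. \<omega> \<in> space \<Omega> - E \<Longrightarrow> w \<in> W \<Longrightarrow> good \<omega> w v" by blast
  show ?thesis
  proof (intro bexI[OF _ E(1)] conjI E(2) ballI allI)
    fix \<omega> w v assume \<omega>: "\<omega> \<in> space \<Omega> - E" and w: "w \<in> W"
    have wN: "w \<in> N" using w W by blast
    have R: "(\<Sum>j\<in>I. a w j ((\<lambda>(l, i). X l i) j \<omega>) + max (\<Sum>k\<in>idx K. c w j k ((\<lambda>(l, i). X l i) j \<omega>) * v k) (- 1 / 4))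
      = (\<Sum>l\<in>UNIV. \<Sum>i<n l. s * nm / real (n l) * u l w (X l i \<omega>)
        + max (s * nm / real (n l) * (\<Sum>k\<in>idx K. \<sigma> k * v k * tang l w (bas k) (X l i \<omega>))) (- 1 / 4))"
      unfolding sumI \<alpha>_def[symmetric] a_def c_def prod.case sum_distrib_left by (simp only: mult_ac)
    have "(\<Sum>k\<in>idx K. Q k * ((v k)\<^sup>2 + 1)) = s\<^sup>2 * nm * (4 * (Ct * ((\<Sum>k\<in>idx K. (\<sigma> k * v k)\<^sup>2) + (\<Sum>k\<in>idx K. (\<sigma> k)\<^sup>2))))"
      unfolding sum.distrib[symmetric] sum_distrib_left by (intro sum.cong) (auto simp: Q_def power_mult_distrib algebra_simps)
    then have L: "- A w - (\<Sum>k\<in>idx K. B w k * v k + Q k * ((v k)\<^sup>2 + 1))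
      = s * nm * (\<Sum>l\<in>UNIV. F l w - F l \<tau>0 + mw l w (\<Sum>k\<in>idx K. (\<sigma> k * v k) *\<^sub>R bas k))
      - s\<^sup>2 * nm * (2 * (Cu * nrm2 (w - \<tau>0)) + 4 * (Ct * ((\<Sum>k\<in>idx K. (\<sigma> k * v k)\<^sup>2) + (\<Sum>k\<in>idx K. (\<sigma> k)\<^sup>2))))"
      unfolding sum.distrib[of "\<lambda>k. B w k * v k"] sumB[OF wN] vec_def[symmetric]
      by (simp add: A_def sum.distrib distrib_left)
    show "s * nm * (\<Sum>l\<in>UNIV. F l w - F l \<tau>0 + mw l w (\<Sum>k\<in>idx K. (\<sigma> k * v k) *\<^sub>R bas k))
      - s\<^sup>2 * nm * (2 * (Cu * nrm2 (w - \<tau>0)) + 4 * (Ct * ((\<Sum>k\<in>idx K. (\<sigma> k * v k)\<^sup>2) + (\<Sum>k\<in>idx K. (\<sigma> k)\<^sup>2))))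
      - (\<Sum>k\<in>idx K. (v k)\<^sup>2) / 2 + ln (\<epsilon> * wt w)
    \<le> (\<Sum>l\<in>UNIV. \<Sum>i<n l. s * nm / real (n l) * u l w (X l i \<omega>)
        + max (s * nm / real (n l) * (\<Sum>k\<in>idx K. \<sigma> k * v k * tang l w (bas k) (X l i \<omega>))) (- 1 / 4))"
      using main[OF \<omega> w, of v] unfolding good_def R L .
  qed
qed

text \<open>\<open>pac_tangent\<close> is applied at the base point \<open>rep d\<close> with the
  posterior centred at \<open>d - rep d\<close>. On the empirical side the tangent is at most the
  increment of \<open>u\<close> plus a divergence, by the single-observation bound; on the
  deterministic side the linearization of \<open>F\<close> at \<open>rep d\<close> is replaced by
  \<open>F l d\<close> at the cost of another divergence. Together they account for the factor
  \<open>exp ubound + real CARD('m)\<close>.\<close>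

lemma pac_finite:
  fixes n :: "'m \<Rightarrow> nat" and \<sigma> :: "'p + nat \<Rightarrow> real"
  assumes conv: nll_convexity
    and D: "finite D" "D \<subseteq> N" "\<And>d. d \<in> D \<Longrightarrow> \<exists>c. d = (\<Sum>k\<in>idx K. c k *\<^sub>R bas k)"
    and rep: "\<And>d. d \<in> D \<Longrightarrow> rep d \<in> D"
    and n: "\<And>l. 0 < n l" and nm: "0 < nm" "\<And>l. nm \<le> real (n l)"
    and s: "0 < s" "s * ubound \<le> 1 / 8"
    and wt: "\<And>w. 0 < wt w" "sum wt (rep ` D) \<le> 1" and \<epsilon>: "0 < \<epsilon>"
    and \<sigma>: "\<And>k. k \<in> idx K \<Longrightarrow> 0 < \<sigma> k"
    and Cu: "\<And>w. w \<in> N \<Longrightarrow> (\<Sum>l\<in>UNIV. \<integral>x. (u l w x)\<^sup>2 \<partial>P l) \<le> Cu * nrm2 (w - \<tau>0)"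
    and Ct: "\<And>w v. w \<in> N \<Longrightarrow> (\<Sum>l\<in>UNIV. \<integral>x. (tang l w v x)\<^sup>2 \<partial>P l) \<le> Ct * nrm2 v"
    and Ck: "\<And>d w. d \<in> N \<Longrightarrow> w \<in> N \<Longrightarrow> (\<Sum>l\<in>UNIV. kl l d w) \<le> Ck * nrm2 (d - w)"
  shows "\<exists>E\<in>events. prob E \<le> \<epsilon> \<and> (\<forall>\<omega>\<in>space \<Omega> - E. \<forall>d\<in>D.
    s * nm * ((\<Sum>l\<in>UNIV. F l d - F l \<tau>0) - (exp ubound + real CARD('m)) * (Ck * nrm2 (d - rep d)))
      - s\<^sup>2 * nm * (2 * (Cu * nrm2 (rep d - \<tau>0)) + 4 * (Ct * (nrm2 (d - rep d) + (\<Sum>k\<in>idx K. (\<sigma> k)\<^sup>2))))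
      - (\<Sum>k\<in>idx K. (co k (d - rep d) / \<sigma> k)\<^sup>2) / 2 + ln (\<epsilon> * wt (rep d))
    \<le> s * nm * emp n (\<lambda>l. u l d) \<omega>)"
proof -
  have W: "finite (rep ` D)" "rep ` D \<subseteq> N" using D(1,2) rep by (blast, blast)
  have s1: "s * ubound \<le> 1" using s by simp
  define pac where "pac \<omega> w v \<longleftrightarrow> s * nm * (\<Sum>l\<in>UNIV. F l w - F l \<tau>0 + mw l w (\<Sum>k\<in>idx K. (\<sigma> k * v k) *\<^sub>R bas k))
      - s\<^sup>2 * nm * (2 * (Cu * nrm2 (w - \<tau>0)) + 4 * (Ct * ((\<Sum>k\<in>idx K. (\<sigma> k * v k)\<^sup>2) + (\<Sum>k\<in>idx K. (\<sigma> k)\<^sup>2))))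
      - (\<Sum>k\<in>idx K. (v k)\<^sup>2) / 2 + ln (\<epsilon> * wt w)
    \<le> (\<Sum>l\<in>UNIV. \<Sum>i<n l. s * nm / real (n l) * u l w (X l i \<omega>)
        + max (s * nm / real (n l) * (\<Sum>k\<in>idx K. \<sigma> k * v k * tang l w (bas k) (X l i \<omega>))) (- 1 / 4))" for \<omega> w v
  have "\<exists>E\<in>events. prob E \<le> \<epsilon> \<and> (\<forall>\<omega>\<in>space \<Omega> - E. \<forall>w\<in>rep ` D. \<forall>v. pac \<omega> w v)"
    unfolding pac_def by (rule pac_tangent[OF W n nm s(1) s1 wt(1) wt(2) \<epsilon> Cu Ct])
  then obtain E0 where E0: "E0 \<in> events" "prob E0 \<le> \<epsilon>"
    and pac: "\<And>\<omega> w v. \<omega> \<in> space \<Omega> - E0 \<Longrightarrow> w \<in> rep ` D \<Longrightarrow> pac \<omega> w v" by blast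
  \<comment> \<open>Both points are finite combinations of the basis, so their difference is
    recovered exactly from its coordinates.\<close>
  have diff: "d - rep d = (\<Sum>k\<in>idx K. co k (d - rep d) *\<^sub>R bas k)" if d: "d \<in> D" for d
  proof -
    obtain c c' where "d = (\<Sum>k\<in>idx K. c k *\<^sub>R bas k)" "rep d = (\<Sum>k\<in>idx K. c' k *\<^sub>R bas k)"
      using D(3)[OF d] D(3)[OF rep[OF d]] by blast
    then have eq: "d - rep d = (\<Sum>k\<in>idx K. (c k - c' k) *\<^sub>R bas k)" by (simp add: scaleR_left_diff_distrib sum_subtractf)
    have "co k (d - rep d) = c k - c' k" if "k \<in> idx K" for k
      unfolding eq by (rule co_comb[OF that])
    then show ?thesis using eq by (simp cong: sum.cong)
  qed
  define Kl where "Kl d = (\<Sum>l\<in>UNIV. kl l d (rep d))" for d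
  define good where "good d l x \<longleftrightarrow>
      tang l (rep d) (d - rep d) x = (\<Sum>k\<in>idx K. co k (d - rep d) * tang l (rep d) (bas k) x) \<and>
      tang l (rep d) (d - rep d) x - Kl d \<le> u l d x - u l (rep d) x \<and> \<bar>u l d x\<bar> \<le> ubound \<and> \<bar>u l (rep d) x\<bar> \<le> ubound" for d l x
  have AEg: "AE x in P l. good d l x" if d: "d \<in> D" for d l
  proof -
    have dN: "d \<in> N" "rep d \<in> N" using d D(2) rep by blast+
    have "AE x in P l. tang l (rep d) (d - rep d) x = (\<Sum>k\<in>idx K. co k (d - rep d) * tang l (rep d) (bas k) x)"
      using tang_comb(1)[OF dN(2), of l "\<lambda>k. co k (d - rep d)" K] by (simp add: diff[OF d, symmetric])
    moreover have "AE x in P l. tang l (rep d) (d - rep d) x - Kl d \<le> u l d x - u l (rep d) x"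
      unfolding Kl_def by (rule tangent_bounds(3)[OF conv dN(2,1)])
    ultimately show ?thesis
      using ubound(2)[OF dN(1), of l] ubound(2)[OF dN(2), of l] by eventually_elim (simp add: good_def)
  qed
  \<comment> \<open>The almost sure bounds are needed at finitely many parameters and observations
    only, so one null set \<open>N0\<close> serves them all.\<close>
  have "AE \<omega> in \<Omega>. \<forall>j\<in>D \<times> Sigma UNIV (\<lambda>l. {..<n l}). good (fst j) (fst (snd j)) (X (fst (snd j)) (snd (snd j)) \<omega>)"
    using D(1) AEg by (subst AE_finite_all) (auto intro: AE_X)
  then obtain N0 where N0: "{\<omega>\<in>space \<Omega>. \<not> (\<forall>j\<in>D \<times> Sigma UNIV (\<lambda>l. {..<n l}). good (fst j) (fst (snd j)) (X (fst (snd j)) (snd (snd j)) \<omega>))} \<subseteq> N0"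
    "emeasure \<Omega> N0 = 0" "N0 \<in> events" by (rule AE_E)
  have g: "good d l (X l i \<omega>)" if "\<omega> \<in> space \<Omega>" "\<omega> \<notin> N0" "d \<in> D" "i < n l" for \<omega> d l i
  proof -
    have "\<forall>j\<in>D \<times> Sigma UNIV (\<lambda>l. {..<n l}). good (fst j) (fst (snd j)) (X (fst (snd j)) (snd (snd j)) \<omega>)"
      using N0(1) that(1,2) by blast
    from bspec[OF this, of "(d, (l, i))"] show ?thesis using that(3,4) by simp
  qed
  show ?thesis
  proof (intro bexI[of _ "E0 \<union> N0"] conjI ballI)
    show "E0 \<union> N0 \<in> events" using E0 N0 by auto
    have "prob (E0 \<union> N0) \<le> prob E0 + prob N0" using E0 N0 by (intro measure_Un_le) auto
    also have "prob N0 = 0" using N0(2) by (simp add: measure_def)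
    finally show "prob (E0 \<union> N0) \<le> \<epsilon>" using E0(2) by simp
    fix \<omega> d assume \<omega>: "\<omega> \<in> space \<Omega> - (E0 \<union> N0)" and d: "d \<in> D"
    have dN: "d \<in> N" "rep d \<in> N" using d D(2) rep by blast+
    define w v where "w = rep d" and "v = d - rep d"
    \<comment> \<open>The posterior centre in units of the prior standard deviations.\<close>
    define y where "y k = co k v / \<sigma> k" for k
    have sy: "\<sigma> k * y k = co k v" if "k \<in> idx K" for k using \<sigma>[OF that] by (simp add: y_def)
    have vec: "(\<Sum>k\<in>idx K. (\<sigma> k * y k) *\<^sub>R bas k) = v"
      using diff[OF d] by (simp add: sy v_def cong: sum.cong)
    have nv: "(\<Sum>k\<in>idx K. (\<sigma> k * y k)\<^sup>2) = nrm2 v"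
      unfolding nrm2_comb[symmetric] vec ..
    have Kl: "0 \<le> Kl d" "Kl d \<le> Ck * nrm2 v"
      unfolding Kl_def v_def using dN by (auto intro!: sum_nonneg kl_bounds(1) Ck)
    define \<alpha> where "\<alpha> l = s * nm / real (n l)" for l
    have n0: "0 < real (n l)" for l using n[of l] by simp
    have \<alpha>: "0 \<le> \<alpha> l" "\<alpha> l * (2 * ubound) \<le> 1 / 4" "real (n l) * \<alpha> l = s * nm" for l
    proof -
      show "0 \<le> \<alpha> l" using s nm n0[of l] by (simp add: \<alpha>_def)
      have "s * nm \<le> s * real (n l)" using s nm(2)[of l] by (intro mult_left_mono) auto
      then have "\<alpha> l \<le> s" using n0[of l] by (simp add: \<alpha>_def pos_divide_le_eq)
      then have "\<alpha> l * ubound \<le> s * ubound" using ubound(1) by (intro mult_right_mono) auto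
      then show "\<alpha> l * (2 * ubound) \<le> 1 / 4" using s by simp
      show "real (n l) * \<alpha> l = s * nm" using n0[of l] by (simp add: \<alpha>_def)
    qed
    have "pac \<omega> w y" using \<omega> d by (intro pac) (auto simp: w_def)
    then have "s * nm * (\<Sum>l\<in>UNIV. F l w - F l \<tau>0 + mw l w v)
      - s\<^sup>2 * nm * (2 * (Cu * nrm2 (w - \<tau>0)) + 4 * (Ct * (nrm2 v + (\<Sum>k\<in>idx K. (\<sigma> k)\<^sup>2))))
      - (\<Sum>k\<in>idx K. (y k)\<^sup>2) / 2 + ln (\<epsilon> * wt w)
      \<le> (\<Sum>l\<in>UNIV. \<Sum>i<n l. \<alpha> l * u l w (X l i \<omega>)
        + max (\<alpha> l * (\<Sum>k\<in>idx K. \<sigma> k * y k * tang l w (bas k) (X l i \<omega>))) (- 1 / 4))"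
      unfolding pac_def vec nv \<alpha>_def .
    also have "\<dots> \<le> (\<Sum>l\<in>UNIV. \<Sum>i<n l. \<alpha> l * (u l d (X l i \<omega>) + Kl d))"
    proof (intro sum_mono)
      fix l i assume "i \<in> {..<n l}"
      define x where "x = X l i \<omega>"
      have gx: "good d l x" unfolding x_def using \<omega> d \<open>i \<in> {..<n l}\<close> by (intro g) auto
      have "(\<Sum>k\<in>idx K. \<sigma> k * y k * tang l w (bas k) x) = (\<Sum>k\<in>idx K. co k v * tang l w (bas k) x)"
        by (intro sum.cong) (auto simp: sy)
      also have "\<dots> = tang l w v x" using gx by (simp add: good_def w_def v_def)
      finally have t: "(\<Sum>k\<in>idx K. \<sigma> k * y k * tang l w (bas k) x) = tang l w v x" .
      have 1: "tang l w v x \<le> u l d x - u l w x + Kl d" using gx by (simp add: good_def w_def v_def)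
      \<comment> \<open>Since \<open>s * ubound \<le> 1 / 8\<close>, the weighted increment of
        \<open>u\<close> stays above \<open>- 1 / 4\<close>, and the truncation in
        \<open>max\<close> does no harm.\<close>
      have 2: "- (2 * ubound) \<le> u l d x - u l w x + Kl d" using gx Kl(1) unfolding good_def w_def by linarith
      have "\<alpha> l * tang l w v x \<le> \<alpha> l * (u l d x - u l w x + Kl d)" using 1 \<alpha>(1) by (rule mult_left_mono)
      moreover have "\<alpha> l * (- (2 * ubound)) \<le> \<alpha> l * (u l d x - u l w x + Kl d)" using 2 \<alpha>(1) by (rule mult_left_mono)
      ultimately have "max (\<alpha> l * tang l w v x) (- 1 / 4) \<le> \<alpha> l * (u l d x - u l w x + Kl d)"
        using \<alpha>(2)[of l] by simp
      then have "\<alpha> l * u l w x + max (\<alpha> l * (\<Sum>k\<in>idx K. \<sigma> k * y k * tang l w (bas k) x)) (- 1 / 4) \<le> \<alpha> l * (u l d x + Kl d)"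
        unfolding t by (simp add: algebra_simps)
      then show "\<alpha> l * u l w (X l i \<omega>) + max (\<alpha> l * (\<Sum>k\<in>idx K. \<sigma> k * y k * tang l w (bas k) (X l i \<omega>))) (- 1 / 4) \<le> \<alpha> l * (u l d (X l i \<omega>) + Kl d)"
        by (simp add: x_def)
    qed
    also have "\<dots> = (\<Sum>l\<in>UNIV. s * nm * (1 / real (n l) * (\<Sum>i<n l. u l d (X l i \<omega>))) + (real (n l) * \<alpha> l) * Kl d)"
      by (intro sum.cong) (auto simp: distrib_left sum.distrib \<alpha>_def sum_distrib_left)
    also have "\<dots> = s * nm * emp n (\<lambda>l. u l d) \<omega> + s * nm * (real CARD('m) * Kl d)"
      unfolding \<alpha>(3) by (simp add: sum.distrib emp_def sum_distrib_left)
    also have "\<dots> \<le> s * nm * emp n (\<lambda>l. u l d) \<omega> + s * nm * (real CARD('m) * (Ck * nrm2 v))"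
      using Kl s nm by (intro add_left_mono mult_left_mono) auto
    finally have upper: "s * nm * (\<Sum>l\<in>UNIV. F l w - F l \<tau>0 + mw l w v)
      - s\<^sup>2 * nm * (2 * (Cu * nrm2 (w - \<tau>0)) + 4 * (Ct * (nrm2 v + (\<Sum>k\<in>idx K. (\<sigma> k)\<^sup>2))))
      - (\<Sum>k\<in>idx K. (y k)\<^sup>2) / 2 + ln (\<epsilon> * wt w) \<le> s * nm * emp n (\<lambda>l. u l d) \<omega> + s * nm * (real CARD('m) * (Ck * nrm2 v))" .
    have "(\<Sum>l\<in>UNIV. F l d - F l w - mw l w v) \<le> exp ubound * Kl d"
      unfolding v_def w_def Kl_def by (rule tangent_bounds(2)[OF conv dN(2,1)])
    also have "\<dots> \<le> exp ubound * (Ck * nrm2 v)" using Kl by (intro mult_left_mono) auto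
    finally have "(\<Sum>l\<in>UNIV. F l d - F l \<tau>0) - exp ubound * (Ck * nrm2 v) \<le> (\<Sum>l\<in>UNIV. F l w - F l \<tau>0 + mw l w v)"
      by (simp add: sum.distrib sum_subtractf)
    then have "s * nm * ((\<Sum>l\<in>UNIV. F l d - F l \<tau>0) - exp ubound * (Ck * nrm2 v)) \<le> s * nm * (\<Sum>l\<in>UNIV. F l w - F l \<tau>0 + mw l w v)"
      using s nm by (intro mult_left_mono) auto
    moreover have "s * nm * ((\<Sum>l\<in>UNIV. F l d - F l \<tau>0) - (exp ubound + real CARD('m)) * (Ck * nrm2 v))
      = s * nm * ((\<Sum>l\<in>UNIV. F l d - F l \<tau>0) - exp ubound * (Ck * nrm2 v)) - s * nm * (real CARD('m) * (Ck * nrm2 v))"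
      by (simp add: algebra_simps)
    ultimately show "s * nm * ((\<Sum>l\<in>UNIV. F l d - F l \<tau>0) - (exp ubound + real CARD('m)) * (Ck * nrm2 (d - rep d)))
      - s\<^sup>2 * nm * (2 * (Cu * nrm2 (rep d - \<tau>0)) + 4 * (Ct * (nrm2 (d - rep d) + (\<Sum>k\<in>idx K. (\<sigma> k)\<^sup>2))))
      - (\<Sum>k\<in>idx K. (co k (d - rep d) / \<sigma> k)\<^sup>2) / 2 + ln (\<epsilon> * wt (rep d)) \<le> s * nm * emp n (\<lambda>l. u l d) \<omega>"
      using upper unfolding v_def[symmetric] unfolding w_def[symmetric] y_def[symmetric] by linarith
  qed
qed

text \<open>The penalty is charged with \<open>lam / 4\<close> instead of \<open>lam / 2\<close>,
  because replacing the minimizer by a nearby point of the dense set may double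
  \<open>J\<close>.\<close>

definition nll_dominates :: "real \<Rightarrow> real \<Rightarrow> ('m \<Rightarrow> nat) \<Rightarrow> real \<Rightarrow> 'w \<Rightarrow> (real^'p) \<times> 'h \<Rightarrow> bool" where
  "nll_dominates k1 C n lam \<omega> d \<longleftrightarrow>
    k1 * nrm2 (d - \<tau>0) - lam / 4 * J (snd d) (snd d) - C * (1 / real (Min (range n)) * lam powr (- 1 / r))
      \<le> emp n (\<lambda>l. u l d) \<omega>"

text \<open>Neither \<open>k1\<close> nor \<open>C\<close> may depend on \<open>K\<close> and
  \<open>D\<close>, which are exhausted later. After division by \<open>s * nm\<close> the errors in
  \<open>pac_finite\<close> are fractions of the growth
  \<open>\<kappa> * nrm2 (d - \<tau>0)\<close>, multiples of \<open>nrm2 (d - rep d)\<close>,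
  fractions of the penalty and terms of the order of the rate. The second kind is in turn bounded by
  the last two.\<close>

lemma nll_lower_bound_finite:
  assumes conv: nll_convexity
  shows "\<exists>k1>0. \<forall>\<epsilon>>0. \<exists>C>0. \<forall>n lam K D. (\<forall>l. 0 < n l) \<and> 0 < lam \<and> lam \<le> 1 \<and>
      finite D \<and> D \<subseteq> N \<and> (\<forall>d\<in>D. \<exists>c. d = (\<Sum>k\<in>idx K. c k *\<^sub>R bas k)) \<longrightarrow>
    (\<exists>E\<in>events. prob E \<le> \<epsilon> \<and> (\<forall>\<omega>\<in>space \<Omega> - E. \<forall>d\<in>D. nll_dominates k1 C n lam \<omega> d))"
proof -
  obtain \<kappa> where \<kappa>: "0 < \<kappa>" "\<And>d. d \<in> N \<Longrightarrow> \<kappa> * nrm2 (d - \<tau>0) \<le> (\<Sum>l\<in>UNIV. F l d - F l \<tau>0)"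
    using F_quadratic_growth[OF conv] by blast
  obtain Cu where Cu: "0 < Cu" "\<And>w. w \<in> N \<Longrightarrow> (\<Sum>l\<in>UNIV. \<integral>x. (u l w x)\<^sup>2 \<partial>P l) \<le> Cu * nrm2 (w - \<tau>0)"
    using u_sq_le by blast
  obtain Ct where Ct: "0 < Ct" "\<And>w v. w \<in> N \<Longrightarrow> (\<Sum>l\<in>UNIV. \<integral>x. (tang l w v x)\<^sup>2 \<partial>P l) \<le> Ct * nrm2 v"
    using tang_sq_le by blast
  obtain Ck where Ck: "0 < Ck" "\<And>d w. d \<in> N \<Longrightarrow> w \<in> N \<Longrightarrow> (\<Sum>l\<in>UNIV. kl l d w) \<le> Ck * nrm2 (d - w)"
    using kl_sum_le by blast
  obtain \<beta>1 \<beta>2 kap where b: "0 < \<beta>1" "\<And>\<nu>. 1 \<le> \<nu> \<Longrightarrow> kap \<nu> \<in> {\<beta>1<..<\<beta>2} \<and> \<rho> \<nu> = kap \<nu> * real \<nu> powr r"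
    using eigenvalue_growth by blast
  have rho_ge: "\<beta>1 * real \<nu> powr r \<le> \<rho> \<nu>" if "1 \<le> \<nu>" for \<nu>
    using b(2)[OF that] by (auto intro!: mult_right_mono)
  have rho0: "0 \<le> rho k" if "k \<in> idx K" for k K
    using that eigenvalue_nonneg by (cases k) (auto simp: rho_def idx_def)
  \<comment> \<open>The first bound makes the truncation harmless, the second lets the second-order
    term in \<open>Cu\<close> consume only a fraction of the quadratic growth.\<close>
  define s where "s = min (1 / (8 * ubound)) (\<kappa> / (16 * Cu))"
  have s: "0 < s" "s * ubound \<le> 1 / 8" "s * Cu \<le> \<kappa> / 16"
  proof -
    show "0 < s" using ubound(1) \<kappa>(1) Cu(1) by (simp add: s_def)
    have "s \<le> 1 / (8 * ubound)" "s \<le> \<kappa> / (16 * Cu)" by (auto simp: s_def)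
    then show "s * ubound \<le> 1 / 8" "s * Cu \<le> \<kappa> / 16"
      using ubound(1) Cu(1) by (simp_all add: pos_le_divide_eq mult_ac)
  qed
  define K1 where "K1 = 8 / (\<kappa> * s)"
  define K0 where "K0 = 16 / s"
  have K: "0 < K1" "0 < K0" using s \<kappa> by (auto simp: K1_def K0_def)
  \<comment> \<open>\<open>K1 / nm\<close> is the squared mesh of the grid and \<open>K0 / (nm * (1 + lam * rho k))\<close> the prior variance of
    coordinate \<open>k\<close>. Only the coordinates with \<open>lam * rho k < A\<close> are discretized: in the others the
    penalty dominates.\<close>
  define Cv where "Cv = (exp ubound + real CARD('m)) * Ck + \<kappa> / 2 + 4 * s * Ct + 1 / 32"
  have Cv: "0 < Cv"
    unfolding Cv_def using Ck \<kappa> s Ct by (intro add_pos_pos mult_pos_pos) (auto intro: add_pos_nonneg)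
  define A where "A = 32 * Cv"
  have A: "0 < A" using Cv by (simp add: A_def)
  define CL where "CL = real CARD('p) + 1 + (A / \<beta>1) powr (1 / r)"
  have CL: "0 \<le> CL" by (simp add: CL_def)
  define Cs where "Cs = 2 + 1 / (\<beta>1 * (r - 1))"
  have Cs: "0 < Cs" using b(1) r_gt_1 by (simp add: Cs_def add_pos_pos)
  show ?thesis
    unfolding nll_dominates_def
  proof (rule exI[of _ "\<kappa> / 2"], intro conjI allI impI)
    show "0 < \<kappa> / 2" using \<kappa> by simp
    fix \<epsilon> :: real assume \<epsilon>: "0 < \<epsilon>"
    \<comment> \<open>The coefficients of the rate, in this order: mesh, prior variances, cell
      weights and \<open>\<epsilon>\<close>.\<close>
    define C where "C = Cv * CL * K1 + 4 * s * Ct * K0 * (real CARD('p) + Cs) + 4 * CL / s + \<bar>ln \<epsilon>\<bar> / s + 1"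
    have C0: "0 < C" unfolding C_def using Cv CL K s Ct Cs by (intro add_nonneg_pos add_nonneg_nonneg) auto
    show "\<exists>C>0. \<forall>n lam K D. (\<forall>l. 0 < n l) \<and> 0 < lam \<and> lam \<le> 1 \<and>
      finite D \<and> D \<subseteq> N \<and> (\<forall>d\<in>D. \<exists>c. d = (\<Sum>k\<in>idx K. c k *\<^sub>R bas k)) \<longrightarrow>
    (\<exists>E\<in>events. prob E \<le> \<epsilon> \<and> (\<forall>\<omega>\<in>space \<Omega> - E. \<forall>d\<in>D.
      \<kappa> / 2 * nrm2 (d - \<tau>0) - lam / 4 * J (snd d) (snd d) - C * (1 / real (Min (range n)) * lam powr (- 1 / r))
        \<le> emp n (\<lambda>l. u l d) \<omega>))"
    proof (intro exI[of _ C] conjI C0 allI impI)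
      fix n :: "'m \<Rightarrow> nat" and lam :: real and K and D :: "((real^'p) \<times> 'h) set"
      assume "(\<forall>l. 0 < n l) \<and> 0 < lam \<and> lam \<le> 1 \<and> finite D \<and> D \<subseteq> N \<and> (\<forall>d\<in>D. \<exists>c. d = (\<Sum>k\<in>idx K. c k *\<^sub>R bas k))"
      then have n: "\<And>l. 0 < n l" and lam: "0 < lam" "lam \<le> 1" and D: "finite D" "D \<subseteq> N"
        "\<And>d. d \<in> D \<Longrightarrow> \<exists>c. d = (\<Sum>k\<in>idx K. c k *\<^sub>R bas k)" by auto
      define nm where "nm = real (Min (range n))"
      have nm: "0 < nm" "nm \<le> real (n l)" for l
      proof -
        have "0 < Min (range n)" using n by (subst Min_gr_iff) auto
        then show "0 < nm" by (simp add: nm_def)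
        show "nm \<le> real (n l)" unfolding nm_def by (intro of_nat_mono Min_le) auto
      qed
      define x0 where "x0 = lam powr (- 1 / r)"
      have x0: "1 \<le> x0" using lam r_gt_1 powr_mono2'[of "- 1 / r" lam 1] by (simp add: x0_def)
      define R where "R = 1 / nm * x0"
      have R: "0 < R" "1 / nm \<le> R" using nm x0 by (auto simp: R_def divide_right_mono)
      define N0 where "N0 = nat \<lceil>(A / (\<beta>1 * lam)) powr (1 / r)\<rceil>"
      define \<delta> where "\<delta> = sqrt (K1 / nm)"
      have \<delta>: "0 < \<delta>" "\<delta>\<^sup>2 = K1 / nm" using K nm by (auto simp: \<delta>_def)
      define L where "L = idx N0"
      have high: "A \<le> lam * \<rho> \<nu>" if "N0 < \<nu>" for \<nu>
      proof -
        have "(A / (\<beta>1 * lam)) powr (1 / r) \<le> real \<nu>" using that unfolding N0_def by linarith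
        then have "((A / (\<beta>1 * lam)) powr (1 / r)) powr r \<le> real \<nu> powr r"
          using r_gt_1 by (intro powr_mono2) auto
        then have "A / (\<beta>1 * lam) \<le> real \<nu> powr r" using r_gt_1 A b(1) lam by (simp add: powr_powr)
        then have "A \<le> lam * (\<beta>1 * real \<nu> powr r)" using b lam by (simp add: pos_divide_le_eq mult_ac)
        also have "\<dots> \<le> lam * \<rho> \<nu>" using lam that by (intro mult_left_mono rho_ge) auto
        finally show ?thesis .
      qed
      have cardL: "real (card L) \<le> CL * x0"
      proof -
        have "real N0 \<le> (A / (\<beta>1 * lam)) powr (1 / r) + 1"
          using powr_ge_zero[of "A / (\<beta>1 * lam)" "1 / r"] unfolding N0_def by linarith
        also have "(A / (\<beta>1 * lam)) powr (1 / r) = (A / \<beta>1) powr (1 / r) * x0"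
        proof -
          have "(A / (\<beta>1 * lam)) powr (1 / r) = ((A / \<beta>1) * (1 / lam)) powr (1 / r)" by simp
          also have "\<dots> = (A / \<beta>1) powr (1 / r) * (1 / lam) powr (1 / r)"
            by (rule powr_mult)
          also have "(1 / lam) powr (1 / r) = x0" using lam by (simp add: x0_def powr_divide powr_minus_divide)
          finally show ?thesis .
        qed
        finally have "real (card L) \<le> real CARD('p) + 1 + (A / \<beta>1) powr (1 / r) * x0"
          by (simp add: L_def idx_def card_Plus)
        also have "\<dots> \<le> (real CARD('p) + 1) * x0 + (A / \<beta>1) powr (1 / r) * x0" using x0 by simp
        finally show ?thesis by (simp add: CL_def algebra_simps)
      qed
      define \<sigma> where "\<sigma> k = sqrt (K0 / (nm * (1 + lam * rho k)))" for k
      have \<sigma>: "0 < \<sigma> k" "(\<sigma> k)\<^sup>2 = K0 / (nm * (1 + lam * rho k))" if "k \<in> idx K" for k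
      proof -
        have "0 < nm * (1 + lam * rho k)" using nm lam rho0[OF that] by (intro mult_pos_pos add_pos_nonneg) auto
        then show "0 < \<sigma> k" "(\<sigma> k)\<^sup>2 = K0 / (nm * (1 + lam * rho k))" using K by (auto simp: \<sigma>_def)
      qed
      \<comment> \<open>The total prior variance is bounded uniformly in \<open>K\<close>, because
        the variances decay with the eigenvalues.\<close>
      have sum\<sigma>: "(\<Sum>k\<in>idx K. (\<sigma> k)\<^sup>2) \<le> K0 * (real CARD('p) + Cs) * R"
      proof -
        have "(\<Sum>k\<in>idx K. (\<sigma> k)\<^sup>2) = (\<Sum>k\<in>idx K. K0 / nm * (1 / (1 + lam * rho k)))"
          by (intro sum.cong) (auto simp: \<sigma>)
        also have "\<dots> = K0 / nm * (\<Sum>k\<in>idx K. 1 / (1 + lam * rho k))" by (simp only: sum_distrib_left)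
        also have "(\<Sum>k\<in>idx K. 1 / (1 + lam * rho k)) = real CARD('p) + (\<Sum>\<nu>=1..K. 1 / (1 + lam * \<rho> \<nu>))"
          by (simp add: sum_idx rho_def)
        also have "K0 / nm * \<dots> \<le> K0 / nm * (real CARD('p) * x0 + Cs * x0)"
        proof (intro mult_left_mono add_mono)
          show "real CARD('p) \<le> real CARD('p) * x0" using x0 by simp
          have "(\<Sum>\<nu>=1..K. 1 / (1 + lam * \<rho> \<nu>)) \<le> (\<Sum>\<nu>\<in>{1..K}. 1 / (1 + lam * (\<beta>1 * real \<nu> powr r)))"
          proof (intro sum_mono divide_left_mono add_left_mono mult_left_mono rho_ge)
            fix \<nu> assume "\<nu> \<in> {1..K}"
            then show "0 < (1 + lam * (\<rho> \<nu>)) * (1 + lam * (\<beta>1 * real \<nu> powr r))"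
              using lam b(1) eigenvalue_nonneg[of \<nu>] by (intro mult_pos_pos add_pos_nonneg) auto
          qed (use lam in auto)
          also have "\<dots> \<le> Cs * x0" unfolding Cs_def x0_def by (rule sum_inverse_eigenvalue_le[OF r_gt_1 b(1) lam])
          finally show "(\<Sum>\<nu>=1..K. 1 / (1 + lam * \<rho> \<nu>)) \<le> Cs * x0" .
        qed (use K nm in auto)
        also have "\<dots> = K0 * (real CARD('p) + Cs) * R" by (simp add: R_def algebra_simps)
        finally show ?thesis .
      qed
      \<comment> \<open>Coordinates are centred at \<open>\<tau>0\<close>, so that the weight of a
        cell costs a multiple of \<open>nrm2 (w - \<tau>0)\<close>, which the quadratic growth can
        pay for.\<close>
      obtain rep wt where rep: "\<And>d. d \<in> D \<Longrightarrow> rep d \<in> D" "\<And>d. d \<in> D \<Longrightarrow> J (snd (rep d)) (snd (rep d)) \<le> J (snd d) (snd d)"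
        "\<And>d k. d \<in> D \<Longrightarrow> k \<in> L \<Longrightarrow> \<bar>co k (d - \<tau>0) / \<delta> - co k (rep d - \<tau>0) / \<delta>\<bar> \<le> 1"
        and wt: "\<And>w. 0 < wt w" "sum wt (rep ` D) \<le> (1 :: real)" "\<And>w. - ln (wt w) \<le> (\<Sum>k\<in>L. (co k (w - \<tau>0) / \<delta>)\<^sup>2 + 4)"
        using cell_representatives[OF D(1), of L "\<lambda>d. J (snd d) (snd d)" "\<lambda>d k. co k (d - \<tau>0) / \<delta>"] finite_idx
        unfolding L_def by blast
      define low where "low \<omega> d \<longleftrightarrow> s * nm * ((\<Sum>l\<in>UNIV. F l d - F l \<tau>0) - (exp ubound + real CARD('m)) * (Ck * nrm2 (d - rep d)))
        - s\<^sup>2 * nm * (2 * (Cu * nrm2 (rep d - \<tau>0)) + 4 * (Ct * (nrm2 (d - rep d) + (\<Sum>k\<in>idx K. (\<sigma> k)\<^sup>2))))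
        - (\<Sum>k\<in>idx K. (co k (d - rep d) / \<sigma> k)\<^sup>2) / 2 + ln (\<epsilon> * wt (rep d))
        \<le> s * nm * emp n (\<lambda>l. u l d) \<omega>" for \<omega> d
      have "\<exists>E\<in>events. prob E \<le> \<epsilon> \<and> (\<forall>\<omega>\<in>space \<Omega> - E. \<forall>d\<in>D. low \<omega> d)"
        unfolding low_def by (rule pac_finite[OF conv D rep(1) n nm s(1,2) wt(1,2) \<epsilon> \<sigma>(1) Cu(2) Ct(2) Ck(2)])
      then obtain E where E: "E \<in> events" "prob E \<le> \<epsilon>" and low: "\<And>\<omega> d. \<omega> \<in> space \<Omega> - E \<Longrightarrow> d \<in> D \<Longrightarrow> low \<omega> d" by blast
      show "\<exists>E\<in>events. prob E \<le> \<epsilon> \<and> (\<forall>\<omega>\<in>space \<Omega> - E. \<forall>d\<in>D.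
        \<kappa> / 2 * nrm2 (d - \<tau>0) - lam / 4 * J (snd d) (snd d) - C * (1 / real (Min (range n)) * lam powr (- 1 / r))
        \<le> emp n (\<lambda>l. u l d) \<omega>)"
      proof (intro bexI[OF _ E(1)] conjI E(2) ballI)
        fix \<omega> d assume \<omega>: "\<omega> \<in> space \<Omega> - E" and d: "d \<in> D"
        have dN: "d \<in> N" "rep d \<in> N" using d D(2) rep(1) by blast+
        define w v where "w = rep d" and "v = d - rep d"
        define nd nv nw Jd Jv where "nd = nrm2 (d - \<tau>0)" and "nv = nrm2 v" and "nw = nrm2 (w - \<tau>0)"
          and "Jd = J (snd d) (snd d)" and "Jv = J (snd v) (snd v)"
        have pos: "0 \<le> nd" "0 \<le> nv" "0 \<le> nw" "0 \<le> Jd" "0 \<le> Jv"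
          by (simp_all add: nd_def nv_def nw_def Jd_def Jv_def nrm2_nonneg J_nonneg)
        have nw: "nw \<le> 2 * nd + 2 * nv"
          using nrm2_add_le[of "d - \<tau>0" "(- 1) *\<^sub>R v"] unfolding nrm2_scale
          by (simp add: nw_def nd_def nv_def w_def v_def)
        have Jv: "Jv \<le> 4 * Jd"
          using J_sub_le[of "snd d" "snd (rep d)"] rep(2)[OF d] by (simp add: Jv_def Jd_def v_def)
        obtain c where c: "v = (\<Sum>k\<in>idx K. c k *\<^sub>R bas k)"
        proof -
          obtain c c' where "d = (\<Sum>k\<in>idx K. c k *\<^sub>R bas k)" "rep d = (\<Sum>k\<in>idx K. c' k *\<^sub>R bas k)"
            using D(3)[OF d] D(3)[OF rep(1)[OF d]] by blast
          then have "v = (\<Sum>k\<in>idx K. (c k - c' k) *\<^sub>R bas k)" by (simp add: v_def scaleR_left_diff_distrib sum_subtractf)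
          then show thesis by (rule that)
        qed
        have cc: "co k v = c k" if "k \<in> idx K" for k unfolding c by (rule co_comb[OF that])
        have nvc: "nv = (\<Sum>k\<in>idx K. (co k v)\<^sup>2)"
          unfolding nv_def by (subst c) (simp add: nrm2_comb cc)
        have Jvc: "Jv = (\<Sum>k\<in>idx K. rho k * (co k v)\<^sup>2)"
          unfolding Jv_def by (subst (1 2) c) (simp add: J_comb cc)
        \<comment> \<open>In the discretized coordinates \<open>d\<close> and \<open>rep d\<close>
          differ by at most the mesh; in the others \<open>lam * rho k\<close> is at least
          \<open>A\<close>, which bounds the squares by the penalty.\<close>
        have nv_le: "nv \<le> CL * K1 * R + 4 * lam / A * Jd"
        proof -
          have "nv = (\<Sum>k\<in>idx K \<inter> L. (co k v)\<^sup>2) + (\<Sum>k\<in>idx K - L. (co k v)\<^sup>2)"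
            unfolding nvc by (subst sum.union_disjoint[symmetric]) (auto simp: finite_idx intro!: sum.cong)
          also have "\<dots> \<le> real (card L) * (K1 / nm) + (\<Sum>k\<in>idx K. lam / A * (rho k * (co k v)\<^sup>2))"
          proof (rule add_mono)
            have "(co k v)\<^sup>2 \<le> K1 / nm" if "k \<in> L" for k
            proof -
              have "co k (d - \<tau>0) - co k (rep d - \<tau>0) = co k v"
                unfolding v_def by (simp add: linear_diff[OF co_linear])
              then have "\<bar>co k v\<bar> \<le> \<delta>" using rep(3)[OF d that] \<delta>(1) by (simp flip: diff_divide_distrib)
              then have "(co k v)\<^sup>2 \<le> \<delta>\<^sup>2" by (metis abs_ge_zero power2_abs power_mono)
              then show ?thesis by (simp add: \<delta>(2))
            qed
            then have "(\<Sum>k\<in>idx K \<inter> L. (co k v)\<^sup>2) \<le> (\<Sum>k\<in>idx K \<inter> L. K1 / nm)" by (intro sum_mono) auto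
            also have "\<dots> \<le> real (card L) * (K1 / nm)"
            proof -
              have "card (idx K \<inter> L) \<le> card L" by (intro card_mono) (auto simp: L_def finite_idx)
              then show ?thesis using K nm by (auto intro!: mult_right_mono divide_right_mono)
            qed
            finally show "(\<Sum>k\<in>idx K \<inter> L. (co k v)\<^sup>2) \<le> real (card L) * (K1 / nm)" .
            have "(\<Sum>k\<in>idx K - L. (co k v)\<^sup>2) \<le> (\<Sum>k\<in>idx K - L. lam / A * (rho k * (co k v)\<^sup>2))"
            proof (rule sum_mono)
              fix k assume k: "k \<in> idx K - L"
              then have "\<exists>\<nu>. k = Inr \<nu> \<and> N0 < \<nu>" by (cases k) (auto simp: L_def idx_def)
              then obtain \<nu> where \<nu>: "k = Inr \<nu>" "N0 < \<nu>" by blast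
              have "1 * (co k v)\<^sup>2 \<le> lam / A * rho k * (co k v)\<^sup>2"
                using high[OF \<nu>(2)] A by (intro mult_right_mono) (auto simp: \<nu>(1) rho_def pos_le_divide_eq)
              then show "(co k v)\<^sup>2 \<le> lam / A * (rho k * (co k v)\<^sup>2)" by (simp add: mult.assoc)
            qed
            also have "\<dots> \<le> (\<Sum>k\<in>idx K. lam / A * (rho k * (co k v)\<^sup>2))"
              using rho0 lam A by (intro sum_mono2) (auto simp: finite_idx intro!: mult_nonneg_nonneg divide_nonneg_nonneg)
            finally show "(\<Sum>k\<in>idx K - L. (co k v)\<^sup>2) \<le> (\<Sum>k\<in>idx K. lam / A * (rho k * (co k v)\<^sup>2))" .
          qed
          also have "(\<Sum>k\<in>idx K. lam / A * (rho k * (co k v)\<^sup>2)) = lam / A * Jv"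
            unfolding Jvc by (simp only: sum_distrib_left)
          also have "real (card L) * (K1 / nm) \<le> CL * x0 * (K1 / nm)"
            using cardL K nm by (intro mult_right_mono) auto
          also have "CL * x0 * (K1 / nm) = CL * K1 * R" by (simp add: R_def)
          also have "lam / A * Jv \<le> lam / A * (4 * Jd)" using Jv lam A by (intro mult_left_mono) auto
          finally show ?thesis by (simp add: mult_ac)
        qed
        have T1: "s * (2 * (Cu * nw)) \<le> \<kappa> / 4 * nd + \<kappa> / 4 * nv"
        proof -
          have "s * (2 * (Cu * nw)) = 2 * (s * Cu) * nw" by simp
          also have "\<dots> \<le> 2 * (\<kappa> / 16) * (2 * nd + 2 * nv)" using s \<kappa> Cu pos nw by (intro mult_mono) auto
          also have "\<dots> = \<kappa> / 4 * nd + \<kappa> / 4 * nv" by (simp add: algebra_simps)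
          finally show ?thesis .
        qed
        \<comment> \<open>The mesh constant \<open>K1\<close> is chosen so that the cell weights
          cost \<open>\<kappa> / 8 * nw\<close>, apart from a constant per coordinate.\<close>
        have T2: "- ln (wt w) / (s * nm) \<le> \<kappa> / 4 * nd + \<kappa> / 4 * nv + 4 * CL / s * R"
        proof -
          have "- ln (wt w) \<le> (\<Sum>k\<in>L. (co k (w - \<tau>0))\<^sup>2) / \<delta>\<^sup>2 + 4 * real (card L)"
            using wt(3)[of w] by (simp add: sum.distrib power_divide sum_divide_distrib mult.commute)
          also have "\<dots> \<le> nw / \<delta>\<^sup>2 + 4 * (CL * x0)"
            using cardL bessel[of "w - \<tau>0" N0] unfolding L_def[symmetric] nw_def by (intro add_mono divide_right_mono mult_left_mono) auto
          also have "\<dots> = nm / K1 * nw + 4 * (CL * x0)" by (simp add: \<delta>(2))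
          finally have "- ln (wt w) / (s * nm) \<le> (nm / K1 * nw + 4 * (CL * x0)) / (s * nm)"
            using s nm by (intro divide_right_mono) auto
          also have "\<dots> = \<kappa> / 8 * nw + 4 * CL / s * R" using s nm \<kappa> by (simp add: K1_def R_def add_divide_distrib)
          also have "\<dots> \<le> \<kappa> / 8 * (2 * nd + 2 * nv) + 4 * CL / s * R"
            using nw \<kappa> by (intro add_right_mono mult_left_mono) auto
          finally show ?thesis by (simp add: algebra_simps)
        qed
        \<comment> \<open>The prior precisions mirror \<open>nrm2\<close> plus \<open>lam\<close>
          times the penalty, so the Gaussian cost is a fixed multiple of that form, which
          \<open>K0\<close> reduces to \<open>1 / 32\<close>.\<close>
        have T3: "(\<Sum>k\<in>idx K. (co k v / \<sigma> k)\<^sup>2) / 2 / (s * nm) \<le> nv / 32 + lam / 8 * Jd"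
        proof -
          have "(\<Sum>k\<in>idx K. (co k v / \<sigma> k)\<^sup>2) = (\<Sum>k\<in>idx K. nm / K0 * ((co k v)\<^sup>2 + lam * (rho k * (co k v)\<^sup>2)))"
          proof (intro sum.cong refl)
            fix k assume "k \<in> idx K"
            then show "(co k v / \<sigma> k)\<^sup>2 = nm / K0 * ((co k v)\<^sup>2 + lam * (rho k * (co k v)\<^sup>2))"
              unfolding power_divide \<sigma>(2)[OF \<open>k \<in> idx K\<close>] by (simp add: algebra_simps add_divide_distrib)
          qed
          also have "\<dots> = nm / K0 * (nv + lam * Jv)"
            unfolding nvc Jvc by (simp only: sum_distrib_left sum.distrib[symmetric])
          finally have eq: "(\<Sum>k\<in>idx K. (co k v / \<sigma> k)\<^sup>2) = nm / K0 * (nv + lam * Jv)" .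
          have "(\<Sum>k\<in>idx K. (co k v / \<sigma> k)\<^sup>2) / 2 / (s * nm) = (nv + lam * Jv) / 32"
            unfolding eq K0_def using s(1) nm(1) by simp
          also have "\<dots> \<le> (nv + lam * (4 * Jd)) / 32" using Jv lam by (intro divide_right_mono add_left_mono mult_left_mono) auto
          finally show ?thesis by (simp add: add_divide_distrib mult.commute)
        qed
        have T4: "s * (4 * (Ct * (\<Sum>k\<in>idx K. (\<sigma> k)\<^sup>2))) \<le> 4 * s * Ct * K0 * (real CARD('p) + Cs) * R"
        proof -
          have "(4 * s * Ct) * (\<Sum>k\<in>idx K. (\<sigma> k)\<^sup>2) \<le> (4 * s * Ct) * (K0 * (real CARD('p) + Cs) * R)"
            using sum\<sigma> s Ct by (intro mult_left_mono) auto
          then show ?thesis by (simp add: mult_ac)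
        qed
        \<comment> \<open>The threshold \<open>A = 32 * Cv\<close> yields the penalty share
          \<open>lam / 8\<close>, which with the share in \<open>T3\<close> makes up
          \<open>lam / 4\<close>.\<close>
        have T5: "Cv * nv \<le> Cv * CL * K1 * R + lam / 8 * Jd"
        proof -
          have "Cv * nv \<le> Cv * (CL * K1 * R + 4 * lam / A * Jd)" using nv_le Cv by (intro mult_left_mono) auto
          also have "\<dots> = Cv * CL * K1 * R + lam / 8 * Jd" using Cv by (simp add: A_def algebra_simps)
          finally show ?thesis .
        qed
        have T6: "- ln \<epsilon> / (s * nm) \<le> \<bar>ln \<epsilon>\<bar> / s * R"
        proof -
          have "- ln \<epsilon> / (s * nm) \<le> \<bar>ln \<epsilon>\<bar> / (s * nm)" using s nm by (intro divide_right_mono) auto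
          also have "\<dots> = \<bar>ln \<epsilon>\<bar> / s * (1 / nm)" by simp
          also have "\<dots> \<le> \<bar>ln \<epsilon>\<bar> / s * R" using R(2) s by (intro mult_left_mono) auto
          finally show ?thesis .
        qed
        define G where "G = (\<Sum>l\<in>UNIV. F l d - F l \<tau>0)"
        have G: "\<kappa> * nd \<le> G" unfolding G_def nd_def by (rule \<kappa>(2)[OF dN(1)])
        define e where "e = emp n (\<lambda>l. u l d) \<omega>"
        define Z where "Z = (\<Sum>k\<in>idx K. (\<sigma> k)\<^sup>2)"
        define Y where "Y = (\<Sum>k\<in>idx K. (co k v / \<sigma> k)\<^sup>2) / 2"
        have "s * nm * (G - (exp ubound + real CARD('m)) * (Ck * nv)) - s\<^sup>2 * nm * (2 * (Cu * nw) + 4 * (Ct * (nv + Z))) - Y + ln (\<epsilon> * wt w) \<le> s * nm * e"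
          using low[OF \<omega> d] unfolding low_def G_def nv_def nw_def v_def w_def Z_def Y_def e_def .
        then have "(s * nm * (G - (exp ubound + real CARD('m)) * (Ck * nv)) - s\<^sup>2 * nm * (2 * (Cu * nw) + 4 * (Ct * (nv + Z))) - Y + ln (\<epsilon> * wt w)) / (s * nm) \<le> s * nm * e / (s * nm)"
          using s nm by (intro divide_right_mono) auto
        moreover have "(s * nm * (G - (exp ubound + real CARD('m)) * (Ck * nv)) - s\<^sup>2 * nm * (2 * (Cu * nw) + 4 * (Ct * (nv + Z))) - Y + ln (\<epsilon> * wt w)) / (s * nm)
          = G - (exp ubound + real CARD('m)) * Ck * nv - s * (2 * (Cu * nw)) - 4 * s * Ct * nv - s * (4 * (Ct * Z)) - Y / (s * nm) - (- ln \<epsilon> / (s * nm)) - (- ln (wt w) / (s * nm))"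
        proof -
          have "ln (\<epsilon> * wt w) = ln \<epsilon> + ln (wt w)" using \<epsilon> wt(1)[of w] by (simp add: ln_mult_pos)
          then show ?thesis using s nm by (simp add: field_simps power2_eq_square)
        qed
        moreover have "s * nm * e / (s * nm) = e" using s nm by simp
        ultimately have "G - (exp ubound + real CARD('m)) * Ck * nv - s * (2 * (Cu * nw)) - 4 * s * Ct * nv - s * (4 * (Ct * Z)) - Y / (s * nm) - (- ln \<epsilon> / (s * nm)) - (- ln (wt w) / (s * nm)) \<le> e"
          by simp
        moreover have "Cv * nv = (exp ubound + real CARD('m)) * Ck * nv + \<kappa> / 4 * nv + \<kappa> / 4 * nv + 4 * s * Ct * nv + nv / 32"
          by (simp add: Cv_def algebra_simps)
        moreover have "C * R = Cv * CL * K1 * R + 4 * s * Ct * K0 * (real CARD('p) + Cs) * R + 4 * CL / s * R + \<bar>ln \<epsilon>\<bar> / s * R + R"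
          by (simp add: C_def algebra_simps)
        moreover have "\<kappa> * nd = \<kappa> / 2 * nd + \<kappa> / 4 * nd + \<kappa> / 4 * nd" "lam / 4 * Jd = lam / 8 * Jd + lam / 8 * Jd" by simp_all
        ultimately have "\<kappa> / 2 * nd - lam / 4 * Jd - C * R \<le> e"
          using G T1 T2 T3[folded Y_def] T4[folded Z_def] T5 T6 R(1) by linarith
        then show "\<kappa> / 2 * nrm2 (d - \<tau>0) - lam / 4 * J (snd d) (snd d) - C * (1 / real (Min (range n)) * lam powr (- 1 / r)) \<le> emp n (\<lambda>l. u l d) \<omega>"
          unfolding nd_def Jd_def R_def x0_def nm_def e_def .
      qed
    qed
  qed
qed

section \<open>From finite sets of parameters to a countable dense set\<close>

lemma idx_mono: "K \<le> K' \<Longrightarrow> idx K \<subseteq> idx K'"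
  by (auto simp: idx_def)

lemma comb_extend:
  assumes "K \<le> K'"
  shows "\<exists>c'. (\<Sum>k\<in>idx K. c k *\<^sub>R bas k) = (\<Sum>k\<in>idx K'. c' k *\<^sub>R bas k)"
proof
  show "(\<Sum>k\<in>idx K. c k *\<^sub>R bas k) = (\<Sum>k\<in>idx K'. (if k \<in> idx K then c k else 0) *\<^sub>R bas k)"
    using idx_mono[OF assms] by (intro sum.mono_neutral_cong_left finite_idx) auto
qed

lemma span_phi:
  assumes "h \<in> span (\<phi> ` {1..})"
  shows "\<exists>K c. h = (\<Sum>\<nu>=1..K. c \<nu> *\<^sub>R \<phi> \<nu>)"
  using assms
proof (induction rule: span_induct_alt)
  case base
  show ?case by (rule exI[of _ 0]) simp
next
  case (step a x y)
  from step(1) obtain \<mu> where \<mu>: "1 \<le> \<mu>" "x = \<phi> \<mu>" by auto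
  from step(2) obtain K c where y: "y = (\<Sum>\<nu>=1..K. c \<nu> *\<^sub>R \<phi> \<nu>)" by auto
  define K' where "K' = max K \<mu>"
  have "(\<Sum>\<nu>=1..K'. (if \<nu> \<le> K then c \<nu> else 0) *\<^sub>R \<phi> \<nu>) = y"
    unfolding y by (rule sum.mono_neutral_cong_right) (auto simp: K'_def)
  moreover have "(\<Sum>\<nu>=1..K'. (if \<nu> = \<mu> then a else 0) *\<^sub>R \<phi> \<nu>) = a *\<^sub>R x"
  proof -
    have "(\<Sum>\<nu>=1..K'. (if \<nu> = \<mu> then a else 0) *\<^sub>R \<phi> \<nu>) = (\<Sum>\<nu>=1..K'. if \<nu> = \<mu> then a *\<^sub>R \<phi> \<mu> else 0)"
      by (intro sum.cong) auto
    also have "\<dots> = a *\<^sub>R \<phi> \<mu>" using \<mu>(1) by (subst sum.delta) (auto simp: K'_def)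
    finally show ?thesis by (simp add: \<mu>(2))
  qed
  ultimately have "a *\<^sub>R x + y = (\<Sum>\<nu>=1..K'. ((if \<nu> = \<mu> then a else 0) + (if \<nu> \<le> K then c \<nu> else 0)) *\<^sub>R \<phi> \<nu>)"
    by (simp only: scaleR_left_distrib sum.distrib)
  then show ?case
    by (intro exI[of _ K'] exI[of _ "\<lambda>\<nu>. (if \<nu> = \<mu> then a else 0) + (if \<nu> \<le> K then c \<nu> else 0)"])
qed

text \<open>Countable, so that finite sets of parameters exhaust it, and dense by
  \<open>eigen_complete\<close>.\<close>

definition ratcomb :: "((real^'p) \<times> 'h) set" where
  "ratcomb = (\<Union>K. (\<lambda>q. \<Sum>k\<in>idx K. real_of_rat (q k) *\<^sub>R bas k) ` (PiE (idx K) (\<lambda>_. UNIV)))"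

lemma countable_ratcomb: "countable ratcomb"
  unfolding ratcomb_def by (intro countable_UN countable_image countable_PiE finite_idx) auto

lemma ratcomb_dense:
  assumes e: "0 < e"
  shows "\<exists>d\<in>ratcomb. dist d t < e"
proof -
  obtain \<theta> h where t: "t = (\<theta>, h)" by fastforce
  have "h \<in> closure (span (\<phi> ` {1..}))" using eigen_complete by simp
  then obtain h' where h': "h' \<in> span (\<phi> ` {1..})" "dist h' h < e / 2"
    using e unfolding closure_approachable by (meson half_gt_zero)
  obtain K c where c: "h' = (\<Sum>\<nu>=1..K. c \<nu> *\<^sub>R \<phi> \<nu>)" using span_phi[OF h'(1)] by blast
  define C where "C k = (case k of Inl i \<Rightarrow> \<theta> $ i | Inr \<nu> \<Rightarrow> c \<nu>)" for k
  define s where "s = (\<Sum>k\<in>idx K. C k *\<^sub>R bas k)"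
  have s: "s = (\<theta>, h')"
    unfolding s_def by (rule prod_eqI) (simp_all only: comb_fst comb_snd, simp_all add: C_def c)
  \<comment> \<open>The \<open>+ 1\<close> rules out a division by zero and makes the last estimate
    strict.\<close>
  define B where "B = (\<Sum>k\<in>idx K. norm (bas k)) + 1"
  have B: "0 < B" unfolding B_def by (intro add_nonneg_pos sum_nonneg) auto
  have "\<forall>k. \<exists>q. \<bar>real_of_rat q - C k\<bar> < e / (2 * B)"
  proof
    fix k
    have "C k < C k + e / (2 * B)" using e B by simp
    from of_rat_dense[OF this] obtain q where "C k < real_of_rat q" "real_of_rat q < C k + e / (2 * B)" by blast
    then have "\<bar>real_of_rat q - C k\<bar> < e / (2 * B)" by linarith
    then show "\<exists>q. \<bar>real_of_rat q - C k\<bar> < e / (2 * B)" ..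
  qed
  from choice[OF this] obtain q where q: "\<And>k. \<bar>real_of_rat (q k) - C k\<bar> < e / (2 * B)" by blast
  define d where "d = (\<Sum>k\<in>idx K. real_of_rat (q k) *\<^sub>R bas k)"
  have "d = (\<Sum>k\<in>idx K. real_of_rat (restrict q (idx K) k) *\<^sub>R bas k)" by (simp add: d_def cong: sum.cong)
  then have dr: "d \<in> ratcomb"
    unfolding ratcomb_def by (intro UN_I[of K] image_eqI[of _ _ "restrict q (idx K)"]) auto
  have "norm (d - s) = norm (\<Sum>k\<in>idx K. (real_of_rat (q k) - C k) *\<^sub>R bas k)"
    by (simp add: d_def s_def scaleR_left_diff_distrib sum_subtractf)
  also have "\<dots> \<le> (\<Sum>k\<in>idx K. \<bar>real_of_rat (q k) - C k\<bar> * norm (bas k))"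
    by (rule order_trans[OF norm_sum]) simp
  also have "\<dots> \<le> (\<Sum>k\<in>idx K. e / (2 * B) * norm (bas k))"
    by (rule sum_mono, rule mult_right_mono[OF less_imp_le[OF q]]) simp
  also have "\<dots> = e / (2 * B) * (B - 1)" by (simp add: B_def sum_distrib_left)
  also have "\<dots> < e / 2" using e B by (simp add: field_simps)
  finally have "dist d s < e / 2" by (simp add: dist_norm)
  moreover have "dist s t < e / 2" using h'(2) by (simp add: s t dist_Pair_Pair)
  ultimately have "dist d t < e" using dist_triangle[of d t s] by linarith
  then show ?thesis using dr by blast
qed

text \<open>The events on which one of the first \<open>k\<close> points of \<open>D\<close>
  violates the bound increase with \<open>k\<close>, and all have probability at most
  \<open>\<epsilon>\<close>, because the constants for finite sets do not depend on the set.
  Continuity of the measure passes to the union.\<close>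

lemma nll_lower_bound:
  assumes conv: nll_convexity
  shows "\<exists>D. D \<subseteq> N \<and> (\<forall>t\<in>N. \<forall>e>0. \<exists>d\<in>D. dist d t < e) \<and> (\<exists>k1>0. \<forall>\<epsilon>>0. \<exists>C>0. \<forall>n lam.
    (\<forall>l. 0 < n l) \<and> 0 < lam \<and> lam \<le> 1 \<longrightarrow>
    (\<exists>E\<in>events. prob E \<le> \<epsilon> \<and> (\<forall>\<omega>\<in>space \<Omega> - E. \<forall>d\<in>D. nll_dominates k1 C n lam \<omega> d)))"
proof -
  define D where "D = ratcomb \<inter> N"
  have dense: "\<exists>d\<in>D. dist d t < e" if t: "t \<in> N" and e: "0 < e" for t e
  proof -
    obtain e' where e': "0 < e'" "\<And>y. dist y t < e' \<Longrightarrow> y \<in> N" using open_N t unfolding open_dist by meson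
    obtain d where "d \<in> ratcomb" "dist d t < min e e'" using ratcomb_dense[of "min e e'" t] e e'(1) by auto
    then show ?thesis using e'(2)[of d] by (auto simp: D_def)
  qed
  have ne: "D \<noteq> {}" using dense[OF \<tau>0_in, of 1] by auto
  have cD: "countable D" unfolding D_def by (intro countable_Int1 countable_ratcomb)
  define f where "f = from_nat_into D"
  have f: "f i \<in> D" for i unfolding f_def by (rule from_nat_into[OF ne])
  have fD: "\<exists>i. f i = d" if "d \<in> D" for d unfolding f_def using from_nat_into_surj[OF cD that] .
  have comb: "\<exists>K. \<forall>d\<in>f ` {..<k}. \<exists>c. d = (\<Sum>k\<in>idx K. c k *\<^sub>R bas k)" for k
  proof -
    have "\<exists>K c. f i = (\<Sum>k\<in>idx K. c k *\<^sub>R bas k)" for i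
      using f[of i] by (auto simp: D_def ratcomb_def)
    then have "\<forall>i. \<exists>K. \<exists>c. f i = (\<Sum>k\<in>idx K. c k *\<^sub>R bas k)" by blast
    from choice[OF this] obtain Kf where Kf: "\<And>i. \<exists>c. f i = (\<Sum>k\<in>idx (Kf i). c k *\<^sub>R bas k)" by blast
    define K where "K = Max (insert 0 (Kf ` {..<k}))"
    have "\<exists>c. f i = (\<Sum>k\<in>idx K. c k *\<^sub>R bas k)" if "i < k" for i
    proof -
      have "Kf i \<le> K" unfolding K_def using that by (intro Max_ge) auto
      obtain c where c: "f i = (\<Sum>k\<in>idx (Kf i). c k *\<^sub>R bas k)" using Kf by blast
      show ?thesis using comb_extend[OF \<open>Kf i \<le> K\<close>, of c] unfolding c .
    qed
    then show ?thesis by blast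
  qed
  obtain k1 where k1: "0 < k1" and main: "\<And>\<epsilon>. 0 < \<epsilon> \<Longrightarrow> \<exists>C>0. \<forall>n lam K D. (\<forall>l. 0 < n l) \<and> 0 < lam \<and> lam \<le> 1 \<and>
      finite D \<and> D \<subseteq> N \<and> (\<forall>d\<in>D. \<exists>c. d = (\<Sum>k\<in>idx K. c k *\<^sub>R bas k)) \<longrightarrow>
    (\<exists>E\<in>events. prob E \<le> \<epsilon> \<and> (\<forall>\<omega>\<in>space \<Omega> - E. \<forall>d\<in>D. nll_dominates k1 C n lam \<omega> d))"
    using nll_lower_bound_finite[OF conv] by blast
  have "\<exists>C>0. \<forall>n lam. (\<forall>l. 0 < n l) \<and> 0 < lam \<and> lam \<le> 1 \<longrightarrow>
    (\<exists>E\<in>events. prob E \<le> \<epsilon> \<and> (\<forall>\<omega>\<in>space \<Omega> - E. \<forall>d\<in>D. nll_dominates k1 C n lam \<omega> d))" if \<epsilon>: "0 < \<epsilon>" for \<epsilon>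
  proof -
    obtain C where C: "0 < C" and fin: "\<And>n lam K D. (\<forall>l. 0 < n l) \<and> 0 < lam \<and> lam \<le> 1 \<and>
      finite D \<and> D \<subseteq> N \<and> (\<forall>d\<in>D. \<exists>c. d = (\<Sum>k\<in>idx K. c k *\<^sub>R bas k)) \<Longrightarrow>
      (\<exists>E\<in>events. prob E \<le> \<epsilon> \<and> (\<forall>\<omega>\<in>space \<Omega> - E. \<forall>d\<in>D. nll_dominates k1 C n lam \<omega> d))"
      using main[OF \<epsilon>] by blast
    have "\<exists>E\<in>events. prob E \<le> \<epsilon> \<and> (\<forall>\<omega>\<in>space \<Omega> - E. \<forall>d\<in>D. nll_dominates k1 C n lam \<omega> d)"
      if nl: "(\<forall>l. 0 < n l) \<and> 0 < lam \<and> lam \<le> 1" for n lam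
    proof -
      define Bad where "Bad k = (\<Union>i<k. {\<omega>\<in>space \<Omega>. \<not> nll_dominates k1 C n lam \<omega> (f i)})" for k
      have em: "(\<lambda>\<omega>. emp n (\<lambda>l. u l d) \<omega>) \<in> borel_measurable \<Omega>" for d
        unfolding emp_def by measurable
      have Bm: "Bad k \<in> events" for k
        unfolding Bad_def nll_dominates_def using em by measurable
      have "prob (Bad k) \<le> \<epsilon>" for k
      proof -
        obtain K where K: "\<forall>d\<in>f ` {..<k}. \<exists>c. d = (\<Sum>k\<in>idx K. c k *\<^sub>R bas k)" using comb by blast
        have "f ` {..<k} \<subseteq> N" using f unfolding D_def by blast
        then have "\<exists>E\<in>events. prob E \<le> \<epsilon> \<and> (\<forall>\<omega>\<in>space \<Omega> - E. \<forall>d\<in>f ` {..<k}. nll_dominates k1 C n lam \<omega> d)"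
          using nl K by (intro fin[of n lam "f ` {..<k}" K]) simp
        then obtain E where E: "E \<in> events" "prob E \<le> \<epsilon>" "\<forall>\<omega>\<in>space \<Omega> - E. \<forall>d\<in>f ` {..<k}. nll_dominates k1 C n lam \<omega> d" by blast
        have "Bad k \<subseteq> E" using E(3) by (auto simp: Bad_def)
        then have "prob (Bad k) \<le> prob E" using E(1) by (rule finite_measure_mono)
        then show ?thesis using E(2) by simp
      qed
      moreover have "incseq Bad" unfolding incseq_def Bad_def by (auto intro: less_le_trans)
      then have "(\<lambda>k. prob (Bad k)) \<longlonglongrightarrow> prob (\<Union>k. Bad k)"
        using Bm by (intro finite_Lim_measure_incseq) auto
      ultimately have "prob (\<Union>k. Bad k) \<le> \<epsilon>" by (intro LIMSEQ_le_const2[of _ _ \<epsilon>]) auto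
      moreover have "(\<Union>k. Bad k) \<in> events" using Bm by auto
      moreover have "\<forall>\<omega>\<in>space \<Omega> - (\<Union>k. Bad k). \<forall>d\<in>D. nll_dominates k1 C n lam \<omega> d"
      proof (intro ballI)
        fix \<omega> d assume \<omega>: "\<omega> \<in> space \<Omega> - (\<Union>k. Bad k)" and "d \<in> D"
        then obtain i where i: "f i = d" using fD by blast
        have "\<omega> \<notin> Bad (Suc i)" using \<omega> by blast
        then show "nll_dominates k1 C n lam \<omega> d" using \<omega> i by (auto simp: Bad_def)
      qed
      ultimately show ?thesis by blast
    qed
    then show ?thesis using C by blast
  qed
  then show ?thesis using dense k1 D_def by (intro exI[of _ D]) blast
qed

text \<open>\<open>norm_equiv\<close> at the single value \<open>lam = 1\<close> bounds both
  quadratic forms in \<open>h\<close>.\<close>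

lemma nrm2_J_le_norm: "\<exists>C>0. \<forall>v. nrm2 v \<le> C * (norm v)\<^sup>2 \<and> J (snd v) (snd v) \<le> C * (norm v)\<^sup>2"
proof -
  obtain M2 where M2: "0 < M2" "\<And>g. (\<Sum>l\<in>UNIV. V M eta l \<tau>0 (Lh l g)) + 1 * J g g \<le> M2 * (norm g)\<^sup>2"
    using norm_equiv[of 1] by auto
  have h: "hip g g + J g g \<le> M2 * (norm g)\<^sup>2" for g
    using M2(2)[of g] V_L2_0[OF L_L2_0(2), of _ g] by (simp add: hip_def power2_eq_square)
  have fs: "norm (fst v) \<le> norm v" "norm (snd v) \<le> norm v" for v :: "(real^'p) \<times> 'h"
    using norm_fst_le[of "fst v" "snd v"] norm_snd_le[of "snd v" "fst v"] by auto
  have "nrm2 v \<le> (1 + M2) * (norm v)\<^sup>2 \<and> J (snd v) (snd v) \<le> (1 + M2) * (norm v)\<^sup>2" for v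
  proof -
    have 1: "(norm (fst v))\<^sup>2 \<le> (norm v)\<^sup>2" "(norm (snd v))\<^sup>2 \<le> (norm v)\<^sup>2" using fs by (auto intro: power_mono)
    have 2: "M2 * (norm (snd v))\<^sup>2 \<le> M2 * (norm v)\<^sup>2" using 1 M2(1) by (intro mult_left_mono) auto
    have 3: "(1 + M2) * (norm v)\<^sup>2 = (norm v)\<^sup>2 + M2 * (norm v)\<^sup>2" by (simp add: distrib_right)
    have 4: "0 \<le> (norm v)\<^sup>2" by simp
    show ?thesis
      using 1 2 4 h[of "snd v"] hip_nonneg[of "snd v"] J_nonneg[of "snd v"] unfolding nrm2_hip 3 by linarith
  qed
  then show ?thesis using M2(1) by (intro exI[of _ "1 + M2"]) auto
qed

subsection \<open>The penalized minimizer\<close>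

lemma F_isCont:
  assumes t: "t \<in> N"
  shows "isCont (F l) t"
proof -
  obtain Ce where Ce: "0 < Ce" "\<And>d w. d \<in> N \<Longrightarrow> w \<in> N \<Longrightarrow> (\<Sum>l\<in>UNIV. \<integral>x. (eta l d x - eta l w x)\<^sup>2 \<partial>P l) \<le> Ce * nrm2 (d - w)"
    using eta_lipschitz by blast
  obtain C where C: "0 < C" "\<And>v. nrm2 v \<le> C * (norm v)\<^sup>2" using nrm2_J_le_norm by blast
  define K where "K = sqrt (exp ubound * Ce * C)"
  have K: "0 < K" using Ce C by (simp add: K_def)
  have lip: "\<bar>F l d - F l t\<bar> \<le> K * norm (d - t)" if d: "d \<in> N" for d
  proof -
    have "(F l d - F l t)\<^sup>2 \<le> exp ubound * (\<integral>x. (eta l d x - eta l t x)\<^sup>2 \<partial>P l)" by (rule u_diff_sq(3)[OF d t])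
    also have "\<dots> \<le> exp ubound * (\<Sum>l\<in>UNIV. \<integral>x. (eta l d x - eta l t x)\<^sup>2 \<partial>P l)"
      by (intro mult_left_mono member_le_sum) auto
    also have "\<dots> \<le> exp ubound * (Ce * (C * (norm (d - t))\<^sup>2))"
    proof (intro mult_left_mono)
      have "Ce * nrm2 (d - t) \<le> Ce * (C * (norm (d - t))\<^sup>2)" using C Ce by (intro mult_left_mono) auto
      then show "(\<Sum>l\<in>UNIV. \<integral>x. (eta l d x - eta l t x)\<^sup>2 \<partial>P l) \<le> Ce * (C * (norm (d - t))\<^sup>2)"
        using Ce(2)[OF d t] by linarith
    qed simp
    finally have "sqrt ((F l d - F l t)\<^sup>2) \<le> sqrt (exp ubound * Ce * C * (norm (d - t))\<^sup>2)"
      by (intro real_sqrt_le_mono) (simp add: mult_ac)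
    then show ?thesis by (simp add: K_def real_sqrt_mult)
  qed
  show ?thesis
    unfolding isCont_def
  proof (rule LIM_I)
    fix e :: real assume e: "0 < e"
    obtain e' where e': "0 < e'" "\<And>y. dist y t < e' \<Longrightarrow> y \<in> N" using open_N t unfolding open_dist by meson
    show "\<exists>s>0. \<forall>x. x \<noteq> t \<and> norm (x - t) < s \<longrightarrow> norm (F l x - F l t) < e"
    proof (intro exI[of _ "min e' (e / K)"] conjI allI impI)
      show "0 < min e' (e / K)" using e e' K by simp
      fix x assume x: "x \<noteq> t \<and> norm (x - t) < min e' (e / K)"
      then have "x \<in> N" by (intro e'(2)) (simp add: dist_norm)
      then have "\<bar>F l x - F l t\<bar> \<le> K * norm (x - t)" by (rule lip)
      also have "\<dots> < e" using x K by (simp add: pos_less_divide_eq mult.commute)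
      finally show "norm (F l x - F l t) < e" by simp
    qed
  qed
qed

text \<open>Point evaluations of \<open>eta\<close> are only known to be continuous in each argument separately;
  convexity makes up for it.\<close>

lemma total_nll_upper_semicontinuous:
  assumes t: "t \<in> N" and x: "\<And>l i. x l i \<in> space (M l)"
    and conv: "convex_on UNIV (total_nll M eta n x)" and e: "0 < e"
  shows "\<exists>\<delta>>0. \<forall>d. dist d t < \<delta> \<longrightarrow> total_nll M eta n x d \<le> total_nll M eta n x t + e"
proof -
  obtain \<theta> h where th: "t = (\<theta>, h)" "\<theta> \<in> N\<theta>" "h \<in> Nh" using t by auto
  define f where "f = total_nll M eta n x"
  have f: "f d = (\<Sum>l\<in>UNIV. - (1 / real (n l)) * (\<Sum>i<n l. eta l d (x l i)) + F l d)" for d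
    by (simp add: f_def total_nll_def nll_def F_def)
  have c1: "isCont (\<lambda>\<theta>'. f (\<theta>', h)) \<theta>"
  proof -
    have a: "isCont (\<lambda>\<theta>'. eta l (\<theta>', h) (x l i)) \<theta>" for l i
    proof -
      have "((\<lambda>\<theta>'. eta l (\<theta>', h) (x l i)) has_derivative (\<lambda>\<zeta>. D\<theta> l (\<theta>, h) \<zeta> (x l i))) (at \<theta>)"
        using eval_derivative[OF th(2,3) x[of l i]] by (rule conjunct1)
      then show ?thesis by (rule has_derivative_continuous)
    qed
    have b: "isCont (\<lambda>\<theta>'. F l (\<theta>', h)) \<theta>" for l
      by (rule isCont_o2[of _ "\<lambda>\<theta>'. (\<theta>', h)"], intro continuous_intros, rule F_isCont[OF t, unfolded th(1)])
    show ?thesis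
      unfolding f by (rule continuous_sum, rule continuous_add[OF continuous_mult[OF continuous_const continuous_sum[OF a]] b])
  qed
  have c2: "isCont (\<lambda>h'. f (\<theta>, h')) h"
  proof -
    have a: "isCont (\<lambda>h'. eta l (\<theta>, h') (x l i)) h" for l i
    proof -
      have "((\<lambda>h'. eta l (\<theta>, h') (x l i)) has_derivative (\<lambda>g. Dh l (\<theta>, h) g (x l i))) (at h)"
        using eval_derivative[OF th(2,3) x[of l i]] by (rule conjunct2)
      then show ?thesis by (rule has_derivative_continuous)
    qed
    have b: "isCont (\<lambda>h'. F l (\<theta>, h')) h" for l
      by (rule isCont_o2[of _ "\<lambda>h'. (\<theta>, h')"], intro continuous_intros, rule F_isCont[OF t, unfolded th(1)])
    show ?thesis
      unfolding f by (rule continuous_sum, rule continuous_add[OF continuous_mult[OF continuous_const continuous_sum[OF a]] b])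
  qed
  obtain d1 where d1: "0 < d1" "\<And>\<theta>'. dist \<theta>' \<theta> < d1 \<Longrightarrow> dist (f (\<theta>', h)) (f (\<theta>, h)) < e"
    using c1[unfolded continuous_at_eps_delta, rule_format, OF e] by blast
  obtain d2 where d2: "0 < d2" "\<And>h'. dist h' h < d2 \<Longrightarrow> dist (f (\<theta>, h')) (f (\<theta>, h)) < e"
    using c2[unfolded continuous_at_eps_delta, rule_format, OF e] by blast
  have "f d \<le> f t + e" if d: "dist d t < min d1 d2 / 2" for d
  proof -
    obtain \<theta>' h' where dd: "d = (\<theta>', h')" by fastforce
    \<comment> \<open>\<open>d\<close> is the midpoint of the axis points \<open>(a, h)\<close> and
      \<open>(\<theta>, b)\<close>, whose displacements are doubled. There separate continuity is
      enough, and convexity passes the bound on to \<open>d\<close>.\<close>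
    define a b where "a = \<theta> + 2 *\<^sub>R (\<theta>' - \<theta>)" and "b = h + 2 *\<^sub>R (h' - h)"
    have n1: "norm (\<theta>' - \<theta>) < d1 / 2"
      using norm_fst_le[of "\<theta>' - \<theta>" "h' - h"] d by (simp add: dd th(1) dist_norm)
    have n2: "norm (h' - h) < d2 / 2"
      using norm_snd_le[of "h' - h" "\<theta>' - \<theta>"] d by (simp add: dd th(1) dist_norm)
    have "dist a \<theta> < d1" "dist b h < d2" using n1 n2 by (auto simp: a_def b_def dist_norm)
    then have ab: "f (a, h) \<le> f t + e" "f (\<theta>, b) \<le> f t + e"
      using d1(2)[of a] d2(2)[of b] by (auto simp: dist_real_def th(1))
    have "d = (1 - 1/2) *\<^sub>R (a, h) + (1/2) *\<^sub>R (\<theta>, b)"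
    proof -
      have "(1 / 2) *\<^sub>R a + (1 / 2) *\<^sub>R \<theta> = \<theta>'" "(1 / 2) *\<^sub>R h + (1 / 2) *\<^sub>R b = h'"
        by (simp_all add: a_def b_def scaleR_right_distrib scaleR_right_diff_distrib scaleR_half_double flip: scaleR_add_left)
           (simp_all add: algebra_simps flip: scaleR_add_left)
      then show ?thesis by (simp add: dd)
    qed
    then have "f d \<le> (1 - 1/2) * f (a, h) + 1/2 * f (\<theta>, b)"
      using convex_onD[OF conv[folded f_def], of "1/2" "(a, h)" "(\<theta>, b)"] by simp
    then show ?thesis using ab by simp
  qed
  then show ?thesis using d1(1) d2(1) unfolding f_def by (intro exI[of _ "min d1 d2 / 2"]) auto
qed

text \<open>In the sum of the divergences in both orders the increments of \<open>F\<close> cancel,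
  and what remains is \<open>SKL\<close>.\<close>

lemma SKL_le: "\<exists>C>0. \<forall>t\<in>N. \<bar>SKL M eta \<tau>0 t\<bar> \<le> C * nrm2 (t - \<tau>0)"
proof -
  obtain C where C: "0 < C" "\<And>d w. d \<in> N \<Longrightarrow> w \<in> N \<Longrightarrow> (\<Sum>l\<in>UNIV. kl l d w) \<le> C * nrm2 (d - w)"
    using kl_sum_le by blast
  have "\<bar>SKL M eta \<tau>0 t\<bar> \<le> (2 * C) * nrm2 (t - \<tau>0)" if t: "t \<in> N" for t
  proof -
    have "mu M eta l \<tau>0 (\<lambda>x. eta l \<tau>0 x - eta l t x) + mu M eta l t (\<lambda>x. eta l t x - eta l \<tau>0 x) = kl l \<tau>0 t + kl l t \<tau>0" for l
    proof -
      have "(\<integral>x. eta l \<tau>0 x - eta l t x \<partial>P l) = 0" "(\<integral>x. eta l t x - eta l \<tau>0 x \<partial>P l) = 0"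
        using L2_0_D(3)[OF eta_diff_L2_0] by auto
      moreover have "(\<integral>x. eta l t x - eta l \<tau>0 x \<partial>gibbs (M l) (eta l t)) = - (\<integral>x. eta l \<tau>0 x - eta l t x \<partial>gibbs (M l) (eta l t))"
        unfolding Bochner_Integration.integral_minus[symmetric] by simp
      ultimately show ?thesis by (simp add: mu_def kl_def)
    qed
    then have eq: "SKL M eta \<tau>0 t = (\<Sum>l\<in>UNIV. kl l \<tau>0 t) + (\<Sum>l\<in>UNIV. kl l t \<tau>0)" by (simp add: SKL_def sum.distrib)
    have "0 \<le> (\<Sum>l\<in>UNIV. kl l \<tau>0 t)" "0 \<le> (\<Sum>l\<in>UNIV. kl l t \<tau>0)"
      by (intro sum_nonneg kl_bounds(1) t \<tau>0_in)+
    moreover have "nrm2 (\<tau>0 - t) = nrm2 (t - \<tau>0)" using nrm2_scale[of "-1" "t - \<tau>0"] by simp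
    ultimately show ?thesis using C(2)[OF t \<tau>0_in] C(2)[OF \<tau>0_in t] unfolding eq by simp
  qed
  then show ?thesis using C(1) by (intro exI[of _ "2 * C"]) auto
qed

lemma J_convex:
  assumes s: "0 \<le> s" "s \<le> 1"
  shows "J ((1 - s) *\<^sub>R g + s *\<^sub>R h) ((1 - s) *\<^sub>R g + s *\<^sub>R h) \<le> (1 - s) * J g g + s * J h h"
proof -
  have right: "J a (b + c) = J a b + J a c" "J a (r *\<^sub>R b) = r * J a b" for a b c r
    by (simp_all add: J_sym[of a] J_add_left J_scale_left)
  have neg: "J (g - h) (g - h) = J g g - 2 * J g h + J h h"
  proof -
    have "J (g + (-1) *\<^sub>R h) (g + (-1) *\<^sub>R h) = J g g - 2 * J g h + J h h"
      unfolding J_add_left J_scale_left right by (simp add: J_sym[of h g])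
    then show ?thesis by simp
  qed
  have "(1 - s) * J g g + s * J h h - J ((1 - s) *\<^sub>R g + s *\<^sub>R h) ((1 - s) *\<^sub>R g + s *\<^sub>R h) = s * (1 - s) * J (g - h) (g - h)"
    unfolding J_add_left J_scale_left right neg by (simp add: J_sym[of h g] algebra_simps power2_eq_square)
  moreover have "0 \<le> s * (1 - s) * J (g - h) (g - h)" using s J_nonneg by simp
  ultimately show ?thesis by linarith
qed

text \<open>By convexity of the penalized criterion a local minimizer is no worse than
  \<open>\<tau>0\<close>. The lower bound is available only on a dense set and reaches
  \<open>t\<close> through upper semicontinuity of the criterion and continuity of the quadratic
  forms. As \<open>J (snd d) (snd d)\<close> is at most \<open>2 * J (snd t) (snd t)\<close> up to
  an error, the charge \<open>lam / 4\<close> is absorbed by the penalty \<open>lam / 2\<close> at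
  \<open>t\<close>.\<close>

lemma penalized_minimizer_bound:
  assumes t: "t \<in> N" and x: "\<And>l i. x l i \<in> space (M l)" and lam: "0 < lam"
    and conv: "convex_on UNIV (total_nll M eta n x)"
    and min: "local_min_in (pen_nll M eta J n lam x) N t"
    and D: "D \<subseteq> N" "\<And>e. 0 < e \<Longrightarrow> \<exists>d\<in>D. dist d t < e"
    and k1: "0 < k1" and low: "\<And>d. d \<in> D \<Longrightarrow> k1 * nrm2 (d - \<tau>0) - lam / 4 * J (snd d) (snd d) - R
      \<le> total_nll M eta n x d - total_nll M eta n x \<tau>0"
  shows "k1 / 2 * nrm2 (t - \<tau>0) \<le> lam / 2 * J (snd \<tau>0) (snd \<tau>0) + R"
proof -
  define f where "f = total_nll M eta n x"
  have glob: "f t + lam / 2 * J (snd t) (snd t) \<le> f \<tau>0 + lam / 2 * J (snd \<tau>0) (snd \<tau>0)"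
  proof -
    let ?p = "pen_nll M eta J n lam x"
    obtain e where e: "0 < e" "\<And>s. s \<in> N \<Longrightarrow> dist s t < e \<Longrightarrow> ?p t \<le> ?p s"
      using min unfolding local_min_in_def by blast
    \<comment> \<open>Small enough for \<open>y\<close> to fall within the radius of local
      minimality; the \<open>+ 1\<close> covers \<open>t = \<tau>0\<close>.\<close>
    define s where "s = min 1 (e / (2 * (norm (\<tau>0 - t) + 1)))"
    have nn: "0 < norm (\<tau>0 - t) + 1" by (simp add: add_nonneg_pos)
    have s: "0 < s" "s \<le> 1" using e nn by (auto simp: s_def)
    define y where "y = (1 - s) *\<^sub>R t + s *\<^sub>R \<tau>0"
    have yN: "y \<in> N" unfolding y_def using convexD_alt[OF convex_N t \<tau>0_in] s by simp
    have "dist y t = s * norm (\<tau>0 - t)"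
    proof -
      have "y - t = s *\<^sub>R (\<tau>0 - t)" by (simp add: y_def algebra_simps)
      then show ?thesis using s by (simp add: dist_norm)
    qed
    also have "\<dots> \<le> s * (norm (\<tau>0 - t) + 1)" using s by simp
    also have "\<dots> \<le> e / 2"
    proof -
      have "s \<le> e / (2 * (norm (\<tau>0 - t) + 1))" by (simp add: s_def)
      then have "s * (2 * (norm (\<tau>0 - t) + 1)) \<le> e" using nn by (subst (asm) pos_le_divide_eq) auto
      then show ?thesis by (simp add: algebra_simps)
    qed
    finally have "dist y t < e" using e(1) by simp
    then have "?p t \<le> ?p y" by (rule e(2)[OF yN])
    also have "\<dots> \<le> (1 - s) * ?p t + s * ?p \<tau>0"
    proof -
      have "f y \<le> (1 - s) * f t + s * f \<tau>0"
        unfolding y_def f_def using s by (intro convex_onD[OF conv]) auto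
      moreover have "lam / 2 * J (snd y) (snd y) \<le> lam / 2 * ((1 - s) * J (snd t) (snd t) + s * J (snd \<tau>0) (snd \<tau>0))"
        using J_convex[of s "snd t" "snd \<tau>0"] s lam by (intro mult_left_mono) (auto simp: y_def)
      moreover have "lam / 2 * ((1 - s) * J (snd t) (snd t) + s * J (snd \<tau>0) (snd \<tau>0))
        = (1 - s) * (lam / 2 * J (snd t) (snd t)) + s * (lam / 2 * J (snd \<tau>0) (snd \<tau>0))"
        by (simp add: distrib_left mult.left_commute)
      ultimately show ?thesis unfolding pen_nll_def f_def[symmetric] distrib_left by linarith
    qed
    finally have "s * ?p t \<le> s * ?p \<tau>0" by (simp add: algebra_simps)
    then have "?p t \<le> ?p \<tau>0" using s(1) by simp
    then show ?thesis by (simp add: pen_nll_def f_def)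
  qed
  obtain C where C: "0 < C" "\<And>v. nrm2 v \<le> C * (norm v)\<^sup>2" "\<And>v :: (real^'p) \<times> 'h. J (snd v) (snd v) \<le> C * (norm v)\<^sup>2"
    using nrm2_J_le_norm by metis
  show ?thesis
  proof (rule field_le_epsilon)
    fix e :: real assume e: "0 < e"
    \<comment> \<open>Three errors of size \<open>e'\<close>, weighted by \<open>1\<close>,
      \<open>lam / 2\<close> and \<open>k1\<close>, add up to \<open>e\<close>.\<close>
    define e' where "e' = e / (1 + lam / 2 + k1)"
    have e': "0 < e'" "e' * (1 + lam / 2 + k1) = e" using e lam k1 by (auto simp: e'_def add_pos_pos)
    obtain \<delta> where \<delta>: "0 < \<delta>" "\<And>d. dist d t < \<delta> \<Longrightarrow> f d \<le> f t + e'"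
      using total_nll_upper_semicontinuous[OF t x conv e'(1)] unfolding f_def by blast
    have "0 < min \<delta> (sqrt (e' / C))" using \<delta> e' C by simp
    from D(2)[OF this] obtain d where d: "d \<in> D" "dist d t < \<delta>" "dist d t < sqrt (e' / C)" by auto
    have "(norm (d - t))\<^sup>2 \<le> (sqrt (e' / C))\<^sup>2" using d(3) by (intro power_mono) (auto simp: dist_norm)
    then have nd: "C * (norm (d - t))\<^sup>2 \<le> e'" using C(1) e' by (simp add: pos_le_divide_eq mult.commute)
    have n1: "nrm2 (t - \<tau>0) \<le> 2 * nrm2 (d - \<tau>0) + 2 * e'"
    proof -
      have "nrm2 (t - d) \<le> e'" using C(2)[of "t - d"] nd by (simp add: norm_minus_commute)
      then show ?thesis using nrm2_add_le[of "d - \<tau>0" "t - d"] by simp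
    qed
    have n2: "J (snd d) (snd d) \<le> 2 * J (snd t) (snd t) + 2 * e'"
      using J_sub_le[of "snd t" "snd (t - d)"] C(3)[of "t - d"] nd by (simp add: norm_minus_commute)
    have "k1 * nrm2 (d - \<tau>0) - lam / 4 * J (snd d) (snd d) - R \<le> f d - f \<tau>0" unfolding f_def by (rule low[OF d(1)])
    moreover have "f d \<le> f t + e'" by (rule \<delta>(2)[OF d(2)])
    moreover have "k1 / 2 * nrm2 (t - \<tau>0) \<le> k1 * nrm2 (d - \<tau>0) + k1 * e'"
      using mult_left_mono[OF n1, of "k1 / 2"] k1 by (simp add: algebra_simps)
    moreover have "lam / 4 * J (snd d) (snd d) \<le> lam / 2 * J (snd t) (snd t) + lam / 2 * e'"
      using mult_left_mono[OF n2, of "lam / 4"] lam by (simp add: algebra_simps)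
    moreover have "e = e' + lam / 2 * e' + k1 * e'" using e'(2) by (simp add: algebra_simps)
    ultimately show "k1 / 2 * nrm2 (t - \<tau>0) \<le> lam / 2 * J (snd \<tau>0) (snd \<tau>0) + R + e"
      using glob by linarith
  qed
qed

end

theorem theorem6:
  fixes \<Omega> :: "'w measure"
    and M :: "'m::finite \<Rightarrow> 'x measure"
    and eta :: "'m \<Rightarrow> (real^'p) \<times> 'h::{real_inner, complete_space} \<Rightarrow> 'x \<Rightarrow> real"
    and n :: "nat \<Rightarrow> 'm \<Rightarrow> nat"
    and lam :: "nat \<Rightarrow> real"
    and \<tau>hat :: "nat \<Rightarrow> 'w \<Rightarrow> (real^'p) \<times> 'h"
  assumes model: "semiparametric_density_model \<Omega> M eta \<tau>0 X J L\<theta> Lh D\<theta> Dh N\<theta> Nh C1 C2 Cd \<phi> \<rho> r"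
    and sizes: "\<And>k l. 0 < n k l"
    and smoothing: "\<And>k. 0 < lam k"
    and nll_convex: "\<And>k. AE \<omega> in \<Omega>. convex_on UNIV (total_nll M eta (n k) (\<lambda>l i. X l i \<omega>))"
    and estimator_in: "prob_to_one \<Omega> (\<lambda>k \<omega>. \<tau>hat k \<omega> \<in> N\<theta> \<times> Nh)"
    and unique_local_min: "prob_to_one \<Omega> (\<lambda>k \<omega>. \<forall>\<tau>.
          local_min_in (pen_nll M eta J (n k) (lam k) (\<lambda>l i. X l i \<omega>)) (N\<theta> \<times> Nh) \<tau> \<longleftrightarrow> \<tau> = \<tau>hat k \<omega>)"
    and unique_critical: "prob_to_one \<Omega> (\<lambda>k \<omega>. \<forall>\<tau> \<in> N\<theta> \<times> Nh.
          critical_point (pen_nll M eta J (n k) (lam k) (\<lambda>l i. X l i \<omega>)) \<tau> \<longleftrightarrow> \<tau> = \<tau>hat k \<omega>)"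
    and quad_min_in: "prob_to_one \<Omega> (\<lambda>k \<omega>. \<exists>\<tau>tilde \<in> N\<theta> \<times> Nh. \<forall>\<tau>.
          pen_quad_nll M eta D\<theta> Dh J \<tau>0 (n k) (lam k) (\<lambda>l i. X l i \<omega>) \<tau>tilde
            \<le> pen_quad_nll M eta D\<theta> Dh J \<tau>0 (n k) (lam k) (\<lambda>l i. X l i \<omega>) \<tau>)"
    and n_limit: "filterlim (\<lambda>k. Min (range (n k))) at_top sequentially"
    and lambda_limit: "lam \<longlonglongrightarrow> 0"
    and n_lambda_limit: "filterlim (\<lambda>k. real (Min (range (n k))) * lam k powr (1 / r)) at_top sequentially"
  shows "big_Op \<Omega> (\<lambda>k \<omega>. SKL M eta \<tau>0 (\<tau>hat k \<omega>))
           (\<lambda>k. 1 / real (Min (range (n k))) * lam k powr (- 1 / r) + lam k)"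
proof -
  interpret semiparametric_density_model \<Omega> M eta \<tau>0 X J L\<theta> Lh D\<theta> Dh N\<theta> Nh C1 C2 Cd \<phi> \<rho> r
    by (rule model)
  have conv: nll_convexity
    unfolding nll_convexity_def using sizes[of 0] nll_convex[of 0] by blast
  obtain D k1 where D: "D \<subseteq> N" and dense: "\<forall>t\<in>N. \<forall>e>0. \<exists>d\<in>D. dist d t < e" and k1: "0 < k1"
    and low: "\<forall>\<epsilon>>0. \<exists>C>0. \<forall>n lam. (\<forall>l. 0 < n l) \<and> 0 < lam \<and> lam \<le> 1 \<longrightarrow>
    (\<exists>E\<in>events. prob E \<le> \<epsilon> \<and> (\<forall>\<omega>\<in>space \<Omega> - E. \<forall>d\<in>D. nll_dominates k1 C n lam \<omega> d))"
    using nll_lower_bound[OF conv] by (elim exE conjE) (rule that)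
  obtain Cs where Cs: "0 < Cs" "\<And>t. t \<in> N \<Longrightarrow> \<bar>SKL M eta \<tau>0 t\<bar> \<le> Cs * nrm2 (t - \<tau>0)"
    using SKL_le by (elim exE conjE) (rule that, assumption, erule bspec)
  define J0 where "J0 = J (snd \<tau>0) (snd \<tau>0)"
  have J0: "0 \<le> J0" by (simp add: J0_def J_nonneg)
  show ?thesis
    unfolding big_Op_def
  proof (intro allI impI)
    fix \<epsilon> :: real assume \<epsilon>: "0 < \<epsilon>"
    \<comment> \<open>Three exceptional events of probability at most \<open>\<epsilon> / 4\<close>
      each, together with a null set, stay strictly below \<open>\<epsilon>\<close>.\<close>
    define \<epsilon>' where "\<epsilon>' = \<epsilon> / 4"
    have \<epsilon>': "0 < \<epsilon>'" using \<epsilon> by (simp add: \<epsilon>'_def)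
    obtain C where C: "0 < C" and ev: "\<forall>n lam. (\<forall>l. 0 < n l) \<and> 0 < lam \<and> lam \<le> 1 \<longrightarrow>
      (\<exists>E\<in>events. prob E \<le> \<epsilon>' \<and> (\<forall>\<omega>\<in>space \<Omega> - E. \<forall>d\<in>D. nll_dominates k1 C n lam \<omega> d))"
      using low[rule_format, OF \<epsilon>'] by (elim exE conjE) (rule that)
    \<comment> \<open>\<open>2 / k1\<close> inverts the factor in
      \<open>penalized_minimizer_bound\<close>, \<open>Cs\<close> comes from \<open>SKL_le\<close>,
      and \<open>J0 / 2 + C\<close> dominates the coefficients of both parts of the rate.\<close>
    define C' where "C' = Cs * (2 / k1) * (J0 / 2 + C)"
    have C': "0 < C'" using Cs k1 C J0 by (simp add: C'_def add_nonneg_pos)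
    have "\<forall>\<^sub>F k in sequentially. lam k \<le> 1"
      using order_tendstoD(2)[OF lambda_limit, of 1] by (auto elim: eventually_mono)
    moreover have "\<forall>\<^sub>F k in sequentially. \<exists>E\<in>events. {\<omega>\<in>space \<Omega>. \<not> \<tau>hat k \<omega> \<in> N} \<subseteq> E \<and> prob E < \<epsilon>'"
      using estimator_in[unfolded prob_to_one_def, rule_format, OF \<epsilon>'] .
    moreover have "\<forall>\<^sub>F k in sequentially. \<exists>E\<in>events. {\<omega>\<in>space \<Omega>. \<not> (\<forall>\<tau>.
          local_min_in (pen_nll M eta J (n k) (lam k) (\<lambda>l i. X l i \<omega>)) N \<tau> \<longleftrightarrow> \<tau> = \<tau>hat k \<omega>)} \<subseteq> E \<and> prob E < \<epsilon>'"
      using unique_local_min[unfolded prob_to_one_def, rule_format, OF \<epsilon>'] .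
    ultimately have "\<forall>\<^sub>F k in sequentially. \<exists>E\<in>events.
      {\<omega>\<in>space \<Omega>. C' * (1 / real (Min (range (n k))) * lam k powr (- 1 / r) + lam k) < \<bar>SKL M eta \<tau>0 (\<tau>hat k \<omega>)\<bar>} \<subseteq> E \<and> prob E < \<epsilon>"
    proof eventually_elim
      case (elim k)
      define R where "R = 1 / real (Min (range (n k))) * lam k powr (- 1 / r)"
      have R: "0 \<le> R" by (simp add: R_def)
      obtain E1 where E1: "E1 \<in> events" "{\<omega>\<in>space \<Omega>. \<not> \<tau>hat k \<omega> \<in> N} \<subseteq> E1" "prob E1 < \<epsilon>'" using elim(2) by blast
      obtain E2 where E2: "E2 \<in> events" "{\<omega>\<in>space \<Omega>. \<not> (\<forall>\<tau>.
          local_min_in (pen_nll M eta J (n k) (lam k) (\<lambda>l i. X l i \<omega>)) N \<tau> \<longleftrightarrow> \<tau> = \<tau>hat k \<omega>)} \<subseteq> E2" "prob E2 < \<epsilon>'"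
        using elim(3) by blast
      obtain E3 where E3: "E3 \<in> events" "prob E3 \<le> \<epsilon>'"
        and bound: "\<forall>\<omega>\<in>space \<Omega> - E3. \<forall>d\<in>D. nll_dominates k1 C (n k) (lam k) \<omega> d"
        using ev[rule_format, of "n k" "lam k"] sizes smoothing elim(1) by auto
      obtain E4 where E4: "{\<omega>\<in>space \<Omega>. \<not> convex_on UNIV (total_nll M eta (n k) (\<lambda>l i. X l i \<omega>))} \<subseteq> E4"
        "emeasure \<Omega> E4 = 0" "E4 \<in> events"
        using nll_convex[of k] by (rule AE_E)
      have good: "\<bar>SKL M eta \<tau>0 (\<tau>hat k \<omega>)\<bar> \<le> C' * (R + lam k)"
        if \<omega>: "\<omega> \<in> space \<Omega>" "\<omega> \<notin> E1" "\<omega> \<notin> E2" "\<omega> \<notin> E3" "\<omega> \<notin> E4" for \<omega>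
      proof -
        have t: "\<tau>hat k \<omega> \<in> N" using \<omega> E1(2) by blast
        have min: "local_min_in (pen_nll M eta J (n k) (lam k) (\<lambda>l i. X l i \<omega>)) N (\<tau>hat k \<omega>)" using \<omega> E2(2) by blast
        have cv: "convex_on UNIV (total_nll M eta (n k) (\<lambda>l i. X l i \<omega>))" using \<omega> E4(1) by blast
        have xs: "X l i \<omega> \<in> space (M l)" for l i using measurable_space[OF X_measurable \<omega>(1)] .
        have "k1 * nrm2 (d - \<tau>0) - lam k / 4 * J (snd d) (snd d) - C * R
          \<le> total_nll M eta (n k) (\<lambda>l i. X l i \<omega>) d - total_nll M eta (n k) (\<lambda>l i. X l i \<omega>) \<tau>0" if "d \<in> D" for d
          using bound[rule_format, of \<omega> d] that \<omega>(1,4)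
          unfolding total_nll_diff[OF sizes] nll_dominates_def R_def by (simp)
        from penalized_minimizer_bound[OF t xs smoothing cv min D dense[rule_format, OF t] k1 this]
        have "nrm2 (\<tau>hat k \<omega> - \<tau>0) \<le> 2 / k1 * (lam k / 2 * J0 + C * R)"
          using k1 by (simp add: J0_def field_simps)
        also have "\<dots> \<le> 2 / k1 * ((J0 / 2 + C) * (R + lam k))"
        proof (intro mult_left_mono)
          have "0 \<le> J0 / 2 * R" "0 \<le> C * lam k" using J0 R C smoothing[of k] by simp_all
          moreover have "(J0 / 2 + C) * (R + lam k) = lam k / 2 * J0 + C * R + (J0 / 2 * R + C * lam k)"
            by (simp add: field_simps)
          ultimately show "lam k / 2 * J0 + C * R \<le> (J0 / 2 + C) * (R + lam k)" by linarith
        qed (use k1 in simp)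
        finally have "Cs * nrm2 (\<tau>hat k \<omega> - \<tau>0) \<le> Cs * (2 / k1 * ((J0 / 2 + C) * (R + lam k)))"
          using Cs(1) by (intro mult_left_mono) auto
        then show ?thesis using Cs(2)[OF t] unfolding C'_def mult.assoc by linarith
      qed
      show ?case
      proof (intro bexI[of _ "E1 \<union> E2 \<union> E3 \<union> E4"] conjI)
        show "E1 \<union> E2 \<union> E3 \<union> E4 \<in> events" using E1(1) E2(1) E3(1) E4(3) by simp
        show "{\<omega>\<in>space \<Omega>. C' * (1 / real (Min (range (n k))) * lam k powr (- 1 / r) + lam k) < \<bar>SKL M eta \<tau>0 (\<tau>hat k \<omega>)\<bar>} \<subseteq> E1 \<union> E2 \<union> E3 \<union> E4"
          using good unfolding R_def[symmetric] by (auto simp: not_le[symmetric])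
        have "prob (E1 \<union> E2 \<union> E3 \<union> E4) \<le> prob (E1 \<union> E2 \<union> E3) + prob E4" using E1 E2 E3 E4 by (intro measure_Un_le) auto
        also have "prob (E1 \<union> E2 \<union> E3) \<le> prob (E1 \<union> E2) + prob E3" using E1 E2 E3 by (intro measure_Un_le) auto
        also have "prob (E1 \<union> E2) \<le> prob E1 + prob E2" using E1 E2 by (intro measure_Un_le) auto
        also have "prob E4 = 0" using E4(2) by (simp add: measure_def)
        finally show "prob (E1 \<union> E2 \<union> E3 \<union> E4) < \<epsilon>" using E1(3) E2(3) E3(2) \<epsilon> by (simp add: \<epsilon>'_def)
      qed
    qed
    then show "\<exists>C>0. \<forall>\<^sub>F k in sequentially. \<exists>E\<in>events.
      {\<omega>\<in>space \<Omega>. C * (1 / real (Min (range (n k))) * lam k powr (- 1 / r) + lam k) < \<bar>SKL M eta \<tau>0 (\<tau>hat k \<omega>)\<bar>} \<subseteq> E \<and> prob E < \<epsilon>"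
      using C' by blast
  qed
qed

end
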